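(* Let $F_1\subset F_2$ be closed subsets of $\mathbb{R}^d$ with $F_1\neq F_2$, and let $P(D)$ be a partial differential operator with constant coefficients, given by a non-constant polynomial $P\in\mathbb{C}[\xi_1,\ldots,\xi_d]$. Then the following assertions are equivalent. (i) $(F_1,F_2)$ is a $P$-Runge pair (for smooth Whitney jets). (ii) Every compactly supported distribution $u$ on $\mathbb{R}^d$ with support contained in $F_2$ has its support already contained in $F_1$ whenever $\check P(D)u$ is supported in $F_1$, where $\check P(\xi)=P(-\xi)$.
   Context: Smooth Whitney jets. For a compact set $K\subset\mathbb{R}^d$, $\mathscr{E}(K)$ is the space of families $f=(f^{(\alpha)})_{\alpha\in\mathbb{N}_0^d}$ of continuous complex-valued functions on $K$ such that, with $T^n_xf(y)=\sum_{|\alpha|\le n}\frac{f^{(\alpha)}(x)}{\alpha!}(y-x)^\alpha$ and $$q_{K,n,t}(f)=\sup\Big\{\tfrac{|f^{(\alpha)}(y)-\partial^\alpha T^n_xf(y)|}{|x-y|^{n-|\alpha|}}: |\alpha|\le n,\ x,y\in K,\ 0<|x-y|<t\Big\},$$ one has $\lim_{t\to0}q_{K,n,t}(f)=0$ for all $n\in\mathbb{N}_0$. It is a Fréchet space with the seminorms $\|f\|_{n,K}=\sup\{|f^{(\alpha)}(x)|:x\in K,|\alpha|\le n\}+\sup_{t>0}q_{K,n,t}(f)$. For a closed set $F\subset\mathbb{R}^d$, $\mathscr{E}(F)$ is the projective limit of the spaces $\mathscr{E}(K_l)$ along a compact exhaustion $(K_l)_l$ of $F$, i.e. the space of families $(f^{(\alpha)})_\alpha$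 of continuous functions on $F$ whose restriction to every compact $K\subset F$ lies in $\mathscr{E}(K)$, with the topology given by the seminorms $f\mapsto\|f|_K\|_{n,K}$. Operators. For $P(\xi)=\sum_{|\alpha|\le m}c_\alpha\xi^\alpha$, $P(D)$ acts on $\mathscr{E}(F)$ by $P(D)f=\sum_{|\alpha|\le m}c_\alpha D_1^{\alpha_1}\cdots D_d^{\alpha_d}f$, where $D_jf=-i(f^{(\alpha+e_j)})_{\alpha}$; on distributions on $\mathbb{R}^d$, $D_j=-i\partial_j$. Put $\mathscr{E}_P(F)=\{f\in\mathscr{E}(F):P(D)f=0\}$. $P$-Runge pair. For closed $F_1\subset F_2$, $(F_1,F_2)$ is a $P$-Runge pair (for smooth Whitney jets) if the image of $\mathscr{E}_P(F_2)$ under the restriction map $f\mapsto(f^{(\alpha)}|_{F_1})_\alpha$ is dense in $\mathscr{E}_P(F_1)$ (with the topology of $\mathscr{E}(F_1)$). *)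

theory Defs
  imports "HOL-Analysis.Analysis" "HOL-Library.Poly_Mapping"
begin

section \<open>Multi-indices and polynomials in several variables\<close>

type_synonym 'n multiindex = "'n \<Rightarrow> nat"

definition mi_abs :: "'n::finite multiindex \<Rightarrow> nat" where
  "mi_abs \<alpha> = (\<Sum>i\<in>UNIV. \<alpha> i)"

definition mi_fact :: "'n::finite multiindex \<Rightarrow> nat" where
  "mi_fact \<alpha> = (\<Prod>i\<in>UNIV. fact (\<alpha> i))"

definition mi_power :: "complex ^ 'n::finite \<Rightarrow> 'n multiindex \<Rightarrow> complex" where
  "mi_power z \<alpha> = (\<Prod>i\<in>UNIV. (z $ i) ^ \<alpha> i)"

definition cvec :: "real ^ 'n::finite \<Rightarrow> complex ^ 'n" where
  "cvec x = (\<chi> i. complex_of_real (x $ i))"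

lemma finite_multiindices: "finite {\<alpha> :: 'n::finite multiindex. mi_abs \<alpha> \<le> n}"
proof (rule finite_subset)
  show "{\<alpha> :: 'n multiindex. mi_abs \<alpha> \<le> n} \<subseteq> UNIV \<rightarrow>\<^sub>E {..n}"
  proof
    fix \<alpha> :: "'n multiindex"
    assume \<alpha>: "\<alpha> \<in> {\<alpha>. mi_abs \<alpha> \<le> n}"
    have "\<alpha> i \<le> n" for i
    proof -
      have "\<alpha> i \<le> mi_abs \<alpha>"
        unfolding mi_abs_def by (rule member_le_sum) simp_all
      also have "\<dots> \<le> n"
        using \<alpha> by simp
      finally show ?thesis .
    qed
    thus "\<alpha> \<in> UNIV \<rightarrow>\<^sub>E {..n}"
      by (simp add: PiE_UNIV_domain)
  qed
  show "finite ((UNIV :: 'n set) \<rightarrow>\<^sub>E {..n})"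
    by (intro finite_PiE) auto
qed

text \<open>A polynomial is its finitely supported family of coefficients.\<close>

type_synonym 'n cpoly = "'n multiindex \<Rightarrow>\<^sub>0 complex"

definition cpoly_eval :: "'n::finite cpoly \<Rightarrow> complex ^ 'n \<Rightarrow> complex" where
  "cpoly_eval P \<xi> = (\<Sum>\<alpha>\<in>Poly_Mapping.keys P. Poly_Mapping.lookup P \<alpha> * mi_power \<xi> \<alpha>)"

definition nonconstant :: "'n::finite cpoly \<Rightarrow> bool" where
  "nonconstant P \<longleftrightarrow> (\<nexists>c. P = Poly_Mapping.single (\<lambda>_. 0) c)"

definition cpoly_reflect :: "'n::finite cpoly \<Rightarrow> 'n cpoly" where
  "cpoly_reflect P = Poly_Mapping.mapp (\<lambda>\<alpha> c. (-1) ^ mi_abs \<alpha> * c) P"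

lemma cpoly_eval_reflect: "cpoly_eval (cpoly_reflect P) \<xi> = cpoly_eval P (- \<xi>)"
proof -
  have keys: "Poly_Mapping.keys (cpoly_reflect P) = Poly_Mapping.keys P"
    by (auto simp: cpoly_reflect_def in_keys_iff lookup_mapp when_def)
  have "mi_power (- \<xi>) \<alpha> = (-1) ^ mi_abs \<alpha> * mi_power \<xi> \<alpha>" for \<alpha>
  proof -
    have "mi_power (- \<xi>) \<alpha> = (\<Prod>i\<in>UNIV. (-1) ^ \<alpha> i * (\<xi> $ i) ^ \<alpha> i)"
      unfolding mi_power_def by (intro prod.cong refl) (simp add: power_minus[of "\<xi> $ _"])
    thus ?thesis
      by (simp add: mi_power_def mi_abs_def prod.distrib power_sum)
  qed
  thus ?thesis
    unfolding cpoly_eval_def keys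
    by (intro sum.cong refl) (simp add: cpoly_reflect_def lookup_mapp)
qed

text \<open>
  \<open>iter_op D \<alpha>\<close> is the composition of the powers \<open>D j ^^ \<alpha> j\<close> over all coordinates \<open>j\<close>, in an
  order that is fixed once and for all.  The order is irrelevant when the operators \<open>D j\<close> commute,
  as they do in all uses below (partial derivatives only on smooth functions).
\<close>

definition coords :: "'n::finite list" where
  "coords = (SOME js. distinct js \<and> set js = UNIV)"

lemma coords: "distinct (coords :: 'n::finite list)" "set (coords :: 'n list) = UNIV"
proof -
  have "\<exists>js :: 'n list. distinct js \<and> set js = UNIV"
    using finite_distinct_list[of "UNIV :: 'n set"] by auto
  from someI_ex[OF this] show "distinct (coords :: 'n list)" "set (coords :: 'n list) = UNIV"
    unfolding coords_def by auto
qed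

definition iter_op :: "('n::finite \<Rightarrow> 'a \<Rightarrow> 'a) \<Rightarrow> 'n multiindex \<Rightarrow> 'a \<Rightarrow> 'a" where
  "iter_op D \<alpha> = foldr (\<lambda>j. D j ^^ \<alpha> j) coords"


section \<open>Smooth functions and distributions\<close>

definition partial :: "'n::finite \<Rightarrow> (real ^ 'n \<Rightarrow> complex) \<Rightarrow> real ^ 'n \<Rightarrow> complex" where
  "partial j \<phi> x = vector_derivative (\<lambda>t. \<phi> (x + t *\<^sub>R axis j 1)) (at 0)"

definition smooth :: "(real ^ 'n::finite \<Rightarrow> complex) \<Rightarrow> bool" where
  "smooth \<phi> \<longleftrightarrow> (\<forall>js x. foldr partial js \<phi> differentiable (at x))"

definition fun_support :: "(real ^ 'n::finite \<Rightarrow> complex) \<Rightarrow> (real ^ 'n) set" where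
  "fun_support \<phi> = closure {x. \<phi> x \<noteq> 0}"

definition test_functions :: "(real ^ 'n::finite \<Rightarrow> complex) set" where
  "test_functions = {\<phi>. smooth \<phi> \<and> compact (fun_support \<phi>)}"

text \<open>
  Distributions are represented by functionals on all functions \<open>\<real>\<^sup>d \<Rightarrow> \<complex>\<close>; only their values on
  test functions matter.
\<close>

type_synonym 'n functional = "(real ^ 'n \<Rightarrow> complex) \<Rightarrow> complex"

definition distribution :: "'n::finite functional \<Rightarrow> bool" where
  "distribution u \<longleftrightarrow>
     (\<forall>\<phi>\<in>test_functions. \<forall>\<psi>\<in>test_functions. u (\<lambda>x. \<phi> x + \<psi> x) = u \<phi> + u \<psi>) \<and>
     (\<forall>c. \<forall>\<phi>\<in>test_functions. u (\<lambda>x. c * \<phi> x) = c * u \<phi>) \<and>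
     (\<forall>K. compact K \<longrightarrow>
        (\<exists>C N. \<forall>\<phi>\<in>test_functions. fun_support \<phi> \<subseteq> K \<longrightarrow>
           cmod (u \<phi>) \<le> C * (\<Sum>\<alpha> | mi_abs \<alpha> \<le> N. SUP x. cmod (iter_op partial \<alpha> \<phi> x))))"

definition dist_support :: "'n::finite functional \<Rightarrow> (real ^ 'n) set" where
  "dist_support u =
     - \<Union>{U. open U \<and> (\<forall>\<phi>\<in>test_functions. fun_support \<phi> \<subseteq> U \<longrightarrow> u \<phi> = 0)}"

definition dist_partial :: "'n::finite \<Rightarrow> 'n functional \<Rightarrow> 'n functional" where
  "dist_partial j u = (\<lambda>\<phi>. - u (partial j \<phi>))"

definition dist_D :: "'n::finite \<Rightarrow> 'n functional \<Rightarrow> 'n functional" where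
  "dist_D j u = (\<lambda>\<phi>. - \<i> * dist_partial j u \<phi>)"

definition dist_op :: "'n::finite cpoly \<Rightarrow> 'n functional \<Rightarrow> 'n functional" where
  "dist_op P u =
     (\<lambda>\<phi>. \<Sum>\<alpha>\<in>Poly_Mapping.keys P. Poly_Mapping.lookup P \<alpha> * iter_op dist_D \<alpha> u \<phi>)"


section \<open>Smooth Whitney jets\<close>

text \<open>
  A family of functions on a set \<open>F\<close> is represented by functions that are \<open>undefined\<close> outside \<open>F\<close>.
\<close>

type_synonym 'n jet = "'n multiindex \<Rightarrow> real ^ 'n \<Rightarrow> complex"

definition jet_restrict :: "(real ^ 'n::finite) set \<Rightarrow> 'n jet \<Rightarrow> 'n jet" where
  "jet_restrict F f = (\<lambda>\<alpha>. restrict (f \<alpha>) F)"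

definition taylor :: "nat \<Rightarrow> 'n::finite jet \<Rightarrow> real ^ 'n \<Rightarrow> real ^ 'n \<Rightarrow> complex" where
  "taylor n f x y =
     (\<Sum>\<alpha> | mi_abs \<alpha> \<le> n. f \<alpha> x / of_nat (mi_fact \<alpha>) * mi_power (cvec (y - x)) \<alpha>)"

text \<open>
  The suprema are taken in \<open>[0,\<infinity>]\<close>: for an arbitrary jet they may be infinite, and the supremum of
  the empty set is \<open>0\<close>.
\<close>

definition whitney_q :: "(real ^ 'n::finite) set \<Rightarrow> nat \<Rightarrow> real \<Rightarrow> 'n jet \<Rightarrow> ennreal" where
  "whitney_q K n t f =
     Sup {ennreal (cmod (f \<alpha> y - iter_op partial \<alpha> (taylor n f x) y) / dist x y ^ (n - mi_abs \<alpha>)) |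
            \<alpha> x y. mi_abs \<alpha> \<le> n \<and> x \<in> K \<and> y \<in> K \<and> 0 < dist x y \<and> dist x y < t}"

definition jet_norm :: "nat \<Rightarrow> (real ^ 'n::finite) set \<Rightarrow> 'n jet \<Rightarrow> ennreal" where
  "jet_norm n K f =
     Sup {ennreal (cmod (f \<alpha> x)) | \<alpha> x. x \<in> K \<and> mi_abs \<alpha> \<le> n} + (SUP t\<in>{0<..}. whitney_q K n t f)"

definition whitney_jets_compact :: "(real ^ 'n::finite) set \<Rightarrow> 'n jet set" where
  "whitney_jets_compact K =
     {f. (\<forall>\<alpha>. f \<alpha> \<in> extensional K \<and> continuous_on K (f \<alpha>)) \<and>
         (\<forall>n. ((\<lambda>t. whitney_q K n t f) \<longlongrightarrow> 0) (at_right 0))}"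

definition whitney_jets :: "(real ^ 'n::finite) set \<Rightarrow> 'n jet set" where
  "whitney_jets F =
     {f. (\<forall>\<alpha>. f \<alpha> \<in> extensional F \<and> continuous_on F (f \<alpha>)) \<and>
         (\<forall>K. compact K \<and> K \<subseteq> F \<longrightarrow> jet_restrict K f \<in> whitney_jets_compact K)}"

definition whitney_ball ::
    "(real ^ 'n::finite) set \<Rightarrow> 'n jet \<Rightarrow> nat \<Rightarrow> (real ^ 'n) set \<Rightarrow> real \<Rightarrow> 'n jet set" where
  "whitney_ball F f n K r =
     {g \<in> whitney_jets F. jet_norm n K (jet_restrict K (g - f)) < ennreal r}"

definition whitney_topology :: "(real ^ 'n::finite) set \<Rightarrow> 'n jet topology" where
  "whitney_topology F =
     topology_generated_by
       {whitney_ball F f n K r | f n K r. f \<in> whitney_jets F \<and> compact K \<and> K \<subseteq> F \<and> r > 0}"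

lemma topspace_whitney_topology: "topspace (whitney_topology F) = whitney_jets F"
proof -
  have "f \<in> whitney_ball F f 0 {} 1" if "f \<in> whitney_jets F" for f
    using that by (simp add: whitney_ball_def jet_norm_def whitney_q_def image_constant_conv bot_ennreal)
  moreover have "whitney_ball F f n K r \<subseteq> whitney_jets F" for f n K r
    unfolding whitney_ball_def by (rule Collect_restrict)
  ultimately show ?thesis
    unfolding whitney_topology_def topology_generated_by_topspace
    by (intro subset_antisym subsetI) (blast, blast intro: zero_less_one compact_empty)
qed

definition jet_D :: "'n::finite \<Rightarrow> 'n jet \<Rightarrow> 'n jet" where
  "jet_D j f = (\<lambda>\<alpha> x. - \<i> * f (\<alpha>(j := Suc (\<alpha> j))) x)"

definition jet_op :: "'n::finite cpoly \<Rightarrow> 'n jet \<Rightarrow> 'n jet" where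
  "jet_op P f =
     (\<lambda>\<beta> x. \<Sum>\<alpha>\<in>Poly_Mapping.keys P. Poly_Mapping.lookup P \<alpha> * iter_op jet_D \<alpha> f \<beta> x)"

definition whitney_kernel :: "'n::finite cpoly \<Rightarrow> (real ^ 'n) set \<Rightarrow> 'n jet set" where
  "whitney_kernel P F = {f \<in> whitney_jets F. \<forall>\<beta>. \<forall>x\<in>F. jet_op P f \<beta> x = 0}"

definition Runge_pair ::
    "'n::finite cpoly \<Rightarrow> (real ^ 'n) set \<Rightarrow> (real ^ 'n) set \<Rightarrow> bool" where
  "Runge_pair P F1 F2 \<longleftrightarrow>
     subtopology (whitney_topology F1) (whitney_kernel P F1)
       closure_of (jet_restrict F1 ` whitney_kernel P F2) = whitney_kernel P F1"

end

theory Submission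
  imports Defs "HOL-Library.Function_Algebras" "HOL-Computational_Algebra.Polynomial"
begin

text \<open>
  For a constant coefficient operator \<open>a(\<partial>)\<close> the Gaussian-weighted norms \<open>\<integral> |f|\<^sup>2 exp(t |x|\<^sup>2)\<close>
  satisfy \<open>\<kappa> \<parallel>f\<parallel> \<le> \<parallel>a(\<partial>) f\<parallel>\<close> uniformly in \<open>t \<ge> 1/2\<close>: the weighted adjoints of the \<open>\<partial>\<^sub>j\<close> obey the
  canonical commutation relations, and normal ordering writes \<open>\<parallel>a(\<partial>) f\<parallel>\<^sup>2\<close> as a sum of squares whose
  top term is a positive multiple of \<open>\<parallel>f\<parallel>\<^sup>2\<close>.  With the Hahn-Banach theorem this yields a fundamental
  solution, and letting \<open>t\<close> tend to infinity it yields Runge approximation on balls.  Consequently, a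
  compactly supported distribution that annihilates all smooth \<open>\<psi>\<close> with \<open>a(\<partial>)\<psi>\<close> flat on \<open>F\<close> is the
  image under the transposed operator of a compactly supported distribution on \<open>F\<close>.

  Smoothing jets at a single scale \<open>e\<close> replaces Whitney's extension theorem.  It shows that smooth
  functions are dense in the jets, and that a compactly supported distribution is bounded by a Whitney
  seminorm on any compact set \<open>K\<close> containing its support: a test function is smoothed at the scales
  \<open>2\<^sup>-\<^sup>k\<close> and the resulting telescoping series is summed.  Hence such distributions extend to jets on \<open>K\<close>
  in a way that respects \<open>P(D) f = 0\<close>, and the theorem follows by duality.
\<close>

section \<open>Smooth functions\<close>

text \<open>Two points shape the argument. One is compactness in the division step. Applying
  \<open>u\<close> to the convolution of a fundamental solution with the test function gives a
  functional whose support lies in \<open>F\<close> almost by construction. The fundamental solution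
  need not have compact support, however, so a distant test function still yields a nonzero
  convolution near the support of \<open>u\<close>. There it is only a local zero solution, whereas
  the annihilation hypothesis concerns functions on the whole space. Runge approximation on balls
  closes this gap, and it is available because the weighted inequality has a constant independent of
  \<open>t\<close>: a datum vanishing for |x| < R + 1/2 and a test function living in |x| <= R + 1/4
  are coupled only by a factor exp(-t q) with q > 0. The other is that a distribution is bounded by
  derivatives in a neighbourhood of its support, while a Whitney seminorm sees the jet on
  \<open>K\<close> alone. Cutoffs at distance e from \<open>K\<close> cost powers of 1/e. One extra
  order of differentiability pays for them and leaves a factor e, which makes the series over the
  scales converge with a constant depending on the seminorm only.\<close>

lemma smooth_differentiable: "smooth \<phi> \<Longrightarrow> \<phi> differentiable (at x)"
  unfolding smooth_def by (metis foldr.simps(1) id_apply)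

lemma smooth_partial: 
  assumes "smooth \<phi>" shows "smooth (partial j \<phi>)"
  unfolding smooth_def
proof (intro allI)
  fix js x
  have "foldr partial js (partial j \<phi>) = foldr partial (js @ [j]) \<phi>" by simp
  with assms show "foldr partial js (partial j \<phi>) differentiable (at x)"
    unfolding smooth_def by metis
qed

text \<open>Used for families that are visibly closed under \<open>partial\<close>; sums and
  products, where the product rule leaves the family, go through \<open>Ck\<close> instead.\<close>

lemma smooth_coinduct:
  assumes "X \<phi>" "\<And>\<phi> x. X \<phi> \<Longrightarrow> \<phi> differentiable (at x)" "\<And>\<phi> j. X \<phi> \<Longrightarrow> X (partial j \<phi>)"
  shows "smooth \<phi>"
proof -
  have "X (foldr partial js \<phi>)" for js
    by (induction js) (use assms in auto)
  with assms(2) show ?thesis unfolding smooth_def by blast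
qed

text \<open>\<open>Ck n\<close> stands for n + 1 successive differentiations. Counting the order
  turns the product and chain rules into inductions, which the list-based definition of
  \<open>smooth\<close> does not offer directly.\<close>

primrec Ck :: "nat \<Rightarrow> (real ^ 'n::finite \<Rightarrow> complex) \<Rightarrow> bool" where
  "Ck 0 \<phi> \<longleftrightarrow> (\<forall>x. \<phi> differentiable (at x))"
| "Ck (Suc n) \<phi> \<longleftrightarrow> (\<forall>x. \<phi> differentiable (at x)) \<and> (\<forall>j. Ck n (partial j \<phi>))"

lemma Ck_differentiable: "Ck n \<phi> \<Longrightarrow> \<phi> differentiable (at x)"
  by (cases n) auto

lemma Ck_Suc_imp: "Ck (Suc n) \<phi> \<Longrightarrow> Ck n \<phi>"
  by (induction n arbitrary: \<phi>) auto

lemma smooth_iff_Ck: "smooth \<phi> \<longleftrightarrow> (\<forall>n. Ck n \<phi>)"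
proof
  assume "smooth \<phi>"
  then have "Ck n \<phi>" for n
    by (induction n arbitrary: \<phi>) (auto simp: smooth_differentiable smooth_partial)
  then show "\<forall>n. Ck n \<phi>" by blast
next
  assume "\<forall>n. Ck n \<phi>"
  then show "smooth \<phi>"
    by (rule smooth_coinduct[where X="\<lambda>\<phi>. \<forall>n. Ck n \<phi>"]) (blast intro: Ck_differentiable, metis Ck.simps(2))
qed

section \<open>Calculus of partial derivatives\<close>

lemma partial_eq:
  assumes "(f has_derivative f') (at x)"
  shows "partial j f x = f' (axis j 1)"
proof -
  have "(\<lambda>t::real. x + t *\<^sub>R axis j 1) = (\<lambda>t. t *\<^sub>R axis j 1 + x)" by auto
  have 1: "((\<lambda>t::real. x + t *\<^sub>R axis j 1) has_vector_derivative axis j 1) (at 0)"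
    by (auto intro!: derivative_eq_intros)
  have "((f \<circ> (\<lambda>t::real. x + t *\<^sub>R axis j 1)) has_vector_derivative f' (axis j 1)) (at 0)"
    by (rule vector_derivative_diff_chain_within[OF 1]) (use assms has_derivative_at_withinI in auto)
  then show ?thesis
    unfolding partial_def by (simp add: vector_derivative_at o_def)
qed

lemma has_derivative_partial:
  fixes f :: "real ^ 'n::finite \<Rightarrow> complex"
  assumes "f differentiable (at x)"
  shows "(f has_derivative (\<lambda>h. \<Sum>j\<in>UNIV. (h $ j) *\<^sub>R partial j f x)) (at x)"
proof -
  obtain f' where f': "(f has_derivative f') (at x)"
    using assms unfolding differentiable_def by blast
  then have l: "linear f'" using has_derivative_linear by blast
  have "f' = (\<lambda>h. \<Sum>j\<in>UNIV. (h $ j) *\<^sub>R partial j f x)"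
  proof
    fix h :: "real ^ 'n"
    have "h = (\<Sum>j\<in>UNIV. (h $ j) *\<^sub>R axis j 1)"
      by (metis basis_expansion scalar_mult_eq_scaleR)
    then have "f' h = f' (\<Sum>j\<in>UNIV. (h $ j) *\<^sub>R axis j 1)" by simp
    also have "\<dots> = (\<Sum>j\<in>UNIV. (h $ j) *\<^sub>R f' (axis j 1))"
      by (simp add: linear_sum[OF l] linear_scale[OF l])
    finally show "f' h = (\<Sum>j\<in>UNIV. (h $ j) *\<^sub>R partial j f x)"
      by (simp add: partial_eq[OF f'])
  qed
  with f' show ?thesis by simp
qed

lemma partial_const [simp]: "partial j (\<lambda>x. c) = (\<lambda>x. 0)"
  by (rule ext) (simp add: partial_eq[OF has_derivative_const])

lemma partial_add:
  assumes "\<And>x. f differentiable (at x)" "\<And>x. g differentiable (at x)"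
  shows "partial j (\<lambda>x. f x + g x) = (\<lambda>x. partial j f x + partial j g x)"
  by (rule ext, subst partial_eq[OF has_derivative_add[OF has_derivative_partial has_derivative_partial]])
     (auto simp: assms axis_def if_distrib[where f="\<lambda>x. x *\<^sub>R _"] sum.delta' cong: if_cong)

lemma sum_axis: "(\<Sum>i\<in>UNIV. (axis j (1::real) $ i) *\<^sub>R (g i :: complex)) = g j"
  by (simp add: axis_def if_distrib[where f="\<lambda>x. x *\<^sub>R _"] sum.delta' cong: if_cong)

lemma partial_mult:
  assumes "\<And>x. f differentiable (at x)" "\<And>x. g differentiable (at x)"
  shows "partial j (\<lambda>x. f x * g x) = (\<lambda>x. partial j f x * g x + f x * partial j g x)"
  by (rule ext, subst partial_eq[OF has_derivative_mult[OF has_derivative_partial has_derivative_partial]])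
     (auto simp: assms sum_axis)

lemma partial_cmult:
  assumes "\<And>x. f differentiable (at x)"
  shows "partial j (\<lambda>x. c * f x) = (\<lambda>x. c * partial j f x)"
  using partial_mult[of "\<lambda>x. c" f j] assms by simp

lemma differentiable_affine:
  fixes f :: "real ^ 'n::finite \<Rightarrow> complex"
  assumes "\<And>x. f differentiable (at x)"
  shows "(\<lambda>x. f (c *\<^sub>R x + a)) differentiable (at x)"
proof -
  have "(f \<circ> (\<lambda>x. c *\<^sub>R x + a)) differentiable (at x)"
    by (rule differentiable_chain_at) (auto intro!: derivative_intros assms)
  then show ?thesis by (simp add: o_def)
qed

lemma partial_affine:
  assumes "\<And>x. f differentiable (at x)"
  shows "partial j (\<lambda>x. f (c *\<^sub>R x + a)) = (\<lambda>x. of_real c * partial j f (c *\<^sub>R x + a))"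
proof
  fix x
  have "((\<lambda>x. c *\<^sub>R x + a) has_derivative (\<lambda>h. c *\<^sub>R h)) (at x)"
    by (auto intro!: derivative_eq_intros)
  from has_derivative_compose[OF this has_derivative_partial[OF assms]]
  have "((\<lambda>x. f (c *\<^sub>R x + a)) has_derivative (\<lambda>h. \<Sum>i\<in>UNIV. ((c *\<^sub>R h) $ i) *\<^sub>R partial i f (c *\<^sub>R x + a))) (at x)" .
  then show "partial j (\<lambda>x. f (c *\<^sub>R x + a)) x = of_real c * partial j f (c *\<^sub>R x + a)"
  proof (subst partial_eq, assumption)
    have "(\<Sum>i\<in>UNIV. ((c *\<^sub>R axis j (1::real)) $ i) *\<^sub>R partial i f (c *\<^sub>R x + a))
        = c *\<^sub>R (\<Sum>i\<in>UNIV. (axis j (1::real) $ i) *\<^sub>R partial i f (c *\<^sub>R x + a))"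
      by (simp only: scaleR_sum_right vector_scaleR_component scaleR_scaleR real_scaleR_def)
    then show "(\<Sum>i\<in>UNIV. ((c *\<^sub>R axis j (1::real)) $ i) *\<^sub>R partial i f (c *\<^sub>R x + a))
        = of_real c * partial j f (c *\<^sub>R x + a)"
      by (simp only: sum_axis) (simp only: scaleR_conv_of_real[of c "partial j f (c *\<^sub>R x + a)"])
  qed
qed

section \<open>Closure properties of smooth functions\<close>

lemma smooth_const [simp]: "smooth (\<lambda>x. c)"
  by (rule smooth_coinduct[where X="\<lambda>\<phi>. \<exists>c. \<phi> = (\<lambda>x. c)"]) auto

lemma Ck_add: "Ck n f \<Longrightarrow> Ck n g \<Longrightarrow> Ck n (\<lambda>x. f x + g x)"
proof (induction n arbitrary: f g)
  case (Suc n)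
  then show ?case by (auto simp: partial_add intro: differentiable_add)
qed (auto intro: differentiable_add)

lemma Ck_mult: "Ck n f \<Longrightarrow> Ck n g \<Longrightarrow> Ck n (\<lambda>x. f x * g x)"
proof (induction n arbitrary: f g)
  case (Suc n)
  have "Ck n f" "Ck n g" using Suc.prems Ck_Suc_imp by auto
  with Suc show ?case by (auto simp: partial_mult intro!: differentiable_mult Ck_add)
qed (auto intro: differentiable_mult)

lemma smooth_add [intro]: "smooth f \<Longrightarrow> smooth g \<Longrightarrow> smooth (\<lambda>x. f x + g x)"
  by (auto simp: smooth_iff_Ck intro: Ck_add)

lemma smooth_mult [intro]: "smooth f \<Longrightarrow> smooth g \<Longrightarrow> smooth (\<lambda>x. f x * g x)"
  by (auto simp: smooth_iff_Ck intro: Ck_mult)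

lemma smooth_cmult: "smooth f \<Longrightarrow> smooth (\<lambda>x. c * f x)"
  by (auto intro: smooth_mult)

lemma smooth_minus: "smooth f \<Longrightarrow> smooth g \<Longrightarrow> smooth (\<lambda>x. f x - g x)"
  using smooth_add[of f "\<lambda>x. -1 * g x"] smooth_cmult[of g "-1"] by simp

lemma smooth_uminus: "smooth f \<Longrightarrow> smooth (\<lambda>x. - f x)"
  using smooth_cmult[of f "-1"] by simp

lemma smooth_sum: "(\<And>i. i \<in> I \<Longrightarrow> smooth (f i)) \<Longrightarrow> smooth (\<lambda>x. \<Sum>i\<in>I. f i x)"
  by (induction I rule: infinite_finite_induct) auto

lemma smooth_prod: "(\<And>i. i \<in> I \<Longrightarrow> smooth (f i)) \<Longrightarrow> smooth (\<lambda>x. \<Prod>i\<in>I. f i x)"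
  by (induction I rule: infinite_finite_induct) auto

lemma smooth_power: "smooth f \<Longrightarrow> smooth (\<lambda>x. f x ^ k)"
  by (induction k) auto

lemma smooth_affine: 
  assumes "smooth f" shows "smooth (\<lambda>x. f (c *\<^sub>R x + a))"
proof (rule smooth_coinduct[where X="\<lambda>\<phi>. \<exists>f k. smooth f \<and> \<phi> = (\<lambda>x. k * f (c *\<^sub>R x + a))"])
  show "\<exists>g k. smooth g \<and> (\<lambda>x. f (c *\<^sub>R x + a)) = (\<lambda>x. k * g (c *\<^sub>R x + a))"
    by (rule exI[of _ f], rule exI[of _ 1]) (simp add: assms)
next
  fix \<phi> :: "real ^ 'a \<Rightarrow> complex" and x
  assume "\<exists>f k. smooth f \<and> \<phi> = (\<lambda>x. k * f (c *\<^sub>R x + a))"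
  then obtain f k where "smooth f" "\<phi> = (\<lambda>x. k * f (c *\<^sub>R x + a))" by blast
  then show "\<phi> differentiable (at x)"
    using differentiable_mult[OF differentiable_const differentiable_affine[OF smooth_differentiable]] by blast
next
  fix \<phi> :: "real ^ 'a \<Rightarrow> complex" and j
  assume "\<exists>f k. smooth f \<and> \<phi> = (\<lambda>x. k * f (c *\<^sub>R x + a))"
  then obtain f k where f: "smooth f" "\<phi> = (\<lambda>x. k * f (c *\<^sub>R x + a))" by blast
  have "partial j \<phi> = (\<lambda>x. (k * of_real c) * partial j f (c *\<^sub>R x + a))"
    unfolding f(2) partial_cmult[OF differentiable_affine[OF smooth_differentiable[OF f(1)]]] 
      partial_affine[OF smooth_differentiable[OF f(1)]] by (simp only: mult.assoc)
  then show "\<exists>f k. smooth f \<and> partial j \<phi> = (\<lambda>x. k * f (c *\<^sub>R x + a))"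
    using smooth_partial[OF f(1)] by blast
qed

lemma smooth_translate: "smooth f \<Longrightarrow> smooth (\<lambda>x. f (x + a))"
  using smooth_affine[of f 1 a] by simp

lemma smooth_reflect: "smooth f \<Longrightarrow> smooth (\<lambda>y. f (x - y))"
  using smooth_affine[of f "-1" x] by simp

lemma differentiable_coord: "(\<lambda>x::real^'n::finite. complex_of_real (x $ i)) differentiable (at x)"
  using bounded_linear_imp_differentiable[of "\<lambda>x::real^'n. complex_of_real (x $ i)"]
  by (simp add: bounded_linear_compose[OF bounded_linear_of_real bounded_linear_vec_nth])

lemma partial_coord: "partial j (\<lambda>x::real^'n::finite. complex_of_real (x $ i)) = (\<lambda>x. if i = j then 1 else 0)"
proof
  fix x
  have "((\<lambda>x::real^'n. complex_of_real (x $ i)) has_derivative (\<lambda>x. complex_of_real (x $ i))) (at x)"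
    by (rule bounded_linear_imp_has_derivative) 
       (simp add: bounded_linear_compose[OF bounded_linear_of_real bounded_linear_vec_nth])
  from partial_eq[OF this]
  show "partial j (\<lambda>x::real^'n. complex_of_real (x $ i)) x = (if i = j then 1 else 0)"
    by (simp add: axis_def)
qed

lemma smooth_coord: "smooth (\<lambda>x::real^'n::finite. complex_of_real (x $ i))"
  by (rule smooth_coinduct[where X="\<lambda>\<phi>. \<phi> = (\<lambda>x. complex_of_real (x $ i)) \<or> (\<exists>c. \<phi> = (\<lambda>x. c))"])
     (auto simp: partial_coord differentiable_coord)

text \<open>\<open>g\<close> lists a function together with all its derivatives. The chain rule
  moves from \<open>g k\<close> to \<open>g (Suc k)\<close>, so the claim is proved for all
  \<open>k\<close> at once by induction on the order. The application is the profile of the bump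
  functions.\<close>

lemma smooth_compose_real:
  fixes g :: "nat \<Rightarrow> real \<Rightarrow> real" and f :: "real ^ 'n::finite \<Rightarrow> real"
  assumes g: "\<And>k t. (g k has_real_derivative g (Suc k) t) (at t)"
    and f: "smooth (\<lambda>x. complex_of_real (f x))"
  shows "smooth (\<lambda>x. complex_of_real (g k (f x)))"
proof -
  let ?f = "\<lambda>x. complex_of_real (f x)"
  have df: "((\<lambda>x. complex_of_real (g k (f x))) has_derivative 
     (\<lambda>h. complex_of_real (g (Suc k) (f x)) * (\<Sum>j\<in>UNIV. (h $ j) *\<^sub>R partial j ?f x))) (at x)" for k x
  proof -
    let ?F = "\<lambda>h. \<Sum>j\<in>UNIV. (h $ j) *\<^sub>R partial j ?f x"
    have F: "(?f has_derivative ?F) (at x)"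
      by (rule has_derivative_partial) (rule smooth_differentiable[OF f])
    have 1: "((\<lambda>x. Re (?f x)) has_derivative (\<lambda>h. Re (?F h))) (at x)"
      by (rule bounded_linear.has_derivative[OF bounded_linear_Re F])
    have "((\<lambda>x. Im (?f x)) has_derivative (\<lambda>h. Im (?F h))) (at x)"
      by (rule bounded_linear.has_derivative[OF bounded_linear_Im F])
    \<comment> \<open>The derivative of a real-valued function is real, since its imaginary part is
      also a derivative of the zero function.\<close>
    then have "((\<lambda>x. 0) has_derivative (\<lambda>h. Im (?F h))) (at x)" by simp
    from has_derivative_unique[OF this has_derivative_const] have im: "Im (?F h) = 0" for h by meson
    have "(*) (g (Suc k) (f x)) = (\<lambda>h. h * g (Suc k) (f x))" by (rule ext) simp
    with g[of k "f x"] have "(g k has_derivative (\<lambda>h. h * g (Suc k) (f x))) (at (f x))"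
      by (simp add: has_field_derivative_def)
    from has_derivative_compose[OF 1[unfolded Re_complex_of_real] this]
    have "((\<lambda>x. g k (f x)) has_derivative (\<lambda>h. Re (?F h) * g (Suc k) (f x))) (at x)" .
    from bounded_linear.has_derivative[OF bounded_linear_of_real this]
    have "((\<lambda>x. complex_of_real (g k (f x))) has_derivative (\<lambda>h. complex_of_real (Re (?F h) * g (Suc k) (f x)))) (at x)" .
    moreover have "complex_of_real (Re (?F h) * g (Suc k) (f x)) = complex_of_real (g (Suc k) (f x)) * ?F h" for h
      using im[of h] by (simp add: complex_eq_iff)
    ultimately show ?thesis by (simp only:)
  qed
  have p: "partial j (\<lambda>x. complex_of_real (g k (f x))) = (\<lambda>x. complex_of_real (g (Suc k) (f x)) * partial j ?f x)" for j k
    by (rule ext, subst partial_eq[OF df]) (simp add: sum_axis)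
  have d: "(\<lambda>x. complex_of_real (g k (f x))) differentiable (at x)" for k x
    using df differentiable_def by blast
  have "Ck n (\<lambda>x. complex_of_real (g k (f x)))" for n k
  proof (induction n arbitrary: k)
    case 0
    then show ?case by (simp add: d)
  next
    case (Suc n)
    then show ?case
      using smooth_partial[OF f] by (auto simp: d p smooth_iff_Ck intro!: Ck_mult)
  qed
  then show ?thesis by (simp add: smooth_iff_Ck)
qed

lemma smooth_continuous: "smooth f \<Longrightarrow> continuous_on S f"
  by (meson continuous_at_imp_continuous_on differentiable_imp_continuous_within smooth_differentiable)

subsection \<open>Symmetry of second derivatives\<close>

text \<open>The second derivative enters only through differentiability of
  \<open>partial i f\<close> at the point \<open>x\<close>; the rest is a mean value inequality in
  direction \<open>i\<close>. The second difference itself is symmetric in \<open>i\<close> and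
  \<open>j\<close>, which \<open>partial_commute\<close> exploits.\<close>

lemma second_difference:
  assumes f: "smooth f" and e: "e > 0"
  shows "\<exists>d>0. \<forall>h. 0 < h \<and> h < d \<longrightarrow>
    cmod (f (x + h *\<^sub>R axis i 1 + h *\<^sub>R axis j 1) - f (x + h *\<^sub>R axis i 1) - f (x + h *\<^sub>R axis j 1) + f x
       - h\<^sup>2 *\<^sub>R partial j (partial i f) x) \<le> e * h\<^sup>2"
proof -
  let ?p = "partial i f"
  let ?L = "\<lambda>h. \<Sum>k\<in>UNIV. (h $ k) *\<^sub>R partial k ?p x"
  have "(?p has_derivative ?L) (at x)"
    by (rule has_derivative_partial) (intro smooth_differentiable smooth_partial f)
  note L = this[unfolded has_derivative_at_alt]
  have bl: "bounded_linear ?L" by (rule conjunct1[OF L])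
  have lim: "\<forall>e>0. \<exists>d>0. \<forall>y. norm (y - x) < d \<longrightarrow>
    norm (?p y - ?p x - ?L (y - x)) \<le> e * norm (y - x)"
    by (rule conjunct2[OF L])
  \<comment> \<open>The linearisation is used at distances up to 2h and h, so the errors e/3 * 2h
    and e/3 * h add up to e * h.\<close>
  obtain d where d: "d > 0" and B: "\<And>y. norm (y - x) < d \<Longrightarrow> norm (?p y - ?p x - ?L (y - x)) \<le> e/3 * norm (y - x)"
    using lim[rule_format, of "e/3"] e by auto
  have B': "norm (?p (x + v) - ?p x - ?L v) \<le> e/3 * norm v" if "norm v < d" for v
    using B[of "x + v"] that by (simp only: add_diff_cancel_left')
  show ?thesis
  proof (intro exI[of _ "d/2"] conjI allI impI)
    show "d/2 > 0" using d by simp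
    fix h assume h: "0 < h \<and> h < d/2"
    let ?a = "axis i (1::real)" and ?b = "axis j (1::real)"
    \<comment> \<open>\<open>?F h - ?F 0\<close> is the second difference minus its main term, and
      the derivative of \<open>?F\<close> compares \<open>partial i f\<close> at two points within
      2h of \<open>x\<close>.\<close>
    let ?F = "\<lambda>s. f (x + s *\<^sub>R ?a + h *\<^sub>R ?b) - f (x + s *\<^sub>R ?a) - (s * h) *\<^sub>R partial j ?p x"
    have D: "((\<lambda>s. f (s *\<^sub>R ?a + c)) has_vector_derivative ?p (s *\<^sub>R ?a + c)) (at s within A)" for s c A
    proof -
      have 1: "((\<lambda>s. s *\<^sub>R ?a + c) has_vector_derivative ?a) (at s)"
        by (auto intro!: derivative_eq_intros)
      have "((f \<circ> (\<lambda>s. s *\<^sub>R ?a + c)) has_vector_derivative (\<Sum>k\<in>UNIV. (?a $ k) *\<^sub>R partial k f (s *\<^sub>R ?a + c))) (at s)"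
        by (rule vector_derivative_diff_chain_within[OF 1])
           (rule has_derivative_at_withinI[OF has_derivative_partial[OF smooth_differentiable[OF f]]])
      then show ?thesis by (simp add: sum_axis o_def has_vector_derivative_at_within)
    qed
    have der: "(?F has_vector_derivative (?p (x + s *\<^sub>R ?a + h *\<^sub>R ?b) - ?p (x + s *\<^sub>R ?a) - h *\<^sub>R partial j ?p x)) (at s within {0..h})" for s
    proof -
      have "((\<lambda>s. (s * h) *\<^sub>R partial j ?p x) has_vector_derivative (h *\<^sub>R partial j ?p x)) (at s within {0..h})"
        by (auto intro!: derivative_eq_intros)
      then show ?thesis
        using D[of "x + h *\<^sub>R ?b" s "{0..h}"] D[of x s "{0..h}"]
        by (intro has_vector_derivative_diff) (simp_all add: ac_simps)
    qed
    have bnd: "norm (?p (x + s *\<^sub>R ?a + h *\<^sub>R ?b) - ?p (x + s *\<^sub>R ?a) - h *\<^sub>R partial j ?p x) \<le> e * h" if s: "s \<in> {0..h}" for s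
    proof -
      have n1: "norm (s *\<^sub>R ?a + h *\<^sub>R ?b) \<le> 2 * h"
        by (rule order_trans[OF norm_triangle_ineq]) (use s h in \<open>simp add: norm_axis_1\<close>)
      have n2: "norm (s *\<^sub>R ?a) \<le> h" using s h by (simp add: norm_axis_1)
      have b1: "norm (?p (x + s *\<^sub>R ?a + h *\<^sub>R ?b) - ?p x - ?L (s *\<^sub>R ?a + h *\<^sub>R ?b)) \<le> e/3 * (2 * h)"
        unfolding add.assoc by (rule order_trans[OF B' mult_left_mono[OF n1]]) (use n1 h e in auto)
      have b2: "norm (?p (x + s *\<^sub>R ?a) - ?p x - ?L (s *\<^sub>R ?a)) \<le> e/3 * h"
        by (rule order_trans[OF B' mult_left_mono[OF n2]]) (use n2 h e in auto)
      have l: "?L (s *\<^sub>R ?a + h *\<^sub>R ?b) = ?L (s *\<^sub>R ?a) + h *\<^sub>R partial j ?p x"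
      proof -
        interpret bounded_linear ?L by (rule bl)
        show ?thesis using add[of "s *\<^sub>R ?a" "h *\<^sub>R ?b"] scale[of h ?b] by (simp only: sum_axis)
      qed
      have "?p (x + s *\<^sub>R ?a + h *\<^sub>R ?b) - ?p (x + s *\<^sub>R ?a) - h *\<^sub>R partial j ?p x
         = (?p (x + s *\<^sub>R ?a + h *\<^sub>R ?b) - ?p x - ?L (s *\<^sub>R ?a + h *\<^sub>R ?b)) - (?p (x + s *\<^sub>R ?a) - ?p x - ?L (s *\<^sub>R ?a))"
        unfolding l by simp
      also have "norm \<dots> \<le> e/3 * (2 * h) + e/3 * h"
        by (rule order_trans[OF norm_triangle_ineq4 add_mono[OF b1 b2]])
      finally show ?thesis by (simp add: algebra_simps)
    qed
    have "norm (?F h - ?F 0) \<le> e * h * norm (h - 0)"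
    proof (rule differentiable_bound[where S="{0..h}" and f'="\<lambda>s t. t *\<^sub>R (?p (x + s *\<^sub>R ?a + h *\<^sub>R ?b) - ?p (x + s *\<^sub>R ?a) - h *\<^sub>R partial j ?p x)"])
      show "onorm (\<lambda>t. t *\<^sub>R (?p (x + s *\<^sub>R ?a + h *\<^sub>R ?b) - ?p (x + s *\<^sub>R ?a) - h *\<^sub>R partial j ?p x)) \<le> e * h" if "s \<in> {0..h}" for s
        by (rule onorm_le) (metis bnd[OF that] mult.commute mult_left_mono norm_ge_zero norm_scaleR real_norm_def)
    qed (use der h in \<open>auto simp: has_vector_derivative_def\<close>)
    then show "cmod (f (x + h *\<^sub>R ?a + h *\<^sub>R ?b) - f (x + h *\<^sub>R ?a) - f (x + h *\<^sub>R ?b) + f x - h\<^sup>2 *\<^sub>R partial j ?p x) \<le> e * h\<^sup>2"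
      using h by (simp add: power2_eq_square algebra_simps)
  qed
qed

lemma partial_commute:
  assumes f: "smooth f"
  shows "partial i (partial j f) = partial j (partial i f)"
proof
  fix x
  let ?u = "partial j (partial i f) x" and ?v = "partial i (partial j f) x"
  have "cmod (?v - ?u) \<le> e" if "e > 0" for e
  proof -
    have e2: "e/2 > 0" using that by simp
    obtain d1 where d1: "d1 > 0" "\<And>h. 0 < h \<and> h < d1 \<Longrightarrow>
        cmod (f (x + h *\<^sub>R axis i 1 + h *\<^sub>R axis j 1) - f (x + h *\<^sub>R axis i 1) - f (x + h *\<^sub>R axis j 1) + f x
       - h\<^sup>2 *\<^sub>R ?u) \<le> e/2 * h\<^sup>2" using second_difference[OF f e2, of x i j] by blast
    obtain d2 where d2: "d2 > 0" "\<And>h. 0 < h \<and> h < d2 \<Longrightarrow>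
        cmod (f (x + h *\<^sub>R axis j 1 + h *\<^sub>R axis i 1) - f (x + h *\<^sub>R axis j 1) - f (x + h *\<^sub>R axis i 1) + f x
       - h\<^sup>2 *\<^sub>R ?v) \<le> e/2 * h\<^sup>2" using second_difference[OF f e2, of x j i] by blast
    define h where "h = min d1 d2 / 2"
    have h: "0 < h" "h < d1" "h < d2" using d1 d2 by (auto simp: h_def)
    let ?D = "f (x + h *\<^sub>R axis i 1 + h *\<^sub>R axis j 1) - f (x + h *\<^sub>R axis i 1) - f (x + h *\<^sub>R axis j 1) + f x"
    have 1: "cmod (?D - h\<^sup>2 *\<^sub>R ?u) \<le> e/2 * h\<^sup>2" using d1 h by blast
    have "cmod (f (x + h *\<^sub>R axis j 1 + h *\<^sub>R axis i 1) - f (x + h *\<^sub>R axis j 1) - f (x + h *\<^sub>R axis i 1) + f x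
       - h\<^sup>2 *\<^sub>R ?v) \<le> e/2 * h\<^sup>2" using d2 h by blast
    also have "f (x + h *\<^sub>R axis j 1 + h *\<^sub>R axis i 1) - f (x + h *\<^sub>R axis j 1) - f (x + h *\<^sub>R axis i 1) + f x = ?D"
      by (simp add: algebra_simps)
    finally have 2: "cmod (?D - h\<^sup>2 *\<^sub>R ?v) \<le> e/2 * h\<^sup>2" .
    have "h\<^sup>2 * cmod (?v - ?u) = cmod (h\<^sup>2 *\<^sub>R (?v - ?u))" by (simp del: scaleR_diff_right)
    also have "\<dots> = cmod ((?D - h\<^sup>2 *\<^sub>R ?u) - (?D - h\<^sup>2 *\<^sub>R ?v))"
      by (simp add: algebra_simps)
    also have "\<dots> \<le> e/2 * h\<^sup>2 + e/2 * h\<^sup>2"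
      by (rule order_trans[OF norm_triangle_ineq4 add_mono[OF 1 2]])
    finally have "h\<^sup>2 * cmod (?v - ?u) \<le> h\<^sup>2 * e" by (simp add: algebra_simps)
    then show ?thesis using h by (simp add: mult_le_cancel_left)
  qed
  then have "cmod (?v - ?u) \<le> 0" by (rule field_le_epsilon[of _ 0, simplified])
  then show "?v = ?u" by simp
qed

section \<open>Multi-indices\<close>

text \<open>Multi-indices are treated as elements of an additive monoid; pointwise unfolding would
  destroy the terms \<open>\<alpha> + ei j\<close> on which rewriting relies.\<close>

declare plus_fun_apply [simp del] zero_fun_apply [simp del]

definition ei :: "'n \<Rightarrow> 'n multiindex" where
  "ei j = (\<lambda>i. if i = j then 1 else 0)"

lemma ei_same [simp]: "ei j j = 1" and ei_other: "i \<noteq> j \<Longrightarrow> ei j i = 0"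
  by (auto simp: ei_def)

lemma mi_abs_add [simp]: "mi_abs (\<alpha> + \<beta>) = mi_abs \<alpha> + mi_abs \<beta>"
  by (simp add: mi_abs_def sum.distrib plus_fun_apply)

lemma mi_abs_ei [simp]: "mi_abs (ei j) = 1"
  by (simp add: mi_abs_def ei_def)

lemma mi_abs_0 [simp]: "mi_abs 0 = 0"
  by (simp add: mi_abs_def zero_fun_apply)

lemma mi_abs_eq_0_iff: "mi_abs \<alpha> = 0 \<longleftrightarrow> \<alpha> = 0"
  by (auto simp: mi_abs_def fun_eq_iff zero_fun_apply)

lemma upd_Suc_eq: "\<alpha>(j := Suc (\<alpha> j)) = \<alpha> + ei j"
  by (auto simp: ei_def fun_eq_iff plus_fun_apply)

lemma mi_cases:
  assumes "\<alpha> j > 0"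
  shows "\<exists>\<beta>. \<alpha> = \<beta> + ei j"
proof
  show "\<alpha> = \<alpha>(j := \<alpha> j - 1) + ei j" using assms by (auto simp: ei_def fun_eq_iff plus_fun_apply)
qed

lemma mi_abs_Suc_cases:
  fixes \<alpha> :: "'n::finite multiindex"
  assumes "mi_abs \<alpha> = Suc k"
  obtains \<beta> j where "\<alpha> = \<beta> + ei j" "mi_abs \<beta> = k"
proof -
  have "\<exists>j. \<alpha> j > 0"
  proof (rule ccontr)
    assume "\<nexists>j. \<alpha> j > 0"
    then have "mi_abs \<alpha> = 0" by (simp add: mi_abs_def)
    with assms show False by simp
  qed
  then obtain j where "\<alpha> j > 0" ..
  from mi_cases[of \<alpha> j, OF this] obtain \<beta> where b: "\<alpha> = \<beta> + ei j" ..
  show ?thesis by (rule that[OF b]) (use assms b in simp)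
qed

lemma mi_induct [case_names zero step]:
  fixes \<alpha> :: "'n::finite multiindex"
  assumes "P 0" "\<And>\<alpha> j. P \<alpha> \<Longrightarrow> P (\<alpha> + ei j)"
  shows "P \<alpha>"
proof (induction "mi_abs \<alpha>" arbitrary: \<alpha>)
  case 0
  then have "\<alpha> = 0" using mi_abs_eq_0_iff by metis
  then show ?case using assms(1) by (simp only:)
next
  case (Suc k)
  from Suc(2)[symmetric] obtain \<beta> j where "\<alpha> = \<beta> + ei j" "mi_abs \<beta> = k" by (rule mi_abs_Suc_cases)
  with Suc(1) assms(2) show ?case by simp
qed

lemma iter_op_0 [simp]: "iter_op D 0 x = x"
proof -
  have "foldr (\<lambda>j. D j ^^ 0) js x = x" for js by (induction js) auto
  then show ?thesis by (simp add: iter_op_def zero_fun_apply)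
qed

text \<open>Closure and commutation are required only on the class \<open>X\<close>, since partial
  derivatives commute only on smooth functions. The list \<open>coords\<close> contains every index
  exactly once, so raising one exponent inserts a single \<open>D j\<close>, which is moved to the
  front past the other powers.\<close>

lemma iter_op_closed_commute:
  assumes X: "X x" and closed: "\<And>x j. X x \<Longrightarrow> X (D j x)"
    and comm: "\<And>x i j. X x \<Longrightarrow> D i (D j x) = D j (D i x)"
  shows iter_op_Suc: "iter_op D (\<alpha> + ei j) x = D j (iter_op D \<alpha> x)"
    and iter_op_closed: "X (iter_op D \<alpha> x)"
    and iter_op_Suc': "iter_op D (\<alpha> + ei j) x = iter_op D \<alpha> (D j x)"
proof -
  define F where "F \<alpha> js = foldr (\<lambda>j. D j ^^ \<alpha> j) js x" for \<alpha> js
  have pw: "X ((D i ^^ k) y)" if "X y" for i k y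
    by (induction k) (auto simp: that closed)
  have X: "X (F \<alpha> js)" for \<alpha> js
    by (induction js) (auto simp: F_def X pw)
  have comm': "D i ((D j ^^ k) y) = (D j ^^ k) (D i y)" if "X y" for i j k y
  proof (induction k)
    case (Suc k)
    have "D i ((D j ^^ Suc k) y) = D j (D i ((D j ^^ k) y))"
      by (simp add: comm[OF pw[OF that], of i j])
    with Suc show ?case by simp
  qed simp
  have "F (\<alpha> + ei j) js = (if j \<in> set js then D j (F \<alpha> js) else F \<alpha> js)" if "distinct js" for js \<alpha> j
    using that
  proof (induction js)
    case (Cons i js)
    show ?case
    proof (cases "i = j")
      case True
      then show ?thesis using Cons by (simp add: F_def plus_fun_apply)
    next
      case False
      then have "F (\<alpha> + ei j) (i # js) = (D i ^^ \<alpha> i) (F (\<alpha> + ei j) js)"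
        by (simp add: F_def ei_other plus_fun_apply)
      with False Cons comm'[OF X] show ?thesis by (auto simp: F_def)
    qed
  qed (simp add: F_def)
  from this[OF coords(1)] have 1: "iter_op D (\<alpha> + ei j) x = D j (iter_op D \<alpha> x)" for \<alpha> j
    by (simp add: F_def iter_op_def coords(2))
  from X[of _ coords] have X': "X (iter_op D \<alpha> x)" for \<alpha> by (simp add: F_def iter_op_def)
  show "iter_op D (\<alpha> + ei j) x = D j (iter_op D \<alpha> x)" "X (iter_op D \<alpha> x)" by (fact 1 X')+
  note 2 = 1
  show "iter_op D (\<alpha> + ei j) x = iter_op D \<alpha> (D j x)"
  proof -
    \<comment> \<open>The first claim with \<open>D j x\<close> in place of \<open>x\<close>, as the
      induction on \<open>\<alpha>\<close> below requires.\<close>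
    have g: "iter_op D (\<beta> + ei k) (D j x) = D k (iter_op D \<beta> (D j x))" for \<beta> k
    proof -
      define G where "G \<alpha> js = foldr (\<lambda>i. D i ^^ \<alpha> i) js (D j x)" for \<alpha> js
      have XG: "X (G \<alpha> js)" for \<alpha> js
        by (induction js) (auto simp: G_def assms pw)
      have "G (\<alpha> + ei j) js = (if j \<in> set js then D j (G \<alpha> js) else G \<alpha> js)" if "distinct js" for js \<alpha> j
        using that
      proof (induction js)
        case (Cons i js)
        show ?case
        proof (cases "i = j")
          case True
          then show ?thesis using Cons by (simp add: G_def plus_fun_apply)
        next
          case False
          then have "G (\<alpha> + ei j) (i # js) = (D i ^^ \<alpha> i) (G (\<alpha> + ei j) js)"
            by (simp add: G_def ei_other plus_fun_apply)
          with False Cons comm'[OF XG] show ?thesis by (auto simp: G_def)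
        qed
      qed (simp add: G_def)
      from this[OF coords(1)] show ?thesis
        by (simp add: G_def iter_op_def coords(2))
    qed
    show ?thesis
    proof (induction \<alpha> rule: mi_induct)
      case zero
      then show ?case using 1[of 0 j] by simp
    next
      case (step \<beta> k)
      have "iter_op D (\<beta> + ei k + ei j) x = D j (D k (iter_op D \<beta> x))" by (simp add: 1)
      also have "\<dots> = D k (iter_op D (\<beta> + ei j) x)" by (simp add: 1 comm[OF X'])
      finally show ?case using step g by simp
    qed
  qed
qed

subsection \<open>Iterated partial derivatives\<close>

abbreviation pd :: "'n::finite multiindex \<Rightarrow> (real ^ 'n \<Rightarrow> complex) \<Rightarrow> real ^ 'n \<Rightarrow> complex" where
  "pd \<equiv> iter_op partial"

lemma pd_Suc: "smooth f \<Longrightarrow> pd (\<alpha> + ei j) f = partial j (pd \<alpha> f)"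
  by (rule iter_op_Suc[where X=smooth]) (auto intro: smooth_partial partial_commute)

lemma pd_Suc': "smooth f \<Longrightarrow> pd (\<alpha> + ei j) f = pd \<alpha> (partial j f)"
  by (rule iter_op_Suc'[where X=smooth]) (auto intro: smooth_partial partial_commute)

lemma smooth_pd: "smooth f \<Longrightarrow> smooth (pd \<alpha> f)"
  by (rule iter_op_closed[where X=smooth]) (auto intro: smooth_partial partial_commute)

lemma pd_ei: "smooth f \<Longrightarrow> pd (ei j) f = partial j f"
  using pd_Suc[of f 0 j] by simp

lemma pd_pd: "smooth f \<Longrightarrow> pd \<alpha> (pd \<beta> f) = pd (\<alpha> + \<beta>) f"
proof (induction \<alpha> rule: mi_induct)
  case (step \<alpha> j)
  have "pd (\<alpha> + ei j) (pd \<beta> f) = partial j (pd (\<alpha> + \<beta>) f)"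
    using step by (simp add: pd_Suc smooth_pd)
  also have "\<dots> = pd (\<alpha> + ei j + \<beta>) f"
    using pd_Suc[OF step(2), of "\<alpha> + \<beta>" j] by (simp add: ac_simps)
  finally show ?case .
qed simp

lemma pd_add: "smooth f \<Longrightarrow> smooth g \<Longrightarrow> pd \<alpha> (\<lambda>x. f x + g x) = (\<lambda>x. pd \<alpha> f x + pd \<alpha> g x)"
proof (induction \<alpha> rule: mi_induct)
  case (step \<alpha> j)
  then show ?case
    by (simp add: pd_Suc smooth_add partial_add smooth_differentiable smooth_pd)
qed simp

lemma pd_cmult: "smooth f \<Longrightarrow> pd \<alpha> (\<lambda>x. c * f x) = (\<lambda>x. c * pd \<alpha> f x)"
proof (induction \<alpha> rule: mi_induct)
  case (step \<alpha> j)
  then show ?case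
    by (simp add: pd_Suc smooth_cmult partial_cmult smooth_differentiable smooth_pd)
qed simp

lemma pd_minus: "smooth f \<Longrightarrow> smooth g \<Longrightarrow> pd \<alpha> (\<lambda>x. f x - g x) = (\<lambda>x. pd \<alpha> f x - pd \<alpha> g x)"
  using pd_add[of f "\<lambda>x. -1 * g x" \<alpha>] pd_cmult[of g \<alpha> "-1"] smooth_cmult[of g "-1"] by simp

lemma pd_zero [simp]: "pd \<alpha> (\<lambda>x. 0) = (\<lambda>x. 0)"
  using pd_cmult[of "\<lambda>x. 0" \<alpha> 0] by simp

lemma pd_sum:
  assumes "\<And>i. i \<in> I \<Longrightarrow> smooth (f i)" 
  shows "pd \<alpha> (\<lambda>x. \<Sum>i\<in>I. f i x) = (\<lambda>x. \<Sum>i\<in>I. pd \<alpha> (f i) x)"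
  using assms
proof (induction I rule: infinite_finite_induct)
  case (insert i I)
  then show ?case by (simp add: pd_add smooth_sum)
qed auto

lemma pd_affine:
  "smooth f \<Longrightarrow> pd \<alpha> (\<lambda>x. f (c *\<^sub>R x + a)) = (\<lambda>x. of_real (c ^ mi_abs \<alpha>) * pd \<alpha> f (c *\<^sub>R x + a))"
proof (induction \<alpha> rule: mi_induct)
  case (step \<alpha> j)
  have "pd (\<alpha> + ei j) (\<lambda>x. f (c *\<^sub>R x + a)) = partial j (\<lambda>x. of_real (c ^ mi_abs \<alpha>) * pd \<alpha> f (c *\<^sub>R x + a))"
    using step by (simp add: pd_Suc smooth_affine)
  also have "\<dots> = (\<lambda>x. of_real (c ^ mi_abs \<alpha>) * (of_real c * partial j (pd \<alpha> f) (c *\<^sub>R x + a)))"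
    by (subst partial_cmult) (simp_all only: partial_affine[OF smooth_differentiable[OF smooth_pd[OF step(2)]]]
      differentiable_affine[OF smooth_differentiable[OF smooth_pd[OF step(2)]]])
  finally show ?case by (simp add: pd_Suc[OF step(2)] ac_simps)
qed simp

lemma pd_reflect: "smooth f \<Longrightarrow> pd \<alpha> (\<lambda>y. f (x - y)) = (\<lambda>y. (-1) ^ mi_abs \<alpha> * pd \<alpha> f (x - y))"
  using pd_affine[of f \<alpha> "-1" x] by simp

lemma pd_mult_Suc:
  assumes "smooth f" "smooth g"
  shows "pd (\<alpha> + ei j) (\<lambda>x. f x * g x) = (\<lambda>x. pd \<alpha> (\<lambda>x. partial j f x * g x) x + pd \<alpha> (\<lambda>x. f x * partial j g x) x)"
  using assms
  by (simp add: pd_Suc' smooth_mult partial_mult smooth_differentiable pd_add smooth_partial)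

text \<open>Bounds of the form \<open>B * r ^ mi_abs \<beta>\<close> describe functions living at
  length scale 1/r and are stable under products. Every differentiation splits into two terms, hence
  a factor 2 per order.\<close>

lemma leibniz_bound:
  assumes "smooth f" "smooth g" "B \<ge> 0" "C \<ge> 0" "r \<ge> 0"
    and "\<And>\<beta>. mi_abs \<beta> \<le> mi_abs \<alpha> \<Longrightarrow> cmod (pd \<beta> f x) \<le> B * r ^ mi_abs \<beta>"
    and "\<And>\<beta>. mi_abs \<beta> \<le> mi_abs \<alpha> \<Longrightarrow> cmod (pd \<beta> g x) \<le> C * r ^ mi_abs \<beta>"
  shows "cmod (pd \<alpha> (\<lambda>x. f x * g x) x) \<le> 2 ^ mi_abs \<alpha> * B * C * r ^ mi_abs \<alpha>"
  using assms
proof (induction "mi_abs \<alpha>" arbitrary: \<alpha> f g B C)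
  case 0
  then have "\<alpha> = 0" by (simp add: mi_abs_eq_0_iff)
  with 0(7)[of 0] 0(8)[of 0] 0(4,5) show ?case by (simp add: norm_mult mult_mono)
next
  case (Suc k)
  obtain \<beta> j where \<alpha>: "\<alpha> = \<beta> + ei j" "mi_abs \<beta> = k"
    using mi_abs_Suc_cases[OF Suc(2)[symmetric]] by blast
  note f = Suc.prems(1) and g = Suc.prems(2)
  have fb: "cmod (pd \<gamma> f x) \<le> B * r ^ mi_abs \<gamma>" "cmod (pd \<gamma> g x) \<le> C * r ^ mi_abs \<gamma>" 
    if "mi_abs \<gamma> \<le> Suc k" for \<gamma>
    using Suc.prems(6,7)[of \<gamma>] that Suc.hyps(2) by auto
  have 1: "cmod (pd \<beta> (\<lambda>x. partial j f x * g x) x) \<le> 2 ^ mi_abs \<beta> * (B * r) * C * r ^ mi_abs \<beta>"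
  proof (rule Suc.hyps(1))
    fix \<gamma> :: "'a multiindex" assume "mi_abs \<gamma> \<le> mi_abs \<beta>"
    then show "cmod (pd \<gamma> (partial j f) x) \<le> B * r * r ^ mi_abs \<gamma>" "cmod (pd \<gamma> g x) \<le> C * r ^ mi_abs \<gamma>"
      using fb[of "\<gamma> + ei j"] fb[of \<gamma>] \<alpha> by (auto simp: pd_Suc'[OF f] mult.assoc)
  qed (use \<alpha> Suc.prems smooth_partial in auto)
  have 2: "cmod (pd \<beta> (\<lambda>x. f x * partial j g x) x) \<le> 2 ^ mi_abs \<beta> * B * (C * r) * r ^ mi_abs \<beta>"
  proof (rule Suc.hyps(1))
    fix \<gamma> :: "'a multiindex" assume "mi_abs \<gamma> \<le> mi_abs \<beta>"
    then show "cmod (pd \<gamma> (partial j g) x) \<le> C * r * r ^ mi_abs \<gamma>" "cmod (pd \<gamma> f x) \<le> B * r ^ mi_abs \<gamma>"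
      using fb[of "\<gamma> + ei j"] fb[of \<gamma>] \<alpha> by (auto simp: pd_Suc'[OF g] mult.assoc)
  qed (use \<alpha> Suc.prems smooth_partial in auto)
  show ?case
    unfolding \<alpha>(1) pd_mult_Suc[OF f g]
    by (rule order_trans[OF norm_triangle_ineq], rule order_trans[OF add_mono[OF 1 2]])
       (simp add: algebra_simps)
qed

section \<open>Taylor expansion\<close>

lemma mean_value_partial:
  fixes f :: "real ^ 'n::finite \<Rightarrow> complex" and B :: real
  assumes f: "smooth f" and S: "convex S" "x \<in> S" "y \<in> S" 
    and B: "\<And>z j. z \<in> S \<Longrightarrow> cmod (partial j f z) \<le> B"
  shows "cmod (f x - f y) \<le> CARD('n) * B * norm (x - y)"
proof (rule differentiable_bound[where f'="\<lambda>z h. \<Sum>j\<in>UNIV. (h $ j) *\<^sub>R partial j f z", OF S(1) _ _ S(2,3)])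
  show "(f has_derivative (\<lambda>h. \<Sum>j\<in>UNIV. (h $ j) *\<^sub>R partial j f z)) (at z within S)" for z
    by (rule has_derivative_at_withinI[OF has_derivative_partial[OF smooth_differentiable[OF f]]])
  show "onorm (\<lambda>h. \<Sum>j\<in>UNIV. (h $ j) *\<^sub>R partial j f z) \<le> CARD('n) * B" if "z \<in> S" for z
  proof (rule onorm_le)
    fix h :: "real ^ 'n"
    have "cmod (\<Sum>j\<in>UNIV. (h $ j) *\<^sub>R partial j f z) \<le> (\<Sum>j\<in>(UNIV::'n set). norm h * B)"
    proof (rule order_trans[OF norm_sum], rule sum_mono)
      fix j
      show "norm ((h $ j) *\<^sub>R partial j f z) \<le> norm h * B"
        unfolding norm_scaleR by (rule mult_mono[OF _ B[OF that]]) (simp_all add: component_le_norm_cart)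
    qed
    then show "cmod (\<Sum>j\<in>UNIV. (h $ j) *\<^sub>R partial j f z) \<le> CARD('n) * B * norm h"
      by (simp add: algebra_simps)
  qed
qed

text \<open>Downward induction on the order: a derivative of order below \<open>n\<close> vanishes
  at \<open>x\<close>, so the mean value inequality on the ball of radius
  \<open>norm (w - x)\<close> integrates the bound once more and costs a factor
  \<open>CARD('n)\<close>.\<close>

lemma iterated_mean_value:
  fixes G :: "real ^ 'n::finite \<Rightarrow> complex" and M :: real
  assumes G: "smooth G" and zero: "\<And>\<gamma>. mi_abs \<gamma> < n \<Longrightarrow> pd \<gamma> G x = 0"
    and M: "\<And>\<gamma> w. mi_abs \<gamma> = n \<Longrightarrow> w \<in> cball x (norm (z - x)) \<Longrightarrow> cmod (pd \<gamma> G w) \<le> M"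
    and \<alpha>: "mi_abs \<alpha> \<le> n"
  shows "cmod (pd \<alpha> G z) \<le> CARD('n) ^ (n - mi_abs \<alpha>) * M * norm (z - x) ^ (n - mi_abs \<alpha>)"
proof -
  have "\<forall>\<alpha> w. mi_abs \<alpha> + k = n \<longrightarrow> w \<in> cball x (norm (z - x)) \<longrightarrow> 
      cmod (pd \<alpha> G w) \<le> CARD('n) ^ k * M * norm (w - x) ^ k" for k
  proof (induction k)
    case 0
    then show ?case using M by simp
  next
    case (Suc k)
    show ?case
    proof (intro allI impI)
      fix \<alpha> :: "'n multiindex" and w
      assume a: "mi_abs \<alpha> + Suc k = n" and w: "w \<in> cball x (norm (z - x))"
      \<comment> \<open>Some multi-index of order exactly \<open>n\<close> must be exhibited to read
        off the sign of \<open>M\<close>.\<close>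
      have M0: "M \<ge> 0"
      proof -
        obtain \<gamma> :: "'n multiindex" where "mi_abs \<gamma> = n"
        proof
          show "mi_abs (\<lambda>i. if i = (undefined::'n) then n else 0) = n" by (simp add: mi_abs_def)
        qed
        from order_trans[OF norm_ge_zero M[OF this, of x]] show ?thesis by simp
      qed
      have "cmod (pd \<alpha> G w - pd \<alpha> G x) \<le> CARD('n) * (CARD('n) ^ k * M * norm (w - x) ^ k) * norm (w - x)"
      proof (rule mean_value_partial[where S="cball x (norm (w - x))"])
        fix v j assume v: "v \<in> cball x (norm (w - x))"
        have "cmod (partial j (pd \<alpha> G) v) = cmod (pd (\<alpha> + ei j) G v)"
          by (simp add: pd_Suc[OF G])
        also have "\<dots> \<le> CARD('n) ^ k * M * norm (v - x) ^ k"
          by (rule Suc.IH[rule_format]) (use a v w in \<open>auto simp: dist_norm norm_minus_commute\<close>)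
        also have "\<dots> \<le> CARD('n) ^ k * M * norm (w - x) ^ k"
          by (intro mult_left_mono power_mono) (use v M0 in \<open>auto simp: dist_norm norm_minus_commute\<close>)
        finally show "cmod (partial j (pd \<alpha> G) v) \<le> CARD('n) ^ k * M * norm (w - x) ^ k" .
      qed (auto simp: smooth_pd G dist_norm norm_minus_commute)
      then show "cmod (pd \<alpha> G w) \<le> CARD('n) ^ Suc k * M * norm (w - x) ^ Suc k"
        using zero[of \<alpha>] a by (simp add: algebra_simps)
    qed
  qed
  from this[of "n - mi_abs \<alpha>", rule_format, of \<alpha> z] \<alpha> show ?thesis by (simp add: dist_norm norm_minus_commute)
qed

text \<open>The \<open>\<alpha>\<close>-th derivative of the Taylor polynomial of order
  \<open>n\<close> at \<open>x\<close>, as \<open>pd_taylor\<close> shows. In this closed form the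
  family over \<open>\<alpha>\<close> is itself a jet, so that Taylor expansion can be iterated as
  in \<open>tay_expand\<close>.\<close>

definition tay :: "nat \<Rightarrow> 'n::finite jet \<Rightarrow> real ^ 'n \<Rightarrow> 'n multiindex \<Rightarrow> real ^ 'n \<Rightarrow> complex" where
  "tay n f x \<alpha> y = (\<Sum>\<beta> | mi_abs \<alpha> + mi_abs \<beta> \<le> n. f (\<alpha> + \<beta>) x / of_nat (mi_fact \<beta>) * mi_power (cvec (y - x)) \<beta>)"

lemma finite_mi [simp]: "finite {\<beta> :: 'n::finite multiindex. k + mi_abs \<beta> \<le> n}"
  by (rule finite_subset[OF _ finite_multiindices[of n]]) auto

lemma taylor_eq_tay: "taylor n f x = tay n f x 0"
  by (simp add: taylor_def tay_def fun_eq_iff)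

lemma mi_power_0 [simp]: "mi_power z 0 = 1"
  by (simp add: mi_power_def zero_fun_apply)

lemma mi_power_ei: "mi_power z (\<alpha> + ei j) = mi_power z \<alpha> * z $ j"
proof -
  have "mi_power z (\<alpha> + ei j) = (\<Prod>i\<in>UNIV. (z $ i) ^ \<alpha> i * (if i = j then z $ j else 1))"
    unfolding mi_power_def by (intro prod.cong) (auto simp: ei_def plus_fun_apply)
  then show ?thesis by (simp add: prod.distrib mi_power_def)
qed

lemma mi_fact_0 [simp]: "mi_fact 0 = 1"
  by (simp add: mi_fact_def zero_fun_apply)

lemma mi_fact_ei: "mi_fact (\<alpha> + ei j) = mi_fact \<alpha> * Suc (\<alpha> j)"
proof -
  have "mi_fact (\<alpha> + ei j) = (\<Prod>i\<in>UNIV. fact (\<alpha> i) * (if i = j then Suc (\<alpha> j) else 1))"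
    unfolding mi_fact_def by (intro prod.cong) (auto simp: ei_def plus_fun_apply)
  then show ?thesis by (simp add: prod.distrib mi_fact_def)
qed

lemma mi_fact_pos: "mi_fact \<alpha> > 0"
  by (simp add: mi_fact_def prod_pos)

lemma smooth_coord_diff: "smooth (\<lambda>y::real^'n::finite. cvec (y - x) $ i)"
  by (simp add: cvec_def smooth_minus smooth_coord)

lemma smooth_mi_power: "smooth (\<lambda>y. mi_power (cvec (y - x)) \<alpha>)"
  unfolding mi_power_def by (intro smooth_prod smooth_power smooth_coord_diff)

lemma partial_coord_diff: "partial j (\<lambda>y. cvec (y - x) $ i) = (\<lambda>y. if i = j then 1 else 0)"
proof -
  have "partial j (\<lambda>y. complex_of_real (y $ i) + - complex_of_real (x $ i)) = (\<lambda>y. if i = j then 1 else 0)"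
    by (subst partial_add) (auto simp: partial_coord differentiable_coord)
  then show ?thesis by (simp add: cvec_def)
qed

lemma partial_mi_power_ei:
  "partial j (\<lambda>y. mi_power (cvec (y - x)) (\<alpha> + ei j)) = (\<lambda>y. of_nat (Suc (\<alpha> j)) * mi_power (cvec (y - x)) \<alpha>)"
  and partial_mi_power_0:
  "\<alpha> j = 0 \<Longrightarrow> partial j (\<lambda>y. mi_power (cvec (y - x)) \<alpha>) = (\<lambda>y. 0)"
proof -
  have *: "partial j (\<lambda>y. mi_power (cvec (y - x)) (\<alpha> + ei i)) = 
      (\<lambda>y. partial j (\<lambda>y. mi_power (cvec (y - x)) \<alpha>) y * cvec (y - x) $ i + mi_power (cvec (y - x)) \<alpha> * (if i = j then 1 else 0))" for \<alpha> i
    unfolding mi_power_ei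
    by (subst partial_mult) (simp_all add: smooth_differentiable smooth_mi_power smooth_coord_diff partial_coord_diff del: mult_if_delta)
  have z: "partial j (\<lambda>y. mi_power (cvec (y - x)) \<alpha>) = (\<lambda>y. 0)" if "\<alpha> j = 0" for \<alpha>
    using that
  proof (induction \<alpha> rule: mi_induct)
    case (step \<alpha> i)
    from step.prems have "\<alpha> j = 0" "i \<noteq> j"
      by (auto simp: plus_fun_apply ei_def split: if_splits)
    with step.IH show ?case by (simp add: *)
  qed simp
  then show "\<alpha> j = 0 \<Longrightarrow> partial j (\<lambda>y. mi_power (cvec (y - x)) \<alpha>) = (\<lambda>y. 0)" .
  have "\<exists>\<beta>. \<alpha> = \<beta> + ei j" if "\<alpha> j = Suc k" for \<alpha> :: "'a multiindex" and k
    using mi_cases[of \<alpha> j] that by auto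
  show "partial j (\<lambda>y. mi_power (cvec (y - x)) (\<alpha> + ei j)) = (\<lambda>y. of_nat (Suc (\<alpha> j)) * mi_power (cvec (y - x)) \<alpha>)"
  proof (induction "\<alpha> j" arbitrary: \<alpha>)
    case 0
    then show ?case by (simp add: * z)
  next
    case (Suc k)
    then obtain \<beta> where \<beta>: "\<alpha> = \<beta> + ei j" using mi_cases[of \<alpha> j] by auto
    with Suc have "partial j (\<lambda>y. mi_power (cvec (y - x)) \<alpha>) = (\<lambda>y. of_nat (Suc k) * mi_power (cvec (y - x)) \<beta>)"
      by (auto simp: plus_fun_apply)
    then show ?case unfolding *[of \<alpha> j] using Suc(2)[symmetric] \<beta>
      by (simp add: mi_power_ei algebra_simps)
  qed
qed

lemma smooth_tay: "smooth (tay n f x \<alpha>)"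
  unfolding tay_def[abs_def] by (intro smooth_sum smooth_cmult smooth_mi_power)

lemma partial_sum:
  assumes "\<And>i. i \<in> I \<Longrightarrow> smooth (f i)" 
  shows "partial j (\<lambda>x. \<Sum>i\<in>I. f i x) = (\<lambda>x. \<Sum>i\<in>I. partial j (f i) x)"
  using pd_sum[of I f "ei j", OF assms] assms by (simp add: pd_ei smooth_sum)

lemma partial_tay: "partial j (tay n f x \<alpha>) = tay n f x (\<alpha> + ei j)"
proof
  fix y
  let ?S = "{\<beta>. mi_abs \<alpha> + mi_abs \<beta> \<le> n}"
  let ?t = "\<lambda>\<beta>. f (\<alpha> + \<beta>) x / of_nat (mi_fact \<beta>) * partial j (\<lambda>y. mi_power (cvec (y - x)) \<beta>) y"
  have "partial j (tay n f x \<alpha>) y = sum ?t ?S"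
    unfolding tay_def[abs_def]
    by (subst partial_sum) 
       (simp_all only: smooth_cmult smooth_mi_power partial_cmult[OF smooth_differentiable[OF smooth_mi_power]])
  also have "\<dots> = sum ?t {\<beta> \<in> ?S. \<beta> j > 0}"
    by (rule sum.mono_neutral_right) (auto simp: partial_mi_power_0)
  \<comment> \<open>Monomials without a factor in direction \<open>j\<close> have dropped out; the
    others are reindexed, and the factor produced by the derivative cancels against the
    factorial.\<close>
  also have "\<dots> = (\<Sum>\<beta> | mi_abs (\<alpha> + ei j) + mi_abs \<beta> \<le> n. ?t (\<beta> + ei j))"
  proof (rule sum.reindex_bij_betw[symmetric])
    show "bij_betw (\<lambda>\<beta>. \<beta> + ei j) {\<beta>. mi_abs (\<alpha> + ei j) + mi_abs \<beta> \<le> n} {\<beta> \<in> ?S. \<beta> j > 0}"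
      unfolding bij_betw_def
    proof
      show "(\<lambda>\<beta>. \<beta> + ei j) ` {\<beta>. mi_abs (\<alpha> + ei j) + mi_abs \<beta> \<le> n} = {\<beta> \<in> ?S. \<beta> j > 0}"
      proof (intro equalityI subsetI)
        fix \<beta> assume b: "\<beta> \<in> {\<beta> \<in> ?S. \<beta> j > 0}"
        then obtain \<gamma> where "\<beta> = \<gamma> + ei j" using mi_cases[of \<beta> j] by auto
        with b show "\<beta> \<in> (\<lambda>\<beta>. \<beta> + ei j) ` {\<beta>. mi_abs (\<alpha> + ei j) + mi_abs \<beta> \<le> n}" by auto
      qed (auto simp: plus_fun_apply)
    qed (auto simp: inj_on_def)
  qed
  also have "\<dots> = tay n f x (\<alpha> + ei j) y"
    unfolding tay_def
  proof (rule sum.cong[OF refl])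
    fix \<beta> :: "'a multiindex"
    have "of_nat (mi_fact \<beta>) \<noteq> (0::complex)" using mi_fact_pos[of \<beta>] by simp
    then show "?t (\<beta> + ei j) = f (\<alpha> + ei j + \<beta>) x / of_nat (mi_fact \<beta>) * mi_power (cvec (y - x)) \<beta>"
      unfolding partial_mi_power_ei mi_fact_ei of_nat_mult by (simp add: ac_simps del: of_nat_Suc)
  qed
  finally show "partial j (tay n f x \<alpha>) y = tay n f x (\<alpha> + ei j) y" .
qed

lemma pd_tay: "pd \<gamma> (tay n f x \<alpha>) = tay n f x (\<alpha> + \<gamma>)"
  by (induction \<gamma> rule: mi_induct) (simp_all add: pd_Suc smooth_tay partial_tay ac_simps)

lemma pd_taylor: "pd \<alpha> (taylor n f x) = tay n f x \<alpha>"
  by (simp add: taylor_eq_tay pd_tay)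

lemma tay_self: "tay n f x \<alpha> x = (if mi_abs \<alpha> \<le> n then f \<alpha> x else 0)"
proof -
  have z: "mi_power (cvec (x - x)) \<beta> = (if \<beta> = 0 then 1 else 0)" for \<beta> :: "'a multiindex"
    by (auto simp: mi_power_def cvec_def fun_eq_iff zero_fun_apply)
  have "tay n f x \<alpha> x = (\<Sum>\<beta>::'a multiindex | mi_abs \<alpha> + mi_abs \<beta> \<le> n. if \<beta> = 0 then f \<alpha> x else 0)"
    unfolding tay_def z by (rule sum.cong) auto
  then show ?thesis by (simp add: sum.delta')
qed

lemma tay_beyond: "mi_abs \<alpha> > n \<Longrightarrow> tay n f x \<alpha> y = 0"
  by (simp add: tay_def)

definition jets :: "(real ^ 'n::finite \<Rightarrow> complex) \<Rightarrow> 'n jet" where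
  "jets \<phi> = (\<lambda>\<alpha>. pd \<alpha> \<phi>)"

lemma jets_apply [simp]: "jets \<phi> \<alpha> x = pd \<alpha> \<phi> x"
  by (simp add: jets_def)

text \<open>Subtracting the Taylor polynomial makes all derivatives up to order \<open>n\<close>
  vanish at \<open>x\<close>, and in order n + 1 the polynomial contributes nothing, so
  \<open>iterated_mean_value\<close> applies.\<close>

lemma taylor_remainder:
  fixes \<phi> :: "real ^ 'n::finite \<Rightarrow> complex" and M :: real
  assumes \<phi>: "smooth \<phi>" 
    and M: "\<And>\<gamma> w. mi_abs \<gamma> = Suc n \<Longrightarrow> w \<in> cball x (norm (z - x)) \<Longrightarrow> cmod (pd \<gamma> \<phi> w) \<le> M"
    and \<alpha>: "mi_abs \<alpha> \<le> n"
  shows "cmod (pd \<alpha> \<phi> z - tay n (jets \<phi>) x \<alpha> z) \<le> CARD('n) ^ (Suc n - mi_abs \<alpha>) * M * norm (z - x) ^ (Suc n - mi_abs \<alpha>)"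
proof -
  let ?G = "\<lambda>y. \<phi> y - tay n (jets \<phi>) x 0 y"
  have pG: "pd \<gamma> ?G = (\<lambda>y. pd \<gamma> \<phi> y - tay n (jets \<phi>) x \<gamma> y)" for \<gamma>
    by (simp add: pd_minus \<phi> smooth_tay pd_tay)
  have "cmod (pd \<alpha> ?G z) \<le> CARD('n) ^ (Suc n - mi_abs \<alpha>) * M * norm (z - x) ^ (Suc n - mi_abs \<alpha>)"
    by (rule iterated_mean_value) 
       (use M \<alpha> in \<open>auto simp: smooth_minus \<phi> smooth_tay pG tay_beyond tay_self\<close>)
  then show ?thesis by (simp add: pG)
qed

text \<open>The derivatives of order n + 1 of a Taylor polynomial vanish, so the remainder estimate
  for its expansion at \<open>a\<close> holds with the bound 0 and the re-expansion is
  exact.\<close>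

lemma tay_expand: 
  "tay n f p \<alpha> z = tay n (\<lambda>\<beta>. tay n f p \<beta>) a \<alpha> z"
proof (cases "mi_abs \<alpha> \<le> n")
  case True
  have j: "jets (tay n f p 0) = (\<lambda>\<beta>. tay n f p \<beta>)" by (simp add: jets_def pd_tay)
  have "cmod (pd \<alpha> (tay n f p 0) z - tay n (jets (tay n f p 0)) a \<alpha> z) \<le> real (CARD('a) ^ (Suc n - mi_abs \<alpha>)) * 0 * norm (z - a) ^ (Suc n - mi_abs \<alpha>)"
    by (rule taylor_remainder[OF smooth_tay]) (use True in \<open>auto simp: pd_tay tay_beyond\<close>)
  then show ?thesis by (simp add: j pd_tay)
qed (simp add: tay_beyond)

section \<open>Bump functions\<close>

text \<open>The functions p(1/t) exp(-1/t) form a family closed under differentiation, with p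
  replaced by X^2 (p - p'); this supplies the sequence of derivatives that
  \<open>smooth_compose_real\<close> expects.\<close>

definition expinv :: "real poly \<Rightarrow> real \<Rightarrow> real" where
  "expinv p t = (if t > 0 then poly p (1 / t) * exp (- (1 / t)) else 0)"

lemma poly_exp_tendsto_0: "((\<lambda>x::real. poly p x * exp (- x)) \<longlongrightarrow> 0) at_top"
proof -
  have "((\<lambda>x. \<Sum>i\<le>degree p. coeff p i * (x ^ i / exp x)) \<longlongrightarrow> (\<Sum>i\<le>degree p. coeff p i * 0)) at_top"
    by (intro tendsto_intros tendsto_power_div_exp_0)
  then show ?thesis
    by (simp add: poly_altdef exp_minus field_simps sum_divide_distrib)
qed

lemma expinv_derivative:
  "(expinv p has_real_derivative expinv ([:0, 0, 1:] * (p - pderiv p)) t) (at t)"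
proof -
  consider "t > 0" | "t < 0" | "t = 0" by linarith
  then show ?thesis
  proof cases
    case 1
    have "((\<lambda>t. poly p (1 / t) * exp (- (1 / t))) has_real_derivative expinv ([:0, 0, 1:] * (p - pderiv p)) t) (at t)"
      using 1 by (auto intro!: derivative_eq_intros poly_DERIV DERIV_chain2[of "poly p"] simp: expinv_def field_simps power2_eq_square)
    then show ?thesis
      by (rule has_field_derivative_transform_within_open[of _ _ _ "{0<..}"]) (use 1 in \<open>auto simp: expinv_def\<close>)
  next
    case 2
    have "((\<lambda>t. 0) has_real_derivative expinv ([:0, 0, 1:] * (p - pderiv p)) t) (at t)"
      using 2 by (simp add: expinv_def)
    then show ?thesis
      by (rule has_field_derivative_transform_within_open[of _ _ _ "{..<0}"]) (use 2 in \<open>auto simp: expinv_def\<close>)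
  next
    case 3
    have "((\<lambda>h. expinv p h / h) \<longlongrightarrow> 0) (at 0)"
    proof (rule filterlim_split_at)
      show "((\<lambda>h. expinv p h / h) \<longlongrightarrow> 0) (at_left 0)"
        by (rule tendsto_eventually) (auto simp: eventually_at_left_field expinv_def intro!: exI[of _ "-1"])
      \<comment> \<open>Dividing by \<open>h\<close> multiplies the polynomial in 1/h by its
        variable, hence \<open>pCons 0 p\<close>.\<close>
      have "((\<lambda>h. poly (pCons 0 p) (inverse h) * exp (- (inverse h))) \<longlongrightarrow> 0) (at_right (0::real))"
        by (rule filterlim_compose[OF poly_exp_tendsto_0 filterlim_inverse_at_top_right])
      then show "((\<lambda>h. expinv p h / h) \<longlongrightarrow> 0) (at_right 0)"
        by (rule Lim_transform_eventually) 
           (auto simp: eventually_at_right_field expinv_def field_simps intro!: exI[of _ 1])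
    qed
    then have "(expinv p has_real_derivative 0) (at 0)"
      unfolding has_field_derivative_iff by (simp add: expinv_def[of p 0])
    then show ?thesis by (simp add: 3 expinv_def)
  qed
qed

lemma smooth_inverse:
  assumes "smooth f" "\<And>x. f x \<noteq> 0"
  shows "smooth (\<lambda>x. inverse (f x))"
proof -
  have d: "(\<lambda>x. inverse (f x)) differentiable (at x)" for x
    by (intro differentiable_inverse smooth_differentiable assms)
  have p: "partial j (\<lambda>x. inverse (f x)) = (\<lambda>x. - partial j f x * (inverse (f x) * inverse (f x)))" for j
    by (rule ext, subst partial_eq[OF Deriv.has_derivative_inverse[OF _ has_derivative_partial[OF smooth_differentiable]]])
       (use assms in \<open>auto simp: sum_axis\<close>)
  have "Ck n (\<lambda>x. inverse (f x))" for n
  proof (induction n)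
    case (Suc n)
    have "Ck n (\<lambda>x. - partial j f x)" for j
      using smooth_uminus[OF smooth_partial[OF assms(1)]] by (auto simp: smooth_iff_Ck)
    with Suc show ?case unfolding Ck.simps(2) p by (intro conjI allI d Ck_mult)
  qed (simp add: d)
  then show ?thesis by (simp add: smooth_iff_Ck)
qed

definition bump0 :: "real \<Rightarrow> real" where "bump0 t = (if t > 0 then exp (- (1 / t)) else 0)"

lemma smooth_bump0:
  assumes "smooth (\<lambda>x. complex_of_real (f x))" shows "smooth (\<lambda>x. complex_of_real (bump0 (f x)))"
proof -
  define p where "p k = ((\<lambda>p. [:0, 0, 1:] * (p - pderiv p)) ^^ k) [:1::real:]" for k
  have "smooth (\<lambda>x. complex_of_real (expinv (p 0) (f x)))"
    by (rule smooth_compose_real[where g="\<lambda>k. expinv (p k)"]) (use expinv_derivative assms in \<open>auto simp: p_def\<close>)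
  then show ?thesis by (simp add: p_def expinv_def bump0_def[abs_def] if_distrib cong: if_cong)
qed

lemma bump0_nonneg: "bump0 t \<ge> 0" and bump0_pos_iff: "bump0 t > 0 \<longleftrightarrow> t > 0"
  by (auto simp: bump0_def)

definition step :: "real \<Rightarrow> real" where "step t = bump0 t / (bump0 t + bump0 (1 - t))"

lemma bump0_sum_pos: "bump0 t + bump0 (1 - t) > 0"
  using bump0_nonneg[of t] bump0_nonneg[of "1 - t"] bump0_pos_iff[of t] bump0_pos_iff[of "1 - t"] by linarith

lemma step_0: "t \<le> 0 \<Longrightarrow> step t = 0" and step_1: "t \<ge> 1 \<Longrightarrow> step t = 1"
  by (auto simp: step_def bump0_def)

lemma smooth_step:
  assumes "smooth (\<lambda>x. complex_of_real (f x))" shows "smooth (\<lambda>x. complex_of_real (step (f x)))"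
proof -
  have s: "smooth (\<lambda>x. complex_of_real (1 - f x))"
    using smooth_minus[OF smooth_const assms] by simp
  have "smooth (\<lambda>x. complex_of_real (bump0 (f x)) * inverse (complex_of_real (bump0 (f x)) + complex_of_real (bump0 (1 - f x))))"
  proof (intro smooth_mult smooth_inverse smooth_add smooth_bump0 assms s)
    show "complex_of_real (bump0 (f x)) + complex_of_real (bump0 (1 - f x)) \<noteq> 0" for x
      using bump0_sum_pos[of "f x"] by (metis less_irrefl of_real_add of_real_eq_0_iff)
  qed
  then show ?thesis by (simp add: step_def[abs_def] divide_inverse)
qed

lemma smooth_norm_square: "smooth (\<lambda>x::real^'n::finite. complex_of_real ((norm (x - a))\<^sup>2))"
proof -
  have "smooth (\<lambda>x::real^'n. \<Sum>i\<in>UNIV. (cvec (x - a) $ i) ^ 2)"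
    by (intro smooth_sum smooth_power smooth_coord_diff)
  moreover have "(\<Sum>i\<in>UNIV. (cvec (x - a) $ i) ^ 2) = complex_of_real ((norm (x - a))\<^sup>2)" for x :: "real^'n"
    unfolding power2_norm_eq_inner inner_vec_def cvec_def by (simp add: power2_eq_square)
  ultimately show ?thesis by simp
qed

text \<open>The squared norm keeps the argument of \<open>step\<close> smooth at the centre. This
  argument is nonpositive for |x - a| <= r and at least 1 for |x - a| >= 2r.\<close>

definition ball_cutoff :: "real ^ 'n::finite \<Rightarrow> real \<Rightarrow> real ^ 'n \<Rightarrow> complex" where
  "ball_cutoff a r x = complex_of_real (1 - step ((norm (x - a))\<^sup>2 / r\<^sup>2 - 1))"

lemma ball_cutoff:
  assumes r: "r > 0"
  shows "smooth (ball_cutoff a r)" 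
    "x \<in> cball a r \<Longrightarrow> ball_cutoff a r x = 1" 
    "x \<notin> cball a (2 * r) \<Longrightarrow> ball_cutoff a r x = 0"
proof -
  have "smooth (\<lambda>x. complex_of_real (1/r\<^sup>2) * complex_of_real ((norm (x - a))\<^sup>2) - 1)"
    by (intro smooth_minus smooth_cmult smooth_norm_square smooth_const)
  then have "smooth (\<lambda>x. complex_of_real ((norm (x - a))\<^sup>2 / r\<^sup>2 - 1))" by simp
  from smooth_minus[OF smooth_const smooth_step[OF this], of 1]
  show "smooth (ball_cutoff a r)" by (simp add: ball_cutoff_def[abs_def])
  show "x \<in> cball a r \<Longrightarrow> ball_cutoff a r x = 1"
  proof -
    assume "x \<in> cball a r"
    then have "norm (x - a) \<le> r" by (simp add: dist_norm norm_minus_commute)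
    then have "(norm (x - a))\<^sup>2 \<le> r\<^sup>2" by (simp add: power_mono)
    then have "(norm (x - a))\<^sup>2 / r\<^sup>2 - 1 \<le> 0" using r by simp
    then show ?thesis by (simp add: ball_cutoff_def step_0)
  qed
  show "x \<notin> cball a (2 * r) \<Longrightarrow> ball_cutoff a r x = 0"
  proof -
    assume "x \<notin> cball a (2 * r)"
    then have "2 * r \<le> norm (x - a)" by (simp add: dist_norm norm_minus_commute)
    then have "(2 * r)\<^sup>2 \<le> (norm (x - a))\<^sup>2" using r by (intro power_mono) auto
    then have "4 * r\<^sup>2 \<le> (norm (x - a))\<^sup>2" by (simp add: power_mult_distrib)
    moreover have "0 \<le> r\<^sup>2" by simp
    ultimately have "2 * r\<^sup>2 \<le> (norm (x - a))\<^sup>2" by linarith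
    then have "(norm (x - a))\<^sup>2 / r\<^sup>2 - 1 \<ge> 1" using r by (simp add: field_simps)
    then show ?thesis by (simp add: ball_cutoff_def step_1)
  qed
qed

section \<open>Test functions\<close>

abbreviation test :: "(real ^ 'n::finite \<Rightarrow> complex) \<Rightarrow> bool" where
  "test \<phi> \<equiv> \<phi> \<in> test_functions"

lemma not_in_fun_support: "x \<notin> fun_support \<phi> \<Longrightarrow> \<phi> x = 0"
  using closure_subset[of "{x. \<phi> x \<noteq> 0}"] by (auto simp: fun_support_def)

lemma fun_support_subset: "closed S \<Longrightarrow> (\<And>x. x \<notin> S \<Longrightarrow> \<phi> x = 0) \<Longrightarrow> fun_support \<phi> \<subseteq> S"
  unfolding fun_support_def by (rule closure_minimal) auto

lemma closed_fun_support: "closed (fun_support \<phi>)"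
  by (simp add: fun_support_def)

lemma fun_support_mono: "(\<And>x. \<phi> x = 0 \<Longrightarrow> \<psi> x = 0) \<Longrightarrow> fun_support \<psi> \<subseteq> fun_support \<phi>"
  by (rule fun_support_subset[OF closed_fun_support]) (auto simp: not_in_fun_support)

lemma test_smooth: "test \<phi> \<Longrightarrow> smooth \<phi>" by (simp add: test_functions_def)

lemma test_compact: "test \<phi> \<Longrightarrow> compact (fun_support \<phi>)" by (simp add: test_functions_def)

lemma testI: 
  assumes "smooth \<phi>" "compact K" "\<And>x. x \<notin> K \<Longrightarrow> \<phi> x = 0"
  shows "test \<phi>"
proof -
  have "fun_support \<phi> \<subseteq> K" using assms(2,3) by (intro fun_support_subset compact_imp_closed)
  then have "K \<inter> fun_support \<phi> = fun_support \<phi>" by blast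
  with compact_Int_closed[OF assms(2) closed_fun_support[of \<phi>]] have "compact (fun_support \<phi>)" by simp
  with assms(1) show ?thesis by (simp add: test_functions_def)
qed

lemma test_mult1: "smooth f \<Longrightarrow> test \<phi> \<Longrightarrow> test (\<lambda>x. f x * \<phi> x)"
  by (rule testI[OF _ test_compact[of \<phi>]]) (auto intro: test_smooth simp: not_in_fun_support)

lemma test_mult2: "smooth f \<Longrightarrow> test \<phi> \<Longrightarrow> test (\<lambda>x. \<phi> x * f x)"
  using test_mult1[of f \<phi>] by (simp add: mult.commute)

lemma test_cmult: "test \<phi> \<Longrightarrow> test (\<lambda>x. c * \<phi> x)"
  by (rule test_mult1) auto

lemma test_add: "test \<phi> \<Longrightarrow> test \<psi> \<Longrightarrow> test (\<lambda>x. \<phi> x + \<psi> x)"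
  by (rule testI[OF _ compact_Un[OF test_compact[of \<phi>] test_compact[of \<psi>]]]) 
     (auto intro: test_smooth simp: not_in_fun_support)

lemma test_zero: "test (\<lambda>x. 0)"
  by (rule testI[of _ "{}"]) auto

lemma test_minus: "test \<phi> \<Longrightarrow> test \<psi> \<Longrightarrow> test (\<lambda>x. \<phi> x - \<psi> x)"
  using test_add[of \<phi> "\<lambda>x. -1 * \<psi> x"] test_cmult[of \<psi> "-1"] by simp

lemma test_sum: "(\<And>i. i \<in> I \<Longrightarrow> test (f i)) \<Longrightarrow> test (\<lambda>x. \<Sum>i\<in>I. f i x)"
  by (induction I rule: infinite_finite_induct) (auto intro: test_add test_zero)

lemma partial_cong_open:
  assumes "smooth g" "open U" "x \<in> U" "\<And>x. x \<in> U \<Longrightarrow> f x = g x"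
  shows "partial j f x = partial j g x"
proof -
  have g: "(g has_derivative (\<lambda>h. \<Sum>j\<in>UNIV. (h $ j) *\<^sub>R partial j g x)) (at x)"
    by (rule has_derivative_partial[OF smooth_differentiable[OF assms(1)]])
  have "(f has_derivative (\<lambda>h. \<Sum>j\<in>UNIV. (h $ j) *\<^sub>R partial j g x)) (at x)"
    by (rule has_derivative_transform_within_open[OF g assms(2,3)]) (simp add: assms(4))
  from partial_eq[OF this] show ?thesis by (simp add: sum_axis)
qed

lemma pd_cong_open:
  assumes "smooth f" "smooth g" "open U" "x \<in> U" "\<And>x. x \<in> U \<Longrightarrow> f x = g x"
  shows "pd \<alpha> f x = pd \<alpha> g x"
  using assms(4)
proof (induction \<alpha> arbitrary: x rule: mi_induct)
  case zero
  then show ?case using assms(5) by simp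
next
  case (step \<alpha> j)
  have "partial j (pd \<alpha> f) x = partial j (pd \<alpha> g) x"
    by (rule partial_cong_open[OF smooth_pd[OF assms(2)] assms(3) step(2)]) (rule step(1))
  then show ?case by (simp add: pd_Suc assms(1,2))
qed

lemma pd_outside_support: "smooth \<phi> \<Longrightarrow> x \<notin> fun_support \<phi> \<Longrightarrow> pd \<alpha> \<phi> x = 0"
  using pd_cong_open[of \<phi> "\<lambda>x. 0" "- fun_support \<phi>" x \<alpha>] closed_fun_support[of \<phi>]
  by (simp add: open_Compl not_in_fun_support)

lemma test_pd: "test \<phi> \<Longrightarrow> test (pd \<alpha> \<phi>)"
  by (rule testI[OF _ test_compact[of \<phi>]]) (auto intro: smooth_pd test_smooth simp: pd_outside_support test_smooth)

lemma test_partial: "test \<phi> \<Longrightarrow> test (partial j \<phi>)"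
  using test_pd[of \<phi> "ei j"] by (simp add: pd_ei test_smooth)

lemma test_reflect: 
  assumes "test \<phi>" shows "test (\<lambda>y. \<phi> (x - y))"
proof (rule testI)
  show "smooth (\<lambda>y. \<phi> (x - y))" by (rule smooth_reflect[OF test_smooth[OF assms]])
  show "compact ((\<lambda>y. x - y) ` fun_support \<phi>)"
    by (intro compact_continuous_image continuous_intros test_compact assms)
  show "\<phi> (x - y) = 0" if "y \<notin> (\<lambda>y. x - y) ` fun_support \<phi>" for y
  proof (rule not_in_fun_support)
    have "y = x - (x - y)" by simp
    then show "x - y \<notin> fun_support \<phi>" using that by blast
  qed
qed

lemma test_bounded: 
  assumes "test \<phi>" obtains M where "M \<ge> 0" "\<And>x. cmod (\<phi> x) \<le> M"
proof -
  have "compact (\<phi> ` fun_support \<phi>)"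
    by (intro compact_continuous_image smooth_continuous test_smooth test_compact assms)
  then obtain B where B: "\<And>x. x \<in> fun_support \<phi> \<Longrightarrow> cmod (\<phi> x) \<le> B"
    by (meson bounded_iff compact_imp_bounded imageI)
  show ?thesis
  proof (rule that[of "max B 0"])
    show "cmod (\<phi> x) \<le> max B 0" for x
      using B[of x] not_in_fun_support[of x \<phi>] by (cases "x \<in> fun_support \<phi>") auto
  qed simp
qed

text \<open>One uniform bound replaces the sum of suprema in \<open>distribution\<close>;
  \<open>distribution_bd\<close> and \<open>distributionI\<close> pass between the two, so that the
  later estimates are plain inequalities between reals.\<close>

definition bd :: "nat \<Rightarrow> real \<Rightarrow> (real ^ 'n::finite \<Rightarrow> complex) \<Rightarrow> bool" where
  "bd N A \<phi> \<longleftrightarrow> (\<forall>\<alpha> x. mi_abs \<alpha> \<le> N \<longrightarrow> cmod (pd \<alpha> \<phi> x) \<le> A)"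

lemma bd_nonneg: "bd N A \<phi> \<Longrightarrow> A \<ge> 0"
  unfolding bd_def by (metis norm_ge_zero order_trans mi_abs_0 zero_le)

lemma bdD: "bd N A \<phi> \<Longrightarrow> mi_abs \<alpha> \<le> N \<Longrightarrow> cmod (pd \<alpha> \<phi> x) \<le> A"
  by (simp add: bd_def)

lemma test_bd: 
  fixes \<phi> :: "real ^ 'n::finite \<Rightarrow> complex"
  assumes "test \<phi>" obtains A where "A \<ge> 0" "bd N A \<phi>"
proof -
  have "\<forall>\<alpha>. \<exists>M. M \<ge> 0 \<and> (\<forall>x. cmod (pd \<alpha> \<phi> x) \<le> M)"
    using test_bounded[OF test_pd[OF assms]] by metis
  then obtain M where M: "\<And>\<alpha>. M \<alpha> \<ge> 0" "\<And>\<alpha> x. cmod (pd \<alpha> \<phi> x) \<le> M \<alpha>" by metis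
  show ?thesis
  proof (rule that[of "\<Sum>\<alpha> | mi_abs \<alpha> \<le> N. M \<alpha>"])
    show "bd N (\<Sum>\<alpha> | mi_abs \<alpha> \<le> N. M \<alpha>) \<phi>"
      unfolding bd_def
    proof (intro allI impI)
      fix \<alpha> :: "'n multiindex" and x assume "mi_abs \<alpha> \<le> N"
      then have "M \<alpha> \<le> (\<Sum>\<alpha> | mi_abs \<alpha> \<le> N. M \<alpha>)"
        by (intro member_le_sum) (auto simp: M finite_multiindices)
      with M(2)[of \<alpha> x] show "cmod (pd \<alpha> \<phi> x) \<le> (\<Sum>\<alpha> | mi_abs \<alpha> \<le> N. M \<alpha>)" by linarith
    qed
  qed (simp add: M sum_nonneg)
qed

lemma cutoff_exists:
  fixes K :: "(real ^ 'n::finite) set"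
  assumes K: "compact K" and U: "open U" "K \<subseteq> U"
  obtains \<zeta> V where "test \<zeta>" "fun_support \<zeta> \<subseteq> U" "open V" "K \<subseteq> V" "\<And>x. x \<in> V \<Longrightarrow> \<zeta> x = 1"
proof -
  have "\<forall>a\<in>K. \<exists>r>0. cball a (2 * r) \<subseteq> U"
  proof
    fix a assume "a \<in> K"
    then obtain e where "e > 0" "cball a e \<subseteq> U" using U open_contains_cball by blast
    then show "\<exists>r>0. cball a (2 * r) \<subseteq> U" by (intro exI[of _ "e/2"]) auto
  qed
  then obtain r where r: "\<And>a. a \<in> K \<Longrightarrow> r a > 0" "\<And>a. a \<in> K \<Longrightarrow> cball a (2 * r a) \<subseteq> U" by metis
  have "K \<subseteq> (\<Union>a\<in>K. ball a (r a))" using r(1) by force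
  then obtain A where A: "A \<subseteq> K" "finite A" "K \<subseteq> (\<Union>a\<in>A. ball a (r a))"
    using compactE_image[OF K, of K "\<lambda>a. ball a (r a)"] by (metis open_ball)
  have rA: "r a > 0" if "a \<in> A" for a using r A that by auto
  \<comment> \<open>The product vanishes as soon as one cutoff equals 1, so \<open>\<zeta>\<close>
    is 1 on all the small balls; it is 0 where every cutoff is 0.\<close>
  define \<zeta> where "\<zeta> x = 1 - (\<Prod>a\<in>A. 1 - ball_cutoff a (r a) x)" for x
  let ?C = "\<Union>a\<in>A. cball a (2 * r a)"
  have C: "compact ?C" using A by (intro compact_UN) auto
  have z: "\<zeta> x = 0" if "x \<notin> ?C" for x
  proof -
    have "ball_cutoff a (r a) x = 0" if "a \<in> A" for a
      using ball_cutoff(3)[OF rA[OF that]] \<open>x \<notin> ?C\<close> that by blast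
    then show ?thesis by (simp add: \<zeta>_def)
  qed
  have s: "smooth \<zeta>"
    unfolding \<zeta>_def[abs_def] by (intro smooth_minus smooth_prod smooth_const ball_cutoff rA)
  show ?thesis
  proof (rule that)
    show "test \<zeta>" by (rule testI[OF s C z])
    have "fun_support \<zeta> \<subseteq> ?C" by (rule fun_support_subset[OF compact_imp_closed[OF C] z])
    then show "fun_support \<zeta> \<subseteq> U" using r A by blast
    show "open (\<Union>a\<in>A. ball a (r a))" by blast
    show "K \<subseteq> (\<Union>a\<in>A. ball a (r a))" by (rule A)
    fix x assume "x \<in> (\<Union>a\<in>A. ball a (r a))"
    then obtain a where a: "a \<in> A" "x \<in> cball a (r a)" by force
    then have "1 - ball_cutoff a (r a) x = 0" using ball_cutoff(2)[OF rA[OF a(1)] a(2)] by simp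
    then have "(\<Prod>a\<in>A. 1 - ball_cutoff a (r a) x) = 0" by (intro prod_zero[OF A(2)] bexI[OF _ a(1)])
    then show "\<zeta> x = 1" by (simp add: \<zeta>_def)
  qed
qed

section \<open>Distributions\<close>

lemma distribution_add: "distribution u \<Longrightarrow> test \<phi> \<Longrightarrow> test \<psi> \<Longrightarrow> u (\<lambda>x. \<phi> x + \<psi> x) = u \<phi> + u \<psi>"
  by (simp add: distribution_def)

lemma distribution_cmult: "distribution u \<Longrightarrow> test \<phi> \<Longrightarrow> u (\<lambda>x. c * \<phi> x) = c * u \<phi>"
  by (simp add: distribution_def)

lemma distribution_zero: "distribution u \<Longrightarrow> u (\<lambda>x. 0) = 0"
  using distribution_cmult[of u "\<lambda>x. 0" 0] test_zero by simp

lemma distribution_minus: "distribution u \<Longrightarrow> test \<phi> \<Longrightarrow> test \<psi> \<Longrightarrow> u (\<lambda>x. \<phi> x - \<psi> x) = u \<phi> - u \<psi>"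
  using distribution_add[of u \<phi> "\<lambda>x. -1 * \<psi> x"] distribution_cmult[of u \<psi> "-1"] test_cmult[of \<psi> "-1"] by simp

lemma distribution_sum: 
  assumes u: "distribution u" and f: "\<And>i. i \<in> I \<Longrightarrow> test (f i)" 
  shows "u (\<lambda>x. \<Sum>i\<in>I. f i x) = (\<Sum>i\<in>I. u (f i))"
  using f
proof (induction I rule: infinite_finite_induct)
  case (insert i I)
  then show ?case by (simp add: distribution_add[OF u] test_sum)
qed (auto simp: distribution_zero[OF u])

lemma distribution_bd:
  fixes u :: "'n::finite functional"
  assumes u: "distribution u" and K: "compact K"
  obtains C N where "C \<ge> 0" "\<And>\<phi> A. test \<phi> \<Longrightarrow> fun_support \<phi> \<subseteq> K \<Longrightarrow> bd N A \<phi> \<Longrightarrow> cmod (u \<phi>) \<le> C * A"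
proof -
  obtain C N where C: "\<And>\<phi>. test \<phi> \<Longrightarrow> fun_support \<phi> \<subseteq> K \<Longrightarrow> 
      cmod (u \<phi>) \<le> C * (\<Sum>\<alpha> | mi_abs \<alpha> \<le> N. SUP x. cmod (pd \<alpha> \<phi> x))"
    using u K unfolding distribution_def by meson
  let ?S = "{\<alpha> :: 'n multiindex. mi_abs \<alpha> \<le> N}"
  show ?thesis
  \<comment> \<open>The constant in \<open>distribution\<close> may be negative, hence the maximum
    with 0.\<close>
  proof (rule that[of "max C 0 * card ?S" N])
    show "max C 0 * card ?S \<ge> 0" by simp
    fix \<phi> :: "real ^ 'n \<Rightarrow> complex" and A assume \<phi>: "test \<phi>" "fun_support \<phi> \<subseteq> K" and A: "bd N A \<phi>"
    have "(SUP x. cmod (pd \<alpha> \<phi> x)) \<le> A" if "\<alpha> \<in> ?S" for \<alpha>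
      using that by (intro cSUP_least) (auto intro: bdD[OF A])
    then have s: "(\<Sum>\<alpha>\<in>?S. SUP x. cmod (pd \<alpha> \<phi> x)) \<le> card ?S * A"
      using sum_bounded_above[of ?S "\<lambda>\<alpha>. SUP x. cmod (pd \<alpha> \<phi> x)" A] by simp
    have "0 \<le> (SUP x. cmod (pd \<alpha> \<phi> x))" for \<alpha>
    proof -
      obtain M where "\<And>x. cmod (pd \<alpha> \<phi> x) \<le> M" using test_bounded[OF test_pd[OF \<phi>(1)]] by metis
      then have "cmod (pd \<alpha> \<phi> 0) \<le> (SUP x. cmod (pd \<alpha> \<phi> x))"
        by (intro cSUP_upper) (auto intro!: bdd_aboveI[of _ M])
      then show ?thesis using norm_ge_zero order_trans by blast
    qed
    then have s0: "0 \<le> (\<Sum>\<alpha>\<in>?S. SUP x. cmod (pd \<alpha> \<phi> x))" by (simp add: sum_nonneg)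
    have "cmod (u \<phi>) \<le> C * (\<Sum>\<alpha>\<in>?S. SUP x. cmod (pd \<alpha> \<phi> x))" by (rule C[OF \<phi>])
    also have "\<dots> \<le> max C 0 * (\<Sum>\<alpha>\<in>?S. SUP x. cmod (pd \<alpha> \<phi> x))"
      by (rule mult_right_mono[OF _ s0]) simp
    also have "\<dots> \<le> max C 0 * (card ?S * A)" by (rule mult_left_mono[OF s]) simp
    finally show "cmod (u \<phi>) \<le> max C 0 * card ?S * A" by (simp add: mult.assoc)
  qed
qed

lemma distributionI:
  fixes u :: "'n::finite functional"
  assumes "\<And>\<phi> \<psi>. test \<phi> \<Longrightarrow> test \<psi> \<Longrightarrow> u (\<lambda>x. \<phi> x + \<psi> x) = u \<phi> + u \<psi>"
    and "\<And>c \<phi>. test \<phi> \<Longrightarrow> u (\<lambda>x. c * \<phi> x) = c * u \<phi>"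
    and bnd: "\<And>K. compact K \<Longrightarrow> \<exists>C N. C \<ge> 0 \<and> (\<forall>\<phi> A. test \<phi> \<longrightarrow> fun_support \<phi> \<subseteq> K \<longrightarrow> bd N A \<phi> \<longrightarrow> cmod (u \<phi>) \<le> C * A)"
  shows "distribution u"
  unfolding distribution_def
proof (intro conjI allI ballI impI)
  fix K :: "(real ^ 'n) set" assume "compact K"
  from bnd[OF this] obtain C N where CN: "C \<ge> 0" "\<And>\<phi> A. test \<phi> \<Longrightarrow> fun_support \<phi> \<subseteq> K \<Longrightarrow> bd N A \<phi> \<Longrightarrow> cmod (u \<phi>) \<le> C * A"
    by blast
  show "\<exists>C N. \<forall>\<phi>\<in>test_functions. fun_support \<phi> \<subseteq> K \<longrightarrow>
           cmod (u \<phi>) \<le> C * (\<Sum>\<alpha> | mi_abs \<alpha> \<le> N. SUP x. cmod (pd \<alpha> \<phi> x))"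
  proof (intro exI ballI impI)
    fix \<phi> :: "real ^ 'n \<Rightarrow> complex" assume \<phi>: "test \<phi>" "fun_support \<phi> \<subseteq> K"
    have sup: "cmod (pd \<alpha> \<phi> x) \<le> (SUP x. cmod (pd \<alpha> \<phi> x))" for \<alpha> x
    proof -
      obtain M where "\<And>x. cmod (pd \<alpha> \<phi> x) \<le> M" using test_bounded[OF test_pd[OF \<phi>(1)]] by metis
      then show ?thesis
        by (intro cSUP_upper) (auto intro!: bdd_aboveI[of _ M])
    qed
    have "bd N (\<Sum>\<alpha> | mi_abs \<alpha> \<le> N. SUP x. cmod (pd \<alpha> \<phi> x)) \<phi>"
      unfolding bd_def
    proof (intro allI impI)
      fix \<alpha> :: "'n multiindex" and x assume a: "mi_abs \<alpha> \<le> N"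
      have "(SUP x. cmod (pd \<alpha> \<phi> x)) \<le> (\<Sum>\<alpha> | mi_abs \<alpha> \<le> N. SUP x. cmod (pd \<alpha> \<phi> x))"
        using a by (intro member_le_sum) (auto simp: finite_multiindices intro: order_trans[OF norm_ge_zero sup])
      with sup[of \<alpha> x] show "cmod (pd \<alpha> \<phi> x) \<le> (\<Sum>\<alpha> | mi_abs \<alpha> \<le> N. SUP x. cmod (pd \<alpha> \<phi> x))" by linarith
    qed
    with CN(2) \<phi> show "cmod (u \<phi>) \<le> C * (\<Sum>\<alpha> | mi_abs \<alpha> \<le> N. SUP x. cmod (pd \<alpha> \<phi> x))" by blast
  qed
qed (use assms in auto)

lemma closed_dist_support: "closed (dist_support u)"
  unfolding dist_support_def by (auto intro!: closed_Compl open_Union)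

lemma dist_support_subset:
  assumes "closed S" "\<And>\<phi>. test \<phi> \<Longrightarrow> fun_support \<phi> \<inter> S = {} \<Longrightarrow> u \<phi> = 0"
  shows "dist_support u \<subseteq> S"
proof -
  have "- S \<in> {U. open U \<and> (\<forall>\<phi>\<in>test_functions. fun_support \<phi> \<subseteq> U \<longrightarrow> u \<phi> = 0)}"
    using assms by blast
  then show ?thesis unfolding dist_support_def by blast
qed

text \<open>Multiplying the test function by a factor 1 - cutoff changes the value of
  \<open>u\<close> only by a term supported in a ball on which \<open>u\<close> vanishes, and after
  finitely many such factors nothing of \<open>\<phi>\<close> is left.\<close>

lemma dist_support_vanish:
  fixes u :: "'n::finite functional"
  assumes u: "distribution u" and \<phi>: "test \<phi>" "fun_support \<phi> \<inter> dist_support u = {}"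
  shows "u \<phi> = 0"
proof -
  let ?K = "fun_support \<phi>"
  have "\<forall>a\<in>?K. \<exists>r>0. \<forall>\<psi>. test \<psi> \<longrightarrow> fun_support \<psi> \<subseteq> cball a (2 * r) \<longrightarrow> u \<psi> = 0"
  proof
    fix a assume "a \<in> ?K"
    then have "a \<notin> dist_support u" using \<phi> by blast
    then obtain U where U: "open U" "a \<in> U" "\<And>\<psi>. test \<psi> \<Longrightarrow> fun_support \<psi> \<subseteq> U \<Longrightarrow> u \<psi> = 0"
      unfolding dist_support_def by blast
    then obtain e where "e > 0" "cball a e \<subseteq> U" using open_contains_cball by blast
    then show "\<exists>r>0. \<forall>\<psi>. test \<psi> \<longrightarrow> fun_support \<psi> \<subseteq> cball a (2 * r) \<longrightarrow> u \<psi> = 0"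
      using U(3) by (intro exI[of _ "e/2"]) auto
  qed
  then obtain r where r: "\<And>a. a \<in> ?K \<Longrightarrow> r a > 0" 
      "\<And>a \<psi>. a \<in> ?K \<Longrightarrow> test \<psi> \<Longrightarrow> fun_support \<psi> \<subseteq> cball a (2 * r a) \<Longrightarrow> u \<psi> = 0" by metis
  have "?K \<subseteq> (\<Union>a\<in>?K. ball a (r a))" using r(1) by force
  then obtain A where A: "A \<subseteq> ?K" "finite A" "?K \<subseteq> (\<Union>a\<in>A. ball a (r a))"
    using compactE_image[OF test_compact[OF \<phi>(1)], of ?K "\<lambda>a. ball a (r a)"] by (metis open_ball)
  have rA: "r a > 0" if "a \<in> A" for a using r A that by auto
  have "B \<subseteq> A \<Longrightarrow> u \<phi> = u (\<lambda>x. (\<Prod>a\<in>B. 1 - ball_cutoff a (r a) x) * \<phi> x)" if "finite B" for B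
    using that
  proof (induction B)
    case (insert a B)
    let ?\<psi> = "\<lambda>x. (\<Prod>a\<in>B. 1 - ball_cutoff a (r a) x) * \<phi> x"
    have \<psi>: "test ?\<psi>"
      using insert rA by (intro test_mult1 smooth_prod smooth_minus smooth_const ball_cutoff \<phi>) auto
    have a: "a \<in> A" using insert by auto
    have c: "smooth (ball_cutoff a (r a))" by (rule ball_cutoff[OF rA[OF a]])
    have "fun_support (\<lambda>x. ball_cutoff a (r a) x * ?\<psi> x) \<subseteq> cball a (2 * r a)"
      by (rule fun_support_subset) (auto simp: ball_cutoff(3)[OF rA[OF a]])
    then have "u (\<lambda>x. ball_cutoff a (r a) x * ?\<psi> x) = 0"
      using r(2)[of a] a A(1) test_mult1[OF c \<psi>] by blast
    then have "u (\<lambda>x. ?\<psi> x - ball_cutoff a (r a) x * ?\<psi> x) = u ?\<psi>"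
      by (simp add: distribution_minus[OF u \<psi> test_mult1[OF c \<psi>]])
    moreover have "(\<lambda>x. ?\<psi> x - ball_cutoff a (r a) x * ?\<psi> x) = (\<lambda>x. (\<Prod>a\<in>insert a B. 1 - ball_cutoff a (r a) x) * \<phi> x)"
      using insert by (auto simp: algebra_simps)
    ultimately show ?case using insert by auto
  qed simp
  from this[OF A(2)] have "u \<phi> = u (\<lambda>x. (\<Prod>a\<in>A. 1 - ball_cutoff a (r a) x) * \<phi> x)" by simp
  also have "(\<lambda>x. (\<Prod>a\<in>A. 1 - ball_cutoff a (r a) x) * \<phi> x) = (\<lambda>x. 0)"
  proof
    fix x
    show "(\<Prod>a\<in>A. 1 - ball_cutoff a (r a) x) * \<phi> x = 0"
    proof (cases "x \<in> ?K")
      case True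
      then obtain a where a: "a \<in> A" "x \<in> cball a (r a)" using A(3) by force
      then have "1 - ball_cutoff a (r a) x = 0" using ball_cutoff(2)[OF rA[OF a(1)] a(2)] by simp
      then have "(\<Prod>a\<in>A. 1 - ball_cutoff a (r a) x) = 0" by (intro prod_zero[OF A(2)] bexI[OF _ a(1)])
      then show ?thesis by simp
    qed (simp add: not_in_fun_support)
  qed
  finally show ?thesis by (simp add: distribution_zero[OF u])
qed

lemma distribution_cong_near_support:
  assumes u: "distribution u" and "test \<phi>" "test \<psi>" "open V" "dist_support u \<subseteq> V" "\<And>x. x \<in> V \<Longrightarrow> \<phi> x = \<psi> x"
  shows "u \<phi> = u \<psi>"
proof -
  have "fun_support (\<lambda>x. \<phi> x - \<psi> x) \<subseteq> - V"
    by (rule fun_support_subset) (use assms in auto)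
  then have "u (\<lambda>x. \<phi> x - \<psi> x) = 0"
    using assms by (intro dist_support_vanish[OF u] test_minus) auto
  then show ?thesis by (simp add: distribution_minus assms)
qed

section \<open>The Hahn-Banach theorem for complex vector spaces\<close>

text \<open>Functionals on subspaces are represented by their graphs; a dominated linear graph is
  automatically single-valued.\<close>

locale complex_space = vector_space scale for scale :: "complex \<Rightarrow> 'v::ab_group_add \<Rightarrow> 'v" (infixr "*c" 75)
begin

text \<open>\<open>R\<close> is the graph of the functional to be extended. Zorn's lemma is applied
  to the additive and homogeneous graphs below \<open>p\<close> that contain \<open>R\<close>; a
  maximal one has domain \<open>V\<close>, because otherwise it extends by one dimension.\<close>

lemma real_hahn_banach:
  fixes V :: "'v set" and p :: "'v \<Rightarrow> real" and R :: "('v \<times> real) set"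
  assumes Vadd: "\<And>x y. x \<in> V \<Longrightarrow> y \<in> V \<Longrightarrow> x + y \<in> V" and Vsc: "\<And>c x. x \<in> V \<Longrightarrow> c *c x \<in> V"
    and padd: "\<And>x y. x \<in> V \<Longrightarrow> y \<in> V \<Longrightarrow> p (x + y) \<le> p x + p y"
    and psc: "\<And>r x. x \<in> V \<Longrightarrow> r > 0 \<Longrightarrow> p (of_real r *c x) = r * p x"
    and R0: "R \<noteq> {}" and RV: "\<And>x a. (x, a) \<in> R \<Longrightarrow> x \<in> V"
    and Radd: "\<And>x a y b. (x, a) \<in> R \<Longrightarrow> (y, b) \<in> R \<Longrightarrow> (x + y, a + b) \<in> R"
    and Rsc: "\<And>x a r. (x, a) \<in> R \<Longrightarrow> (of_real r *c x, r * a) \<in> R"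
    and Rp: "\<And>x a. (x, a) \<in> R \<Longrightarrow> a \<le> p x"
  shows "\<exists>F. (\<forall>x\<in>V. \<forall>y\<in>V. F (x + y) = F x + F y) \<and> (\<forall>x\<in>V. \<forall>r. F (of_real r *c x) = r * F x)
      \<and> (\<forall>x a. (x, a) \<in> R \<longrightarrow> F x = a) \<and> (\<forall>x\<in>V. F x \<le> p x)"
proof -
  define good where "good G \<longleftrightarrow> R \<subseteq> G \<and> (\<forall>x a. (x, a) \<in> G \<longrightarrow> x \<in> V \<and> a \<le> p x) \<and>
     (\<forall>x a y b. (x, a) \<in> G \<longrightarrow> (y, b) \<in> G \<longrightarrow> (x + y, a + b) \<in> G) \<and>
     (\<forall>x a r. (x, a) \<in> G \<longrightarrow> (of_real r *c x, r * a) \<in> G)" for G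
  have goodR: "good R" unfolding good_def using RV Radd Rsc Rp by blast
  have "\<exists>M\<in>Collect good. \<forall>X\<in>Collect good. M \<subseteq> X \<longrightarrow> X = M"
  proof (rule subset_Zorn_nonempty)
    show "Collect good \<noteq> {}" using goodR by blast
    fix C assume C0: "C \<noteq> {}" and C: "subset.chain (Collect good) C"
    have gC: "good X" if "X \<in> C" for X using C that by (auto simp: subset.chain_def)
    have two: "\<exists>X\<in>C. u \<in> X \<and> v \<in> X" if uv: "u \<in> \<Union>C" "v \<in> \<Union>C" for u v
    proof -
      obtain X Y where XY: "X \<in> C" "Y \<in> C" "u \<in> X" "v \<in> Y" using uv by blast
      then have "X \<subseteq> Y \<or> Y \<subseteq> X" using C by (auto simp: subset.chain_def)
      then show ?thesis using XY by blast
    qed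
    have "good (\<Union>C)"
      unfolding good_def
    proof (intro conjI allI impI)
      show "R \<subseteq> \<Union>C" using C0 gC unfolding good_def by blast
      fix x a assume xa: "(x, a) \<in> \<Union>C"
      then obtain X where X: "X \<in> C" "(x, a) \<in> X" by blast
      then show "x \<in> V" "a \<le> p x" using gC[OF X(1)] unfolding good_def by blast+
      show "(of_real r *c x, r * a) \<in> \<Union>C" for r using gC[OF X(1)] X unfolding good_def by blast
      fix y b assume "(y, b) \<in> \<Union>C"
      with two[OF xa this] obtain X where "X \<in> C" "(x, a) \<in> X" "(y, b) \<in> X" by blast
      then show "(x + y, a + b) \<in> \<Union>C" using gC[of X] unfolding good_def by blast
    qed
    then show "\<Union>C \<in> Collect good" by simp
  qed
  then obtain M where M: "good M" and max: "\<And>X. good X \<Longrightarrow> M \<subseteq> X \<Longrightarrow> X = M" by blast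
  have MR: "R \<subseteq> M" using M unfolding good_def by blast
  have MV: "(x, a) \<in> M \<Longrightarrow> x \<in> V" for x a using M unfolding good_def by blast
  have Mp: "(x, a) \<in> M \<Longrightarrow> a \<le> p x" for x a using M unfolding good_def by blast
  have Madd: "(x, a) \<in> M \<Longrightarrow> (y, b) \<in> M \<Longrightarrow> (x + y, a + b) \<in> M" for x a y b using M unfolding good_def by blast
  have Msc: "(x, a) \<in> M \<Longrightarrow> (of_real r *c x, r * a) \<in> M" for x a r using M unfolding good_def by blast
  obtain x1 a1 where "(x1, a1) \<in> M" using R0 MR by fastforce
  from Msc[OF this, of 0] have M0: "(0, 0) \<in> M" by simp
  then have V0: "0 \<in> V" using MV by blast
  have p0: "p 0 = 0" using psc[OF V0, of 2] by simp
  \<comment> \<open>Two values over the same \<open>x\<close> put their difference over 0, where it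
    is at most \<open>p 0\<close>, hence at most 0; the roles of the two values are then
    exchanged.\<close>
  have uniq: "a = b" if "(x, a) \<in> M" "(x, b) \<in> M" for x a b
  proof -
    have "c \<le> 0" if "(x, a) \<in> M" "(x, b) \<in> M" "c = a - b" for a b c
      using Mp[OF Madd[OF that(1) Msc[OF that(2), of "-1"]]] that(3) p0 by simp
    from this[OF that refl] this[OF that(2,1) refl] show ?thesis by simp
  qed
  have dom: "\<exists>a. (x, a) \<in> M" if x0: "x \<in> V" for x
  proof (rule ccontr)
    assume no: "\<nexists>a. (x, a) \<in> M"
    have mx: "-1 *c x \<in> V" by (rule Vsc[OF x0])
    \<comment> \<open>Subadditivity separates the lower bounds for a possible value at
      \<open>x\<close> from the upper bounds; the supremum of the lower bounds is the value
      \<open>c\<close> chosen below.\<close>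
    have key: "a - p (y + -1 *c x) \<le> p (z + x) - b" if yz: "(y, a) \<in> M" "(z, b) \<in> M" for y a z b
    proof -
      have "a + b \<le> p (y + z)" by (rule Mp[OF Madd[OF yz]])
      also have "y + z = (y + -1 *c x) + (z + x)" by simp
      also have "p \<dots> \<le> p (y + -1 *c x) + p (z + x)"
        by (rule padd) (use yz MV Vadd mx x0 in blast)+
      finally show ?thesis by simp
    qed
    define S where "S = {a - p (y + -1 *c x) | y a. (y, a) \<in> M}"
    define c where "c = Sup S"
    have S0: "S \<noteq> {}" using M0 unfolding S_def by blast
    have Sb: "bdd_above S"
      by (rule bdd_aboveI[of _ "p (0 + x) - 0"]) (use key M0 in \<open>force simp: S_def\<close>)
    have c1: "a - p (y + -1 *c x) \<le> c" if "(y, a) \<in> M" for y a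
      unfolding c_def by (rule cSup_upper[OF _ Sb]) (use that in \<open>auto simp: S_def\<close>)
    have c2: "c \<le> p (z + x) - b" if "(z, b) \<in> M" for z b
      unfolding c_def by (rule cSup_least[OF S0]) (use key that in \<open>auto simp: S_def\<close>)
    define M' where "M' = {(y + of_real t *c x, a + t * c) | y a t. (y, a) \<in> M}"
    have "good M'"
      unfolding good_def
    proof (intro conjI allI impI)
      show "R \<subseteq> M'"
      proof
        fix w assume "w \<in> R"
        then obtain y a where w: "w = (y, a)" "(y, a) \<in> M" using MR by (cases w) auto
        then have "w = (y + of_real 0 *c x, a + 0 * c)" by simp
        with w(2) show "w \<in> M'" unfolding M'_def by blast
      qed
      fix w a' assume "(w, a') \<in> M'"
      then obtain y a t where w: "w = y + of_real t *c x" "a' = a + t * c" "(y, a) \<in> M" unfolding M'_def by blast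
      have yV: "y \<in> V" using MV w(3) by blast
      show "w \<in> V" unfolding w by (intro Vadd yV Vsc x0)
      show "(of_real r *c w, r * a') \<in> M'" for r
      proof -
        have "(of_real r *c w, r * a') = ((of_real r *c y) + of_real (r * t) *c x, r * a + (r * t) * c)"
          by (simp add: w scale_right_distrib algebra_simps)
        with Msc[OF w(3), of r] show ?thesis unfolding M'_def by blast
      qed
      show "a' \<le> p w"
      proof -
        \<comment> \<open>Homogeneity reduces domination to the coefficients 1 and -1 of
          \<open>x\<close>, which are the inequalities \<open>c2\<close> and
          \<open>c1\<close>.\<close>
        consider "t = 0" | "t > 0" | "t < 0" by linarith
        then show ?thesis
        proof cases
          case 1
          then show ?thesis using Mp w by simp
        next
          case 2
          have "t * c \<le> t * (p (of_real (1/t) *c y + x) - 1/t * a)"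
            by (rule mult_left_mono[OF c2[OF Msc[OF w(3)]]]) (use 2 in simp)
          also have "\<dots> = p (of_real t *c (of_real (1/t) *c y + x)) - a"
            using 2 by (subst psc) (auto intro!: Vadd Vsc yV x0 simp: right_diff_distrib)
          also have "of_real t *c (of_real (1/t) *c y + x) = w"
            using 2 by (simp add: w scale_right_distrib)
          finally show ?thesis by (simp add: w)
        next
          case 3
          have "(-t) * (1/(-t) * a - p (of_real (1/(-t)) *c y + -1 *c x)) \<le> (-t) * c"
            by (rule mult_left_mono[OF c1[OF Msc[OF w(3)]]]) (use 3 in simp)
          moreover have "(-t) * (1/(-t) * a - p (of_real (1/(-t)) *c y + -1 *c x)) = 
              a - p (of_real (-t) *c (of_real (1/(-t)) *c y + -1 *c x))"
          proof -
            have V3: "of_real (1/(-t)) *c y + -1 *c x \<in> V" by (intro Vadd Vsc yV mx)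
            have nt: "-t > 0" using 3 by simp
            show ?thesis unfolding psc[OF V3 nt] using 3 by (simp add: right_diff_distrib)
          qed
          moreover have "of_real (-t) *c (of_real (1/(-t)) *c y + -1 *c x) = w"
            using 3 by (simp add: w scale_right_distrib scale_right_diff_distrib scale_minus_right)
          ultimately show ?thesis by (simp add: w)
        qed
      qed
      fix w2 b' assume "(w2, b') \<in> M'"
      then obtain z b s where w2: "w2 = z + of_real s *c x" "b' = b + s * c" "(z, b) \<in> M" unfolding M'_def by blast
      have "(w + w2, a' + b') = ((y + z) + of_real (t + s) *c x, (a + b) + (t + s) * c)"
        by (simp add: w w2 scale_left_distrib algebra_simps)
      with Madd[OF w(3) w2(3)] show "(w + w2, a' + b') \<in> M'" unfolding M'_def by blast
    qed
    moreover have "M \<subseteq> M'"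
    proof
      fix w assume w: "w \<in> M"
      obtain y a where ya: "w = (y, a)" by (cases w)
      then have "w = (y + of_real 0 *c x, a + 0 * c)" by simp
      with w ya show "w \<in> M'" unfolding M'_def by blast
    qed
    ultimately have eq: "M' = M" by (rule max)
    have "(0 + of_real 1 *c x, 0 + 1 * c) \<in> M'" using M0 unfolding M'_def by blast
    then have "(x, c) \<in> M" by (simp add: eq)
    with no show False by blast
  qed
  define F where "F x = (THE a. (x, a) \<in> M)" for x
  have Feq: "F x = a" if "(x, a) \<in> M" for x a
    unfolding F_def
  proof (rule the_equality)
    show "(x, a) \<in> M" by (rule that)
    show "b = a" if "(x, b) \<in> M" for b by (rule uniq[OF that \<open>(x, a) \<in> M\<close>])
  qed
  have FM: "(x, F x) \<in> M" if "x \<in> V" for x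
    using dom[OF that] Feq by metis
  show ?thesis
  proof (intro exI[of _ F] conjI ballI allI impI)
    show "F (x + y) = F x + F y" if "x \<in> V" "y \<in> V" for x y
      by (rule Feq[OF Madd[OF FM FM]]) (use that in auto)
    show "F (of_real r *c x) = r * F x" if "x \<in> V" for x r
      by (rule Feq[OF Msc[OF FM]]) (use that in auto)
    show "F x = a" if "(x, a) \<in> R" for x a using Feq MR that by blast
    show "F x \<le> p x" if "x \<in> V" for x using Mp FM that by blast
  qed
qed

text \<open>The real part \<open>F\<close> is extended, and the complex functional is recovered as
  F(x) - i F(i x). Multiplying \<open>x\<close> by a unimodular number makes the value real and
  nonnegative, which transfers the bound from the real part to the modulus.\<close>

lemma hahn_banach:
  fixes V :: "'v set" and p :: "'v \<Rightarrow> real" and R :: "('v \<times> complex) set"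
  assumes Vadd: "\<And>x y. x \<in> V \<Longrightarrow> y \<in> V \<Longrightarrow> x + y \<in> V" and Vsc: "\<And>c x. x \<in> V \<Longrightarrow> c *c x \<in> V"
    and padd: "\<And>x y. x \<in> V \<Longrightarrow> y \<in> V \<Longrightarrow> p (x + y) \<le> p x + p y"
    and psc: "\<And>c x. x \<in> V \<Longrightarrow> p (c *c x) = cmod c * p x"
    and R0: "R \<noteq> {}" and RV: "\<And>x a. (x, a) \<in> R \<Longrightarrow> x \<in> V"
    and Radd: "\<And>x a y b. (x, a) \<in> R \<Longrightarrow> (y, b) \<in> R \<Longrightarrow> (x + y, a + b) \<in> R"
    and Rsc: "\<And>x a c. (x, a) \<in> R \<Longrightarrow> (c *c x, c * a) \<in> R"
    and Rp: "\<And>x a. (x, a) \<in> R \<Longrightarrow> cmod a \<le> p x"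
  obtains L where "\<And>x y. x \<in> V \<Longrightarrow> y \<in> V \<Longrightarrow> L (x + y) = L x + L y" "\<And>x c. x \<in> V \<Longrightarrow> L (c *c x) = c * L x"
      "\<And>x a. (x, a) \<in> R \<Longrightarrow> L x = a" "\<And>x. x \<in> V \<Longrightarrow> cmod (L x) \<le> p x"
proof -
  define R' where "R' = (\<lambda>(x, a). (x, Re a)) ` R"
  have R'D: "\<exists>a. (x, a) \<in> R \<and> b = Re a" if "(x, b) \<in> R'" for x b using that by (auto simp: R'_def)
  have R'I: "(x, Re a) \<in> R'" if "(x, a) \<in> R" for x a using that by (force simp: R'_def)
  have "\<exists>F. (\<forall>x\<in>V. \<forall>y\<in>V. F (x + y) = F x + F y) \<and> (\<forall>x\<in>V. \<forall>r. F (of_real r *c x) = r * F x)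
      \<and> (\<forall>x a. (x, a) \<in> R' \<longrightarrow> F x = a) \<and> (\<forall>x\<in>V. F x \<le> p x)"
  proof (rule real_hahn_banach[OF Vadd Vsc padd])
    show "p (of_real r *c x) = r * p x" if "x \<in> V" "r > 0" for r x using psc[OF that(1), of "of_real r"] that(2) by simp
    show "R' \<noteq> {}" using R0 by (simp add: R'_def)
    show "x \<in> V" if "(x, a) \<in> R'" for x a using R'D[OF that] RV by blast
    show "(x + y, a + b) \<in> R'" if "(x, a) \<in> R'" "(y, b) \<in> R'" for x a y b
      using R'D[OF that(1)] R'D[OF that(2)] R'I[OF Radd] by fastforce
    show "(of_real r *c x, r * a) \<in> R'" if "(x, a) \<in> R'" for x a r
      using R'D[OF that] R'I[OF Rsc, of _ _ "of_real r"] by fastforce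
    show "a \<le> p x" if "(x, a) \<in> R'" for x a
      using R'D[OF that] Rp complex_Re_le_cmod order_trans by blast
  qed
  then obtain F where Fadd: "\<And>x y. x \<in> V \<Longrightarrow> y \<in> V \<Longrightarrow> F (x + y) = F x + F y" 
    and Fsc: "\<And>x r. x \<in> V \<Longrightarrow> F (of_real r *c x) = r * F x"
    and FR: "\<And>x a. (x, a) \<in> R' \<Longrightarrow> F x = a" and Fp: "\<And>x. x \<in> V \<Longrightarrow> F x \<le> p x" by blast
  define L where "L x = Complex (F x) (- F (\<i> *c x))" for x
  have Ladd: "L (x + y) = L x + L y" if "x \<in> V" "y \<in> V" for x y
    using that by (simp add: L_def Fadd Vsc scale_right_distrib complex_eq_iff)
  have Lsc: "L (c *c x) = c * L x" if x: "x \<in> V" for x c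
  proof -
    have 1: "F (c *c x) = Re c * F x + Im c * F (\<i> *c x)" for c
    proof -
      have "c *c x = of_real (Re c) *c x + of_real (Im c) *c (\<i> *c x)"
        by (simp add: scale_left_distrib[symmetric] complex_eq_iff mult.commute[of \<i>] complex_eq[symmetric])
      then show ?thesis using x by (simp only: Fadd Fsc Vsc)
    qed
    have "F (\<i> *c c *c x) = Re (\<i> * c) * F x + Im (\<i> * c) * F (\<i> *c x)"
      using 1[of "\<i> * c"] by simp
    then show ?thesis using 1[of c] by (simp add: L_def complex_eq_iff algebra_simps)
  qed
  show ?thesis
  proof (rule that[of L, OF Ladd Lsc])
    show "L x = a" if xa: "(x, a) \<in> R" for x a
      using FR[OF R'I[OF xa]] FR[OF R'I[OF Rsc[OF xa, of \<i>]]] by (simp add: L_def complex_eq_iff)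
    show "cmod (L x) \<le> p x" if x: "x \<in> V" for x
    proof (cases "L x = 0")
      case True
      then show ?thesis using psc[OF x, of 0] padd[OF x Vsc[OF x, of "-1"]] psc[OF x, of "-1"] by simp
    next
      case False
      define c where "c = cnj (L x) / cmod (L x)"
      have c1: "cmod c = 1" using False by (simp add: c_def norm_divide)
      have "L (c *c x) = cnj (L x) * L x / cmod (L x)" using x by (simp add: Lsc c_def)
      also have "\<dots> = of_real (cmod (L x))"
        using False by (simp add: complex_norm_square[symmetric] mult.commute[of "cnj _"] power2_eq_square)
      finally have "F (c *c x) = cmod (L x)" by (simp add: L_def complex_eq_iff)
      with Fp[OF Vsc[OF x, of c]] psc[OF x, of c] c1 show ?thesis by simp
    qed
  qed
qed

end

section \<open>Normal ordering\<close>

text \<open>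
  The operators \<open>d j\<close> and their adjoints \<open>e j\<close> satisfy the canonical commutation relations.  Normal
  ordering writes \<open>B (Q(d) f) (Q(d) f)\<close> as a sum of squares, one of which is a positive multiple of
  \<open>B f f\<close>.
\<close>

locale heisenberg =
  fixes V :: "'v set" and B :: "'v \<Rightarrow> 'v \<Rightarrow> complex" and d e :: "'n::finite \<Rightarrow> 'v \<Rightarrow> 'v" and s :: real
  assumes d_closed: "f \<in> V \<Longrightarrow> d j f \<in> V" and e_closed: "f \<in> V \<Longrightarrow> e j f \<in> V"
    and adj1: "f \<in> V \<Longrightarrow> g \<in> V \<Longrightarrow> B (d j f) g = B f (e j g)"
    and adj2: "f \<in> V \<Longrightarrow> g \<in> V \<Longrightarrow> B (e j f) g = B f (d j g)"
    and ccr: "f \<in> V \<Longrightarrow> g \<in> V \<Longrightarrow> B (e j (d j f)) g = B (d j (e j f)) g + of_real s * B f g"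
    and comm: "i \<noteq> j \<Longrightarrow> f \<in> V \<Longrightarrow> e i (d j f) = d j (e i f)"
    and pos: "finite (A :: ('n \<Rightarrow> nat) set) \<Longrightarrow> (\<And>a. a \<in> A \<Longrightarrow> F a \<in> V) \<Longrightarrow>
        0 \<le> Re (\<Sum>a\<in>A. \<Sum>b\<in>A. k a * cnj (k b) * B (F b) (F a))"
    and s1: "s \<ge> 1"
begin

lemma dk_closed: "f \<in> V \<Longrightarrow> (d j ^^ k) f \<in> V" and ek_closed: "f \<in> V \<Longrightarrow> (e j ^^ k) f \<in> V"
  by (induction k) (auto intro: d_closed e_closed)

text \<open>Stated against a vector \<open>h\<close>, because \<open>ccr\<close> is assumed only
  inside \<open>B\<close>; the induction passes to \<open>d j h\<close> by the adjunction. At m = 0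
  the truncated exponent is harmless since its coefficient is 0.\<close>

lemma e_power_d:
  "f \<in> V \<Longrightarrow> h \<in> V \<Longrightarrow> 
    B ((e j ^^ m) (d j f)) h = B (d j ((e j ^^ m) f)) h + of_nat m * of_real s * B ((e j ^^ (m - 1)) f) h"
proof (induction m arbitrary: h)
  case (Suc m)
  have "B ((e j ^^ Suc m) (d j f)) h = B ((e j ^^ m) (d j f)) (d j h)"
    using Suc.prems by (simp add: adj2 ek_closed d_closed)
  also have "\<dots> = B (d j ((e j ^^ m) f)) (d j h) + of_nat m * of_real s * B ((e j ^^ (m - 1)) f) (d j h)"
    using Suc by (simp add: d_closed)
  also have "B (d j ((e j ^^ m) f)) (d j h) = B (e j (d j ((e j ^^ m) f))) h"
    using Suc.prems by (simp add: adj2 ek_closed d_closed)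
  also have "\<dots> = B (d j ((e j ^^ Suc m) f)) h + of_real s * B ((e j ^^ m) f) h"
    using Suc.prems by (simp add: ccr ek_closed)
  also have "of_nat m * of_real s * B ((e j ^^ (m - 1)) f) (d j h) = of_nat m * of_real s * B ((e j ^^ m) f) h"
  proof (cases m)
    case (Suc k)
    then show ?thesis using Suc.prems \<open>f \<in> V\<close> \<open>h \<in> V\<close> by (simp add: adj2 ek_closed)
  qed simp
  finally show ?case by (simp add: algebra_simps)
qed simp

text \<open>The coefficients of normal ordering in the Weyl algebra with commutator
  \<open>s\<close>: \<open>i\<close> of the \<open>k\<close> factors and \<open>i\<close> of the
  \<open>l\<close> factors are chosen and paired in i! ways.\<close>

definition nc :: "nat \<Rightarrow> nat \<Rightarrow> nat \<Rightarrow> complex" where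
  "nc k l i = of_nat (fact i * (k choose i) * (l choose i)) * of_real s ^ i"

lemma nc_Suc: "nc (Suc k) l (Suc i) = nc k l (Suc i) + of_nat (l - i) * of_real s * nc k l i"
proof -
  have a: "Suc i * (l choose Suc i) = (l - i) * (l choose i)"
    by (simp only: binomial_absorb_comp binomial_absorption)
  have "fact (Suc i) * (k choose i) * (l choose Suc i) = fact i * (k choose i) * (Suc i * (l choose Suc i))"
    by (simp only: fact_Suc of_nat_id ac_simps)
  also have "\<dots> = (l - i) * (fact i * (k choose i) * (l choose i))"
    unfolding a by (simp only: ac_simps)
  finally have F: "fact (Suc i) * (k choose i) * (l choose Suc i) = (l - i) * (fact i * (k choose i) * (l choose i))" .
  have X: "fact (Suc i) * (Suc k choose Suc i) * (l choose Suc i) = 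
     fact (Suc i) * (k choose Suc i) * (l choose Suc i) + (l - i) * (fact i * (k choose i) * (l choose i))"
    unfolding F[symmetric] by (simp only: binomial_Suc_Suc distrib_left distrib_right add.commute)
  show ?thesis unfolding nc_def X of_nat_add of_nat_mult power_Suc by (simp only: distrib_left distrib_right ac_simps)
qed

lemma nc_0: "nc k l 0 = 1" by (simp add: nc_def)

lemma nc_beyond: "i > l \<Longrightarrow> nc k l i = 0" "i > k \<Longrightarrow> nc k l i = 0" by (simp_all add: nc_def binomial_eq_0)

lemma adj2_power: "f \<in> V \<Longrightarrow> g \<in> V \<Longrightarrow> B ((e j ^^ l) f) g = B f ((d j ^^ l) g)"
  by (induction l arbitrary: g) (simp_all add: adj2 ek_closed d_closed funpow_swap1[of "d j"])

text \<open>Induction on \<open>k\<close>: one more \<open>d j\<close> is moved across the powers of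
  \<open>e j\<close>, and the commutator terms merge with the shifted sum by the recursion
  \<open>nc_Suc\<close>.\<close>

lemma normal_order:
  assumes "f \<in> V" "g \<in> V"
  shows "B ((d j ^^ k) f) ((d j ^^ l) g) = (\<Sum>i\<le>l. nc k l i * B ((e j ^^ (l - i)) f) ((e j ^^ (k - i)) g))"
  using assms(1)
proof (induction k arbitrary: f)
  case 0
  have "(\<Sum>i\<le>l. nc 0 l i * B ((e j ^^ (l - i)) f) ((e j ^^ (0 - i)) g)) = 
      (\<Sum>i\<in>{0}. nc 0 l i * B ((e j ^^ (l - i)) f) ((e j ^^ (0 - i)) g))"
    by (rule sum.mono_neutral_right) (auto simp: nc_beyond)
  then show ?case using 0 assms(2) by (simp add: nc_0 adj2_power)
next
  case (Suc k)
  let ?b = "\<lambda>p q. B ((e j ^^ p) f) ((e j ^^ q) g)"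
  have "B ((d j ^^ Suc k) f) ((d j ^^ l) g) = B ((d j ^^ k) (d j f)) ((d j ^^ l) g)"
    by (simp add: funpow_swap1)
  also have "\<dots> = (\<Sum>i\<le>l. nc k l i * B ((e j ^^ (l - i)) (d j f)) ((e j ^^ (k - i)) g))"
    by (rule Suc.IH) (rule d_closed[OF Suc.prems])
  also have "\<dots> = (\<Sum>i\<le>l. nc k l i * ?b (l - i) (Suc k - i) + of_nat (l - i) * of_real s * nc k l i * ?b (l - Suc i) (k - i))"
  proof (rule sum.cong[OF refl])
    fix i
    show "nc k l i * B ((e j ^^ (l - i)) (d j f)) ((e j ^^ (k - i)) g) = 
      nc k l i * ?b (l - i) (Suc k - i) + of_nat (l - i) * of_real s * nc k l i * ?b (l - Suc i) (k - i)"
    \<comment> \<open>For \<open>i > k\<close> the coefficient is 0, which makes the truncated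
      exponents harmless.\<close>
    proof (cases "i \<le> k")
      case True
      then have "(e j ^^ (Suc k - i)) g = e j ((e j ^^ (k - i)) g)" by (simp add: Suc_diff_le)
      then show ?thesis using Suc.prems assms(2)
        by (simp add: e_power_d ek_closed adj1 algebra_simps)
    qed (simp add: nc_beyond)
  qed
  also have "\<dots> = (\<Sum>i\<le>l. nc k l i * ?b (l - i) (Suc k - i)) + (\<Sum>i\<le>l. of_nat (l - i) * of_real s * nc k l i * ?b (l - Suc i) (k - i))"
    by (rule sum.distrib)
  also have "(\<Sum>i\<le>l. of_nat (l - i) * of_real s * nc k l i * ?b (l - Suc i) (k - i)) = 
      (\<Sum>i<l. of_nat (l - i) * of_real s * nc k l i * ?b (l - Suc i) (k - i))"
    by (rule sum.mono_neutral_right) (auto simp: not_less)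
  also have "(\<Sum>i\<le>l. nc k l i * ?b (l - i) (Suc k - i)) = ?b l (Suc k) + (\<Sum>i<l. nc k l (Suc i) * ?b (l - Suc i) (k - i))"
    by (cases l) (simp_all add: sum.atMost_shift nc_0 lessThan_Suc_atMost del: sum.lessThan_Suc sum.atMost_Suc)
  also have "?b l (Suc k) + (\<Sum>i<l. nc k l (Suc i) * ?b (l - Suc i) (k - i)) + 
     (\<Sum>i<l. of_nat (l - i) * of_real s * nc k l i * ?b (l - Suc i) (k - i)) = 
     ?b l (Suc k) + (\<Sum>i<l. nc (Suc k) l (Suc i) * ?b (l - Suc i) (k - i))"
    by (simp add: sum.distrib[symmetric] nc_Suc algebra_simps)
  also have "\<dots> = (\<Sum>i\<le>l. nc (Suc k) l i * ?b (l - i) (Suc k - i))"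
    by (cases l) (simp_all add: sum.atMost_shift nc_0 lessThan_Suc_atMost del: sum.lessThan_Suc sum.atMost_Suc)
  finally show ?case .
qed

definition dd :: "'n list \<Rightarrow> ('n \<Rightarrow> nat) \<Rightarrow> 'v \<Rightarrow> 'v" where
  "dd js \<alpha> = foldr (\<lambda>j. d j ^^ \<alpha> j) js"

definition ee :: "'n list \<Rightarrow> ('n \<Rightarrow> nat) \<Rightarrow> 'v \<Rightarrow> 'v" where
  "ee js \<alpha> = foldr (\<lambda>j. e j ^^ \<alpha> j) js"

lemma dd_closed: "f \<in> V \<Longrightarrow> dd js \<alpha> f \<in> V" and ee_closed: "f \<in> V \<Longrightarrow> ee js \<alpha> f \<in> V"
  by (induction js) (auto simp: dd_def ee_def dk_closed ek_closed)

lemma dd_cong: "(\<And>j. j \<in> set js \<Longrightarrow> \<alpha> j = \<beta> j) \<Longrightarrow> dd js \<alpha> = dd js \<beta>"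
  and ee_cong: "(\<And>j. j \<in> set js \<Longrightarrow> \<alpha> j = \<beta> j) \<Longrightarrow> ee js \<alpha> = ee js \<beta>"
  by (induction js) (auto simp: dd_def ee_def)

lemma e_dk: "i \<noteq> j \<Longrightarrow> f \<in> V \<Longrightarrow> e i ((d j ^^ k) f) = (d j ^^ k) (e i f)"
  by (induction k) (simp_all add: comm dk_closed)

lemma ek_dk: "i \<noteq> j \<Longrightarrow> f \<in> V \<Longrightarrow> (e i ^^ l) ((d j ^^ k) f) = (d j ^^ k) ((e i ^^ l) f)"
  by (induction l) (simp_all add: e_dk ek_closed)

lemma ee_dk: "j \<notin> set js \<Longrightarrow> f \<in> V \<Longrightarrow> ee js \<alpha> ((d j ^^ k) f) = (d j ^^ k) (ee js \<alpha> f)"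
proof (induction js)
  case (Cons i js)
  then have "ee js \<alpha> f \<in> V" by (simp add: ee_closed)
  with Cons show ?case by (auto simp: ee_def ek_dk)
qed (simp add: ee_def)

text \<open>A double sum that is normally ordered in the variables \<open>js1\<close> and not yet in
  \<open>js2\<close>. The exponents in \<open>js1\<close> are attached crosswise, as
  \<open>normal_order\<close> leaves them. With \<open>js1\<close> empty it expands the squared norm
  of the operator applied to \<open>f\<close>; with \<open>js2\<close> empty it is the nonnegative
  form of \<open>pos\<close>.\<close>

definition XX :: "('n \<Rightarrow> nat) set \<Rightarrow> 'n list \<Rightarrow> 'n list \<Rightarrow> (('n \<Rightarrow> nat) \<Rightarrow> complex) \<Rightarrow> (('n \<Rightarrow> nat) \<Rightarrow> 'n \<Rightarrow> nat) \<Rightarrow> 'v \<Rightarrow> complex" where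
  "XX A js1 js2 c \<mu> f = (\<Sum>a\<in>A. \<Sum>b\<in>A. c a * cnj (c b) * 
      B (ee js1 (\<mu> b) (dd js2 (\<mu> a) f)) (ee js1 (\<mu> a) (dd js2 (\<mu> b) f)))"

text \<open>The coefficient \<open>nc\<close> splits into a positive number and one binomial factor
  for each of the two monomials. These factors are absorbed into \<open>c\<close>, so every term of
  the normal ordering is again of the form \<open>XX\<close>.\<close>

lemma XX_move:
  assumes f: "f \<in> V" and A: "finite A" and j: "j \<notin> set js1" "j \<notin> set js2" and m: "\<And>a. a \<in> A \<Longrightarrow> \<mu> a j \<le> m"
  shows "XX A js1 (j # js2) c \<mu> f = (\<Sum>i\<le>m. of_real (fact i * s ^ i) * 
     XX A (j # js1) js2 (\<lambda>a. c a * of_nat (\<mu> a j choose i)) (\<lambda>a. (\<mu> a)(j := \<mu> a j - i)) f)"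
proof -
  let ?\<nu> = "\<lambda>i a. (\<mu> a)(j := \<mu> a j - i)"
  let ?c = "\<lambda>i a. c a * of_nat (\<mu> a j choose i)"
  have "XX A js1 (j # js2) c \<mu> f = (\<Sum>a\<in>A. \<Sum>b\<in>A. \<Sum>i\<le>m. of_real (fact i * s ^ i) * (?c i a * cnj (?c i b) * 
     B (ee (j # js1) (?\<nu> i b) (dd js2 (?\<nu> i a) f)) (ee (j # js1) (?\<nu> i a) (dd js2 (?\<nu> i b) f))))"
    unfolding XX_def
  proof (intro sum.cong refl)
    fix a b assume ab: "a \<in> A" "b \<in> A"
    let ?F = "ee js1 (\<mu> b) (dd js2 (\<mu> a) f)" and ?G = "ee js1 (\<mu> a) (dd js2 (\<mu> b) f)"
    have FG: "?F \<in> V" "?G \<in> V" using f by (auto intro: ee_closed dd_closed)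
    have "ee js1 (\<mu> q) (dd (j # js2) (\<mu> p) f) = (d j ^^ \<mu> p j) (ee js1 (\<mu> q) (dd js2 (\<mu> p) f))" for p q
      using ee_dk[OF j(1) dd_closed[OF f]] by (simp add: dd_def)
    then have "B (ee js1 (\<mu> b) (dd (j # js2) (\<mu> a) f)) (ee js1 (\<mu> a) (dd (j # js2) (\<mu> b) f)) = 
        B ((d j ^^ \<mu> a j) ?F) ((d j ^^ \<mu> b j) ?G)" by simp
    also have "\<dots> = (\<Sum>i\<le>\<mu> b j. nc (\<mu> a j) (\<mu> b j) i * B ((e j ^^ (\<mu> b j - i)) ?F) ((e j ^^ (\<mu> a j - i)) ?G))"
      by (rule normal_order[OF FG])
    also have "\<dots> = (\<Sum>i\<le>m. nc (\<mu> a j) (\<mu> b j) i * B ((e j ^^ (\<mu> b j - i)) ?F) ((e j ^^ (\<mu> a j - i)) ?G))"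
      by (rule sum.mono_neutral_left) (use m[OF ab(2)] in \<open>auto simp: nc_beyond\<close>)
    also have "\<dots> = (\<Sum>i\<le>m. nc (\<mu> a j) (\<mu> b j) i * B (ee (j # js1) (?\<nu> i b) (dd js2 (?\<nu> i a) f)) (ee (j # js1) (?\<nu> i a) (dd js2 (?\<nu> i b) f)))"
    proof -
      have "ee (j # js1) (?\<nu> i b) (dd js2 (?\<nu> i a) f) = (e j ^^ (\<mu> b j - i)) (ee js1 (\<mu> b) (dd js2 (\<mu> a) f))" for i a b
      proof -
        have "ee js1 (?\<nu> i b) = ee js1 (\<mu> b)" by (rule ee_cong) (use j in auto)
        moreover have "dd js2 (?\<nu> i a) = dd js2 (\<mu> a)" by (rule dd_cong) (use j in auto)
        ultimately show ?thesis by (simp add: ee_def)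
      qed
      then show ?thesis by simp
    qed
    finally show "c a * cnj (c b) * B (ee js1 (\<mu> b) (dd (j # js2) (\<mu> a) f)) (ee js1 (\<mu> a) (dd (j # js2) (\<mu> b) f)) = 
      (\<Sum>i\<le>m. of_real (fact i * s ^ i) * (?c i a * cnj (?c i b) * 
     B (ee (j # js1) (?\<nu> i b) (dd js2 (?\<nu> i a) f)) (ee (j # js1) (?\<nu> i a) (dd js2 (?\<nu> i b) f))))"
      by (simp add: sum_distrib_left nc_def algebra_simps)
  qed
  also have "\<dots> = (\<Sum>i\<le>m. \<Sum>a\<in>A. \<Sum>b\<in>A. of_real (fact i * s ^ i) * (?c i a * cnj (?c i b) * 
     B (ee (j # js1) (?\<nu> i b) (dd js2 (?\<nu> i a) f)) (ee (j # js1) (?\<nu> i a) (dd js2 (?\<nu> i b) f))))"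
    by (rule trans[OF sum.cong[OF refl sum.swap] sum.swap])
  finally show ?thesis unfolding XX_def by (simp only: sum_distrib_left)
qed

text \<open>Moving the variables one by one ends in the form of \<open>pos\<close>, and the weights
  \<open>fact i * s ^ i\<close> picked up on the way are nonnegative.\<close>

lemma XX_nonneg:
  assumes f: "f \<in> V" and A: "finite A" 
  shows "distinct js2 \<Longrightarrow> set js1 \<inter> set js2 = {} \<Longrightarrow> 0 \<le> Re (XX A js1 js2 c \<mu> f)"
proof (induction js2 arbitrary: js1 c \<mu>)
  case Nil
  show ?case unfolding XX_def
    using pos[OF A, of "\<lambda>a. ee js1 (\<mu> a) f" c] f by (simp add: dd_def ee_closed)
next
  case (Cons j js2)
  define m where "m = Max ((\<lambda>a. \<mu> a j) ` A)"
  have m: "\<mu> a j \<le> m" if "a \<in> A" for a using that A by (simp add: m_def)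
  have jn: "j \<notin> set js1" "j \<notin> set js2" using Cons.prems by auto
  have eq: "XX A js1 (j # js2) c \<mu> f = (\<Sum>i\<le>m. of_real (fact i * s ^ i) * 
     XX A (j # js1) js2 (\<lambda>a. c a * of_nat (\<mu> a j choose i)) (\<lambda>a. (\<mu> a)(j := \<mu> a j - i)) f)"
    by (rule XX_move[OF f A jn]) (rule m)
  show ?case
    unfolding eq Re_sum
  proof (rule sum_nonneg)
    fix i
    have "0 \<le> fact i * s ^ i" using s1 by simp
    moreover have "0 \<le> Re (XX A (j # js1) js2 (\<lambda>a. c a * of_nat (\<mu> a j choose i)) (\<lambda>a. (\<mu> a)(j := \<mu> a j - i)) f)"
      by (rule Cons.IH) (use Cons.prems in auto)
    ultimately show "0 \<le> Re (of_real (fact i * s ^ i) * XX A (j # js1) js2 (\<lambda>a. c a * of_nat (\<mu> a j choose i)) (\<lambda>a. (\<mu> a)(j := \<mu> a j - i)) f)"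
      by (simp del: of_real_mult of_real_power add: mult_nonneg_nonneg)
  qed
qed

text \<open>In each variable only the term of the maximal exponent \<open>m\<close> is kept: the
  binomial factor annihilates all monomials of smaller exponent and is 1 on the others, whose
  exponent drops to 0. In the end a single monomial survives, the lexicographically largest one, and
  \<open>f\<close> carries no operator any more. The weights on the way are at least 1 because
  \<open>s\<close> is.\<close>

lemma XX_lower:
  assumes f: "f \<in> V" and A: "finite A" and \<kappa>: "\<kappa> \<ge> 0"
  shows "distinct js2 \<Longrightarrow> set js1 \<inter> set js2 = {} \<Longrightarrow> a0 \<in> A \<Longrightarrow> c a0 \<noteq> 0 \<Longrightarrow>
     (\<And>a. a \<in> A \<Longrightarrow> c a \<noteq> 0 \<Longrightarrow> \<kappa> \<le> (cmod (c a))\<^sup>2) \<Longrightarrow>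
     (\<And>a j. a \<in> A \<Longrightarrow> c a \<noteq> 0 \<Longrightarrow> j \<in> set js1 \<Longrightarrow> \<mu> a j = 0) \<Longrightarrow>
     (\<And>a b. a \<in> A \<Longrightarrow> b \<in> A \<Longrightarrow> c a \<noteq> 0 \<Longrightarrow> c b \<noteq> 0 \<Longrightarrow> (\<And>j. j \<in> set js2 \<Longrightarrow> \<mu> a j = \<mu> b j) \<Longrightarrow> a = b) \<Longrightarrow>
     \<kappa> * Re (B f f) \<le> Re (XX A js1 js2 c \<mu> f)"
proof (induction js2 arbitrary: js1 c \<mu> a0)
  case Nil
  have c: "c a = 0" if "a \<in> A" "a \<noteq> a0" for a using Nil.prems(7)[of a a0] Nil.prems(3,4) that by auto
  let ?t = "\<lambda>a b. c a * cnj (c b) * B (ee js1 (\<mu> b) (dd [] (\<mu> a) f)) (ee js1 (\<mu> a) (dd [] (\<mu> b) f))"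
  have "XX A js1 [] c \<mu> f = (\<Sum>a\<in>{a0}. \<Sum>b\<in>A. ?t a b)"
    unfolding XX_def by (rule sum.mono_neutral_right[OF A]) (use Nil.prems(3) c in auto)
  also have "\<dots> = (\<Sum>b\<in>A. ?t a0 b)" by simp
  also have "\<dots> = (\<Sum>b\<in>{a0}. ?t a0 b)"
    by (rule sum.mono_neutral_right[OF A]) (use Nil.prems(3) c in auto)
  also have "\<dots> = ?t a0 a0" by simp
  also have "\<dots> = of_real ((cmod (c a0))\<^sup>2) * B f f"
  proof -
    have "ee js1 (\<mu> a0) = ee js1 (\<lambda>_. 0)" by (rule ee_cong) (rule Nil.prems(6)[OF Nil.prems(3,4)])
    moreover have "ee js1 (\<lambda>_. 0) f = f" by (induction js1) (auto simp: ee_def)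
    ultimately show ?thesis by (simp add: dd_def complex_norm_square del: of_real_power)
  qed
  finally have "Re (XX A js1 [] c \<mu> f) = (cmod (c a0))\<^sup>2 * Re (B f f)" by (simp del: of_real_power)
  moreover have "0 \<le> Re (B f f)" using pos[of "{a0}" "\<lambda>_. f" "\<lambda>_. 1"] f by simp
  ultimately show ?case using Nil.prems(5)[OF Nil.prems(3,4)] by (simp add: mult_right_mono)
next
  case (Cons j js2)
  define m where "m = Max ((\<lambda>a. \<mu> a j) ` {a\<in>A. c a \<noteq> 0})"
  \<comment> \<open>\<open>m\<close> is the maximum over the monomials with nonzero coefficient,
    while \<open>XX_move\<close> requires a bound over all of \<open>A\<close>.\<close>
  define M where "M = Max ((\<lambda>a. \<mu> a j) ` A)"
  have M: "\<mu> a j \<le> M" if "a \<in> A" for a using that A by (simp add: M_def)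
  have m: "\<mu> a j \<le> m" if "a \<in> A" "c a \<noteq> 0" for a using that A by (simp add: m_def)
  have "m \<in> (\<lambda>a. \<mu> a j) ` {a\<in>A. c a \<noteq> 0}"
    unfolding m_def by (rule Max_in) (use A Cons.prems(3,4) in auto)
  then obtain a1 where a1: "a1 \<in> A" "c a1 \<noteq> 0" "\<mu> a1 j = m" by blast
  have jn: "j \<notin> set js1" "j \<notin> set js2" using Cons.prems by auto
  let ?c = "\<lambda>i a. c a * of_nat (\<mu> a j choose i)" and ?\<nu> = "\<lambda>i a. (\<mu> a)(j := \<mu> a j - i)"
  have c': "\<mu> a j = m" "?c m a = c a" "c a \<noteq> 0" if "a \<in> A" "?c m a \<noteq> 0" for a
  proof -
    show 1: "c a \<noteq> 0" using that(2) by auto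
    have "m \<le> \<mu> a j" using that(2) by (metis binomial_eq_0 mult_zero_right not_le of_nat_0)
    with m[OF that(1) 1] show 2: "\<mu> a j = m" by simp
    then show "?c m a = c a" by simp
  qed
  have "\<kappa> * Re (B f f) \<le> Re (XX A (j # js1) js2 (?c m) (?\<nu> m) f)"
  proof (rule Cons.IH)
    show "?c m a1 \<noteq> 0" "a1 \<in> A" using a1 by auto
    show "\<kappa> \<le> (cmod (?c m a))\<^sup>2" if "a \<in> A" "?c m a \<noteq> 0" for a
      using c'[OF that] Cons.prems(5)[OF that(1)] by simp
    show "?\<nu> m a i = 0" if "a \<in> A" "?c m a \<noteq> 0" "i \<in> set (j # js1)" for a i
      using c'[OF that(1,2)] Cons.prems(6)[OF that(1)] that by auto
    show "a = b" if ab: "a \<in> A" "b \<in> A" "?c m a \<noteq> 0" "?c m b \<noteq> 0" "\<And>i. i \<in> set js2 \<Longrightarrow> ?\<nu> m a i = ?\<nu> m b i" for a b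
    proof (rule Cons.prems(7)[OF ab(1,2)])
      show "c a \<noteq> 0" "c b \<noteq> 0" using c' ab by blast+
      fix i assume "i \<in> set (j # js2)"
      then show "\<mu> a i = \<mu> b i"
        using c'(1)[OF ab(1,3)] c'(1)[OF ab(2,4)] ab(5)[of i] jn by (cases "i = j") auto
    qed
  qed (use Cons.prems(1,2) in auto)
  also have "\<dots> \<le> fact m * s ^ m * \<dots>"
  proof -
    have "1 \<le> fact m * s ^ m"
      using mult_mono[of 1 "fact m" 1 "s ^ m"] s1 by (simp add: fact_ge_1)
    moreover have "0 \<le> Re (XX A (j # js1) js2 (?c m) (?\<nu> m) f)"
      by (rule XX_nonneg[OF f A]) (use Cons.prems(1,2) in auto)
    ultimately show ?thesis using mult_right_mono[of 1 "fact m * s ^ m" "Re (XX A (j # js1) js2 (?c m) (?\<nu> m) f)"] by simp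
  qed
  also have "\<dots> = Re (of_real (fact m * s ^ m) * XX A (j # js1) js2 (?c m) (?\<nu> m) f)"
    by (simp del: of_real_mult of_real_power)
  also have "\<dots> \<le> (\<Sum>i\<le>M. Re (of_real (fact i * s ^ i) * XX A (j # js1) js2 (?c i) (?\<nu> i) f))"
  proof (rule member_le_sum[where f="\<lambda>i. Re (of_real (fact i * s ^ i) * XX A (j # js1) js2 (?c i) (?\<nu> i) f)"])
    show "m \<in> {..M}" using a1 M by auto
    fix i
    have "0 \<le> fact i * s ^ i" using s1 by simp
    moreover have "0 \<le> Re (XX A (j # js1) js2 (?c i) (?\<nu> i) f)"
      by (rule XX_nonneg[OF f A]) (use Cons.prems(1,2) in auto)
    ultimately show "0 \<le> Re (of_real (fact i * s ^ i) * XX A (j # js1) js2 (?c i) (?\<nu> i) f)"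
      by (simp del: of_real_mult of_real_power add: mult_nonneg_nonneg)
  qed simp
  also have "\<dots> = Re (XX A js1 (j # js2) c \<mu> f)"
    unfolding Re_sum[symmetric] by (rule arg_cong[where f=Re], rule XX_move[OF f A jn, symmetric]) (rule M)
  finally show ?case .
qed

end

section \<open>Weighted inequality for constant coefficient operators\<close>

lemma integrable_compact_support:
  fixes f :: "real ^ 'n::finite \<Rightarrow> 'b::{banach, second_countable_topology}"
  assumes "continuous_on UNIV f" "compact K" "\<And>x. x \<notin> K \<Longrightarrow> f x = 0"
  shows "integrable lborel f"
proof -
  have "integrable lborel (\<lambda>x. indicator K x *\<^sub>R f x)"
    by (rule borel_integrable_compact[OF assms(2) continuous_on_subset[OF assms(1)]]) simp
  moreover have "(\<lambda>x. indicator K x *\<^sub>R f x) = f"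
    using assms(3) by (auto simp: indicator_def)
  ultimately show ?thesis by simp
qed

lemma test_continuous: "test \<phi> \<Longrightarrow> continuous_on S \<phi>"
  by (intro smooth_continuous test_smooth)

lemma test_integrable: "test \<phi> \<Longrightarrow> integrable lborel \<phi>"
  by (rule integrable_compact_support[OF test_continuous test_compact]) (auto simp: not_in_fun_support)

lemma test_cball: 
  assumes "test \<phi>" obtains R where "R > 0" "\<And>x. norm x > R \<Longrightarrow> \<phi> x = 0"
proof -
  have "bounded (fun_support \<phi>)" using test_compact[OF assms] by (rule compact_imp_bounded)
  then obtain R where R: "R > 0" "\<And>x. x \<in> fun_support \<phi> \<Longrightarrow> norm x \<le> R" by (auto simp: bounded_pos)
  show ?thesis by (rule that[OF R(1)]) (use R(2) not_in_fun_support in force)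
qed

lemma integral_translate:
  fixes f :: "real ^ 'n::finite \<Rightarrow> complex"
  assumes f: "test f" 
  shows "integrable lborel (\<lambda>x. f (x + c))" "integral\<^sup>L lborel (\<lambda>x. f (x + c)) = integral\<^sup>L lborel f"
proof -
  have l: "lborel = distr lborel borel (\<lambda>x::real^'n. c + x)" by (metis lborel_distr_plus)
  have m: "f \<in> borel_measurable borel" by (intro borel_measurable_continuous_onI test_continuous f)
  have "integral\<^sup>L lborel f = integral\<^sup>L (distr lborel borel (\<lambda>x::real^'n. c + x)) f" using l by simp
  also have "\<dots> = integral\<^sup>L lborel (\<lambda>x. f (c + x))" by (rule integral_distr) (use m in auto)
  finally show "integral\<^sup>L lborel (\<lambda>x. f (x + c)) = integral\<^sup>L lborel f" by (simp add: add.commute)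
  have "integrable (distr lborel borel (\<lambda>x::real^'n. c + x)) f" using test_integrable[OF f] l by simp
  then show "integrable lborel (\<lambda>x. f (x + c))"
    by (subst (asm) integrable_distr_eq) (use m in \<open>auto simp: add.commute\<close>)
qed

text \<open>Difference quotients have integral 0 by translation invariance, and they converge to the
  derivative under a bounded, compactly supported majorant.\<close>

lemma integral_partial:
  fixes f :: "real ^ 'n::finite \<Rightarrow> complex"
  assumes f: "test f" shows "integral\<^sup>L lborel (partial j f) = 0"
proof -
  let ?a = "axis j (1::real)"
  let ?h = "\<lambda>i::nat. inverse (real (Suc i))"
  let ?s = "\<lambda>i x. (f (x + ?h i *\<^sub>R ?a) - f x) /\<^sub>R ?h i"
  obtain R where R: "R > 0" "\<And>x. norm x > R \<Longrightarrow> f x = 0" using test_cball[OF f] by blast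
  obtain A where A: "A \<ge> 0" "bd 1 A f" using test_bd[OF f] by blast
  have h: "0 < ?h i" "?h i \<le> 1" for i by (auto simp: field_simps)
  note tr = integral_translate[OF f]
  have lim: "(\<lambda>i. integral\<^sup>L lborel (?s i)) \<longlonglongrightarrow> integral\<^sup>L lborel (partial j f)"
  proof (rule integral_dominated_convergence[where w="\<lambda>x. indicator (cball 0 (R+1)) x *\<^sub>R (real CARD('n) * A)"])
    show "partial j f \<in> borel_measurable lborel" "\<And>i. ?s i \<in> borel_measurable lborel"
      using borel_measurable_integrable[OF test_integrable[OF test_partial[OF f]]] borel_measurable_integrable[OF tr(1)]
        borel_measurable_integrable[OF test_integrable[OF f]] by (auto simp del: inverse_Suc)
    show "integrable lborel (\<lambda>x. indicator (cball 0 (R+1)) x *\<^sub>R (real CARD('n) * A))"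
      by (intro borel_integrable_compact continuous_intros) auto
    show "AE x in lborel. (\<lambda>i. ?s i x) \<longlonglongrightarrow> partial j f x"
    proof (rule AE_I2)
      fix x
      have 1: "((\<lambda>t::real. t *\<^sub>R ?a + x) has_vector_derivative ?a) (at 0)"
        by (auto intro!: derivative_eq_intros)
      have "((f \<circ> (\<lambda>t. t *\<^sub>R ?a + x)) has_vector_derivative (\<Sum>k\<in>UNIV. (?a $ k) *\<^sub>R partial k f (0 *\<^sub>R ?a + x))) (at 0)"
        by (rule vector_derivative_diff_chain_within[OF 1])
           (rule has_derivative_at_withinI[OF has_derivative_partial[OF smooth_differentiable[OF test_smooth[OF f]]]])
      then have "((\<lambda>t. f (t *\<^sub>R ?a + x)) has_vector_derivative partial j f x) (at 0)"
        unfolding sum_axis by (simp add: o_def)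
      then have "((\<lambda>t. f (t *\<^sub>R ?a + x)) has_derivative (\<lambda>t. t *\<^sub>R partial j f x)) (at 0)"
        by (simp only: has_vector_derivative_def)
      then have der: "\<exists>d>0. \<forall>y. norm (y - 0) < d \<longrightarrow> norm (f (y *\<^sub>R ?a + x) - f (0 *\<^sub>R ?a + x) - (y - 0) *\<^sub>R partial j f x) \<le> e * norm (y - 0)" if "e > 0" for e
        using that unfolding has_derivative_at_alt by blast
      have "(\<lambda>i. (f (?h i *\<^sub>R ?a + x) - f x) /\<^sub>R ?h i) \<longlonglongrightarrow> partial j f x"
      proof (rule LIMSEQ_I)
        fix e :: real assume e: "e > 0"
        then obtain d where d: "d > 0" "\<And>y. norm y < d \<Longrightarrow> norm (f (y *\<^sub>R ?a + x) - f x - y *\<^sub>R partial j f x) \<le> (e/2) * norm y"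
          using der[of "e/2"] by auto
        obtain n0 where n0: "?h n0 < d" using reals_Archimedean[OF d(1)] by blast
        show "\<exists>no. \<forall>i\<ge>no. norm ((f (?h i *\<^sub>R ?a + x) - f x) /\<^sub>R ?h i - partial j f x) < e"
        proof (intro exI allI impI)
          fix i assume "n0 \<le> i"
          then have "?h i \<le> ?h n0" by (intro le_imp_inverse_le) auto
          then have "?h i < d" using n0 by (rule le_less_trans)
          then have hd: "norm (?h i) < d" using h(1)[of i] by simp
          let ?D = "f (?h i *\<^sub>R ?a + x) - f x - ?h i *\<^sub>R partial j f x"
          have "(f (?h i *\<^sub>R ?a + x) - f x) /\<^sub>R ?h i - partial j f x = ?D /\<^sub>R ?h i"
            using h(1)[of i] by (simp add: scaleR_right_diff_distrib del: inverse_Suc of_nat_Suc inverse_inverse_eq)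
          then have "norm ((f (?h i *\<^sub>R ?a + x) - f x) /\<^sub>R ?h i - partial j f x) = norm ?D / ?h i"
            using h(1)[of i] by (simp only: norm_scaleR) (simp add: divide_inverse mult.commute)
          also have "\<dots> \<le> e/2"
            using d(2)[OF hd] h(1)[of i] by (simp add: divide_le_eq del: inverse_Suc of_nat_Suc)
          finally show "norm ((f (?h i *\<^sub>R ?a + x) - f x) /\<^sub>R ?h i - partial j f x) < e" using e by simp
        qed
      qed
      then show "(\<lambda>i. ?s i x) \<longlonglongrightarrow> partial j f x" by (simp add: add.commute)
    qed
    show "AE x in lborel. norm (?s i x) \<le> indicator (cball 0 (R+1)) x *\<^sub>R (real CARD('n) * A)" for i
    proof (rule AE_I2)
      fix x
      have "cmod (f (x + ?h i *\<^sub>R ?a) - f x) \<le> CARD('n) * A * norm (x + ?h i *\<^sub>R ?a - x)"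
      proof (rule mean_value_partial[OF test_smooth[OF f], of UNIV])
        show "cmod (partial k f z) \<le> A" for k z
          using bdD[OF A(2), of "ei k" z] by (simp add: pd_ei test_smooth f)
      qed auto
      then have 1: "cmod (f (x + ?h i *\<^sub>R ?a) - f x) \<le> (CARD('n) * A) * ?h i"
        using h[of i] by (simp add: norm_axis_1)
      have "norm (?s i x) = cmod (f (x + ?h i *\<^sub>R ?a) - f x) / ?h i"
        using h(1)[of i] by (simp add: divide_inverse mult.commute)
      also have "\<dots> \<le> CARD('n) * A" using 1 h(1)[of i] by (simp add: divide_le_eq del: inverse_Suc)
      finally have 2: "norm (?s i x) \<le> CARD('n) * A" .
      show "norm (?s i x) \<le> indicator (cball 0 (R+1)) x *\<^sub>R (real CARD('n) * A)"
      proof (cases "x \<in> cball 0 (R+1)")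
        case False
        then have x: "norm x > R + 1" by simp
        have "norm (?h i *\<^sub>R ?a) \<le> 1" using h[of i] by (simp add: norm_axis_1)
        then have "norm (x + ?h i *\<^sub>R ?a) > R" using x norm_diff_ineq[of x "?h i *\<^sub>R ?a"] by linarith
        then show ?thesis using R(2) x by simp
      qed (use 2 in simp)
    qed
  qed
  have Z: "integral\<^sup>L lborel (?s i) = 0" for i
    using tr(1)[of "?h i *\<^sub>R ?a"] tr(2)[of "?h i *\<^sub>R ?a"] test_integrable[OF f] by (simp del: inverse_Suc)
  have "(\<lambda>i::nat. 0) \<longlonglongrightarrow> integral\<^sup>L lborel (partial j f)" using lim by (simp only: Z)
  then show ?thesis by (simp add: LIMSEQ_const_iff)
qed

section \<open>The Gaussian weight and the adjoints of the partial derivatives\<close>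

lemma smooth_cnj: "smooth f \<Longrightarrow> smooth (\<lambda>x. cnj (f x))"
  and partial_cnj: "smooth f \<Longrightarrow> partial j (\<lambda>x. cnj (f x)) = (\<lambda>x. cnj (partial j f x))"
proof -
  have d: "((\<lambda>x. cnj (f x)) has_derivative (\<lambda>h. cnj (\<Sum>j\<in>UNIV. (h $ j) *\<^sub>R partial j f x))) (at x)" if "smooth f" for f x
    by (rule bounded_linear.has_derivative[OF bounded_linear_cnj has_derivative_partial[OF smooth_differentiable[OF that]]])
  have p: "partial j (\<lambda>x. cnj (f x)) = (\<lambda>x. cnj (partial j f x))" if "smooth f" for f j
    by (rule ext, subst partial_eq[OF d[OF that]]) (simp only: sum_axis)
  then show "smooth f \<Longrightarrow> partial j (\<lambda>x. cnj (f x)) = (\<lambda>x. cnj (partial j f x))" .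
  have C: "smooth f \<Longrightarrow> Ck n (\<lambda>x. cnj (f x))" for n f
  proof (induction n arbitrary: f)
    case 0
    have "(\<lambda>x. cnj (f x)) differentiable (at x)" for x
      by (rule differentiableI[OF d[OF 0]])
    then show ?case by simp
  next
    case (Suc n)
    have "(\<lambda>x. cnj (f x)) differentiable (at x)" for x
      by (rule differentiableI[OF d[OF Suc.prems]])
    with Suc.IH[OF smooth_partial[OF Suc.prems]] show ?case unfolding Ck.simps(2) p[OF Suc.prems] by simp
  qed
  show "smooth f \<Longrightarrow> smooth (\<lambda>x. cnj (f x))" using C smooth_iff_Ck by blast
qed

definition wt :: "real \<Rightarrow> real ^ 'n::finite \<Rightarrow> real" where
  "wt t x = exp (t * (norm x)\<^sup>2)"

lemma wt_pos: "wt t x > 0" by (simp add: wt_def)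

lemma has_derivative_wt: "((\<lambda>x. complex_of_real (wt t x)) has_derivative (\<lambda>h. complex_of_real (wt t x * (t * (2 * (x \<bullet> h)))))) (at x)"
proof -
  have "((\<lambda>x. exp (t * (x \<bullet> x))) has_derivative (\<lambda>h. exp (t * (x \<bullet> x)) * (t * (2 * (x \<bullet> h))))) (at x)"
    by (auto intro!: derivative_eq_intros simp: inner_commute)
  from bounded_linear.has_derivative[OF bounded_linear_of_real this]
  show ?thesis by (simp add: wt_def[abs_def] power2_norm_eq_inner)
qed

lemma partial_wt: "partial j (\<lambda>x. complex_of_real (wt t x)) = (\<lambda>x. complex_of_real (2 * t) * complex_of_real (x $ j) * complex_of_real (wt t x))"
  by (rule ext, subst partial_eq[OF has_derivative_wt]) (simp add: inner_axis)

lemma smooth_wt: "smooth (\<lambda>x::real^'n::finite. complex_of_real (wt t x))"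
proof -
  have dw: "(\<lambda>x::real^'n. complex_of_real (wt t x)) differentiable (at x)" for x
    by (rule differentiableI[OF has_derivative_wt])
  have "Ck n (\<lambda>x::real^'n. complex_of_real (wt t x))" for n
  proof (induction n)
    case (Suc n)
    have "Ck n (\<lambda>x::real^'n. complex_of_real (2 * t) * complex_of_real (x $ j))" for j
      using smooth_cmult[OF smooth_coord] unfolding smooth_iff_Ck by blast
    from Ck_mult[OF this Suc] show ?case unfolding Ck.simps(2) partial_wt by (intro conjI allI dw)
  qed (simp add: dw)
  then show ?thesis by (simp add: smooth_iff_Ck)
qed

lemma continuous_wt: "continuous_on S (wt t)"
  unfolding wt_def[abs_def] by (intro continuous_intros)

definition BB :: "real \<Rightarrow> (real ^ 'n::finite \<Rightarrow> complex) \<Rightarrow> (real ^ 'n \<Rightarrow> complex) \<Rightarrow> complex" where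
  "BB t f g = integral\<^sup>L lborel (\<lambda>x. f x * cnj (g x) * complex_of_real (wt t x))"

lemma test_BB: "test f \<Longrightarrow> smooth g \<Longrightarrow> test (\<lambda>x. f x * cnj (g x) * complex_of_real (wt t x))"
  by (intro test_mult2 smooth_cnj smooth_wt)

lemma BB_sum:
  fixes F G :: "'a \<Rightarrow> real ^ 'n::finite \<Rightarrow> complex"
  assumes A: "finite A" and F: "\<And>a. a \<in> A \<Longrightarrow> test (F a)" "\<And>a. a \<in> A \<Longrightarrow> test (G a)"
  shows "BB t (\<lambda>x. \<Sum>a\<in>A. c a * F a x) (\<lambda>x. \<Sum>b\<in>A. k b * G b x) = (\<Sum>a\<in>A. \<Sum>b\<in>A. c a * cnj (k b) * BB t (F a) (G b))"
proof -
  have i: "integrable lborel (\<lambda>x. F a x * cnj (G b x) * complex_of_real (wt t x))" if "a \<in> A" "b \<in> A" for a b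
    by (intro test_integrable test_BB test_smooth F that)
  have "BB t (\<lambda>x. \<Sum>a\<in>A. c a * F a x) (\<lambda>x. \<Sum>b\<in>A. k b * G b x) = 
      integral\<^sup>L lborel (\<lambda>x. \<Sum>a\<in>A. \<Sum>b\<in>A. c a * cnj (k b) * (F a x * cnj (G b x) * complex_of_real (wt t x)))"
    unfolding BB_def
    by (simp add: sum_distrib_left sum_distrib_right algebra_simps cong: sum.cong)
       (subst sum.swap, simp)
  also have "\<dots> = (\<Sum>a\<in>A. \<Sum>b\<in>A. c a * cnj (k b) * BB t (F a) (G b))"
    unfolding BB_def
    by (subst Bochner_Integration.integral_sum; (intro sum.cong refl)?)
       (auto intro!: Bochner_Integration.integrable_sum integrable_mult_right i simp: Bochner_Integration.integral_sum i)
  finally show ?thesis .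
qed

lemma BB_add_left:
  assumes "test f" "test f'" "test g"
  shows "BB t (\<lambda>x. f x + f' x) g = BB t f g + BB t f' g"
  using Bochner_Integration.integral_add[OF test_integrable[OF test_BB[OF assms(1) test_smooth[OF assms(3)], of t]] 
      test_integrable[OF test_BB[OF assms(2) test_smooth[OF assms(3)], of t]]]
  by (simp add: BB_def algebra_simps)

lemma BB_cmult_left: "BB t (\<lambda>x. c * f x) g = c * BB t f g"
  unfolding BB_def by (simp only: mult.assoc integral_mult_right_zero)

lemma BB_self_Re: "Re (BB t f f) = integral\<^sup>L lborel (\<lambda>x. (cmod (f x))\<^sup>2 * wt t x)"
proof -
  have "BB t f f = integral\<^sup>L lborel (\<lambda>x. complex_of_real ((cmod (f x))\<^sup>2 * wt t x))"
    unfolding BB_def by (simp add: complex_norm_square del: of_real_power)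
  then show ?thesis by (simp only: integral_complex_of_real Re_complex_of_real)
qed

text \<open>The adjoint of \<open>partial j\<close> with respect to \<open>BB t\<close>; the
  multiplication term comes from differentiating the weight.\<close>

definition ej :: "real \<Rightarrow> 'n \<Rightarrow> (real ^ 'n::finite \<Rightarrow> complex) \<Rightarrow> real ^ 'n \<Rightarrow> complex" where
  "ej t j g = (\<lambda>x. -1 * (partial j g x + complex_of_real (2 * t) * complex_of_real (x $ j) * g x))"

lemma smooth_2tx: "smooth (\<lambda>x. complex_of_real (2 * t) * complex_of_real (x $ j))"
  by (rule smooth_cmult[OF smooth_coord])

lemma test_ej: "test g \<Longrightarrow> test (ej t j g)"
  unfolding ej_def by (intro test_cmult test_add test_partial test_mult1[OF smooth_2tx])

lemma partial_ej: 
  assumes g: "smooth g"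
  shows "partial k (ej t j g) = (\<lambda>x. -1 * (partial k (partial j g) x + 
    ((if j = k then complex_of_real (2 * t) else 0) * g x + complex_of_real (2 * t) * complex_of_real (x $ j) * partial k g x)))"
proof -
  note sd = smooth_differentiable
  have s: "smooth (\<lambda>x. complex_of_real (2 * t) * complex_of_real (x $ j) * g x)"
    by (rule smooth_mult[OF smooth_2tx g])
  have "partial k (\<lambda>x. complex_of_real (2 * t) * complex_of_real (x $ j)) = (\<lambda>x. if j = k then complex_of_real (2 * t) else 0)"
    by (subst partial_cmult) (auto simp: partial_coord differentiable_coord)
  then have "partial k (\<lambda>x. complex_of_real (2 * t) * complex_of_real (x $ j) * g x) = 
    (\<lambda>x. (if j = k then complex_of_real (2 * t) else 0) * g x + complex_of_real (2 * t) * complex_of_real (x $ j) * partial k g x)"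
    by (subst partial_mult) (simp_all only: sd[OF smooth_2tx] sd[OF g])
  then show ?thesis unfolding ej_def
    by (subst partial_cmult, simp only: sd[OF smooth_add[OF smooth_partial[OF g] s]],
        subst partial_add, simp_all only: sd[OF smooth_partial[OF g]] sd[OF s])
qed

text \<open>The product rule for \<open>f\<close>, the conjugate of \<open>g\<close> and the weight,
  integrated: the integral of the derivative of a test function vanishes.\<close>

lemma ibp:
  assumes f: "test f" and g: "test g"
  shows "BB t (partial j f) g + BB t f (partial j g) + 
    integral\<^sup>L lborel (\<lambda>x. complex_of_real (2 * t) * complex_of_real (x $ j) * f x * cnj (g x) * complex_of_real (wt t x)) = 0"
proof -
  let ?w = "\<lambda>x. complex_of_real (wt t x)"
  let ?T = "\<lambda>x. complex_of_real (2 * t) * complex_of_real (x $ j) * f x * cnj (g x) * ?w x"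
  have sf: "smooth f" and sg: "smooth g" using f g test_smooth by auto
  have "test (\<lambda>x. f x * cnj (g x) * ?w x)" by (rule test_BB[OF f sg])
  then have "integral\<^sup>L lborel (partial j (\<lambda>x. f x * cnj (g x) * ?w x)) = 0" by (rule integral_partial)
  also have "partial j (\<lambda>x. f x * cnj (g x) * ?w x) = 
     (\<lambda>x. partial j f x * cnj (g x) * ?w x + f x * cnj (partial j g x) * ?w x + ?T x)"
  proof -
    have s1: "smooth (\<lambda>x. f x * cnj (g x))" by (intro smooth_mult smooth_cnj sf sg)
    note sd = smooth_differentiable
    show ?thesis
      unfolding partial_mult[OF sd[OF s1] sd[OF smooth_wt]] partial_mult[OF sd[OF sf] sd[OF smooth_cnj[OF sg]]] partial_cnj[OF sg] partial_wt
      by (simp add: algebra_simps)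
  qed
  also have "integral\<^sup>L lborel \<dots> = BB t (partial j f) g + BB t f (partial j g) + integral\<^sup>L lborel ?T"
  proof -
    have 1: "integrable lborel (\<lambda>x. partial j f x * cnj (g x) * ?w x)"
      by (intro test_integrable test_BB test_partial f sg)
    have 2: "integrable lborel (\<lambda>x. f x * cnj (partial j g x) * ?w x)"
      by (intro test_integrable test_BB f smooth_partial sg)
    have 3: "integrable lborel ?T"
      by (intro test_integrable test_BB test_mult1[OF smooth_2tx] f sg)
    show ?thesis unfolding BB_def
      by (simp only: Bochner_Integration.integral_add[OF Bochner_Integration.integrable_add[OF 1 2] 3] Bochner_Integration.integral_add[OF 1 2])
  qed
  finally show ?thesis .
qed

lemma BB_ej_right:
  assumes f: "test f" and g: "test g"
  shows "BB t f (ej t j g) = BB t (partial j f) g" "BB t (ej t j f) g = BB t f (partial j g)"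
proof -
  let ?w = "\<lambda>x. complex_of_real (wt t x)"
  let ?T = "\<lambda>x. complex_of_real (2 * t) * complex_of_real (x $ j) * f x * cnj (g x) * ?w x"
  have sf: "smooth f" and sg: "smooth g" using f g test_smooth by auto
  have 1: "integrable lborel (\<lambda>x. partial j f x * cnj (g x) * ?w x)"
    by (intro test_integrable test_BB test_partial f sg)
  have 2: "integrable lborel (\<lambda>x. f x * cnj (partial j g x) * ?w x)"
    by (intro test_integrable test_BB f smooth_partial sg)
  have 3: "integrable lborel ?T"
    by (intro test_integrable test_BB test_mult1[OF smooth_2tx] f sg)
  have "BB t f (ej t j g) = integral\<^sup>L lborel (\<lambda>x. - (f x * cnj (partial j g x) * ?w x + ?T x))"
    unfolding BB_def ej_def by (simp add: algebra_simps)
  also have "\<dots> = - (BB t f (partial j g) + integral\<^sup>L lborel ?T)"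
    unfolding BB_def by (simp only: integral_minus Bochner_Integration.integral_add[OF 2 3])
  also have "\<dots> = BB t (partial j f) g"
    using ibp[OF f g, of t j] by (intro sym[of "BB t (partial j f) g"]) (simp only: eq_neg_iff_add_eq_0 add.assoc)
  finally show "BB t f (ej t j g) = BB t (partial j f) g" .
  have "BB t (ej t j f) g = integral\<^sup>L lborel (\<lambda>x. - (partial j f x * cnj (g x) * ?w x + ?T x))"
    unfolding BB_def ej_def by (simp add: algebra_simps)
  also have "\<dots> = - (BB t (partial j f) g + integral\<^sup>L lborel ?T)"
    unfolding BB_def by (simp only: integral_minus Bochner_Integration.integral_add[OF 1 3])
  also have "\<dots> = BB t f (partial j g)"
    using ibp[OF f g, of t j] by (intro sym[of "BB t f (partial j g)"]) (simp only: eq_neg_iff_add_eq_0 add.assoc add.left_commute)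
  finally show "BB t (ej t j f) g = BB t f (partial j g)" .
qed

text \<open>The commutator of \<open>ej t j\<close> and \<open>partial j\<close> is multiplication
  by 2t, so the requirement \<open>s \<ge> 1\<close> of the locale becomes t >= 1/2.\<close>

lemma heisenberg_BB:
  assumes t: "t \<ge> 1/2"
  shows "heisenberg (test_functions :: (real ^ 'n::finite \<Rightarrow> complex) set) (BB t) partial (ej t) (2 * t)"
proof
  fix f g :: "real ^ 'n \<Rightarrow> complex" and i j :: 'n
  assume f: "test f"
  have sf: "smooth f" by (rule test_smooth[OF f])
  show "test (partial j f)" "test (ej t j f)" using f test_partial test_ej by auto
  show "ej t i (partial j f) = partial j (ej t i f)" if "i \<noteq> j"
    unfolding partial_ej[OF sf] unfolding ej_def using that by (simp add: partial_commute[OF sf, of i j])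
  assume g: "test g"
  show "BB t (partial j f) g = BB t f (ej t j g)" "BB t (ej t j f) g = BB t f (partial j g)"
    using BB_ej_right[OF f g] by auto
  have "ej t j (partial j f) = (\<lambda>x. partial j (ej t j f) x + complex_of_real (2 * t) * f x)"
    unfolding partial_ej[OF sf] unfolding ej_def by (auto simp: algebra_simps)
  then have "BB t (ej t j (partial j f)) g = BB t (\<lambda>x. partial j (ej t j f) x + complex_of_real (2 * t) * f x) g" by simp
  also have "\<dots> = BB t (partial j (ej t j f)) g + complex_of_real (2 * t) * BB t f g"
    by (subst BB_add_left) (auto intro: test_partial test_ej test_cmult f g simp: BB_cmult_left)
  finally show "BB t (ej t j (partial j f)) g = BB t (partial j (ej t j f)) g + complex_of_real (2 * t) * BB t f g" .
next
  fix A :: "('n \<Rightarrow> nat) set" and F :: "('n \<Rightarrow> nat) \<Rightarrow> real ^ 'n \<Rightarrow> complex" and k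
  assume A: "finite A" and F: "\<And>a. a \<in> A \<Longrightarrow> test (F a)"
  have "(\<Sum>a\<in>A. \<Sum>b\<in>A. k a * cnj (k b) * BB t (F b) (F a)) = (\<Sum>b\<in>A. \<Sum>a\<in>A. cnj (k b) * cnj (cnj (k a)) * BB t (F b) (F a))"
    by (subst sum.swap) (simp add: mult.commute)
  also have "\<dots> = BB t (\<lambda>x. \<Sum>a\<in>A. cnj (k a) * F a x) (\<lambda>x. \<Sum>a\<in>A. cnj (k a) * F a x)"
    by (rule BB_sum[OF A F F, symmetric])
  finally show "0 \<le> Re (\<Sum>a\<in>A. \<Sum>b\<in>A. k a * cnj (k b) * BB t (F b) (F a))"
    by (simp only: BB_self_Re) (simp add: wt_pos less_imp_le)
qed (use t in simp)

definition pdo :: "'n::finite multiindex set \<Rightarrow> ('n multiindex \<Rightarrow> complex) \<Rightarrow> (real ^ 'n \<Rightarrow> complex) \<Rightarrow> real ^ 'n \<Rightarrow> complex" where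
  "pdo S a \<phi> = (\<lambda>x. \<Sum>\<alpha>\<in>S. a \<alpha> * pd \<alpha> \<phi> x)"

text \<open>\<open>\<kappa>\<close> is the smallest squared modulus of a nonzero coefficient. It is
  fixed before \<open>t\<close>, and this uniformity is what Runge approximation lives on.\<close>

lemma weighted_inequality:
  fixes S :: "'n::finite multiindex set"
  assumes S: "finite S" and a0: "\<alpha>0 \<in> S" "a \<alpha>0 \<noteq> 0"
  obtains \<kappa> where "\<kappa> > 0" "\<And>t f. t \<ge> 1/2 \<Longrightarrow> test f \<Longrightarrow> \<kappa> * Re (BB t f f) \<le> Re (BB t (pdo S a f) (pdo S a f))"
proof -
  define \<kappa> where "\<kappa> = Min ((\<lambda>\<alpha>. (cmod (a \<alpha>))\<^sup>2) ` {\<alpha>\<in>S. a \<alpha> \<noteq> 0})"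
  have fin: "finite ((\<lambda>\<alpha>. (cmod (a \<alpha>))\<^sup>2) ` {\<alpha>\<in>S. a \<alpha> \<noteq> 0})" using S by simp
  have ne: "(\<lambda>\<alpha>. (cmod (a \<alpha>))\<^sup>2) ` {\<alpha>\<in>S. a \<alpha> \<noteq> 0} \<noteq> {}" using a0 by blast
  have kpos: "\<kappa> > 0" unfolding \<kappa>_def by (subst Min_gr_iff[OF fin ne]) auto
  have le: "\<kappa> \<le> (cmod (a \<alpha>))\<^sup>2" if "\<alpha> \<in> S" "a \<alpha> \<noteq> 0" for \<alpha>
    unfolding \<kappa>_def by (rule Min_le[OF fin]) (use that in auto)
  show ?thesis
  proof (rule that[OF kpos])
    fix t :: real and f :: "real ^ 'n \<Rightarrow> complex"
    assume t: "t \<ge> 1/2" and f: "test f"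
    interpret heisenberg "test_functions :: (real ^ 'n \<Rightarrow> complex) set" "BB t" partial "ej t" "2 * t"
      by (rule heisenberg_BB[OF t])
    have "\<kappa> * Re (BB t f f) \<le> Re (XX S [] coords a (\<lambda>\<alpha>. \<alpha>) f)"
      by (rule XX_lower[where c=a and \<mu>="\<lambda>\<alpha>. \<alpha>", OF f S _ _ _ a0]) (use kpos le in \<open>auto simp: fun_eq_iff coords\<close>)
    also have "XX S [] coords a (\<lambda>\<alpha>. \<alpha>) f = (\<Sum>\<alpha>\<in>S. \<Sum>\<beta>\<in>S. a \<alpha> * cnj (a \<beta>) * BB t (pd \<alpha> f) (pd \<beta> f))"
      unfolding XX_def dd_def ee_def iter_op_def by simp
    also have "\<dots> = BB t (pdo S a f) (pdo S a f)"
      unfolding pdo_def by (rule BB_sum[OF S, symmetric]) (rule test_pd[OF f])+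
    finally show "\<kappa> * Re (BB t f f) \<le> Re (BB t (pdo S a f) (pdo S a f))" .
  qed
qed

section \<open>Weighted norms and a Sobolev inequality\<close>

lemma Cauchy_Schwarz_integral:
  fixes f g :: "'a \<Rightarrow> real"
  assumes [measurable]: "f \<in> borel_measurable M" "g \<in> borel_measurable M"
    and nn: "\<And>x. f x \<ge> 0" "\<And>x. g x \<ge> 0"
    and i: "integrable M (\<lambda>x. (f x)\<^sup>2)" "integrable M (\<lambda>x. (g x)\<^sup>2)"
  shows "integrable M (\<lambda>x. f x * g x)" 
    "integral\<^sup>L M (\<lambda>x. f x * g x) \<le> sqrt (integral\<^sup>L M (\<lambda>x. (f x)\<^sup>2)) * sqrt (integral\<^sup>L M (\<lambda>x. (g x)\<^sup>2))"
proof -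
  show 1: "integrable M (\<lambda>x. f x * g x)"
  proof (rule Bochner_Integration.integrable_bound)
    show "integrable M (\<lambda>x. (f x)\<^sup>2 + (g x)\<^sup>2)" using i by simp
    show "AE x in M. norm (f x * g x) \<le> norm ((f x)\<^sup>2 + (g x)\<^sup>2)"
    proof (rule AE_I2)
      fix x
      have "2 * (f x * g x) \<le> (f x)\<^sup>2 + (g x)\<^sup>2"
        using sum_squares_bound[of "f x" "g x"] by (simp add: mult.assoc)
      moreover have "0 \<le> f x * g x" using nn by simp
      ultimately have "f x * g x \<le> (f x)\<^sup>2 + (g x)\<^sup>2" by linarith
      then show "norm (f x * g x) \<le> norm ((f x)\<^sup>2 + (g x)\<^sup>2)" using nn[of x] by simp
    qed
  qed measurable
  have "(\<integral>\<^sup>+x. ennreal (f x) * ennreal (g x) \<partial>M)\<^sup>2 \<le> (\<integral>\<^sup>+x. ennreal (f x) ^ 2 \<partial>M) * (\<integral>\<^sup>+x. ennreal (g x) ^ 2 \<partial>M)"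
    by (rule Cauchy_Schwarz_nn_integral) measurable
  then have "ennreal (integral\<^sup>L M (\<lambda>x. f x * g x)) ^ 2 \<le> ennreal (integral\<^sup>L M (\<lambda>x. (f x)\<^sup>2)) * ennreal (integral\<^sup>L M (\<lambda>x. (g x)\<^sup>2))"
    using nn by (simp add: ennreal_mult[symmetric] ennreal_power nn_integral_eq_integral 1 i)
  then have "ennreal ((integral\<^sup>L M (\<lambda>x. f x * g x))\<^sup>2) \<le> ennreal (integral\<^sup>L M (\<lambda>x. (f x)\<^sup>2) * integral\<^sup>L M (\<lambda>x. (g x)\<^sup>2))"
    using nn by (simp add: ennreal_mult[symmetric] ennreal_power)
  then have "(integral\<^sup>L M (\<lambda>x. f x * g x))\<^sup>2 \<le> integral\<^sup>L M (\<lambda>x. (f x)\<^sup>2) * integral\<^sup>L M (\<lambda>x. (g x)\<^sup>2)"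
    by (subst (asm) ennreal_le_iff) simp_all
  then have "integral\<^sup>L M (\<lambda>x. f x * g x) \<le> sqrt (integral\<^sup>L M (\<lambda>x. (f x)\<^sup>2) * integral\<^sup>L M (\<lambda>x. (g x)\<^sup>2))"
    by (rule real_le_rsqrt)
  then show "integral\<^sup>L M (\<lambda>x. f x * g x) \<le> sqrt (integral\<^sup>L M (\<lambda>x. (f x)\<^sup>2)) * sqrt (integral\<^sup>L M (\<lambda>x. (g x)\<^sup>2))"
    by (simp add: real_sqrt_mult)
qed

definition NN :: "real \<Rightarrow> (real ^ 'n::finite \<Rightarrow> complex) \<Rightarrow> real" where
  "NN t f = sqrt (integral\<^sup>L lborel (\<lambda>x. (cmod (f x))\<^sup>2 * wt t x))"

lemma NN_eq: "NN t f = sqrt (Re (BB t f f))"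
  by (simp add: NN_def BB_self_Re)

lemma NN_nonneg: "NN t f \<ge> 0"
  by (simp add: NN_def wt_pos less_imp_le)

lemma NN_square: "(NN t f)\<^sup>2 = integral\<^sup>L lborel (\<lambda>x. (cmod (f x))\<^sup>2 * wt t x)"
  by (simp add: NN_def wt_pos less_imp_le)

lemma wt_half: "wt (t / 2) x * wt (t / 2) x = wt t x" "(wt (t / 2) x)\<^sup>2 = wt t x"
  by (simp_all add: wt_def exp_add[symmetric] power2_eq_square)

lemma test_measurable: "test f \<Longrightarrow> f \<in> borel_measurable borel"
  by (intro borel_measurable_continuous_onI test_continuous)

lemma wt_measurable [measurable]: "wt t \<in> borel_measurable borel"
  by (intro borel_measurable_continuous_onI continuous_wt)

lemma integrable_sq_wt: 
  assumes "test f" shows "integrable lborel (\<lambda>x. (cmod (f x))\<^sup>2 * wt t x)"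
  by (rule integrable_compact_support[OF _ test_compact[OF assms]])
     (auto intro!: continuous_intros test_continuous continuous_wt assms simp: not_in_fun_support)

text \<open>The factors exp(-t|x|^2/2) and exp(t|x|^2/2) cancel in the product, which makes the
  norms with weights -t and t dual to each other.\<close>

lemma weighted_Cauchy_Schwarz:
  fixes f g :: "real ^ 'n::finite \<Rightarrow> complex"
  assumes f: "test f" and g: "test g"
  shows "integral\<^sup>L lborel (\<lambda>x. cmod (f x) * cmod (g x)) \<le> NN (-t) f * NN t g"
proof -
  note [measurable] = test_measurable[OF f] test_measurable[OF g]
  let ?F = "\<lambda>x. cmod (f x) * wt (-t / 2) x" and ?G = "\<lambda>x. cmod (g x) * wt (t / 2) x"
  have "(?F x) * (?G x) = cmod (f x) * cmod (g x)" for x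
    by (simp add: wt_def exp_add[symmetric] mult.assoc mult.left_commute)
  moreover have "(?F x)\<^sup>2 = (cmod (f x))\<^sup>2 * wt (-t) x" "(?G x)\<^sup>2 = (cmod (g x))\<^sup>2 * wt t x" for x
    by (simp_all only: power_mult_distrib wt_half)
  moreover have "integral\<^sup>L lborel (\<lambda>x. ?F x * ?G x) \<le> sqrt (integral\<^sup>L lborel (\<lambda>x. (?F x)\<^sup>2)) * sqrt (integral\<^sup>L lborel (\<lambda>x. (?G x)\<^sup>2))"
  proof (rule Cauchy_Schwarz_integral(2))
    show "integrable lborel (\<lambda>x. (?F x)\<^sup>2)" "integrable lborel (\<lambda>x. (?G x)\<^sup>2)"
      using integrable_sq_wt[OF f, of "-t"] integrable_sq_wt[OF g, of t] by (simp_all only: power_mult_distrib wt_half)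
  qed (auto simp: less_imp_le[OF wt_pos])
  ultimately show ?thesis by (simp only: NN_def)
qed

lemma NN_triangle:
  assumes f: "test f" and g: "test g"
  shows "NN t (\<lambda>x. f x + g x) \<le> NN t f + NN t g"
proof -
  note [measurable] = test_measurable[OF f] test_measurable[OF g]
  let ?F = "\<lambda>x. cmod (f x) * wt (t / 2) x" and ?G = "\<lambda>x. cmod (g x) * wt (t / 2) x"
  have FG: "(?F x)\<^sup>2 = (cmod (f x))\<^sup>2 * wt t x" "(?G x)\<^sup>2 = (cmod (g x))\<^sup>2 * wt t x" for x
    by (simp_all only: power_mult_distrib wt_half)
  have i: "integrable lborel (\<lambda>x. (?F x)\<^sup>2)" "integrable lborel (\<lambda>x. (?G x)\<^sup>2)"
    using integrable_sq_wt[OF f, of t] integrable_sq_wt[OF g, of t] by (simp_all only: FG)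
  have m: "integrable lborel (\<lambda>x. ?F x * ?G x)" 
       "integral\<^sup>L lborel (\<lambda>x. ?F x * ?G x) \<le> sqrt (integral\<^sup>L lborel (\<lambda>x. (?F x)\<^sup>2)) * sqrt (integral\<^sup>L lborel (\<lambda>x. (?G x)\<^sup>2))"
    by (rule Cauchy_Schwarz_integral[OF _ _ _ _ i]; simp add: less_imp_le[OF wt_pos])+
  have "(NN t (\<lambda>x. f x + g x))\<^sup>2 \<le> integral\<^sup>L lborel (\<lambda>x. (?F x)\<^sup>2 + 2 * (?F x * ?G x) + (?G x)\<^sup>2)"
    unfolding NN_square
  proof (rule integral_mono)
    show "integrable lborel (\<lambda>x. (cmod (f x + g x))\<^sup>2 * wt t x)" by (rule integrable_sq_wt[OF test_add[OF f g]])
    show "integrable lborel (\<lambda>x. (?F x)\<^sup>2 + 2 * (?F x * ?G x) + (?G x)\<^sup>2)"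
      using i m(1) by (intro Bochner_Integration.integrable_add integrable_mult_right)
    fix x
    have "(cmod (f x + g x))\<^sup>2 * wt t x \<le> (cmod (f x) + cmod (g x))\<^sup>2 * wt t x"
      by (intro mult_right_mono power_mono norm_triangle_ineq) (auto simp: less_imp_le[OF wt_pos])
    also have "\<dots> = (?F x)\<^sup>2 + 2 * (?F x * ?G x) + (?G x)\<^sup>2"
      unfolding FG wt_half(1)[of t x, symmetric] by (simp add: power2_eq_square algebra_simps)
    finally show "(cmod (f x + g x))\<^sup>2 * wt t x \<le> (?F x)\<^sup>2 + 2 * (?F x * ?G x) + (?G x)\<^sup>2" .
  qed
  also have "\<dots> = (NN t f)\<^sup>2 + 2 * integral\<^sup>L lborel (\<lambda>x. ?F x * ?G x) + (NN t g)\<^sup>2"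
    unfolding NN_square FG[symmetric]
    using i m(1) by (simp only: Bochner_Integration.integral_add[OF Bochner_Integration.integrable_add[OF i(1) integrable_mult_right[OF m(1)]] i(2)]
        Bochner_Integration.integral_add[OF i(1) integrable_mult_right[OF m(1)]] integral_mult_right_zero)
  also have "\<dots> \<le> (NN t f)\<^sup>2 + 2 * (NN t f * NN t g) + (NN t g)\<^sup>2"
    using m(2) unfolding FG NN_def[symmetric] by simp
  also have "\<dots> = (NN t f + NN t g)\<^sup>2" by (simp add: power2_eq_square algebra_simps)
  finally show ?thesis by (rule power2_le_imp_le) (simp add: NN_nonneg)
qed

lemma NN_cmult: "NN t (\<lambda>x. c * f x) = cmod c * NN t f"
proof -
  have "(\<lambda>x. (cmod (c * f x))\<^sup>2 * wt t x) = (\<lambda>x. (cmod c)\<^sup>2 * ((cmod (f x))\<^sup>2 * wt t x))"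
    by (auto simp: norm_mult power_mult_distrib)
  then show ?thesis by (simp add: NN_def real_sqrt_mult)
qed

lemma NN_bound:
  fixes f :: "real ^ 'n::finite \<Rightarrow> complex"
  assumes f: "test f" and A: "\<And>x. cmod (f x) \<le> A" and R: "\<And>x. norm x > R \<Longrightarrow> f x = 0" and t: "t \<ge> 0" and "R \<ge> 0"
  shows "NN t f \<le> A * exp (t * R\<^sup>2 / 2) * sqrt (measure lborel (cball 0 R :: (real ^ 'n) set))"
proof -
  have A0: "A \<ge> 0" using order_trans[OF norm_ge_zero A[of 0]] .
  have iB: "integrable lborel (\<lambda>x::real^'n. indicator (cball 0 R) x *\<^sub>R (A\<^sup>2 * exp (t * R\<^sup>2)))"
    by (intro borel_integrable_compact continuous_intros) auto
  have "(NN t f)\<^sup>2 \<le> integral\<^sup>L lborel (\<lambda>x::real^'n. indicator (cball 0 R) x *\<^sub>R (A\<^sup>2 * exp (t * R\<^sup>2)))"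
    unfolding NN_square
  proof (rule integral_mono[OF integrable_sq_wt[OF f] iB])
    fix x :: "real ^ 'n"
    show "(cmod (f x))\<^sup>2 * wt t x \<le> indicator (cball 0 R) x *\<^sub>R (A\<^sup>2 * exp (t * R\<^sup>2))"
    proof (cases "norm x \<le> R")
      case True
      then have "wt t x \<le> exp (t * R\<^sup>2)" using t by (simp add: wt_def mult_left_mono power_mono)
      then have "(cmod (f x))\<^sup>2 * wt t x \<le> A\<^sup>2 * exp (t * R\<^sup>2)"
        using A[of x] by (intro mult_mono power_mono) (auto simp: less_imp_le[OF wt_pos])
      with True show ?thesis by simp
    qed (use R in simp)
  qed
  also have "\<dots> = measure lborel (cball 0 R :: (real^'n) set) * (A\<^sup>2 * exp (t * R\<^sup>2))"
    by (simp add: integral_indicator[unfolded real_scaleR_def] emeasure_lborel_cball_finite)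
  also have "\<dots> = (A * exp (t * R\<^sup>2 / 2) * sqrt (measure lborel (cball 0 R :: (real ^ 'n) set)))\<^sup>2"
    by (simp add: power_mult_distrib exp_double[symmetric])
  finally show ?thesis
    by (rule power2_le_imp_le) (simp add: A0)
qed

section \<open>Pointwise bounds by weighted norms of derivatives\<close>

definition ix :: "real ^ 'n::finite \<Rightarrow> 'n" where "ix b = (SOME j. b = axis j 1)"

lemma ix: "b \<in> Basis \<Longrightarrow> b = axis (ix b) 1"
proof -
  assume "b \<in> Basis"
  then have "\<exists>j. b = axis j 1" by (auto simp: Basis_vec_def)
  then show ?thesis unfolding ix_def by (rule someI_ex)
qed

lemma sobolev_one:
  fixes f :: "real ^ 'n::finite \<Rightarrow> complex"
  assumes f: "test f" and b: "b \<in> Basis"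
  shows "ennreal (cmod (f x)) \<le> (\<integral>\<^sup>+r. ennreal (cmod (partial (ix b) f (x + (r - x \<bullet> b) *\<^sub>R b))) \<partial>lborel)"
proof -
  obtain R where R: "R > 0" "\<And>x. norm x > R \<Longrightarrow> f x = 0" using test_cball[OF f] by blast
  let ?g = "\<lambda>r. f (x + (r - x \<bullet> b) *\<^sub>R b)" and ?g' = "\<lambda>r. partial (ix b) f (x + (r - x \<bullet> b) *\<^sub>R b)"
  \<comment> \<open>A starting point on the line that is not beyond \<open>x\<close> and lies
    outside the ball carrying \<open>f\<close>.\<close>
  define a where "a = min (- R - 1) (x \<bullet> b)"
  have ab: "a \<le> x \<bullet> b" by (simp add: a_def)
  have ga: "?g a = 0"
  proof (rule R(2))
    have "(x + (a - x \<bullet> b) *\<^sub>R b) \<bullet> b = a" using b by (simp add: inner_simps)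
    then have "\<bar>a\<bar> \<le> norm (x + (a - x \<bullet> b) *\<^sub>R b)" using Basis_le_norm[OF b] by metis
    then show "R < norm (x + (a - x \<bullet> b) *\<^sub>R b)" using R(1) by (simp add: a_def)
  qed
  have d: "(?g has_vector_derivative ?g' r) (at r within {a..x \<bullet> b})" for r
  proof -
    have 1: "((\<lambda>r. x + (r - x \<bullet> b) *\<^sub>R b) has_vector_derivative b) (at r)"
      by (auto intro!: derivative_eq_intros)
    have "((f \<circ> (\<lambda>r. x + (r - x \<bullet> b) *\<^sub>R b)) has_vector_derivative (\<Sum>k\<in>UNIV. (b $ k) *\<^sub>R partial k f (x + (r - x \<bullet> b) *\<^sub>R b))) (at r)"
      by (rule vector_derivative_diff_chain_within[OF 1])
         (rule has_derivative_at_withinI[OF has_derivative_partial[OF smooth_differentiable[OF test_smooth[OF f]]]])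
    moreover have "(\<Sum>k\<in>UNIV. (b $ k) *\<^sub>R partial k f (x + (r - x \<bullet> b) *\<^sub>R b)) = ?g' r"
      by (subst (1) ix[OF b]) (rule sum_axis)
    ultimately show ?thesis by (simp add: o_def has_vector_derivative_at_within)
  qed
  have c: "continuous_on S ?g'" for S
    by (rule continuous_on_compose2[OF test_continuous[OF test_partial[OF f], of UNIV]]) (auto intro!: continuous_intros)
  have B: "has_bochner_integral lborel (\<lambda>r. indicator {a..x \<bullet> b} r *\<^sub>R ?g' r) (?g (x \<bullet> b) - ?g a)"
    by (rule has_bochner_integral_FTC_Icc[OF ab d c])
  then have "f x = integral\<^sup>L lborel (\<lambda>r. indicator {a..x \<bullet> b} r *\<^sub>R ?g' r)"
    unfolding ga by (simp add: has_bochner_integral_integral_eq)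
  then have "ennreal (cmod (f x)) = ennreal (cmod (integral\<^sup>L lborel (\<lambda>r. indicator {a..x \<bullet> b} r *\<^sub>R ?g' r)))" by simp
  also have "\<dots> \<le> (\<integral>\<^sup>+r. ennreal (norm (indicator {a..x \<bullet> b} r *\<^sub>R ?g' r)) \<partial>lborel)"
    by (rule integral_norm_bound_ennreal) (rule has_bochner_integral_iff[THEN iffD1, THEN conjunct1, OF B])
  also have "\<dots> \<le> (\<integral>\<^sup>+r. ennreal (cmod (?g' r)) \<partial>lborel)"
    by (intro nn_integral_mono ennreal_leI) (auto simp: indicator_def)
  finally show ?thesis .
qed

text \<open>\<open>rp S x y\<close> replaces the coordinates of \<open>x\<close> in \<open>S\<close>
  by those of \<open>y\<close>. Adding a basis vector to \<open>S\<close> applies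
  \<open>sobolev_one\<close> in its direction, so \<open>\<alpha>\<close> ends up with one
  derivative per coordinate.\<close>

lemma sobolev_nn:
  obtains \<alpha> :: "'n::finite multiindex" where "\<And>f x. test f \<Longrightarrow> ennreal (cmod (f x)) \<le> (\<integral>\<^sup>+y. ennreal (cmod (pd \<alpha> f y)) \<partial>lborel)"
proof -
  define rp where "rp S x y = (\<Sum>b\<in>Basis. (if b \<in> S then y b else x \<bullet> b) *\<^sub>R b)" for S and x :: "real ^ 'n" and y
  interpret product_sigma_finite "\<lambda>_::real^'n. lborel :: real measure" by standard
  have rpm: "(\<lambda>y. rp S x y) \<in> borel_measurable (Pi\<^sub>M S (\<lambda>_. lborel))" if "S \<subseteq> Basis" for S x
  proof -
    have "(\<lambda>y. (if b \<in> S then y b else x \<bullet> b) *\<^sub>R b) \<in> borel_measurable (Pi\<^sub>M S (\<lambda>_. lborel))" for b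
      by (cases "b \<in> S") (auto intro!: borel_measurable_scaleR measurable_component_singleton[of b S "\<lambda>_. lborel", simplified])
    then show ?thesis unfolding rp_def by (intro borel_measurable_sum)
  qed
  have claim: "\<exists>\<alpha>. \<forall>f x. test f \<longrightarrow> ennreal (cmod (f x)) \<le> (\<integral>\<^sup>+y. ennreal (cmod (pd \<alpha> f (rp S x y))) \<partial>Pi\<^sub>M S (\<lambda>_. lborel))"
    if "finite S" "S \<subseteq> Basis" for S
    using that
  proof (induction S)
    case empty
    have "rp {} x y = x" for x y by (simp add: rp_def euclidean_representation)
    then show ?case by (intro exI[of _ 0]) (simp add: PiM_empty nn_integral_count_space_finite)
  next
    case (insert b S)
    then obtain \<alpha> where \<alpha>: "\<And>f x. test f \<Longrightarrow> ennreal (cmod (f x)) \<le> (\<integral>\<^sup>+y. ennreal (cmod (pd \<alpha> f (rp S x y))) \<partial>Pi\<^sub>M S (\<lambda>_. lborel))"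
      by auto
    have b: "b \<in> Basis" "b \<notin> S" using insert by auto
    show ?case
    proof (intro exI[of _ "\<alpha> + ei (ix b)"] allI impI)
      fix f :: "real ^ 'n \<Rightarrow> complex" and x assume f: "test f"
      have rpb: "rp S x y + (r - rp S x y \<bullet> b) *\<^sub>R b = rp (insert b S) x (y(b := r))" for y r
      proof (rule euclidean_eqI)
        fix c :: "real ^ 'n" assume c: "c \<in> Basis"
        have i: "rp S x y \<bullet> c = (if c \<in> S then y c else x \<bullet> c)" if "c \<in> Basis" for c S y
          unfolding rp_def using that by (simp add: inner_sum_left_Basis)
        show "(rp S x y + (r - rp S x y \<bullet> b) *\<^sub>R b) \<bullet> c = rp (insert b S) x (y(b := r)) \<bullet> c"
          using b c by (auto simp: inner_add_left i inner_Basis)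
      qed
      have meas: "(\<lambda>y. ennreal (cmod (pd (\<alpha> + ei (ix b)) f (rp (insert b S) x y)))) \<in> borel_measurable (Pi\<^sub>M (insert b S) (\<lambda>_. lborel))"
      proof -
        have sub: "insert b S \<subseteq> Basis" using insert by simp
        have G: "(\<lambda>z. ennreal (cmod (pd (\<alpha> + ei (ix b)) f z))) \<in> borel_measurable borel"
          using test_measurable[OF test_pd[OF f, of "\<alpha> + ei (ix b)"]] by measurable
        show ?thesis by (rule measurable_compose[OF rpm[OF sub] G])
      qed
      have "ennreal (cmod (f x)) \<le> (\<integral>\<^sup>+y. ennreal (cmod (pd \<alpha> f (rp S x y))) \<partial>Pi\<^sub>M S (\<lambda>_. lborel))" by (rule \<alpha>[OF f])
      also have "\<dots> \<le> (\<integral>\<^sup>+y. \<integral>\<^sup>+r. ennreal (cmod (partial (ix b) (pd \<alpha> f) (rp S x y + (r - rp S x y \<bullet> b) *\<^sub>R b))) \<partial>lborel \<partial>Pi\<^sub>M S (\<lambda>_. lborel))"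
        by (intro nn_integral_mono sobolev_one test_pd f b)
      also have "\<dots> = (\<integral>\<^sup>+y. \<integral>\<^sup>+r. ennreal (cmod (pd (\<alpha> + ei (ix b)) f (rp (insert b S) x (y(b := r))))) \<partial>lborel \<partial>Pi\<^sub>M S (\<lambda>_. lborel))"
        by (simp only: rpb pd_Suc[OF test_smooth[OF f]])
      also have "\<dots> = (\<integral>\<^sup>+y. ennreal (cmod (pd (\<alpha> + ei (ix b)) f (rp (insert b S) x y))) \<partial>Pi\<^sub>M (insert b S) (\<lambda>_. lborel))"
        by (rule product_nn_integral_insert[OF insert(1) b(2) meas, symmetric])
      finally show "ennreal (cmod (f x)) \<le> (\<integral>\<^sup>+y. ennreal (cmod (pd (\<alpha> + ei (ix b)) f (rp (insert b S) x y))) \<partial>Pi\<^sub>M (insert b S) (\<lambda>_. lborel))" .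
    qed
  qed
  from claim[OF finite_Basis order_refl] obtain \<alpha> where 
    \<alpha>: "\<And>f x. test f \<Longrightarrow> ennreal (cmod (f x)) \<le> (\<integral>\<^sup>+y. ennreal (cmod (pd \<alpha> f (rp Basis x y))) \<partial>Pi\<^sub>M Basis (\<lambda>_. lborel))" by blast
  show ?thesis
  proof (rule that[of \<alpha>])
    fix f :: "real ^ 'n \<Rightarrow> complex" and x assume f: "test f"
    have "rp Basis x = (\<lambda>y. \<Sum>b\<in>Basis. y b *\<^sub>R b)" by (auto simp: rp_def)
    then have "ennreal (cmod (f x)) \<le> (\<integral>\<^sup>+y. ennreal (cmod (pd \<alpha> f (\<Sum>b\<in>Basis. y b *\<^sub>R b))) \<partial>Pi\<^sub>M Basis (\<lambda>_. lborel))"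
      using \<alpha>[OF f, of x] by simp
    also have "\<dots> = (\<integral>\<^sup>+z. ennreal (cmod (pd \<alpha> f z)) \<partial>distr (Pi\<^sub>M Basis (\<lambda>_. lborel)) borel (\<lambda>y. \<Sum>b\<in>Basis. y b *\<^sub>R b))"
    proof -
      have T: "(\<lambda>y. \<Sum>b\<in>Basis. y b *\<^sub>R b :: real ^ 'n) \<in> Pi\<^sub>M Basis (\<lambda>_. lborel) \<rightarrow>\<^sub>M borel"
        using rpm[of Basis x] by (simp add: \<open>rp Basis x = _\<close>)
      have G: "(\<lambda>z. ennreal (cmod (pd \<alpha> f z))) \<in> borel_measurable borel"
        using test_measurable[OF test_pd[OF f, of \<alpha>]] by measurable
      show ?thesis by (subst nn_integral_distr) (use T G in auto)
    qed
    also have "\<dots> = (\<integral>\<^sup>+y. ennreal (cmod (pd \<alpha> f y)) \<partial>lborel)" by (simp add: lborel_eq[symmetric])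
    finally show "ennreal (cmod (f x)) \<le> (\<integral>\<^sup>+y. ennreal (cmod (pd \<alpha> f y)) \<partial>lborel)" .
  qed
qed

text \<open>Comparison with 1/(1 + x^2), whose integral over a half-line is given by the
  arctangent.\<close>

lemma integrable_gauss_real: "(\<integral>\<^sup>+x. ennreal (exp (- x\<^sup>2)) \<partial>lborel) < \<infinity>"
proof -
  let ?h = "\<lambda>x::real. 1 / (1 + x\<^sup>2)"
  have le: "exp (- x\<^sup>2) \<le> ?h x" for x :: real
  proof -
    have "1 + x\<^sup>2 \<le> exp (x\<^sup>2)" by (rule exp_ge_add_one_self)
    moreover have "1 + x\<^sup>2 > 0" by (simp add: add_pos_nonneg)
    ultimately show ?thesis by (simp add: exp_minus divide_inverse le_imp_inverse_le)
  qed
  have h: "(\<integral>\<^sup>+x. ennreal (?h x) * indicator {0..} x \<partial>lborel) = ennreal (pi/2 - arctan 0)"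
  proof (rule nn_integral_FTC_atLeast)
    show "DERIV arctan x :> ?h x" for x by (auto intro!: derivative_eq_intros simp: divide_inverse)
  qed (auto intro: tendsto_arctan_at_top add_nonneg_nonneg)
  have "(\<integral>\<^sup>+x. ennreal (exp (- x\<^sup>2)) \<partial>lborel) \<le> (\<integral>\<^sup>+x. ennreal (?h x) * indicator {0..} x + ennreal (?h x) * indicator {..0} x \<partial>lborel)"
    by (intro nn_integral_mono) (use le in \<open>auto simp: indicator_def intro: ennreal_leI\<close>)
  also have "\<dots> = (\<integral>\<^sup>+x. ennreal (?h x) * indicator {0..} x \<partial>lborel) + (\<integral>\<^sup>+x. ennreal (?h x) * indicator {..0} x \<partial>lborel)"
    by (rule nn_integral_add) auto
  also have "(\<integral>\<^sup>+x. ennreal (?h x) * indicator {..0} x \<partial>lborel) = (\<integral>\<^sup>+x. ennreal (?h x) * indicator {0..} x \<partial>lborel)"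
    by (subst nn_integral_real_affine[where c="-1" and t=0]) (auto intro!: nn_integral_cong simp: indicator_def)
  finally have "(\<integral>\<^sup>+x. ennreal (exp (- x\<^sup>2)) \<partial>lborel) \<le> ennreal (pi/2 - arctan 0) + ennreal (pi/2 - arctan 0)" 
    unfolding h .
  also have "\<dots> < \<infinity>" by simp
  finally show ?thesis .
qed

lemma integrable_gauss: "integrable lborel (\<lambda>x::real^'n::finite. wt (-1) x)"
proof (rule integrableI_nonneg)
  have "nn_integral lborel (\<lambda>x::real^'n. ennreal (wt (-1) x)) = nn_integral lborel (\<lambda>x::real^'n. \<Prod>b\<in>Basis. ennreal (exp (- (x \<bullet> b)\<^sup>2)))"
  proof (rule nn_integral_cong)
    fix x :: "real ^ 'n"
    have "(norm x)\<^sup>2 = (\<Sum>b\<in>Basis. (x \<bullet> b)\<^sup>2)"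
      unfolding power2_norm_eq_inner by (subst euclidean_inner) (simp add: power2_eq_square)
    then show "ennreal (wt (-1) x) = (\<Prod>b\<in>Basis. ennreal (exp (- (x \<bullet> b)\<^sup>2)))"
      by (simp add: wt_def prod_ennreal exp_sum[symmetric] sum_negf)
  qed
  also have "\<dots> = (\<Prod>b\<in>(Basis::(real^'n) set). (\<integral>\<^sup>+x. ennreal (exp (- x\<^sup>2)) \<partial>lborel))"
    by (rule nn_integral_lborel_prod) auto
  also have "\<dots> < \<infinity>" using integrable_gauss_real by (simp add: power_less_top_ennreal)
  finally show "nn_integral lborel (\<lambda>x::real^'n. ennreal (wt (-1) x)) < \<infinity>" .
qed (auto simp: less_imp_le[OF wt_pos])

text \<open>Cauchy-Schwarz against the integrable Gaussian exp(-|x|^2) turns the integral of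
  \<open>sobolev_nn\<close> into a weighted norm with t = 1.\<close>

lemma sobolev:
  obtains \<alpha> :: "'n::finite multiindex" and C where "C \<ge> 0" "\<And>f x. test f \<Longrightarrow> cmod (f x) \<le> C * NN 1 (pd \<alpha> f)"
proof -
  obtain \<alpha> :: "'n multiindex" where \<alpha>: "\<And>f x. test f \<Longrightarrow> ennreal (cmod (f x)) \<le> (\<integral>\<^sup>+y. ennreal (cmod (pd \<alpha> f y)) \<partial>lborel)"
    using sobolev_nn by blast
  show ?thesis
  proof (rule that[of "sqrt (integral\<^sup>L lborel (\<lambda>x::real^'n. wt (-1) x))" \<alpha>])
    fix f :: "real ^ 'n \<Rightarrow> complex" and x assume f: "test f"
    let ?F = "\<lambda>x. cmod (pd \<alpha> f x) * wt (1/2) x"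
    note [measurable] = test_measurable[OF test_pd[OF f, of \<alpha>]]
    have "(\<lambda>x. wt (-1/2) x * ?F x) = (\<lambda>x. cmod (pd \<alpha> f x))"
      by (auto simp: wt_def exp_minus)
    moreover have "(wt (-1/2) x)\<^sup>2 = wt (-1) x" "(?F x)\<^sup>2 = (cmod (pd \<alpha> f x))\<^sup>2 * wt 1 x" for x
      by (simp_all only: power_mult_distrib wt_half)
    moreover have "integral\<^sup>L lborel (\<lambda>x. wt (-1/2) x * ?F x) \<le> sqrt (integral\<^sup>L lborel (\<lambda>x::real^'n. (wt (-1/2) x :: real)\<^sup>2)) * sqrt (integral\<^sup>L lborel (\<lambda>x. (?F x)\<^sup>2))"
    proof (rule Cauchy_Schwarz_integral(2))
      show "integrable lborel (\<lambda>x. (?F x)\<^sup>2)"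
        using integrable_sq_wt[OF test_pd[OF f], of \<alpha> 1] by (simp only: power_mult_distrib wt_half)
      show "integrable lborel (\<lambda>x::real^'n. (wt (-1/2) x)\<^sup>2)"
        using integrable_gauss by (simp only: wt_half)
    qed (auto simp: less_imp_le[OF wt_pos])
    ultimately have "integral\<^sup>L lborel (\<lambda>x. cmod (pd \<alpha> f x)) \<le> sqrt (integral\<^sup>L lborel (\<lambda>x::real^'n. wt (-1) x)) * NN 1 (pd \<alpha> f)"
      by (simp only: NN_def)
    moreover have "ennreal (cmod (f x)) \<le> ennreal (integral\<^sup>L lborel (\<lambda>x. cmod (pd \<alpha> f x)))"
      using \<alpha>[OF f, of x] test_integrable[OF test_pd[OF f]] by (simp add: nn_integral_eq_integral)
    then have "cmod (f x) \<le> integral\<^sup>L lborel (\<lambda>x. cmod (pd \<alpha> f x))"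
      by (subst (asm) ennreal_le_iff) simp_all
    ultimately show "cmod (f x) \<le> sqrt (integral\<^sup>L lborel (\<lambda>x::real^'n. wt (-1) x)) * NN 1 (pd \<alpha> f)" by linarith
  qed (simp add: less_imp_le[OF wt_pos])
qed

section \<open>Convolution of distributions with test functions\<close>

lemma first_order_remainder:
  fixes G :: "real ^ 'n::finite \<Rightarrow> complex" and M :: real
  assumes G: "smooth G" and M: "\<And>\<gamma> w. mi_abs \<gamma> \<le> 2 \<Longrightarrow> cmod (pd \<gamma> G w) \<le> M"
  shows "cmod (G (z + h) - G z - (\<Sum>j\<in>UNIV. of_real (h $ j) * partial j G z)) \<le> CARD('n) * (CARD('n) * M) * (norm h)\<^sup>2"
proof -
  let ?L = "\<lambda>w. \<Sum>j\<in>UNIV. partial j G z * cvec (w - z) $ j"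
  let ?F = "\<lambda>w. G w - ?L w"
  have M0: "M \<ge> 0" using order_trans[OF norm_ge_zero M[of 0]] by simp
  have sL: "smooth ?L" by (intro smooth_sum smooth_cmult smooth_coord_diff)
  have pL: "partial k ?L = (\<lambda>w. partial k G z)" for k
  proof -
    have "partial k ?L = (\<lambda>w. \<Sum>j\<in>UNIV. partial j G z * (if j = k then 1 else 0))"
      by (subst partial_sum) (simp_all add: smooth_cmult smooth_coord_diff partial_cmult smooth_differentiable partial_coord_diff)
    then show ?thesis by (simp add: if_distrib cong: if_cong)
  qed
  have pF: "partial k ?F = (\<lambda>w. partial k G w - partial k G z)" for k
    using pd_minus[OF G sL, of "ei k"] by (simp add: pd_ei G sL smooth_minus pL)
  have "cmod (?F (z + h) - ?F z) \<le> CARD('n) * (CARD('n) * M * norm h) * norm (z + h - z)"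
  proof (rule mean_value_partial[where S="cball z (norm h)"])
    show "smooth ?F" by (rule smooth_minus[OF G sL])
    fix w k assume w: "w \<in> cball z (norm h)"
    have "cmod (partial k G w - partial k G z) \<le> CARD('n) * M * norm (w - z)"
    proof (rule mean_value_partial[OF smooth_partial[OF G], of UNIV])
      show "cmod (partial j (partial k G) v) \<le> M" for j v
        using M[of "ei k + ei j" v] by (simp add: pd_Suc[OF G] pd_ei[OF G])
    qed auto
    also have "\<dots> \<le> CARD('n) * M * norm h"
      by (rule mult_left_mono) (use w M0 in \<open>auto simp: dist_norm norm_minus_commute\<close>)
    finally show "cmod (partial k ?F w) \<le> CARD('n) * M * norm h" by (simp add: pF)
  qed (auto simp: dist_norm)
  moreover have "?F (z + h) - ?F z = G (z + h) - G z - (\<Sum>j\<in>UNIV. of_real (h $ j) * partial j G z)"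
    by (simp add: cvec_def algebra_simps)
  ultimately have "cmod (G (z + h) - G z - (\<Sum>j\<in>UNIV. of_real (h $ j) * partial j G z)) 
      \<le> CARD('n) * (CARD('n) * M * norm h) * norm (z + h - z)" by (simp only:)
  then show ?thesis by (simp add: power2_eq_square mult.assoc mult.left_commute)
qed

lemma test_pd_cball: 
  assumes "test \<phi>" obtains R where "R > 0" "\<And>\<alpha> x. norm x > R \<Longrightarrow> pd \<alpha> \<phi> x = 0"
proof -
  have "bounded (fun_support \<phi>)" using test_compact[OF assms] by (rule compact_imp_bounded)
  then obtain R where R: "R > 0" "\<And>x. x \<in> fun_support \<phi> \<Longrightarrow> norm x \<le> R" by (auto simp: bounded_pos)
  show ?thesis by (rule that[OF R(1)], rule pd_outside_support[OF test_smooth[OF assms]]) (use R(2) in force)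
qed

definition conv :: "'n::finite functional \<Rightarrow> (real ^ 'n \<Rightarrow> complex) \<Rightarrow> real ^ 'n \<Rightarrow> complex" where
  "conv u \<phi> x = u (\<lambda>y. \<phi> (x - y))"

text \<open>For |h| <= 1 the first order remainder of the reflected translates is supported in a
  fixed ball, on which \<open>u\<close> is bounded by derivatives of order \<open>N\<close>. Those
  derivatives of the remainder are of size |h|^2, which is why \<open>\<phi>\<close> is bounded up
  to order N + 2.\<close>

lemma conv_has_derivative:
  fixes u :: "'n::finite functional"
  assumes u: "distribution u" and \<phi>: "test \<phi>"
  shows "(conv u \<phi> has_derivative (\<lambda>h. \<Sum>j\<in>UNIV. of_real (h $ j) * conv u (partial j \<phi>) x)) (at x)"
proof -
  obtain R where R: "R > 0" "\<And>\<alpha> x. norm x > R \<Longrightarrow> pd \<alpha> \<phi> x = 0" using test_pd_cball[OF \<phi>] by blast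
  obtain C N where C: "C \<ge> 0" "\<And>\<psi> A. test \<psi> \<Longrightarrow> fun_support \<psi> \<subseteq> cball 0 (norm x + 1 + R) \<Longrightarrow> bd N A \<psi> \<Longrightarrow> cmod (u \<psi>) \<le> C * A"
    using distribution_bd[OF u compact_cball] by blast
  obtain M where M: "M \<ge> 0" "bd (N + 2) M \<phi>" using test_bd[OF \<phi>] by blast
  let ?K = "CARD('n) * (CARD('n) * M)"
  have s\<phi>: "smooth \<phi>" by (rule test_smooth[OF \<phi>])
  let ?L = "\<lambda>h. \<Sum>j\<in>UNIV. of_real (h $ j) * conv u (partial j \<phi>) x"
  have key: "cmod (conv u \<phi> (x + h) - conv u \<phi> x - ?L h) \<le> C * ?K * (norm h)\<^sup>2" if h: "norm h \<le> 1" for h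
  proof -
    let ?\<psi> = "\<lambda>y. \<phi> (x + h - y) - \<phi> (x - y) - (\<Sum>j\<in>UNIV. of_real (h $ j) * partial j \<phi> (x - y))"
    have t1: "test (\<lambda>y. \<phi> (x + h - y))" and t2: "test (\<lambda>y. \<phi> (x - y))" by (rule test_reflect[OF \<phi>])+
    have t3: "test (\<lambda>y. of_real (h $ j) * partial j \<phi> (x - y))" for j
      by (intro test_cmult test_reflect test_partial \<phi>)
    have t4: "test (\<lambda>y. \<Sum>j\<in>UNIV. of_real (h $ j) * partial j \<phi> (x - y))" by (rule test_sum[OF t3])
    have t: "test ?\<psi>" by (intro test_minus t1 t2 t4)
    have "u (\<lambda>y. \<Sum>j\<in>UNIV. of_real (h $ j) * partial j \<phi> (x - y)) = (\<Sum>j\<in>UNIV. u (\<lambda>y. of_real (h $ j) * partial j \<phi> (x - y)))"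
      by (rule distribution_sum[OF u t3])
    also have "\<dots> = ?L h"
      unfolding conv_def by (intro sum.cong refl distribution_cmult[OF u] test_reflect test_partial \<phi>)
    finally have "u ?\<psi> = conv u \<phi> (x + h) - conv u \<phi> x - ?L h"
      unfolding distribution_minus[OF u test_minus[OF t1 t2] t4] distribution_minus[OF u t1 t2] by (simp only: conv_def)
    moreover have "cmod (u ?\<psi>) \<le> C * (?K * (norm h)\<^sup>2)"
    proof (rule C(2)[OF t])
      show "fun_support ?\<psi> \<subseteq> cball 0 (norm x + 1 + R)"
      proof (rule fun_support_subset)
        fix y :: "real ^ 'n" assume "y \<notin> cball 0 (norm x + 1 + R)"
        then have y: "norm y > norm x + 1 + R" by simp
        have "norm (x - y) > R" using y norm_triangle_ineq2[of y x] by (simp add: norm_minus_commute)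
        moreover have "norm (x + h - y) > R" 
          using y norm_triangle_ineq2[of y "x + h"] norm_triangle_ineq[of x h] h by (simp add: norm_minus_commute)
        moreover have "partial j \<phi> (x - y) = 0" if "norm (x - y) > R" for j
          using R(2)[OF that, of "ei j"] by (simp add: pd_ei s\<phi>)
        ultimately show "?\<psi> y = 0" using R(2)[of _ 0] by simp
      qed simp
      show "bd N (?K * (norm h)\<^sup>2) ?\<psi>"
        unfolding bd_def
      proof (intro allI impI)
        fix \<alpha> :: "'n multiindex" and y assume \<alpha>: "mi_abs \<alpha> \<le> N"
        let ?G = "pd \<alpha> \<phi>"
        have "pd \<alpha> ?\<psi> y = pd \<alpha> (\<lambda>y. \<phi> (x + h - y)) y - pd \<alpha> (\<lambda>y. \<phi> (x - y)) y - 
            (\<Sum>j\<in>UNIV. pd \<alpha> (\<lambda>y. of_real (h $ j) * partial j \<phi> (x - y)) y)"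
          unfolding pd_minus[OF test_smooth[OF test_minus[OF t1 t2]] test_smooth[OF t4]] pd_minus[OF test_smooth[OF t1] test_smooth[OF t2]]
          by (subst pd_sum) (simp_all only: test_smooth[OF t3])
        also have "\<dots> = (-1) ^ mi_abs \<alpha> * (?G (x - y + h) - ?G (x - y) - (\<Sum>j\<in>UNIV. of_real (h $ j) * partial j ?G (x - y)))"
        proof -
          have "pd \<alpha> (\<lambda>y. of_real (h $ j) * partial j \<phi> (x - y)) y = (-1) ^ mi_abs \<alpha> * (of_real (h $ j) * partial j ?G (x - y))" for j
            by (simp add: pd_cmult smooth_reflect smooth_partial s\<phi> pd_reflect pd_Suc'[OF s\<phi>, symmetric] pd_Suc[OF s\<phi>])
          moreover have "pd \<alpha> (\<lambda>y. \<phi> (x + h - y)) y = (-1) ^ mi_abs \<alpha> * ?G (x - y + h)"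
            by (simp only: pd_reflect[OF s\<phi>]) (simp add: algebra_simps)
          ultimately show ?thesis by (simp add: pd_reflect s\<phi> sum_distrib_left right_diff_distrib)
        qed
        finally have "cmod (pd \<alpha> ?\<psi> y) = cmod (?G (x - y + h) - ?G (x - y) - (\<Sum>j\<in>UNIV. of_real (h $ j) * partial j ?G (x - y)))"
          by (simp add: norm_mult norm_power)
        also have "\<dots> \<le> ?K * (norm h)\<^sup>2"
        proof (rule first_order_remainder[OF smooth_pd[OF s\<phi>]])
          show "cmod (pd \<gamma> ?G w) \<le> M" if "mi_abs \<gamma> \<le> 2" for \<gamma> w
            using bdD[OF M(2), of "\<gamma> + \<alpha>" w] that \<alpha> by (simp add: pd_pd s\<phi>)
        qed
        finally show "cmod (pd \<alpha> ?\<psi> y) \<le> ?K * (norm h)\<^sup>2" .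
      qed
    qed
    ultimately show ?thesis by (simp add: mult.assoc)
  qed
  have "bounded_linear ?L"
    by (intro bounded_linear_sum bounded_linear_mult_left bounded_linear_compose[OF bounded_linear_of_real bounded_linear_vec_nth]
          bounded_linear_compose[OF bounded_linear_mult_left])
  moreover have "\<exists>d>0. \<forall>y. norm (y - x) < d \<longrightarrow> norm (conv u \<phi> y - conv u \<phi> x - ?L (y - x)) \<le> e * norm (y - x)" if e: "e > 0" for e
  proof -
    let ?B = "C * ?K + 1"
    have B: "?B > 0" using C(1) M(1) by (simp add: add_nonneg_pos)
    show ?thesis
    proof (intro exI[of _ "min 1 (e / ?B)"] conjI allI impI)
      fix y assume y: "norm (y - x) < min 1 (e / ?B)"
      have "norm (conv u \<phi> (x + (y - x)) - conv u \<phi> x - ?L (y - x)) \<le> C * ?K * (norm (y - x))\<^sup>2"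
        by (rule key) (use y in simp)
      also have "\<dots> \<le> (?B * norm (y - x)) * norm (y - x)"
        by (simp add: power2_eq_square algebra_simps)
      also have "\<dots> \<le> e * norm (y - x)"
        by (rule mult_right_mono) (use y B in \<open>auto simp: pos_less_divide_eq mult.commute\<close>)
      finally show "norm (conv u \<phi> y - conv u \<phi> x - ?L (y - x)) \<le> e * norm (y - x)" by simp
    qed (use B e in simp)
  qed
  ultimately show ?thesis unfolding has_derivative_at_alt by blast
qed

lemma
  assumes u: "distribution u" and \<phi>: "test \<phi>"
  shows partial_conv: "partial j (conv u \<phi>) = conv u (partial j \<phi>)" and smooth_conv: "smooth (conv u \<phi>)"
proof -
  have p: "partial j (conv u \<phi>) = conv u (partial j \<phi>)" if "test \<phi>" for j \<phi>
  proof
    fix x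
    have "(\<Sum>k\<in>UNIV. complex_of_real (axis j 1 $ k) * conv u (partial k \<phi>) x) = conv u (partial j \<phi>) x"
      using sum_axis[of j "\<lambda>k. conv u (partial k \<phi>) x"] by (simp only: scaleR_conv_of_real)
    then show "partial j (conv u \<phi>) x = conv u (partial j \<phi>) x"
      by (simp only: partial_eq[OF conv_has_derivative[OF u that]])
  qed
  then show "partial j (conv u \<phi>) = conv u (partial j \<phi>)" using \<phi> by blast
  have C: "test \<phi> \<Longrightarrow> Ck n (conv u \<phi>)" for n \<phi>
  proof (induction n arbitrary: \<phi>)
    case 0
    then show ?case using differentiableI[OF conv_has_derivative[OF u 0]] by simp
  next
    case (Suc n)
    then show ?case using differentiableI[OF conv_has_derivative[OF u Suc.prems]] by (simp add: p test_partial)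
  qed
  show "smooth (conv u \<phi>)" using C[OF \<phi>] smooth_iff_Ck by blast
qed

lemma pd_conv:
  assumes u: "distribution u" and \<phi>: "test \<phi>"
  shows "pd \<alpha> (conv u \<phi>) = conv u (pd \<alpha> \<phi>)"
proof (induction \<alpha> rule: mi_induct)
  case (step \<alpha> j)
  then show ?case
    by (simp add: pd_Suc smooth_conv[OF u \<phi>] test_smooth[OF \<phi>] partial_conv[OF u test_pd[OF \<phi>]])
qed simp

section \<open>Fundamental solutions\<close>

lemma smooth_pdo: "smooth \<phi> \<Longrightarrow> smooth (pdo S a \<phi>)"
  unfolding pdo_def by (intro smooth_sum smooth_cmult smooth_pd)

lemma test_pdo: "test \<phi> \<Longrightarrow> test (pdo S a \<phi>)"
  unfolding pdo_def by (intro test_sum test_cmult test_pd)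

lemma pdo_add: "smooth f \<Longrightarrow> smooth g \<Longrightarrow> pdo S a (\<lambda>x. f x + g x) = (\<lambda>x. pdo S a f x + pdo S a g x)"
  by (simp add: pdo_def pd_add sum.distrib algebra_simps)

lemma pdo_cmult: "smooth f \<Longrightarrow> pdo S a (\<lambda>x. c * f x) = (\<lambda>x. c * pdo S a f x)"
  by (simp add: pdo_def pd_cmult sum_distrib_left algebra_simps)

lemma pd_pdo: "smooth \<phi> \<Longrightarrow> pd \<beta> (pdo S a \<phi>) = (\<lambda>x. \<Sum>\<alpha>\<in>S. a \<alpha> * pd (\<beta> + \<alpha>) \<phi> x)"
  unfolding pdo_def by (subst pd_sum) (simp_all add: smooth_cmult smooth_pd pd_cmult pd_pd)

lemma pdo_pd: "smooth \<phi> \<Longrightarrow> pdo S a (pd \<beta> \<phi>) = pd \<beta> (pdo S a \<phi>)"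
  by (simp add: pd_pdo) (simp add: pdo_def pd_pd add.commute)

lemma pdo_cong_open:
  assumes "smooth f" "smooth g" "open U" "x \<in> U" "\<And>x. x \<in> U \<Longrightarrow> f x = g x"
  shows "pdo S a f x = pdo S a g x"
  unfolding pdo_def using pd_cong_open[OF assms] by simp

text \<open>The coefficients of the transposed operator. Reflection of the argument produces the
  same signs as integration by parts, as \<open>pdo_adj_reflect\<close> uses.\<close>

definition adj :: "('n::finite multiindex \<Rightarrow> complex) \<Rightarrow> 'n multiindex \<Rightarrow> complex" where
  "adj a \<alpha> = (-1) ^ mi_abs \<alpha> * a \<alpha>"

lemma pdo_adj_reflect: "smooth \<phi> \<Longrightarrow> pdo S (adj a) (\<lambda>y. \<phi> (x - y)) = (\<lambda>y. pdo S a \<phi> (x - y))"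
proof -
  have "(-1) ^ k * c * ((-1) ^ k * d) = c * d" for c d :: complex and k
    by (simp add: power_mult_distrib[symmetric])
  then show "smooth \<phi> \<Longrightarrow> ?thesis" by (simp only: pdo_def adj_def pd_reflect)
qed

lemma pdo_conv:
  assumes u: "distribution u" and \<phi>: "test \<phi>"
  shows "pdo S a (conv u \<phi>) = conv u (pdo S a \<phi>)" 
    "pdo S a (conv u \<phi>) x = u (pdo S (adj a) (\<lambda>y. \<phi> (x - y)))"
proof -
  have "conv u (pdo S a \<phi>) x = pdo S a (conv u \<phi>) x" for x
    unfolding pdo_def pd_conv[OF u \<phi>] conv_def
    by (subst distribution_sum[OF u]) (auto intro!: test_cmult test_reflect test_pd \<phi> sum.cong distribution_cmult[OF u])
  then show 1: "pdo S a (conv u \<phi>) = conv u (pdo S a \<phi>)" by auto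
  show "pdo S a (conv u \<phi>) x = u (pdo S (adj a) (\<lambda>y. \<phi> (x - y)))"
    unfolding 1 pdo_adj_reflect[OF test_smooth[OF \<phi>]] conv_def ..
qed

interpretation fs: complex_space "\<lambda>c (f :: real ^ 'n::finite \<Rightarrow> complex) x. c * f x"
  by unfold_locales (auto simp: plus_fun_def algebra_simps)

text \<open>By \<open>kp\<close> the value \<open>k f\<close> depends only on
  \<open>pdo S b f\<close> and is dominated by the seminorm \<open>p\<close> there, so the
  Hahn-Banach theorem applies to the graph over the range of the operator. The hypothesis
  \<open>bnd\<close> turns every linear functional below \<open>p\<close> into a
  distribution.\<close>

lemma extend_from_range:
  fixes S :: "'n::finite multiindex set" and k :: "'n functional" and p :: "(real ^ 'n \<Rightarrow> complex) \<Rightarrow> real"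
  assumes padd: "\<And>f g. test f \<Longrightarrow> test g \<Longrightarrow> p (\<lambda>x. f x + g x) \<le> p f + p g"
    and psc: "\<And>c f. test f \<Longrightarrow> p (\<lambda>x. c * f x) = cmod c * p f"
    and kadd: "\<And>f g. test f \<Longrightarrow> test g \<Longrightarrow> k (\<lambda>x. f x + g x) = k f + k g"
    and ksc: "\<And>c f. test f \<Longrightarrow> k (\<lambda>x. c * f x) = c * k f"
    and kp: "\<And>f. test f \<Longrightarrow> cmod (k f) \<le> p (pdo S b f)"
    and bnd: "\<And>R. R > 0 \<Longrightarrow> \<exists>C N. C \<ge> 0 \<and> (\<forall>f A. test f \<longrightarrow> (\<forall>x. norm x > R \<longrightarrow> f x = 0) \<longrightarrow> bd N A f \<longrightarrow> p f \<le> C * A)"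
  obtains L where "distribution L" "\<And>f. test f \<Longrightarrow> L (pdo S b f) = k f" "\<And>f. test f \<Longrightarrow> cmod (L f) \<le> p f"
proof -
  let ?R = "{(pdo S b f, k f) | f. test f}"
  obtain L where L: "\<And>f g. test f \<Longrightarrow> test g \<Longrightarrow> L (f + g) = L f + L g" "\<And>f c. test f \<Longrightarrow> L (\<lambda>x. c * f x) = c * L f"
      "\<And>f a. (f, a) \<in> ?R \<Longrightarrow> L f = a" "\<And>f. test f \<Longrightarrow> cmod (L f) \<le> p f"
  proof (rule fs.hahn_banach[of "test_functions" p ?R])
    show "?R \<noteq> {}" using test_zero by blast
    show "(f + g, a + b') \<in> ?R" if fa: "(f, a) \<in> ?R" and gb: "(g, b') \<in> ?R" for f a g b'
    proof -
      obtain f' where f: "f = pdo S b f'" "a = k f'" "test f'" using fa by blast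
      obtain g' where g: "g = pdo S b g'" "b' = k g'" "test g'" using gb by blast
      have "f + g = pdo S b (\<lambda>x. f' x + g' x)" "a + b' = k (\<lambda>x. f' x + g' x)"
        using f g by (simp_all add: pdo_add test_smooth kadd plus_fun_def)
      then show ?thesis using test_add[OF f(3) g(3)] by blast
    qed
    show "((\<lambda>x. c * f x), c * a) \<in> ?R" if fa: "(f, a) \<in> ?R" for f a c
    proof -
      obtain f' where f: "f = pdo S b f'" "a = k f'" "test f'" using fa by blast
      have "(\<lambda>x. c * f x) = pdo S b (\<lambda>x. c * f' x)" "c * a = k (\<lambda>x. c * f' x)"
        using f by (simp_all add: pdo_cmult test_smooth ksc)
      then show ?thesis using test_cmult[OF f(3)] by blast
    qed
    show "cmod a \<le> p f" if "(f, a) \<in> ?R" for f a using that kp by auto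
    show "test f" if "(f, a) \<in> ?R" for f a using that test_pdo by auto
  qed (auto simp: plus_fun_def intro: test_add test_cmult padd psc)
  show ?thesis
  proof (rule that[of L])
    show "L (pdo S b f) = k f" if "test f" for f using L(3) that by blast
    show "cmod (L f) \<le> p f" if "test f" for f by (rule L(4)[OF that])
    show "distribution L"
    proof (rule distributionI)
      show "L (\<lambda>x. f x + g x) = L f + L g" if "test f" "test g" for f g using L(1)[OF that] by (simp add: plus_fun_def)
      show "L (\<lambda>x. c * f x) = c * L f" if "test f" for c f by (rule L(2)[OF that])
      fix K :: "(real ^ 'n) set" assume "compact K"
      then obtain R where R: "R > 0" "\<And>x. x \<in> K \<Longrightarrow> norm x \<le> R" using compact_imp_bounded bounded_pos by metis
      from bnd[OF R(1)] obtain C N where CN: "C \<ge> 0" "\<And>f A. test f \<Longrightarrow> (\<And>x. norm x > R \<Longrightarrow> f x = 0) \<Longrightarrow> bd N A f \<Longrightarrow> p f \<le> C * A" by blast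
      show "\<exists>C N. C \<ge> 0 \<and> (\<forall>\<phi> A. test \<phi> \<longrightarrow> fun_support \<phi> \<subseteq> K \<longrightarrow> bd N A \<phi> \<longrightarrow> cmod (L \<phi>) \<le> C * A)"
      proof (intro exI conjI allI impI)
        fix \<phi> :: "real ^ 'n \<Rightarrow> complex" and A assume \<phi>: "test \<phi>" "fun_support \<phi> \<subseteq> K" "bd N A \<phi>"
        have "p \<phi> \<le> C * A"
          by (rule CN(2)[OF \<phi>(1) _ \<phi>(3)]) (use R(2) \<phi>(2) not_in_fun_support in force)
        with L(4)[OF \<phi>(1)] show "cmod (L \<phi>) \<le> C * A" by linarith
      qed (rule CN(1))
    qed
  qed
qed

lemma NN_bound_bd:
  assumes t: "t \<ge> 0" and R: "R > 0"
  shows "\<exists>C. C \<ge> 0 \<and> (\<forall>f A. test f \<longrightarrow> (\<forall>x. norm x > R \<longrightarrow> f x = 0) \<longrightarrow> bd (mi_abs \<alpha>) A f \<longrightarrow> NN t (pd \<alpha> f :: real^'n::finite \<Rightarrow> complex) \<le> C * A)"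
proof (intro exI conjI allI impI)
  let ?C = "exp (t * R\<^sup>2 / 2) * sqrt (measure lborel (cball 0 R :: (real ^ 'n) set))"
  show "?C \<ge> 0" by simp
  fix f :: "real ^ 'n \<Rightarrow> complex" and A
  assume f: "test f" and R0: "\<forall>x. norm x > R \<longrightarrow> f x = 0" and A: "bd (mi_abs \<alpha>) A f"
  have "fun_support f \<subseteq> cball 0 R" by (rule fun_support_subset) (use R0 in auto)
  then have "pd \<alpha> f x = 0" if "norm x > R" for x
    using that by (intro pd_outside_support[OF test_smooth[OF f]]) force
  from NN_bound[OF test_pd[OF f] bdD[OF A order_refl] this t] R
  show "NN t (pd \<alpha> f) \<le> ?C * A" by (simp add: algebra_simps)
qed

lemma weighted_inequality_NN:
  fixes S :: "'n::finite multiindex set"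
  assumes S: "finite S" and a0: "\<alpha>0 \<in> S" "a \<alpha>0 \<noteq> 0"
  obtains C where "C \<ge> 0" "\<And>t f. t \<ge> 1/2 \<Longrightarrow> test f \<Longrightarrow> NN t f \<le> C * NN t (pdo S (adj a) f)"
proof -
  have "adj a \<alpha>0 \<noteq> 0" using a0 by (simp add: adj_def)
  from weighted_inequality[where a="adj a", OF S a0(1) this] obtain \<kappa> where \<kappa>: "\<kappa> > 0" 
    "\<And>t f. t \<ge> 1/2 \<Longrightarrow> test f \<Longrightarrow> \<kappa> * Re (BB t f f) \<le> Re (BB t (pdo S (adj a) f) (pdo S (adj a) f))" by metis
  show ?thesis
  proof (rule that[of "1 / sqrt \<kappa>"])
    fix t :: real and f :: "real ^ 'n \<Rightarrow> complex" assume "t \<ge> 1/2" "test f"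
    from real_sqrt_le_mono[OF \<kappa>(2)[OF this]] have "sqrt \<kappa> * NN t f \<le> NN t (pdo S (adj a) f)"
      by (simp add: NN_eq real_sqrt_mult)
    then show "NN t f \<le> 1 / sqrt \<kappa> * NN t (pdo S (adj a) f)" using \<kappa>(1) by (simp add: field_simps)
  qed (use \<kappa> in simp)
qed

text \<open>Evaluation at 0 is bounded by a weighted norm of \<open>pd \<alpha>1 f\<close> through
  the Sobolev inequality. The weighted inequality with t = 1 applies to
  \<open>pd \<alpha>1 f\<close>, because derivatives commute with the operator. Hence
  \<open>f 0\<close> is controlled by the image of \<open>f\<close>, and the extension from the
  range is \<open>E\<close>.\<close>

lemma fundamental_solution:
  fixes S :: "'n::finite multiindex set"
  assumes S: "finite S" and a0: "\<alpha>0 \<in> S" "a \<alpha>0 \<noteq> 0"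
  obtains E where "distribution E" "\<And>\<phi>. test \<phi> \<Longrightarrow> E (pdo S (adj a) \<phi>) = \<phi> 0"
proof -
  obtain \<alpha>1 :: "'n multiindex" and C1 where C1: "C1 \<ge> 0" "\<And>f x. test f \<Longrightarrow> cmod (f x) \<le> C1 * NN 1 (pd \<alpha>1 f)" by (rule sobolev, rule that)
  obtain C2 where C2: "C2 \<ge> 0" "\<And>t f. t \<ge> 1/2 \<Longrightarrow> test f \<Longrightarrow> NN t f \<le> C2 * NN t (pdo S (adj a) f)"
    by (rule weighted_inequality_NN[where a=a, OF S a0], rule that)
  let ?p = "\<lambda>f. C1 * (C2 * NN 1 (pd \<alpha>1 f))"
  show ?thesis
  proof (rule extend_from_range[of ?p "\<lambda>f. f 0" S "adj a"])
    fix f g :: "real ^ 'n \<Rightarrow> complex" and c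
    assume f: "test f"
    show "?p (\<lambda>x. c * f x) = cmod c * ?p f" by (simp add: pd_cmult test_smooth f NN_cmult)
    have "cmod (f 0) \<le> C1 * NN 1 (pd \<alpha>1 f)" by (rule C1(2)[OF f])
    also have "\<dots> \<le> C1 * (C2 * NN 1 (pdo S (adj a) (pd \<alpha>1 f)))"
      by (intro mult_left_mono C2 test_pd f C1) simp
    finally show "cmod (f 0) \<le> ?p (pdo S (adj a) f)" by (simp add: pdo_pd test_smooth f)
    assume g: "test g"
    have "NN 1 (pd \<alpha>1 (\<lambda>x. f x + g x)) \<le> NN 1 (pd \<alpha>1 f) + NN 1 (pd \<alpha>1 g)"
      by (simp add: pd_add test_smooth f g NN_triangle test_pd)
    then have "?p (\<lambda>x. f x + g x) \<le> C1 * (C2 * (NN 1 (pd \<alpha>1 f) + NN 1 (pd \<alpha>1 g)))"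
      by (intro mult_left_mono C1 C2)
    then show "?p (\<lambda>x. f x + g x) \<le> ?p f + ?p g" by (simp add: algebra_simps)
  next
    fix R :: real assume R: "R > 0"
    have "(0::real) \<le> 1" by simp
    from NN_bound_bd[OF this R, of \<alpha>1] obtain C where C: "C \<ge> 0"
      "\<And>f A. test f \<Longrightarrow> (\<And>x. norm x > R \<Longrightarrow> f x = 0) \<Longrightarrow> bd (mi_abs \<alpha>1) A f \<Longrightarrow> NN 1 (pd \<alpha>1 f :: real^'n \<Rightarrow> complex) \<le> C * A" by blast
    show "\<exists>C N. C \<ge> 0 \<and> (\<forall>f A. test f \<longrightarrow> (\<forall>x. norm x > R \<longrightarrow> f x = 0) \<longrightarrow> bd N A f \<longrightarrow> ?p f \<le> C * A)"
    proof (intro exI[of _ "C1 * (C2 * C)"] exI[of _ "mi_abs \<alpha>1"] conjI allI impI)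
      fix f :: "real ^ 'n \<Rightarrow> complex" and A assume "test f" "\<forall>x. norm x > R \<longrightarrow> f x = 0" "bd (mi_abs \<alpha>1) A f"
      then have "NN 1 (pd \<alpha>1 f) \<le> C * A" using C(2) by blast
      then have "?p f \<le> C1 * (C2 * (C * A))" by (intro mult_left_mono C1 C2)
      then show "?p f \<le> C1 * (C2 * C) * A" by (simp add: mult.assoc)
    qed (use C C1 C2 in simp)
  next
    fix L assume "distribution L" "\<And>f. test f \<Longrightarrow> L (pdo S (adj a) f) = f 0"
    then show thesis by (rule that)
  qed auto
qed

lemma conv_fundamental:
  assumes E: "distribution E" "\<And>\<phi>. test \<phi> \<Longrightarrow> E (pdo S (adj a) \<phi>) = \<phi> 0" and \<phi>: "test \<phi>"
  shows "pdo S a (conv E \<phi>) = \<phi>" "conv E (pdo S a \<phi>) = \<phi>"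
proof -
  show 1: "pdo S a (conv E \<phi>) = \<phi>"
    using pdo_conv(2)[OF E(1) \<phi>, of S a] E(2)[OF test_reflect[OF \<phi>]] by auto
  then show "conv E (pdo S a \<phi>) = \<phi>" by (simp add: pdo_conv(1)[OF E(1) \<phi>])
qed

section \<open>Runge approximation and division by the operator\<close>

lemma ibp_pd:
  assumes f: "test f"
  shows "test g \<Longrightarrow> integral\<^sup>L lborel (\<lambda>x. pd \<alpha> f x * g x) = (-1) ^ mi_abs \<alpha> * integral\<^sup>L lborel (\<lambda>x. f x * pd \<alpha> g x)"
proof (induction \<alpha> arbitrary: g rule: mi_induct)
  case (step \<alpha> j)
  have sf: "smooth f" and sg: "smooth g" using f step.prems test_smooth by auto
  let ?F = "pd \<alpha> f"
  have F: "test ?F" by (rule test_pd[OF f])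
  have "integral\<^sup>L lborel (partial j (\<lambda>x. ?F x * g x)) = 0"
    by (intro integral_partial test_mult2 F sg)
  also have "partial j (\<lambda>x. ?F x * g x) = (\<lambda>x. partial j ?F x * g x + ?F x * partial j g x)"
    by (intro partial_mult smooth_differentiable smooth_pd sf sg)
  also have "integral\<^sup>L lborel \<dots> = integral\<^sup>L lborel (\<lambda>x. partial j ?F x * g x) + integral\<^sup>L lborel (\<lambda>x. ?F x * partial j g x)"
    by (intro Bochner_Integration.integral_add test_integrable test_mult2 test_partial F sg smooth_partial)
  finally have "integral\<^sup>L lborel (\<lambda>x. partial j ?F x * g x) = - integral\<^sup>L lborel (\<lambda>x. ?F x * partial j g x)"
    by (simp add: add_eq_0_iff2)
  also have "\<dots> = - ((-1) ^ mi_abs \<alpha> * integral\<^sup>L lborel (\<lambda>x. f x * pd \<alpha> (partial j g) x))"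
    by (simp only: step.IH[OF test_partial[OF step.prems]])
  finally show ?case by (simp add: pd_Suc[OF sf] pd_Suc'[OF sg])
qed simp

lemma ibp_pdo:
  assumes f: "test f" and g: "test g"
  shows "integral\<^sup>L lborel (\<lambda>x. pdo S a f x * g x) = integral\<^sup>L lborel (\<lambda>x. f x * pdo S (adj a) g x)"
proof -
  have "integral\<^sup>L lborel (\<lambda>x. pdo S a f x * g x) = integral\<^sup>L lborel (\<lambda>x. \<Sum>\<alpha>\<in>S. a \<alpha> * (pd \<alpha> f x * g x))"
    by (simp add: pdo_def sum_distrib_right mult.assoc)
  also have "\<dots> = (\<Sum>\<alpha>\<in>S. a \<alpha> * integral\<^sup>L lborel (\<lambda>x. pd \<alpha> f x * g x))"
    by (subst Bochner_Integration.integral_sum, rule integrable_mult_right[OF test_integrable[OF test_mult2[OF test_smooth[OF g] test_pd[OF f]]]])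
       (simp only: integral_mult_right_zero)
  also have "\<dots> = (\<Sum>\<alpha>\<in>S. adj a \<alpha> * integral\<^sup>L lborel (\<lambda>x. f x * pd \<alpha> g x))"
    by (simp only: ibp_pd[OF f g] adj_def) (simp add: mult.assoc mult.left_commute)
  also have "\<dots> = integral\<^sup>L lborel (\<lambda>x. \<Sum>\<alpha>\<in>S. adj a \<alpha> * (f x * pd \<alpha> g x))"
    by (subst Bochner_Integration.integral_sum, rule integrable_mult_right[OF test_integrable[OF test_mult2[OF smooth_pd[OF test_smooth[OF g]] f]]])
       (simp only: integral_mult_right_zero)
  also have "\<dots> = integral\<^sup>L lborel (\<lambda>x. f x * pdo S (adj a) g x)"
    by (simp add: pdo_def sum_distrib_left mult.left_commute)
  finally show ?thesis .
qed

lemma distribution_diff: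
  assumes u: "distribution u" and v: "distribution v"
  shows "distribution (\<lambda>\<phi>. u \<phi> - v \<phi>)"
proof (rule distributionI)
  fix K :: "(real ^ 'a) set" assume K: "compact K"
  obtain C N where C: "C \<ge> 0" "\<And>\<phi> A. test \<phi> \<Longrightarrow> fun_support \<phi> \<subseteq> K \<Longrightarrow> bd N A \<phi> \<Longrightarrow> cmod (u \<phi>) \<le> C * A"
    by (rule distribution_bd[OF u K], rule that)
  obtain C' N' where C': "C' \<ge> 0" "\<And>\<phi> A. test \<phi> \<Longrightarrow> fun_support \<phi> \<subseteq> K \<Longrightarrow> bd N' A \<phi> \<Longrightarrow> cmod (v \<phi>) \<le> C' * A"
    by (rule distribution_bd[OF v K], rule that)
  show "\<exists>C N. C \<ge> 0 \<and> (\<forall>\<phi> A. test \<phi> \<longrightarrow> fun_support \<phi> \<subseteq> K \<longrightarrow> bd N A \<phi> \<longrightarrow> cmod (u \<phi> - v \<phi>) \<le> C * A)"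
  proof (intro exI[of _ "C + C'"] exI[of _ "max N N'"] conjI allI impI)
    fix \<phi> :: "real ^ 'a \<Rightarrow> complex" and A assume \<phi>: "test \<phi>" "fun_support \<phi> \<subseteq> K" "bd (max N N') A \<phi>"
    then have "bd N A \<phi>" "bd N' A \<phi>" by (auto simp: bd_def)
    then have "cmod (u \<phi>) \<le> C * A" "cmod (v \<phi>) \<le> C' * A" using C C' \<phi> by auto
    then show "cmod (u \<phi> - v \<phi>) \<le> (C + C') * A" using norm_triangle_ineq4[of "u \<phi>" "v \<phi>"] by (simp add: distrib_right)
  qed (use C C' in simp)
qed (simp_all add: distribution_add[OF u] distribution_add[OF v] distribution_cmult[OF u] distribution_cmult[OF v] algebra_simps)

lemma distribution_of_test:
  assumes f: "test f"
  shows "distribution (\<lambda>\<phi>. integral\<^sup>L lborel (\<lambda>x. f x * \<phi> x))"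
proof (rule distributionI)
  have i: "integrable lborel (\<lambda>x. f x * \<phi> x)" if "test \<phi>" for \<phi>
    by (intro test_integrable test_mult2 f test_smooth[OF that])
  show "integral\<^sup>L lborel (\<lambda>x. f x * (\<phi> x + \<psi> x)) = integral\<^sup>L lborel (\<lambda>x. f x * \<phi> x) + integral\<^sup>L lborel (\<lambda>x. f x * \<psi> x)"
    if "test \<phi>" "test \<psi>" for \<phi> \<psi>
    using Bochner_Integration.integral_add[OF i[OF that(1)] i[OF that(2)]] by (simp add: distrib_left)
  show "integral\<^sup>L lborel (\<lambda>x. f x * (c * \<phi> x)) = c * integral\<^sup>L lborel (\<lambda>x. f x * \<phi> x)" for c \<phi>
    by (simp only: mult.left_commute[of "f _"] integral_mult_right_zero)
  fix K :: "(real ^ 'a) set"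
  let ?C = "integral\<^sup>L lborel (\<lambda>x. cmod (f x))"
  show "\<exists>C N. C \<ge> 0 \<and> (\<forall>\<phi> A. test \<phi> \<longrightarrow> fun_support \<phi> \<subseteq> K \<longrightarrow> bd N A \<phi> \<longrightarrow> cmod (integral\<^sup>L lborel (\<lambda>x. f x * \<phi> x)) \<le> C * A)"
  proof (intro exI[of _ ?C] exI[of _ 0] conjI allI impI)
    fix \<phi> :: "real ^ 'a \<Rightarrow> complex" and A assume \<phi>: "test \<phi>" "bd 0 A \<phi>"
    have "cmod (integral\<^sup>L lborel (\<lambda>x. f x * \<phi> x)) \<le> integral\<^sup>L lborel (\<lambda>x. cmod (f x * \<phi> x))"
      by (rule integral_norm_bound)
    also have "\<dots> \<le> integral\<^sup>L lborel (\<lambda>x. cmod (f x) * A)"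
    proof (rule integral_mono)
      show "cmod (f x * \<phi> x) \<le> cmod (f x) * A" for x
        using bdD[OF \<phi>(2), of 0 x] by (simp add: norm_mult mult_left_mono)
    qed (use i[OF \<phi>(1)] test_integrable[OF f] in auto)
    finally show "cmod (integral\<^sup>L lborel (\<lambda>x. f x * \<phi> x)) \<le> ?C * A" by simp
  qed simp
qed

section \<open>Mollifiers and decay of weighted norms\<close>

lemma step_le_1: "step t \<le> 1"
  using bump0_nonneg[of t] bump0_nonneg[of "1 - t"] bump0_sum_pos[of t] by (simp add: step_def divide_le_eq_1)

lemma mollifier:
  assumes e: "e > 0"
  obtains s :: "real ^ 'n::finite \<Rightarrow> real" where "test (\<lambda>x. complex_of_real (s x))" "\<And>x. s x \<ge> 0" "\<And>x. norm x > e \<Longrightarrow> s x = 0"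
    "integral\<^sup>L lborel s = 1"
proof -
  define b where "b x = 1 - step ((norm x)\<^sup>2 / (e/2)\<^sup>2 - 1)" for x :: "real ^ 'n"
  have bc: "complex_of_real (b x) = ball_cutoff 0 (e/2) x" for x by (simp add: b_def ball_cutoff_def)
  have e2: "e/2 > 0" using e by simp
  have b0: "b x \<ge> 0" for x using step_le_1 by (simp add: b_def)
  have bz: "b x = 0" if "norm x > e" for x
  proof -
    have "ball_cutoff 0 (e/2) x = 0" by (rule ball_cutoff(3)[OF e2]) (use that in simp)
    then show ?thesis using bc[of x] by simp
  qed
  have t: "test (\<lambda>x. complex_of_real (b x))"
    unfolding bc by (rule testI[OF ball_cutoff(1)[OF e2], of "cball 0 (2 * (e/2))"]) (auto simp: ball_cutoff(3)[OF e2])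
  have ib: "integrable lborel b"
    using integrable_Re[OF test_integrable[OF t]] by simp
  have "0 < measure lborel (cball 0 (e/2) :: (real ^ 'n) set)" using content_cball_pos[OF e2, of "0 :: real ^ 'n"] by simp
  also have "\<dots> = integral\<^sup>L lborel (indicator (cball 0 (e/2) :: (real ^ 'n) set) :: _ \<Rightarrow> real)"
    by simp
  also have "\<dots> \<le> integral\<^sup>L lborel b"
  proof (rule integral_mono[OF _ ib])
    show "integrable lborel (indicator (cball 0 (e/2) :: (real ^ 'n) set) :: _ \<Rightarrow> real)"
    proof (rule integrable_real_indicator)
      show "emeasure lborel (cball 0 (e/2) :: (real ^ 'n) set) < \<infinity>" by (rule emeasure_bounded_finite) simp
    qed simp
    fix x :: "real ^ 'n"
    show "indicator (cball 0 (e/2)) x \<le> b x"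
    proof (cases "x \<in> cball 0 (e/2)")
      case True
      have "b x = 1" using ball_cutoff(2)[OF e2 True] bc[of x] by (metis of_real_1 of_real_eq_iff)
      then show ?thesis by (simp add: indicator_def)
    qed (simp add: b0)
  qed
  finally have c: "integral\<^sup>L lborel b > 0" .
  show ?thesis
  proof (rule that[of "\<lambda>x. 1 / integral\<^sup>L lborel b * b x"])
    show "test (\<lambda>x. complex_of_real (1 / integral\<^sup>L lborel b * b x))"
      using test_cmult[OF t, of "complex_of_real (1 / integral\<^sup>L lborel b)"] by simp
    show "integral\<^sup>L lborel (\<lambda>x. 1 / integral\<^sup>L lborel b * b x) = 1"
      using c by (simp only: integral_mult_right_zero) simp
  qed (use c b0 bz in auto)
qed

lemma NN_weight_decay:
  assumes f: "test f" and z: "\<And>x. norm x < r \<Longrightarrow> f x = 0" and t: "t \<ge> 0" and r: "r \<ge> 0"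
  shows "NN (-t) f \<le> exp (- t * r\<^sup>2 / 2) * NN 0 f"
proof -
  have "(NN (-t) f)\<^sup>2 \<le> integral\<^sup>L lborel (\<lambda>x. exp (- t * r\<^sup>2) * ((cmod (f x))\<^sup>2 * wt 0 x))"
    unfolding NN_square
  proof (rule integral_mono)
    fix x
    show "(cmod (f x))\<^sup>2 * wt (-t) x \<le> exp (- t * r\<^sup>2) * ((cmod (f x))\<^sup>2 * wt 0 x)"
    proof (cases "norm x < r")
      case False
      then have "r\<^sup>2 \<le> (norm x)\<^sup>2" using r by (intro power_mono) auto
      then have "wt (-t) x \<le> exp (- t * r\<^sup>2)" using t by (simp add: wt_def mult_left_mono)
      then have "(cmod (f x))\<^sup>2 * wt (-t) x \<le> (cmod (f x))\<^sup>2 * exp (- t * r\<^sup>2)" by (intro mult_left_mono) auto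
      then show ?thesis by (simp add: wt_def mult.commute)
    qed (simp add: z)
  qed (intro integrable_mult_right integrable_sq_wt f)+
  also have "\<dots> = (exp (- t * r\<^sup>2 / 2) * NN 0 f)\<^sup>2"
    by (simp add: power_mult_distrib NN_square exp_double[symmetric])
  finally show ?thesis by (rule power2_le_imp_le) (simp add: NN_nonneg)
qed

lemma mollify_close:
  fixes G :: "real ^ 'n::finite \<Rightarrow> complex" and A e :: real
  assumes G: "test G" and A: "\<And>j x. cmod (partial j G x) \<le> A"
    and s: "test (\<lambda>x. complex_of_real (s x))" "\<And>x. s x \<ge> 0" "\<And>x. norm x > e \<Longrightarrow> s x = 0" "integral\<^sup>L lborel s = 1"
  shows "cmod (integral\<^sup>L lborel (\<lambda>y. G y * complex_of_real (s (y - x))) - G x) \<le> CARD('n) * A * e"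
proof -
  let ?s = "\<lambda>y. complex_of_real (s (y - x))"
  have iss: "integrable lborel ?s" "integral\<^sup>L lborel ?s = 1"
    using integral_translate[OF s(1), of "-x"] s(4) by simp_all
  have iG: "integrable lborel (\<lambda>y. G y * ?s y)"
    using smooth_translate[OF test_smooth[OF s(1)], of "-x"] by (intro test_integrable test_mult2 G) simp
  have A0: "A \<ge> 0" using order_trans[OF norm_ge_zero A] .
  have "integral\<^sup>L lborel (\<lambda>y. G y * ?s y) - G x = integral\<^sup>L lborel (\<lambda>y. G y * ?s y - G x * ?s y)"
    by (subst Bochner_Integration.integral_diff[OF iG integrable_mult_right[OF iss(1)]]) (simp only: integral_mult_right_zero iss(2) mult_1_right)
  also have "cmod \<dots> \<le> integral\<^sup>L lborel (\<lambda>y. cmod (G y * ?s y - G x * ?s y))" by (rule integral_norm_bound)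
  also have "\<dots> \<le> integral\<^sup>L lborel (\<lambda>y. CARD('n) * A * e * cmod (?s y))"
  proof (rule integral_mono)
    fix y
    show "cmod (G y * ?s y - G x * ?s y) \<le> CARD('n) * A * e * cmod (?s y)"
    proof (cases "norm (y - x) > e")
      case False
      have "cmod (G y - G x) \<le> CARD('n) * A * norm (y - x)"
        by (rule mean_value_partial[OF test_smooth[OF G], of UNIV]) (auto simp: A)
      also have "\<dots> \<le> CARD('n) * A * e" by (rule mult_left_mono) (use False A0 in auto)
      finally show ?thesis unfolding left_diff_distrib[symmetric] norm_mult by (rule mult_right_mono) simp
    qed (simp add: s(3))
  next
    show "integrable lborel (\<lambda>y. CARD('n) * A * e * cmod (?s y))"
      by (rule integrable_mult_right[OF integrable_norm[OF iss(1)]])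
    show "integrable lborel (\<lambda>y. cmod (G y * ?s y - G x * ?s y))"
      by (rule integrable_norm[OF Bochner_Integration.integrable_diff[OF iG integrable_mult_right[OF iss(1)]]])
  qed
  also have "\<dots> = CARD('n) * A * e * integral\<^sup>L lborel (\<lambda>y. cmod (?s y))" by (simp only: integral_mult_right_zero)
  also have "(\<lambda>y. cmod (?s y)) = (\<lambda>y. s (y - x))" by (simp add: s(2))
  also have "integral\<^sup>L lborel (\<lambda>y. s (y - x)) = 1"
    using iss(2) by (simp only: integral_complex_of_real of_real_eq_1_iff)
  finally show ?thesis by simp
qed

text \<open>Cutting off \<open>h\<close> to \<open>f\<close> leaves an error \<open>g\<close> that
  vanishes for |x| < R + 1/2. The equation with right-hand side \<open>g\<close> is solved by a
  functional \<open>L\<close> dominated by the product of the norm of \<open>g\<close> with weight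
  -t and the norm of the test function with weight t. On test functions in |x| <= R + 1/4 this
  product is of order exp(-t q). Thus \<open>f\<close> minus \<open>L\<close>, regularised by a
  mollifier, is a zero solution everywhere and close to \<open>h\<close> on the ball of radius
  \<open>R\<close>.\<close>

lemma runge_approximation:
  fixes S :: "'n::finite multiindex set"
  assumes S: "finite S" and a0: "\<alpha>0 \<in> S" "a \<alpha>0 \<noteq> 0"
    and h: "smooth h" "\<And>x. norm x < R + 1 \<Longrightarrow> pdo S a h x = 0" and R: "R > 0" and \<eta>: "\<eta> > 0"
  obtains \<kappa> where "smooth \<kappa>" "pdo S a \<kappa> = (\<lambda>x. 0)" 
    "\<And>\<alpha> x. mi_abs \<alpha> \<le> N \<Longrightarrow> norm x \<le> R \<Longrightarrow> cmod (pd \<alpha> \<kappa> x - pd \<alpha> h x) \<le> \<eta>"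
proof -
  let ?B = "cball 0 (R + 1/2) :: (real ^ 'n) set"
  obtain \<theta> V where \<theta>: "test \<theta>" "open V" "?B \<subseteq> V" "\<And>x. x \<in> V \<Longrightarrow> \<theta> x = 1"
    by (rule cutoff_exists[of ?B UNIV]) auto
  define f where "f x = \<theta> x * h x" for x
  have f: "test f" unfolding f_def by (rule test_mult2[OF h(1) \<theta>(1)])
  have sf: "smooth f" by (rule test_smooth[OF f])
  have fh: "f x = h x" if "x \<in> ball 0 (R + 1/2)" for x
    using \<theta>(3,4) that by (force simp: f_def)
  define g where "g = pdo S a f"
  have g: "test g" unfolding g_def by (rule test_pdo[OF f])
  have gz: "g x = 0" if "norm x < R + 1/2" for x
    unfolding g_def using pdo_cong_open[OF sf h(1) open_ball, of x 0 "R + 1/2" S a] fh that h(2)[of x] by simp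
  obtain A where A: "A \<ge> 0" "bd (N + 1) A f" by (rule test_bd[OF f, of "N + 1"], rule that)
  \<comment> \<open>Radius of the mollifier: at most 1/4, so that its translates by |x| <= R stay
    inside |y| <= R + 1/4, and small enough for a mollification error of at most
    \<open>\<eta>\<close> / 2.\<close>
  define e where "e = min (1/4) (\<eta> / (2 * (CARD('n) * A + 1)))"
  have cA: "CARD('n) * A + 1 > 0" using A by (simp add: add_nonneg_pos)
  have e: "e > 0" "e \<le> 1/4" unfolding e_def using \<eta> cA by (simp, intro min.cobounded1)
  have eA: "CARD('n) * A * e \<le> \<eta> / 2"
  proof -
    have "CARD('n) * A * e \<le> (CARD('n) * A + 1) * e" using e by (simp add: mult_right_mono)
    also have "\<dots> \<le> (CARD('n) * A + 1) * (\<eta> / (2 * (CARD('n) * A + 1)))" by (rule mult_left_mono) (use cA in \<open>auto simp: e_def\<close>)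
    also have "\<dots> = \<eta> / 2" using cA by (simp add: field_simps)
    finally show ?thesis .
  qed
  obtain s :: "real ^ 'n \<Rightarrow> real" where s: "test (\<lambda>x. complex_of_real (s x))" "\<And>x. s x \<ge> 0" "\<And>x. norm x > e \<Longrightarrow> s x = 0" "integral\<^sup>L lborel s = 1"
    by (rule mollifier[OF e(1)], rule that)
  \<comment> \<open>Convolution evaluates \<open>\<rho>\<close> at x - y, which by this reflection
    is \<open>s\<close> at y - x.\<close>
  define \<rho> where "\<rho> x = complex_of_real (s (- x))" for x
  have \<rho>: "test \<rho>" using test_reflect[OF s(1), of 0] by (simp add: \<rho>_def[abs_def])
  have s\<rho>: "smooth \<rho>" by (rule test_smooth[OF \<rho>])
  obtain B where B: "B \<ge> 0" "bd N B \<rho>" by (rule test_bd[OF \<rho>, of N], rule that)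
  obtain C where C: "C \<ge> 0" "\<And>t f. t \<ge> 1/2 \<Longrightarrow> test f \<Longrightarrow> NN t f \<le> C * NN t (pdo S (adj a) f)"
    by (rule weighted_inequality_NN[where a=a, OF S a0], rule that)
  define D where "D = NN 0 g * (C * (B * sqrt (measure lborel (cball 0 (R + 1/4) :: (real ^ 'n) set))))"
  have D: "D \<ge> 0" using B C by (simp add: D_def NN_nonneg)
  \<comment> \<open>Half the difference of the squared radii of the ball on which \<open>g\<close>
    vanishes and of the ball tested by the mollifier: the decay rate in \<open>t\<close>.\<close>
  define q where "q = ((R + 1/2)\<^sup>2 - (R + 1/4)\<^sup>2) / 2"
  have q: "q > 0" using R by (simp add: q_def power2_eq_square algebra_simps)
  \<comment> \<open>Large enough for exp(-t q) D <= \<open>\<eta>\<close> / 2, by means of x <= exp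
    x.\<close>
  define t where "t = max (1/2) (2 * D / (q * \<eta>))"
  have t: "t \<ge> 1/2" by (simp add: t_def)
  have tD: "exp (- (t * q)) * D \<le> \<eta> / 2"
  proof -
    have "t * q > 0" using t q by simp
    have "t * q \<le> exp (t * q)" using exp_ge_add_one_self[of "t * q"] by linarith
    have "2 * D / (q * \<eta>) \<le> t" by (simp add: t_def)
    then have "D \<le> \<eta> / 2 * (t * q)" using q \<eta> by (simp add: field_simps)
    also have "\<dots> \<le> \<eta> / 2 * exp (t * q)" by (rule mult_left_mono) (use \<open>t * q \<le> exp (t * q)\<close> \<eta> in auto)
    finally show ?thesis by (simp add: exp_minus field_simps)
  qed
  let ?p = "\<lambda>f :: real ^ 'n \<Rightarrow> complex. NN (-t) g * (C * NN t f)"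
  let ?k = "\<lambda>\<xi>. integral\<^sup>L lborel (\<lambda>x. g x * \<xi> x)"
  note dk = distribution_of_test[OF g]
  have kb: "cmod (?k \<phi>) \<le> ?p (pdo S (adj a) \<phi>)" if \<phi>: "test \<phi>" for \<phi>
  proof -
    have "cmod (?k \<phi>) \<le> integral\<^sup>L lborel (\<lambda>x. cmod (g x) * cmod (\<phi> x))"
      using integral_norm_bound[of lborel "\<lambda>x. g x * \<phi> x"] by (simp add: norm_mult)
    also have "\<dots> \<le> NN (-t) g * NN t \<phi>" by (rule weighted_Cauchy_Schwarz[OF g \<phi>])
    also have "\<dots> \<le> ?p (pdo S (adj a) \<phi>)" by (intro mult_left_mono C t \<phi> NN_nonneg)
    finally show ?thesis .
  qed
  obtain L where L: "distribution L" "\<And>\<phi>. test \<phi> \<Longrightarrow> L (pdo S (adj a) \<phi>) = ?k \<phi>" "\<And>\<phi>. test \<phi> \<Longrightarrow> cmod (L \<phi>) \<le> ?p \<phi>"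
  proof (rule extend_from_range[of ?p ?k S "adj a"])
    show "?p (\<lambda>x. f x + f' x) \<le> ?p f + ?p f'" if ff: "test f" "test f'" for f f'
    proof -
      have "?p (\<lambda>x. f x + f' x) \<le> NN (-t) g * (C * (NN t f + NN t f'))"
        by (intro mult_left_mono NN_triangle ff NN_nonneg C)
      then show ?thesis by (simp add: algebra_simps)
    qed
    show "?p (\<lambda>x. c * f x) = cmod c * ?p f" for c f by (simp add: NN_cmult)
    show "?k (\<lambda>x. f x + f' x) = ?k f + ?k f'" if ff: "test f" "test f'" for f f' by (rule distribution_add[OF dk ff])
    show "?k (\<lambda>x. c * f x) = c * ?k f" if "test f" for c f by (rule distribution_cmult[OF dk that])
    show "cmod (?k f) \<le> ?p (pdo S (adj a) f)" if "test f" for f by (rule kb[OF that])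
    fix r :: real assume r: "r > 0"
    have t0: "t \<ge> 0" using t by simp
    from NN_bound_bd[OF t0 r, of 0] obtain C' where C': "C' \<ge> 0"
      "\<And>f A. test f \<Longrightarrow> (\<And>x. norm x > r \<Longrightarrow> f x = 0) \<Longrightarrow> bd 0 A f \<Longrightarrow> NN t (f :: real^'n \<Rightarrow> complex) \<le> C' * A" by auto
    show "\<exists>C N. C \<ge> 0 \<and> (\<forall>f A. test f \<longrightarrow> (\<forall>x. norm x > r \<longrightarrow> f x = 0) \<longrightarrow> bd N A f \<longrightarrow> ?p f \<le> C * A)"
    proof (intro exI[of _ "NN (-t) g * (C * C')"] exI[of _ 0] conjI allI impI)
      fix f :: "real ^ 'n \<Rightarrow> complex" and A assume "test f" "\<forall>x. norm x > r \<longrightarrow> f x = 0" "bd 0 A f"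
      then have "NN t f \<le> C' * A" using C'(2) by blast
      then have "?p f \<le> NN (-t) g * (C * (C' * A))" by (intro mult_left_mono C NN_nonneg)
      then show "?p f \<le> NN (-t) g * (C * C') * A" by (simp add: mult.assoc)
    qed (intro mult_nonneg_nonneg NN_nonneg C(1) C'(1))
  qed (rule that)
  \<comment> \<open>The operator annihilates this difference, because \<open>f\<close> and
    \<open>L\<close> have the same right-hand side \<open>g\<close>.\<close>
  define \<mu> where "\<mu> \<phi> = integral\<^sup>L lborel (\<lambda>x. f x * \<phi> x) - L \<phi>" for \<phi>
  have d\<mu>: "distribution \<mu>" unfolding \<mu>_def by (rule distribution_diff[OF distribution_of_test[OF f] L(1)])
  show ?thesis
  proof (rule that[of "conv \<mu> \<rho>"])
    show "smooth (conv \<mu> \<rho>)" by (rule smooth_conv[OF d\<mu> \<rho>])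
    show "pdo S a (conv \<mu> \<rho>) = (\<lambda>x. 0)"
    proof
      fix x
      have r: "test (\<lambda>y. \<rho> (x - y))" by (rule test_reflect[OF \<rho>])
      show "pdo S a (conv \<mu> \<rho>) x = 0"
        unfolding pdo_conv(2)[OF d\<mu> \<rho>] \<mu>_def L(2)[OF r] ibp_pdo[OF f r, symmetric] g_def by simp
    qed
    fix \<alpha> :: "'n multiindex" and x :: "real ^ 'n"
    assume \<alpha>: "mi_abs \<alpha> \<le> N" and x: "norm x \<le> R"
    let ?r = "\<lambda>y. pd \<alpha> \<rho> (x - y)"
    have r: "test ?r" by (rule test_reflect[OF test_pd[OF \<rho>]])
    have 1: "pd \<alpha> (conv \<mu> \<rho>) x = integral\<^sup>L lborel (\<lambda>y. f y * ?r y) - L ?r"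
      unfolding pd_conv[OF d\<mu> \<rho>] by (simp add: conv_def \<mu>_def)
    \<comment> \<open>The derivatives are moved from the mollifier to \<open>f\<close>; the signs
      from integration by parts and from the reflection cancel.\<close>
    have "integral\<^sup>L lborel (\<lambda>y. pd \<alpha> f y * \<rho> (x - y)) = (-1) ^ mi_abs \<alpha> * integral\<^sup>L lborel (\<lambda>y. f y * ((-1) ^ mi_abs \<alpha> * ?r y))"
      unfolding ibp_pd[OF f test_reflect[OF \<rho>]] pd_reflect[OF s\<rho>] ..
    also have "\<dots> = integral\<^sup>L lborel (\<lambda>y. f y * ?r y)"
      by (simp only: mult.left_commute[of "f _"] integral_mult_right_zero) (simp add: mult.assoc[symmetric] power_mult_distrib[symmetric])
    finally have 2: "integral\<^sup>L lborel (\<lambda>y. f y * ?r y) = integral\<^sup>L lborel (\<lambda>y. pd \<alpha> f y * complex_of_real (s (y - x)))"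
      by (simp add: \<rho>_def)
    have "cmod (integral\<^sup>L lborel (\<lambda>y. pd \<alpha> f y * complex_of_real (s (y - x))) - pd \<alpha> f x) \<le> CARD('n) * A * e"
    proof (rule mollify_close[OF test_pd[OF f] _ s])
      show "cmod (partial j (pd \<alpha> f) y) \<le> A" for j y
        using bdD[OF A(2), of "\<alpha> + ei j" y] \<alpha> by (simp add: pd_Suc[OF sf])
    qed
    with eA have 3: "cmod (integral\<^sup>L lborel (\<lambda>y. f y * ?r y) - pd \<alpha> f x) \<le> \<eta> / 2" unfolding 2 by linarith
    have 4: "pd \<alpha> f x = pd \<alpha> h x"
      by (rule pd_cong_open[OF sf h(1) open_ball, of x 0 "R + 1/2"]) (use x fh in auto)
    have \<rho>z: "pd \<alpha> \<rho> z = 0" if "norm z > e" for z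
    proof (rule pd_outside_support[OF s\<rho>])
      have "fun_support \<rho> \<subseteq> cball 0 e" by (rule fun_support_subset) (auto simp: \<rho>_def s(3))
      then show "z \<notin> fun_support \<rho>" using that by auto
    qed
    have "cmod (L ?r) \<le> ?p ?r" by (rule L(3)[OF r])
    also have "\<dots> \<le> NN (-t) g * (C * (B * exp (t * (R + 1/4)\<^sup>2 / 2) * sqrt (measure lborel (cball 0 (R + 1/4) :: (real ^ 'n) set))))"
    proof (intro mult_left_mono NN_bound[OF r])
      show "cmod (?r y) \<le> B" for y by (rule bdD[OF B(2) \<alpha>])
      show "?r y = 0" if "norm y > R + 1/4" for y
        using that x e norm_triangle_ineq2[of y x] by (intro \<rho>z) (simp add: norm_minus_commute)
    qed (use t R C NN_nonneg in auto)
    also have "\<dots> \<le> (exp (- t * (R + 1/2)\<^sup>2 / 2) * NN 0 g) * (C * (B * exp (t * (R + 1/4)\<^sup>2 / 2) * sqrt (measure lborel (cball 0 (R + 1/4) :: (real ^ 'n) set))))"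
      by (intro mult_right_mono NN_weight_decay g gz) (use t R C B in auto)
    also have "\<dots> = (exp (- t * (R + 1/2)\<^sup>2 / 2) * exp (t * (R + 1/4)\<^sup>2 / 2)) * D"
      by (simp add: D_def)
    also have "exp (- t * (R + 1/2)\<^sup>2 / 2) * exp (t * (R + 1/4)\<^sup>2 / 2) = exp (- (t * q))"
      unfolding exp_add[symmetric] q_def by (rule arg_cong[where f=exp]) (simp add: field_simps)
    also note tD
    finally have 5: "cmod (L ?r) \<le> \<eta> / 2" .
    have "pd \<alpha> (conv \<mu> \<rho>) x - pd \<alpha> h x = (integral\<^sup>L lborel (\<lambda>y. f y * ?r y) - pd \<alpha> f x) - L ?r"
      unfolding 1 4 by simp
    then have "cmod (pd \<alpha> (conv \<mu> \<rho>) x - pd \<alpha> h x) \<le> \<eta>/2 + \<eta>/2"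
      using order_trans[OF norm_triangle_ineq4 add_mono[OF 3 5]] by simp
    then show "cmod (pd \<alpha> (conv \<mu> \<rho>) x - pd \<alpha> h x) \<le> \<eta>" by simp
  qed
qed

lemma cutoff_mult_bd:
  assumes \<zeta>: "test \<zeta>" "bd N B \<zeta>" "B \<ge> 0" "fun_support \<zeta> \<subseteq> K" and h: "smooth h" and D: "D \<ge> 0"
    "\<And>\<alpha> x. mi_abs \<alpha> \<le> N \<Longrightarrow> x \<in> K \<Longrightarrow> cmod (pd \<alpha> h x) \<le> D"
  shows "bd N (2 ^ N * B * D) (\<lambda>x. \<zeta> x * h x)"
  unfolding bd_def
proof (intro allI impI)
  fix \<alpha> :: "'a multiindex" and x assume \<alpha>: "mi_abs \<alpha> \<le> N"
  show "cmod (pd \<alpha> (\<lambda>x. \<zeta> x * h x) x) \<le> 2 ^ N * B * D"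
  proof (cases "x \<in> fun_support \<zeta>")
    case True
    have "cmod (pd \<alpha> (\<lambda>x. \<zeta> x * h x) x) \<le> 2 ^ mi_abs \<alpha> * B * D * 1 ^ mi_abs \<alpha>"
      by (rule leibniz_bound) (use True \<zeta> h D \<alpha> in \<open>auto intro: bdD[OF \<zeta>(2)] test_smooth\<close>)
    also have "\<dots> \<le> 2 ^ N * B * D * 1"
      by (intro mult_mono power_increasing) (use \<alpha> \<zeta> D in auto)
    finally show ?thesis by simp
  next
    case False
    then have "x \<notin> fun_support (\<lambda>x. \<zeta> x * h x)" using fun_support_mono[of \<zeta> "\<lambda>x. \<zeta> x * h x"] by auto
    then show ?thesis using \<zeta> D by (simp add: pd_outside_support[OF smooth_mult[OF test_smooth[OF \<zeta>(1)] h]])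
  qed
qed

text \<open>\<open>v\<close> applies \<open>u\<close> to the convolution of \<open>E\<close> with
  the test function. For a test function supported off \<open>F\<close>, the operator maps this
  convolution to a function that is flat on \<open>F\<close>, so \<open>kill\<close> gives the value
  0. On an image of the operator the convolution returns the original function, which gives the last
  claim. Cutoffs appear in \<open>kill\<close> because \<open>u\<close> acts on test functions
  only.\<close>

lemma division:
  fixes S :: "'n::finite multiindex set"
  assumes S: "finite S" and a0: "\<alpha>0 \<in> S" "a \<alpha>0 \<noteq> 0"
    and u: "distribution u" "compact (dist_support u)" and F: "closed F"
    and kill: "\<And>\<zeta> V \<psi>. test \<zeta> \<Longrightarrow> open V \<Longrightarrow> dist_support u \<subseteq> V \<Longrightarrow> (\<And>x. x \<in> V \<Longrightarrow> \<zeta> x = 1) \<Longrightarrow> smooth \<psi> \<Longrightarrow>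
       (\<And>\<beta> x. x \<in> F \<Longrightarrow> pd \<beta> (pdo S a \<psi>) x = 0) \<Longrightarrow> u (\<lambda>x. \<zeta> x * \<psi> x) = 0"
  obtains v where "distribution v" "compact (dist_support v)" "dist_support v \<subseteq> F" "\<And>\<phi>. test \<phi> \<Longrightarrow> v (pdo S a \<phi>) = u \<phi>"
proof -
  obtain E where E: "distribution E" "\<And>\<phi>. test \<phi> \<Longrightarrow> E (pdo S (adj a) \<phi>) = \<phi> 0"
    by (rule fundamental_solution[where a=a, OF S a0], rule that)
  have cf: "pdo S a (conv E \<phi>) = \<phi>" "conv E (pdo S a \<phi>) = \<phi>" if "test \<phi>" for \<phi>
    by (rule conv_fundamental[OF E(1) _ that]; rule E(2); assumption)+
  obtain \<zeta> V where \<zeta>: "test \<zeta>" "open V" "dist_support u \<subseteq> V" "\<And>x. x \<in> V \<Longrightarrow> \<zeta> x = 1"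
    by (rule cutoff_exists[OF u(2) open_UNIV]) auto
  have "bounded (fun_support \<zeta>)" using test_compact[OF \<zeta>(1)] by (rule compact_imp_bounded)
  then obtain R where R0: "R > 0" "\<forall>x\<in>fun_support \<zeta>. norm x \<le> R" by (auto simp: bounded_pos)
  then have R: "R > 0" "fun_support \<zeta> \<subseteq> cball 0 R" by auto
  obtain C N where C: "C \<ge> 0" "\<And>\<phi> A. test \<phi> \<Longrightarrow> fun_support \<phi> \<subseteq> cball 0 R \<Longrightarrow> bd N A \<phi> \<Longrightarrow> cmod (u \<phi>) \<le> C * A"
    by (rule distribution_bd[OF u(1) compact_cball], rule that)
  obtain B where B: "B \<ge> 0" "bd N B \<zeta>" by (rule test_bd[OF \<zeta>(1), of N], rule that)
  have ub: "cmod (u (\<lambda>x. \<zeta> x * h x)) \<le> C * (2 ^ N * B * D)" 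
    if h: "smooth h" and D: "D \<ge> 0" "\<And>\<alpha> x. mi_abs \<alpha> \<le> N \<Longrightarrow> x \<in> cball 0 R \<Longrightarrow> cmod (pd \<alpha> h x) \<le> D" for h D
  proof (rule C(2))
    show "test (\<lambda>x. \<zeta> x * h x)" by (rule test_mult2[OF h \<zeta>(1)])
    show "fun_support (\<lambda>x. \<zeta> x * h x) \<subseteq> cball 0 R" using fun_support_mono[of \<zeta> "\<lambda>x. \<zeta> x * h x"] R(2) by auto
    show "bd N (2 ^ N * B * D) (\<lambda>x. \<zeta> x * h x)" by (rule cutoff_mult_bd[OF \<zeta>(1) B(2,1) R(2) h D])
  qed
  define v where "v \<phi> = u (\<lambda>x. \<zeta> x * conv E \<phi> x)" for \<phi>
  have tc: "test (\<lambda>x. \<zeta> x * conv E \<phi> x)" if "test \<phi>" for \<phi>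
    by (rule test_mult2[OF smooth_conv[OF E(1) that] \<zeta>(1)])
  have v: "distribution v"
  proof (rule distributionI)
    show "v (\<lambda>x. \<phi> x + \<psi> x) = v \<phi> + v \<psi>" if pq: "test \<phi>" "test \<psi>" for \<phi> \<psi>
    proof -
      have "(\<lambda>x. \<zeta> x * conv E (\<lambda>x. \<phi> x + \<psi> x) x) = (\<lambda>x. \<zeta> x * conv E \<phi> x + \<zeta> x * conv E \<psi> x)"
        unfolding conv_def by (simp add: distribution_add[OF E(1) test_reflect[OF pq(1)] test_reflect[OF pq(2)]] distrib_left)
      then show ?thesis unfolding v_def by (simp add: distribution_add[OF u(1) tc[OF pq(1)] tc[OF pq(2)]])
    qed
    show "v (\<lambda>x. c * \<phi> x) = c * v \<phi>" if p: "test \<phi>" for c \<phi>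
    proof -
      have "(\<lambda>x. \<zeta> x * conv E (\<lambda>x. c * \<phi> x) x) = (\<lambda>x. c * (\<zeta> x * conv E \<phi> x))"
        unfolding conv_def by (simp add: distribution_cmult[OF E(1) test_reflect[OF p]] mult.left_commute)
      then show ?thesis unfolding v_def by (simp add: distribution_cmult[OF u(1) tc[OF p]])
    qed
    fix K :: "(real ^ 'n) set" assume "compact K"
    then obtain r where r: "r > 0" "\<And>x. x \<in> K \<Longrightarrow> norm x \<le> r" using compact_imp_bounded bounded_pos by metis
    obtain C' N' where C': "C' \<ge> 0" "\<And>\<phi> A. test \<phi> \<Longrightarrow> fun_support \<phi> \<subseteq> cball 0 (R + r) \<Longrightarrow> bd N' A \<phi> \<Longrightarrow> cmod (E \<phi>) \<le> C' * A"
      by (rule distribution_bd[OF E(1) compact_cball], rule that)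
    show "\<exists>C N. C \<ge> 0 \<and> (\<forall>\<phi> A. test \<phi> \<longrightarrow> fun_support \<phi> \<subseteq> K \<longrightarrow> bd N A \<phi> \<longrightarrow> cmod (v \<phi>) \<le> C * A)"
    proof (intro exI[of _ "C * (2 ^ N * B * C')"] exI[of _ "N + N'"] conjI allI impI)
      fix \<phi> :: "real ^ 'n \<Rightarrow> complex" and A assume \<phi>: "test \<phi>" "fun_support \<phi> \<subseteq> K" "bd (N + N') A \<phi>"
      have A0: "A \<ge> 0" by (rule bd_nonneg[OF \<phi>(3)])
      have "cmod (v \<phi>) \<le> C * (2 ^ N * B * (C' * A))"
        unfolding v_def
      proof (rule ub[OF smooth_conv[OF E(1) \<phi>(1)]])
        show "0 \<le> C' * A" using A0 C' by simp
        fix \<alpha> :: "'n multiindex" and x :: "real ^ 'n" assume \<alpha>: "mi_abs \<alpha> \<le> N" and x: "x \<in> cball 0 R"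
        have sr: "fun_support (\<lambda>y. pd \<alpha> \<phi> (x - y)) \<subseteq> cball 0 (R + r)"
        proof (rule fun_support_subset)
          fix y :: "real ^ 'n" assume "y \<notin> cball 0 (R + r)"
          then have "norm (x - y) > r" using x norm_triangle_ineq2[of y x] by (simp add: norm_minus_commute)
          then have "x - y \<notin> fun_support \<phi>" using r(2) \<phi>(2) by force
          then show "pd \<alpha> \<phi> (x - y) = 0" by (rule pd_outside_support[OF test_smooth[OF \<phi>(1)]])
        qed simp
        have "bd N' A (\<lambda>y. pd \<alpha> \<phi> (x - y))"
          unfolding bd_def
        proof (intro allI impI)
          fix \<beta> :: "'n multiindex" and y assume "mi_abs \<beta> \<le> N'"
          then show "cmod (pd \<beta> (\<lambda>y. pd \<alpha> \<phi> (x - y)) y) \<le> A"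
            using bdD[OF \<phi>(3), of "\<beta> + \<alpha>" "x - y"] \<alpha>
            by (simp add: pd_reflect smooth_pd test_smooth \<phi>(1) norm_mult norm_power pd_pd)
        qed
        from C'(2)[OF test_reflect[OF test_pd[OF \<phi>(1)]] sr this]
        show "cmod (pd \<alpha> (conv E \<phi>) x) \<le> C' * A"
          by (simp add: pd_conv[OF E(1) \<phi>(1)] conv_def)
      qed
      then show "cmod (v \<phi>) \<le> C * (2 ^ N * B * C') * A" by (simp add: algebra_simps)
    qed (use C C' B in simp)
  qed
  have vF: "dist_support v \<subseteq> F"
  proof (rule dist_support_subset[OF F])
    fix \<phi> :: "real ^ 'n \<Rightarrow> complex" assume \<phi>: "test \<phi>" "fun_support \<phi> \<inter> F = {}"
    show "v \<phi> = 0"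
      unfolding v_def
    proof (rule kill[OF \<zeta> smooth_conv[OF E(1) \<phi>(1)]])
      show "pd \<beta> (pdo S a (conv E \<phi>)) x = 0" if "x \<in> F" for \<beta> x
        unfolding cf(1)[OF \<phi>(1)] by (rule pd_outside_support[OF test_smooth[OF \<phi>(1)]]) (use that \<phi> in blast)
    qed
  qed
  \<comment> \<open>For a test function supported outside this ball, the convolution is a zero
    solution inside it, hence approximable for |x| <= R by zero solutions on the whole space, and
    these are annihilated by \<open>kill\<close>.\<close>
  have vB: "dist_support v \<subseteq> cball 0 (R + 1)"
  proof (rule dist_support_subset)
    fix \<phi> :: "real ^ 'n \<Rightarrow> complex" assume \<phi>: "test \<phi>" "fun_support \<phi> \<inter> cball 0 (R + 1) = {}"
    let ?h = "conv E \<phi>"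
    have h: "smooth ?h" by (rule smooth_conv[OF E(1) \<phi>(1)])
    have hz: "pdo S a ?h x = 0" if "norm x < R + 1" for x
      unfolding cf(1)[OF \<phi>(1)] by (rule not_in_fun_support) (use that \<phi> in force)
    have "cmod (v \<phi>) \<le> 0 + e" if e: "e > 0" for e
    proof -
      let ?c = "C * (2 ^ N * B) + 1"
      have c: "?c > 0" using C B by (simp add: add_nonneg_pos)
      have \<eta>: "e / ?c > 0" using e c by simp
      obtain \<kappa> where \<kappa>: "smooth \<kappa>" "pdo S a \<kappa> = (\<lambda>x. 0)" 
        "\<And>\<alpha> x. mi_abs \<alpha> \<le> N \<Longrightarrow> norm x \<le> R \<Longrightarrow> cmod (pd \<alpha> \<kappa> x - pd \<alpha> ?h x) \<le> e / ?c"
        by (rule runge_approximation[where a=a and N=N, OF S a0 h hz R(1) \<eta>]) blast+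
      have kz: "pd \<beta> (pdo S a \<kappa>) x = 0" for \<beta> x unfolding \<kappa>(2) by (rule fun_cong[OF pd_zero])
      have "u (\<lambda>x. \<zeta> x * \<kappa> x) = 0" by (rule kill[OF \<zeta> \<kappa>(1) kz])
      moreover have "u (\<lambda>x. \<zeta> x * ?h x - \<zeta> x * \<kappa> x) = u (\<lambda>x. \<zeta> x * ?h x) - u (\<lambda>x. \<zeta> x * \<kappa> x)"
        by (rule distribution_minus[OF u(1) test_mult2[OF h \<zeta>(1)] test_mult2[OF \<kappa>(1) \<zeta>(1)]])
      ultimately have "v \<phi> = u (\<lambda>x. \<zeta> x * (?h x - \<kappa> x))" by (simp add: v_def right_diff_distrib)
      also have "cmod \<dots> \<le> C * (2 ^ N * B * (e / ?c))"
      proof (rule ub[OF smooth_minus[OF h \<kappa>(1)]])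
        show "cmod (pd \<alpha> (\<lambda>x. ?h x - \<kappa> x) x) \<le> e / ?c" if "mi_abs \<alpha> \<le> N" "x \<in> cball 0 R" for \<alpha> x
          using \<kappa>(3)[OF that(1), of x] that(2) by (simp add: pd_minus[OF h \<kappa>(1)] norm_minus_commute)
      qed (use \<eta> in simp)
      also have "\<dots> = C * (2 ^ N * B) * (e / ?c)" by (simp only: mult.assoc)
      also have "\<dots> \<le> ?c * (e / ?c)" by (rule mult_right_mono[OF _ less_imp_le[OF \<eta>]]) simp
      also have "\<dots> = e" using c by simp
      finally show ?thesis by simp
    qed
    then have "cmod (v \<phi>) \<le> 0" by (rule field_le_epsilon)
    then show "v \<phi> = 0" by simp
  qed simp
  show ?thesis
  proof (rule that[OF v _ vF])
    show "compact (dist_support v)"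
      using vB closed_dist_support[of v] compact_cball bounded_subset[OF bounded_cball] compact_eq_bounded_closed by blast
    fix \<phi> :: "real ^ 'n \<Rightarrow> complex" assume \<phi>: "test \<phi>"
    show "v (pdo S a \<phi>) = u \<phi>"
      unfolding v_def cf(2)[OF \<phi>]
      by (rule distribution_cong_near_support[OF u(1) test_mult2[OF test_smooth[OF \<phi>] \<zeta>(1)] \<phi> \<zeta>(2,3)]) (simp add: \<zeta>(4))
  qed
qed

section \<open>A lattice partition of unity\<close>

text \<open>The sum over integer translates telescopes to a constant, so products over the
  coordinates give a smooth partition of unity with no normalising denominator.\<close>

definition tent :: "real \<Rightarrow> real" where "tent t = step (t + 1) - step t"

lemma tent_zero: "\<bar>t\<bar> \<ge> 1 \<Longrightarrow> tent t = 0"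
  by (cases "t \<ge> 0") (auto simp: tent_def step_0 step_1)

lemma tent_sum: "(\<Sum>k\<in>{- int m..int m}. tent (t - of_int k)) = step (t + m + 1) - step (t - m)"
proof (induction m)
  case (Suc m)
  have s: "{- int (Suc m)..int (Suc m)} = insert (- int (Suc m)) (insert (int (Suc m)) {- int m..int m})" by auto
  show ?case unfolding s using Suc by (simp add: tent_def algebra_simps)
qed (simp add: tent_def)

definition lbump :: "real ^ 'n::finite \<Rightarrow> complex" where
  "lbump z = (\<Prod>i\<in>UNIV. complex_of_real (tent (z $ i)))"

definition lvec :: "('n::finite \<Rightarrow> int) \<Rightarrow> real ^ 'n" where "lvec k = (\<chi> i. of_int (k i))"

lemma smooth_lbump: "smooth (lbump :: real ^ 'n::finite \<Rightarrow> complex)"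
proof -
  have "smooth (\<lambda>z::real^'n. complex_of_real (z $ i + 1))" for i
    using smooth_add[OF smooth_coord smooth_const, of i 1] by simp
  from smooth_minus[OF smooth_step[OF this] smooth_step[OF smooth_coord]]
  have "smooth (\<lambda>z::real^'n. complex_of_real (tent (z $ i)))" for i by (simp add: tent_def)
  then show ?thesis unfolding lbump_def[abs_def] by (intro smooth_prod)
qed

lemma lbump_zero: "\<bar>z $ i\<bar> \<ge> 1 \<Longrightarrow> lbump z = 0"
  unfolding lbump_def by (rule prod_zero) (auto intro!: exI[of _ i] simp: tent_zero)

lemma norm_le_card: 
  fixes z :: "real ^ 'n::finite" and r :: real assumes "\<And>i. \<bar>z $ i\<bar> \<le> r" shows "norm z \<le> CARD('n) * r"
proof -
  have "norm z \<le> (\<Sum>i\<in>UNIV. \<bar>z $ i\<bar>)" by (rule norm_le_l1_cart)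
  also have "\<dots> \<le> (\<Sum>i\<in>(UNIV::'n set). r)" by (intro sum_mono assms)
  finally show ?thesis by simp
qed

lemma test_lbump: "test (lbump :: real ^ 'n::finite \<Rightarrow> complex)"
proof (rule testI[OF smooth_lbump compact_cball])
  fix z :: "real ^ 'n" assume z: "z \<notin> cball 0 (real CARD('n) * 1)"
  have "\<exists>i. \<bar>z $ i\<bar> \<ge> 1"
  proof (rule ccontr)
    assume "\<nexists>i. \<bar>z $ i\<bar> \<ge> 1"
    then have "norm z \<le> real CARD('n) * 1" by (intro norm_le_card) (auto simp: not_le less_imp_le)
    with z show False by simp
  qed
  then show "lbump z = 0" using lbump_zero by blast
qed

lemma lbump_sum:
  fixes z :: "real ^ 'n::finite"
  assumes "\<And>i. \<bar>z $ i\<bar> \<le> real m"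
  shows "(\<Sum>k\<in>PiE UNIV (\<lambda>_. {- int m..int m}). lbump (z - lvec k)) = 1"
proof -
  have "(\<Sum>k\<in>PiE UNIV (\<lambda>_. {- int m..int m}). lbump (z - lvec k)) = 
      (\<Prod>i\<in>(UNIV::'n set). \<Sum>j\<in>{- int m..int m}. complex_of_real (tent (z $ i - of_int j)))"
    unfolding lbump_def lvec_def by (subst prod_sum_PiE) auto
  also have "\<dots> = (\<Prod>i\<in>(UNIV::'n set). complex_of_real (\<Sum>j\<in>{- int m..int m}. tent (z $ i - of_int j)))" by simp
  also have "\<dots> = 1"
  proof (rule prod.neutral, intro ballI)
    fix i
    have "z $ i \<le> real m" "- real m \<le> z $ i" using assms[of i] by auto
    then show "complex_of_real (\<Sum>j\<in>{- int m..int m}. tent (z $ i - of_int j)) = 1"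
      unfolding tent_sum by (simp add: step_0 step_1)
  qed
  finally show ?thesis .
qed

text \<open>In each coordinate an interval of length 2 contains at most three integers.\<close>

lemma lattice_count: "finite {k :: 'n::finite \<Rightarrow> int. \<forall>i. \<bar>z $ i - of_int (k i)\<bar> \<le> 1}" (is "finite ?S")
  "card {k :: 'n::finite \<Rightarrow> int. \<forall>i. \<bar>z $ i - of_int (k i)\<bar> \<le> (1::real)} \<le> 3 ^ CARD('n)"
proof -
  let ?I = "\<lambda>i. {\<lceil>z $ i - 1\<rceil>..\<lfloor>z $ i + 1\<rfloor>}"
  have sub: "{k :: 'n \<Rightarrow> int. \<forall>i. \<bar>z $ i - of_int (k i)\<bar> \<le> 1} \<subseteq> PiE UNIV ?I"
  proof
    fix k :: "'n \<Rightarrow> int" assume k: "k \<in> {k. \<forall>i. \<bar>z $ i - of_int (k i)\<bar> \<le> 1}"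
    have "k i \<in> ?I i" for i
    proof -
      have "\<bar>z $ i - of_int (k i)\<bar> \<le> 1" using k by blast
      then have "z $ i - 1 \<le> of_int (k i)" "of_int (k i) \<le> z $ i + 1" by linarith+
      then show ?thesis by (simp only: atLeastAtMost_iff ceiling_le_iff le_floor_iff simp_thms)
    qed
    then show "k \<in> PiE UNIV ?I" by (simp add: PiE_UNIV_domain)
  qed
  have fin: "finite (PiE (UNIV :: 'n set) ?I)" by (intro finite_PiE) auto
  show "finite {k :: 'n \<Rightarrow> int. \<forall>i. \<bar>z $ i - of_int (k i)\<bar> \<le> 1}" by (rule finite_subset[OF sub fin])
  have "card {k :: 'n \<Rightarrow> int. \<forall>i. \<bar>z $ i - of_int (k i)\<bar> \<le> 1} \<le> card (PiE (UNIV :: 'n set) ?I)"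
    by (rule card_mono[OF fin sub])
  also have "\<dots> = (\<Prod>i\<in>(UNIV :: 'n set). card (?I i))" by (simp add: card_PiE)
  also have "\<dots> \<le> (\<Prod>i\<in>(UNIV :: 'n set). 3)"
  proof (rule prod_mono)
    fix i :: 'n
    show "0 \<le> card (?I i) \<and> card (?I i) \<le> 3"
      using floor_le_ceiling[of "z $ i"] by (simp add: nat_le_iff)
  qed
  finally show "card {k :: 'n \<Rightarrow> int. \<forall>i. \<bar>z $ i - of_int (k i)\<bar> \<le> 1} \<le> 3 ^ CARD('n)" by simp
qed

text \<open>A partition of unity of mesh \<open>e\<close> near \<open>K\<close>, with a point
  \<open>p k\<close> of \<open>K\<close> attached to each cell. \<open>B\<close> and
  \<open>c\<close> are parameters because their independence of \<open>K\<close> and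
  \<open>e\<close> is what the later estimates rest on.\<close>

definition lattice_cover :: "nat \<Rightarrow> real \<Rightarrow> real \<Rightarrow> (real ^ 'n::finite) set \<Rightarrow> real \<Rightarrow> ('n \<Rightarrow> int) set \<Rightarrow>
    (('n \<Rightarrow> int) \<Rightarrow> real ^ 'n \<Rightarrow> complex) \<Rightarrow> (('n \<Rightarrow> int) \<Rightarrow> real ^ 'n) \<Rightarrow> bool" where
  "lattice_cover n B c K e J b p \<longleftrightarrow> finite J \<and>
       (\<forall>k\<in>J. test (b k) \<and> p k \<in> K) \<and> (\<forall>z. \<forall>a\<in>K. norm (z - a) < e \<longrightarrow> (\<Sum>k\<in>J. b k z) = 1) \<and>
       (\<forall>k\<in>J. \<forall>z\<in>fun_support (b k). norm (z - p k) \<le> c * e) \<and> 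
       (\<forall>k\<in>J. \<forall>\<gamma> z. mi_abs \<gamma> \<le> n \<longrightarrow> cmod (pd \<gamma> (b k) z) \<le> B * (1 / e) ^ mi_abs \<gamma>) \<and>
       (\<forall>z. card {k\<in>J. z \<in> fun_support (b k)} \<le> 3 ^ CARD('n))"

lemma lattice_coverD:
  assumes "lattice_cover n B c K e J b (p :: _ \<Rightarrow> real ^ 'n::finite)"
  shows "finite J" "k \<in> J \<Longrightarrow> test (b k)" "k \<in> J \<Longrightarrow> p k \<in> K"
    "a \<in> K \<Longrightarrow> norm (z - a) < e \<Longrightarrow> (\<Sum>k\<in>J. b k z) = 1"
    "k \<in> J \<Longrightarrow> z \<in> fun_support (b k) \<Longrightarrow> norm (z - p k) \<le> c * e"
    "k \<in> J \<Longrightarrow> mi_abs \<gamma> \<le> n \<Longrightarrow> cmod (pd \<gamma> (b k) z) \<le> B * (1 / e) ^ mi_abs \<gamma>"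
    "card {k\<in>J. z \<in> fun_support (b k)} \<le> 3 ^ CARD('n)"
  using assms unfolding lattice_cover_def by auto

lemma lattice_partition:
  fixes n :: nat
  obtains B c :: real where "B \<ge> 0" "c \<ge> 1" 
    "\<And>(K :: (real ^ 'n::finite) set) e. compact K \<Longrightarrow> 0 < e \<Longrightarrow> e \<le> 1 \<Longrightarrow> \<exists>J b p. lattice_cover n B c K e J b p"
proof -
  obtain B where B: "B \<ge> 0" "bd n B (lbump :: real ^ 'n \<Rightarrow> complex)" by (rule test_bd[OF test_lbump, of n], rule that)
  let ?d = "real CARD('n)"
  show ?thesis
  proof (rule that[of B "2 * ?d + 1"])
    fix K :: "(real ^ 'n) set" and e :: real
    assume K: "compact K" and e: "0 < e" "e \<le> 1"
    obtain R where R: "R > 0" "\<And>x. x \<in> K \<Longrightarrow> norm x \<le> R" using compact_imp_bounded[OF K] by (auto simp: bounded_pos)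
    \<comment> \<open>Makes the finite box of lattice points large enough for the sum to be 1 on the
      \<open>e\<close>-neighbourhood of \<open>K\<close>.\<close>
    define m where "m = nat \<lceil>(R + 1) / e\<rceil>"
    have m: "(R + 1) / e \<le> real m" unfolding m_def by (rule real_nat_ceiling_ge)
    define I where "I = PiE (UNIV :: 'n set) (\<lambda>_. {- int m..int m})"
    \<comment> \<open>The cells that can meet the \<open>e\<close>-neighbourhood of
      \<open>K\<close>: a point of a cell lies within \<open>?d * e\<close> of the lattice point,
      and a point of \<open>K\<close> is at most \<open>e\<close> further away.\<close>
    define J where "J = {k\<in>I. \<exists>a\<in>K. norm (a - e *\<^sub>R lvec k) \<le> (1 + ?d) * e}"
    define p where "p k = (SOME a. a \<in> K \<and> norm (a - e *\<^sub>R lvec k) \<le> (1 + ?d) * e)" for k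
    define b where "b k z = lbump ((1 / e) *\<^sub>R z + (- lvec k))" for k and z :: "real ^ 'n"
    have fI: "finite I" unfolding I_def by (intro finite_PiE) auto
    then have fJ: "finite J" by (simp add: J_def)
    have p: "p k \<in> K" "norm (p k - e *\<^sub>R lvec k) \<le> (1 + ?d) * e" if "k \<in> J" for k
    proof -
      have "\<exists>a. a \<in> K \<and> norm (a - e *\<^sub>R lvec k) \<le> (1 + ?d) * e" using that by (auto simp: J_def)
      then have "p k \<in> K \<and> norm (p k - e *\<^sub>R lvec k) \<le> (1 + ?d) * e" unfolding p_def by (rule someI_ex)
      then show "p k \<in> K" "norm (p k - e *\<^sub>R lvec k) \<le> (1 + ?d) * e" by auto
    qed
    have sb: "smooth (b k)" for k unfolding b_def[abs_def] by (rule smooth_affine[OF smooth_lbump])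
    have supp: "fun_support (b k) \<subseteq> {z. \<forall>i. \<bar>((1 / e) *\<^sub>R z) $ i - of_int (k i)\<bar> \<le> 1}" for k
    proof (rule fun_support_subset)
      have "{z. \<forall>i. \<bar>((1 / e) *\<^sub>R z) $ i - of_int (k i)\<bar> \<le> 1} = (\<Inter>i. {z::real^'n. \<bar>((1 / e) *\<^sub>R z) $ i - of_int (k i)\<bar> \<le> 1})" by auto
      also have "closed \<dots>" by (intro closed_INT ballI closed_Collect_le continuous_intros)
      finally show "closed {z::real^'n. \<forall>i. \<bar>((1 / e) *\<^sub>R z) $ i - of_int (k i)\<bar> \<le> 1}" .
      fix z :: "real ^ 'n" assume "z \<notin> {z. \<forall>i. \<bar>((1 / e) *\<^sub>R z) $ i - of_int (k i)\<bar> \<le> 1}"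
      then obtain i where "\<not> \<bar>((1 / e) *\<^sub>R z) $ i - of_int (k i)\<bar> \<le> 1" by blast
      then have "\<bar>((1 / e) *\<^sub>R z + (- lvec k)) $ i\<bar> \<ge> 1" by (simp add: lvec_def)
      then show "b k z = 0" unfolding b_def by (rule lbump_zero)
    qed
    have near: "norm (z - e *\<^sub>R lvec k) \<le> ?d * e" if "z \<in> fun_support (b k)" for z k
    proof -
      have "z \<in> {z. \<forall>i. \<bar>((1 / e) *\<^sub>R z) $ i - of_int (k i)\<bar> \<le> 1}" using supp that by blast
      then have z: "\<bar>((1 / e) *\<^sub>R z) $ i - of_int (k i)\<bar> \<le> 1" for i by blast
      show ?thesis
      proof (rule norm_le_card)
        fix i
        have "(z - e *\<^sub>R lvec k) $ i = e * (((1 / e) *\<^sub>R z) $ i - of_int (k i))"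
          using e by (simp add: lvec_def field_simps)
        then have "\<bar>(z - e *\<^sub>R lvec k) $ i\<bar> = e * \<bar>((1 / e) *\<^sub>R z) $ i - of_int (k i)\<bar>" using e by (simp add: abs_mult)
        also have "\<dots> \<le> e * 1" by (rule mult_left_mono[OF z]) (use e in simp)
        finally show "\<bar>(z - e *\<^sub>R lvec k) $ i\<bar> \<le> e" by simp
      qed
    qed
    show "\<exists>J b p. lattice_cover n B (2 * ?d + 1) K e J b p"
      unfolding lattice_cover_def
    proof (intro exI[of _ J] exI[of _ b] exI[of _ p] conjI ballI allI impI)
      show "finite J" by (rule fJ)
      show "p k \<in> K" if "k \<in> J" for k by (rule p(1)[OF that])
      show "test (b k)" for k
      proof (rule testI[OF sb compact_cball])
        fix z assume z: "z \<notin> cball (e *\<^sub>R lvec k) (?d * e)"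
        have "z \<notin> fun_support (b k)"
          using near[of z k] z by (auto simp: dist_norm norm_minus_commute)
        then show "b k z = 0" by (rule not_in_fun_support)
      qed
      show "norm (z - p k) \<le> (2 * ?d + 1) * e" if k: "k \<in> J" and z: "z \<in> fun_support (b k)" for k z
      proof -
        have "norm (z - p k) \<le> norm (z - e *\<^sub>R lvec k) + norm (p k - e *\<^sub>R lvec k)"
          using norm_triangle_ineq4[of "z - e *\<^sub>R lvec k" "p k - e *\<^sub>R lvec k"] by simp
        also have "\<dots> \<le> ?d * e + (1 + ?d) * e" by (rule add_mono[OF near[OF z] p(2)[OF k]])
        finally show ?thesis by (simp add: algebra_simps)
      qed
      show "cmod (pd \<gamma> (b k) z) \<le> B * (1 / e) ^ mi_abs \<gamma>" if "mi_abs \<gamma> \<le> n" for k \<gamma> z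
      proof -
        have "cmod (pd \<gamma> (b k) z) = (1 / e) ^ mi_abs \<gamma> * cmod (pd \<gamma> lbump ((1 / e) *\<^sub>R z + (- lvec k)))"
          unfolding b_def[abs_def] pd_affine[OF smooth_lbump] norm_mult norm_of_real using e by simp
        also have "\<dots> \<le> (1 / e) ^ mi_abs \<gamma> * B"
          by (rule mult_left_mono[OF bdD[OF B(2) that]]) (use e in simp)
        finally show ?thesis by (simp add: mult.commute)
      qed
      show "card {k\<in>J. z \<in> fun_support (b k)} \<le> 3 ^ CARD('n)" for z
      proof (rule order_trans[OF card_mono lattice_count(2)[of "(1 / e) *\<^sub>R z"]])
        show "{k\<in>J. z \<in> fun_support (b k)} \<subseteq> {k. \<forall>i. \<bar>((1 / e) *\<^sub>R z) $ i - of_int (k i)\<bar> \<le> 1}"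
          using supp by blast
      qed (rule lattice_count(1))
      fix z a assume a: "a \<in> K" and za: "norm (z - a) < e"
      have "norm z \<le> R + 1" using norm_triangle_ineq2[of z a] R(2)[OF a] za e by linarith
      then have "norm ((1 / e) *\<^sub>R z) \<le> real m" using order_trans[OF divide_right_mono m, of "norm z"] e by simp
      then have "\<bar>((1 / e) *\<^sub>R z) $ i\<bar> \<le> real m" for i using component_le_norm_cart order_trans by blast
      from lbump_sum[OF this] have "(\<Sum>k\<in>I. b k z) = 1" by (simp add: I_def b_def)
      moreover have "(\<Sum>k\<in>I. b k z) = (\<Sum>k\<in>J. b k z)"
      proof (rule sum.mono_neutral_right[OF fI])
        show "J \<subseteq> I" by (auto simp: J_def)
        show "\<forall>k\<in>I - J. b k z = 0"
        proof
          fix k assume k: "k \<in> I - J"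
          show "b k z = 0"
          proof (rule not_in_fun_support, rule notI)
            assume "z \<in> fun_support (b k)"
            then have "norm (z - e *\<^sub>R lvec k) \<le> ?d * e" by (rule near)
            then have "norm (a - e *\<^sub>R lvec k) \<le> (1 + ?d) * e"
              using norm_triangle_ineq4[of "z - e *\<^sub>R lvec k" "z - a"] za by (simp add: algebra_simps)
            then show False using k a by (auto simp: J_def)
          qed
        qed
      qed
      ultimately show "(\<Sum>k\<in>J. b k z) = 1" by simp
    qed
  qed (use B in auto)
qed

lemma sum_few:
  fixes f :: "'a \<Rightarrow> complex" and M :: real
  assumes "finite J" "\<And>k. k \<in> J \<Longrightarrow> k \<notin> J0 \<Longrightarrow> f k = 0" "\<And>k. k \<in> J \<Longrightarrow> cmod (f k) \<le> M" "card {k\<in>J. k \<in> J0} \<le> m" "M \<ge> 0"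
  shows "cmod (\<Sum>k\<in>J. f k) \<le> m * M"
proof -
  have "(\<Sum>k\<in>J. f k) = (\<Sum>k\<in>{k\<in>J. k \<in> J0}. f k)" by (rule sum.mono_neutral_right) (use assms in auto)
  also have "cmod \<dots> \<le> card {k\<in>J. k \<in> J0} * M" by (rule sum_norm_bound) (use assms in auto)
  also have "\<dots> \<le> m * M" by (intro mult_right_mono) (use assms in auto)
  finally show ?thesis .
qed

text \<open>The partition functions are summed at the smaller mesh e / (c + 1), so that their
  supports stay within c e / (c + 1) < e of \<open>K\<close>; only the constant in the derivative
  bounds changes.\<close>

lemma scaled_cutoff:
  obtains B :: real where "B \<ge> 0" "\<And>(K :: (real ^ 'n::finite) set) e. compact K \<Longrightarrow> 0 < e \<Longrightarrow> e \<le> 1 \<Longrightarrow> \<exists>\<zeta> V. test \<zeta> \<and> open V \<and> K \<subseteq> V \<and>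
       (\<forall>x\<in>V. \<zeta> x = 1) \<and> (\<forall>z\<in>fun_support \<zeta>. \<exists>a\<in>K. norm (z - a) < e) \<and>
       (\<forall>\<gamma> z. mi_abs \<gamma> \<le> n \<longrightarrow> cmod (pd \<gamma> \<zeta> z) \<le> B * (1 / e) ^ mi_abs \<gamma>)"
proof -
  obtain B c :: real where B: "B \<ge> 0" "c \<ge> 1" and
    P: "\<And>(K :: (real ^ 'n) set) e. compact K \<Longrightarrow> 0 < e \<Longrightarrow> e \<le> 1 \<Longrightarrow> \<exists>J b p. lattice_cover n B c K e J b p"
    by (rule lattice_partition[of n], rule that)
  let ?B = "3 ^ CARD('n) * (B * (c + 1) ^ n)"
  show ?thesis
  proof (rule that[of ?B])
    show "?B \<ge> 0" using B by simp
    fix K :: "(real ^ 'n) set" and e :: real assume K: "compact K" and e: "0 < e" "e \<le> 1"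
    let ?e = "e / (c + 1)"
    have e': "0 < ?e" "?e \<le> 1" "?e < e" using e B by (auto simp: divide_le_eq divide_less_eq)
    obtain J b p where L: "lattice_cover n B c K (?e) J b p"
      using P[OF K e'(1,2)] by (elim exE) 
    note J = lattice_coverD(1)[OF L] and b = lattice_coverD(2)[OF L] and p = lattice_coverD(3)[OF L] and one = lattice_coverD(4)[OF L]
      and near = lattice_coverD(5)[OF L] and der = lattice_coverD(6)[OF L] and cnt = lattice_coverD(7)[OF L]
    let ?\<zeta> = "\<lambda>z. \<Sum>k\<in>J. b k z" and ?V = "\<Union>a\<in>K. ball a ?e"
    have t: "test ?\<zeta>" by (rule test_sum[OF b])
    have nz: "?\<zeta> z = 0" if "z \<notin> (\<Union>k\<in>J. fun_support (b k))" for z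
      by (rule sum.neutral) (use that not_in_fun_support in blast)
    have sup: "fun_support ?\<zeta> \<subseteq> (\<Union>k\<in>J. fun_support (b k))"
      by (rule fun_support_subset[OF closed_UN[OF J] nz]) (simp_all add: closed_fun_support)
    show "\<exists>\<zeta> V. test \<zeta> \<and> open V \<and> K \<subseteq> V \<and>
       (\<forall>x\<in>V. \<zeta> x = 1) \<and> (\<forall>z\<in>fun_support \<zeta>. \<exists>a\<in>K. norm (z - a) < e) \<and>
       (\<forall>\<gamma> z. mi_abs \<gamma> \<le> n \<longrightarrow> cmod (pd \<gamma> \<zeta> z) \<le> ?B * (1 / e) ^ mi_abs \<gamma>)"
    proof (intro exI[of _ ?\<zeta>] exI[of _ ?V] conjI ballI allI impI)
      show "K \<subseteq> ?V" using e' by force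
      show "?\<zeta> x = 1" if "x \<in> ?V" for x
        using that one by (auto simp: dist_norm norm_minus_commute)
      show "\<exists>a\<in>K. norm (z - a) < e" if zz: "z \<in> fun_support ?\<zeta>" for z
      proof -
        obtain k where k: "k \<in> J" "z \<in> fun_support (b k)" using zz sup by blast
        have "norm (z - p k) \<le> c * ?e" by (rule near[OF k])
        also have "\<dots> < (c + 1) * ?e" by (rule mult_strict_right_mono) (use e' in auto)
        also have "\<dots> = e" using B by simp
        finally show ?thesis using p[OF k(1)] by blast
      qed
      fix \<gamma> :: "'n multiindex" and z assume \<gamma>: "mi_abs \<gamma> \<le> n"
      have "pd \<gamma> ?\<zeta> z = (\<Sum>k\<in>J. pd \<gamma> (b k) z)" by (subst pd_sum) (simp_all add: test_smooth b)
      also have "cmod \<dots> \<le> real (3 ^ CARD('n)) * (B * (1 / ?e) ^ mi_abs \<gamma>)"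
      proof (rule sum_few[of J "{k. z \<in> fun_support (b k)}" "\<lambda>k. pd \<gamma> (b k) z" "B * (1 / ?e) ^ mi_abs \<gamma>" "3 ^ CARD('n)"])
        show "pd \<gamma> (b k) z = 0" if "k \<in> J" "k \<notin> {k. z \<in> fun_support (b k)}" for k
          by (rule pd_outside_support[OF test_smooth[OF b[OF that(1)]]]) (use that in simp)
      qed (use J der[OF _ \<gamma>] cnt B e' in auto)
      also have "\<dots> \<le> real (3 ^ CARD('n)) * (B * ((c + 1) ^ n * (1 / e) ^ mi_abs \<gamma>))"
      proof (intro mult_left_mono)
        have "(1 / ?e) ^ mi_abs \<gamma> = (c + 1) ^ mi_abs \<gamma> * (1 / e) ^ mi_abs \<gamma>" by (simp add: power_divide)
        also have "\<dots> \<le> (c + 1) ^ n * (1 / e) ^ mi_abs \<gamma>"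
          by (intro mult_right_mono power_increasing) (use \<gamma> B e in auto)
        finally show "(1 / ?e) ^ mi_abs \<gamma> \<le> (c + 1) ^ n * (1 / e) ^ mi_abs \<gamma>" .
      qed (use B in auto)
      finally show "cmod (pd \<gamma> ?\<zeta> z) \<le> ?B * (1 / e) ^ mi_abs \<gamma>" by (simp add: mult.assoc)
    qed (rule t, blast)
  qed
qed

section \<open>Smoothing of Whitney jets\<close>

lemma mi_power_bound: "cmod (mi_power (cvec v) \<beta>) \<le> norm v ^ mi_abs \<beta>"
proof -
  have "cmod (mi_power (cvec v) \<beta>) = (\<Prod>i\<in>UNIV. \<bar>v $ i\<bar> ^ \<beta> i)"
    by (simp add: mi_power_def cvec_def prod_norm[symmetric] norm_power)
  also have "\<dots> \<le> (\<Prod>i\<in>UNIV. norm v ^ \<beta> i)"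
    by (intro prod_mono conjI power_mono component_le_norm_cart) auto
  finally show ?thesis by (simp add: mi_abs_def power_sum)
qed

text \<open>Bounds the number of terms of every Taylor sum of order \<open>n\<close>, including the
  shorter sums for derivatives.\<close>

definition Nm :: "nat \<Rightarrow> 'n::finite itself \<Rightarrow> real" where
  "Nm n _ = card {\<beta> :: 'n multiindex. mi_abs \<beta> \<le> n}"

lemma Nm_nonneg: "Nm n T \<ge> 0" by (simp add: Nm_def)

lemma tay_bound:
  fixes f :: "'n::finite jet" and M :: real
  assumes "\<And>\<beta>. mi_abs \<alpha> + mi_abs \<beta> \<le> n \<Longrightarrow> cmod (f (\<alpha> + \<beta>) x) * norm (z - x) ^ mi_abs \<beta> \<le> M" and M: "M \<ge> 0"
  shows "cmod (tay n f x \<alpha> z) \<le> Nm n TYPE('n) * M"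
proof -
  let ?S = "{\<beta> :: 'n multiindex. mi_abs \<alpha> + mi_abs \<beta> \<le> n}"
  have "cmod (tay n f x \<alpha> z) \<le> card ?S * M"
    unfolding tay_def
  proof (rule sum_norm_bound)
    fix \<beta> assume \<beta>: "\<beta> \<in> ?S"
    have "cmod (f (\<alpha> + \<beta>) x / of_nat (mi_fact \<beta>)) \<le> cmod (f (\<alpha> + \<beta>) x)"
    proof -
      have 1: "1 \<le> real (mi_fact \<beta>)" using mi_fact_pos[of \<beta>] by linarith
      have "cmod (f (\<alpha> + \<beta>) x) * 1 \<le> cmod (f (\<alpha> + \<beta>) x) * real (mi_fact \<beta>)"
        by (rule mult_left_mono[OF 1]) simp
      then show ?thesis using 1 by (simp add: norm_divide divide_le_eq)
    qed
    then have "cmod (f (\<alpha> + \<beta>) x / of_nat (mi_fact \<beta>) * mi_power (cvec (z - x)) \<beta>) \<le> cmod (f (\<alpha> + \<beta>) x) * norm (z - x) ^ mi_abs \<beta>"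
      unfolding norm_mult by (intro mult_mono mi_power_bound) auto
    also have "\<dots> \<le> M" using assms(1) \<beta> by simp
    finally show "cmod (f (\<alpha> + \<beta>) x / of_nat (mi_fact \<beta>) * mi_power (cvec (z - x)) \<beta>) \<le> M" .
  qed
  also have "\<dots> \<le> Nm n TYPE('n) * M"
    unfolding Nm_def by (intro mult_right_mono M of_nat_mono card_mono finite_multiindices) auto
  finally show ?thesis .
qed

lemma tay_diff: "tay n f x \<alpha> y - tay n g x \<alpha> y = tay n (\<lambda>\<alpha> x. f \<alpha> x - g \<alpha> x) x \<alpha> y"
  by (simp add: tay_def sum_subtractf[symmetric] diff_divide_distrib left_diff_distrib)

lemma tay_cong: "(\<And>\<alpha>. f \<alpha> x = g \<alpha> x) \<Longrightarrow> tay n f x \<alpha> y = tay n g x \<alpha> y"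
  by (simp add: tay_def)

text \<open>After re-expansion of the polynomial at \<open>a\<close> by \<open>tay_expand\<close>,
  the difference of the two polynomials has the Whitney remainders at \<open>a\<close> as its
  coefficients.\<close>

lemma tay_basepoint_change:
  fixes f :: "'n::finite jet" and A c e :: real
  assumes A: "A \<ge> 0" and e: "e > 0" and c: "c \<ge> 1" and pa: "norm (a - p) \<le> c * e" and za: "norm (z - a) \<le> e"
    and m: "\<And>\<alpha>. mi_abs \<alpha> \<le> n \<Longrightarrow> cmod (f \<alpha> a - tay n f p \<alpha> a) \<le> A * norm (a - p) ^ (n - mi_abs \<alpha>)" and \<delta>: "mi_abs \<delta> \<le> n"
  shows "cmod (tay n f p \<delta> z - tay n f a \<delta> z) \<le> Nm n TYPE('n) * (A * c ^ n * e ^ (n - mi_abs \<delta>))"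
proof -
  have "tay n f p \<delta> z - tay n f a \<delta> z = tay n (\<lambda>\<beta> x. tay n f p \<beta> x - f \<beta> x) a \<delta> z"
    unfolding tay_expand[of n f p \<delta> z a] by (rule tay_diff)
  also have "cmod \<dots> \<le> Nm n TYPE('n) * (A * c ^ n * e ^ (n - mi_abs \<delta>))"
  proof (rule tay_bound)
    fix \<beta> :: "'n multiindex" assume \<beta>: "mi_abs \<delta> + mi_abs \<beta> \<le> n"
    have "cmod (tay n f p (\<delta> + \<beta>) a - f (\<delta> + \<beta>) a) \<le> A * norm (a - p) ^ (n - mi_abs (\<delta> + \<beta>))"
      using m[of "\<delta> + \<beta>"] \<beta> by (simp add: norm_minus_commute)
    also have "\<dots> \<le> A * (c * e) ^ (n - mi_abs (\<delta> + \<beta>))" by (intro mult_left_mono power_mono pa A) simp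
    also have "\<dots> \<le> A * (c ^ n * e ^ (n - mi_abs (\<delta> + \<beta>)))"
      unfolding power_mult_distrib by (intro mult_left_mono mult_right_mono power_increasing A) (use c e in auto)
    finally have 1: "cmod (tay n f p (\<delta> + \<beta>) a - f (\<delta> + \<beta>) a) \<le> A * (c ^ n * e ^ (n - mi_abs (\<delta> + \<beta>)))" .
    have "cmod (tay n f p (\<delta> + \<beta>) a - f (\<delta> + \<beta>) a) * norm (z - a) ^ mi_abs \<beta> \<le> A * (c ^ n * e ^ (n - mi_abs (\<delta> + \<beta>))) * e ^ mi_abs \<beta>"
      by (intro mult_mono 1 power_mono za) (use A c e in auto)
    also have "\<dots> = A * c ^ n * e ^ (n - mi_abs (\<delta> + \<beta>) + mi_abs \<beta>)" by (simp only: power_add mult.assoc)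
    also have "n - mi_abs (\<delta> + \<beta>) + mi_abs \<beta> = n - mi_abs \<delta>" using \<beta> by simp
    finally show "cmod (tay n f p (\<delta> + \<beta>) a - f (\<delta> + \<beta>) a) * norm (z - a) ^ mi_abs \<beta> \<le> A * c ^ n * e ^ (n - mi_abs \<delta>)" .
  qed (use A c e in simp)
  finally show ?thesis .
qed

text \<open>Taylor polynomials at points of \<open>K\<close> are glued by the lattice partition.
  Within distance \<open>e\<close> of \<open>a\<close> the weights sum to 1, so the deviation from
  the polynomial at \<open>a\<close> is a weighted sum of differences of polynomials based at points
  O(e) apart; the powers of 1/e lost to the weights are regained from the remainders. Remainders
  enter only for pairs at distance at most \<open>c * e\<close>, so a small modulus of continuity of
  the jet gives a small \<open>A\<close>.\<close>

lemma whitney_smoothing: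
  obtains C c :: real where "C \<ge> 0" "c \<ge> 1" 
    "\<And>(K :: (real ^ 'n::finite) set) e f A. compact K \<Longrightarrow> 0 < e \<Longrightarrow> e \<le> 1 \<Longrightarrow> A \<ge> 0 \<Longrightarrow>
      \<forall>\<alpha> x y. mi_abs \<alpha> \<le> n \<longrightarrow> x \<in> K \<longrightarrow> y \<in> K \<longrightarrow> norm (y - x) \<le> c * e \<longrightarrow> cmod (f \<alpha> y - tay n f x \<alpha> y) \<le> A * norm (y - x) ^ (n - mi_abs \<alpha>) \<Longrightarrow>
      \<exists>g. test g \<and> (\<forall>a\<in>K. \<forall>z. norm (z - a) < e \<longrightarrow> (\<forall>\<gamma>. mi_abs \<gamma> \<le> n \<longrightarrow> 
          cmod (pd \<gamma> g z - tay n f a \<gamma> z) \<le> C * A * e ^ (n - mi_abs \<gamma>)))"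
proof -
  obtain B c :: real where B: "B \<ge> 0" "c \<ge> 1" and
    P: "\<And>(K :: (real ^ 'n) set) e. compact K \<Longrightarrow> 0 < e \<Longrightarrow> e \<le> 1 \<Longrightarrow> \<exists>J b p. lattice_cover n B c K e J b p"
    by (rule lattice_partition[of n], rule that)
  let ?N = "Nm n TYPE('n)"
  let ?C = "3 ^ CARD('n) * (2 ^ n * B * (?N * (c + 1) ^ n))"
  show ?thesis
  proof (rule that[of ?C "c + 1"])
    show "?C \<ge> 0" using B by (simp add: Nm_nonneg)
    show "c + 1 \<ge> 1" using B by simp
    fix K :: "(real ^ 'n) set" and e A :: real and f :: "'n jet"
    assume K: "compact K" and e: "0 < e" "e \<le> 1" and A: "A \<ge> 0" and
      mod0: "\<forall>\<alpha> x y. mi_abs \<alpha> \<le> n \<longrightarrow> x \<in> K \<longrightarrow> y \<in> K \<longrightarrow> norm (y - x) \<le> (c + 1) * e \<longrightarrow> cmod (f \<alpha> y - tay n f x \<alpha> y) \<le> A * norm (y - x) ^ (n - mi_abs \<alpha>)"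
    note mod = mod0[rule_format]
    obtain J b p where L: "lattice_cover n B c K (e) J b p"
      using P[OF K e] by (elim exE) 
    note J = lattice_coverD(1)[OF L] and b = lattice_coverD(2)[OF L] and p = lattice_coverD(3)[OF L] and one = lattice_coverD(4)[OF L]
      and near = lattice_coverD(5)[OF L] and der = lattice_coverD(6)[OF L] and cnt = lattice_coverD(7)[OF L]
    define g where "g z = (\<Sum>k\<in>J. b k z * tay n f (p k) 0 z)" for z
    have g: "test g" unfolding g_def by (intro test_sum test_mult2 smooth_tay b)
    show "\<exists>g. test g \<and> (\<forall>a\<in>K. \<forall>z. norm (z - a) < e \<longrightarrow> (\<forall>\<gamma>. mi_abs \<gamma> \<le> n \<longrightarrow> 
          cmod (pd \<gamma> g z - tay n f a \<gamma> z) \<le> ?C * A * e ^ (n - mi_abs \<gamma>)))"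
    proof (intro exI[of _ g] conjI ballI allI impI g)
      fix a z and \<gamma> :: "'n multiindex" assume a: "a \<in> K" and z: "norm (z - a) < e" and \<gamma>: "mi_abs \<gamma> \<le> n"
      let ?T = "\<lambda>k w. tay n f (p k) 0 w - tay n f a 0 w"
      let ?h = "\<lambda>w. \<Sum>k\<in>J. b k w * ?T k w"
      have sT: "smooth (?T k)" for k by (intro smooth_minus smooth_tay)
      have sh: "smooth (\<lambda>w. b k w * ?T k w)" if "k \<in> J" for k by (intro smooth_mult test_smooth b that sT)
      have "pd \<gamma> (\<lambda>w. g w - tay n f a 0 w) z = pd \<gamma> ?h z"
      proof (rule pd_cong_open[of _ _ "ball a e"])
        show "smooth (\<lambda>w. g w - tay n f a 0 w)" by (intro smooth_minus smooth_tay test_smooth g)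
        show "smooth ?h" by (intro smooth_sum sh)
        show "z \<in> ball a e" using z by (simp add: dist_norm norm_minus_commute)
        show "g w - tay n f a 0 w = ?h w" if "w \<in> ball a e" for w
        proof -
          have "(\<Sum>k\<in>J. b k w) = 1" by (rule one[OF a]) (use that in \<open>simp add: dist_norm norm_minus_commute\<close>)
          then have "tay n f a 0 w = (\<Sum>k\<in>J. b k w) * tay n f a 0 w" by simp
          also have "\<dots> = (\<Sum>k\<in>J. b k w * tay n f a 0 w)" by (rule sum_distrib_right)
          finally show ?thesis unfolding g_def by (simp add: sum_subtractf right_diff_distrib)
        qed
      qed simp
      then have "pd \<gamma> g z - tay n f a \<gamma> z = pd \<gamma> ?h z"
        by (simp add: pd_minus smooth_tay test_smooth[OF g] pd_tay)
      also have "\<dots> = (\<Sum>k\<in>J. pd \<gamma> (\<lambda>w. b k w * ?T k w) z)" by (subst pd_sum) (simp_all add: sh)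
      finally have eq: "pd \<gamma> g z - tay n f a \<gamma> z = (\<Sum>k\<in>J. pd \<gamma> (\<lambda>w. b k w * ?T k w) z)" .
      let ?D = "?N * (A * (c + 1) ^ n)"
      have D0: "?D \<ge> 0" using A B by (simp add: Nm_nonneg)
      let ?M = "2 ^ n * B * ?D * e ^ (n - mi_abs \<gamma>)"
      have off: "pd \<gamma> (\<lambda>w. b k w * ?T k w) z = 0" if k: "k \<in> J" "z \<notin> fun_support (b k)" for k
      proof (rule pd_outside_support[OF sh[OF k(1)]])
        show "z \<notin> fun_support (\<lambda>w. b k w * ?T k w)"
          using fun_support_mono[of "b k" "\<lambda>w. b k w * ?T k w"] k(2) by auto
      qed
      have M0: "?M \<ge> 0" using B D0 e by simp
      have bnd: "cmod (pd \<gamma> (\<lambda>w. b k w * ?T k w) z) \<le> ?M" if k: "k \<in> J" for k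
      proof (cases "z \<in> fun_support (b k)")
        case True
        have "norm (a - p k) \<le> norm (z - p k) + norm (z - a)" using norm_triangle_ineq4[of "z - p k" "z - a"] by simp
        also have "\<dots> \<le> (c + 1) * e" using near[OF k True] z by (simp add: algebra_simps)
        finally have ap: "norm (a - p k) \<le> (c + 1) * e" .
        have Tb: "cmod (pd \<delta> (?T k) z) \<le> (?D * e ^ n) * (1 / e) ^ mi_abs \<delta>" if \<delta>: "mi_abs \<delta> \<le> n" for \<delta>
        proof -
          have "pd \<delta> (?T k) z = tay n f (p k) \<delta> z - tay n f a \<delta> z" by (simp add: pd_minus smooth_tay pd_tay)
          also have "cmod \<dots> \<le> ?N * (A * (c + 1) ^ n * e ^ (n - mi_abs \<delta>))"
            by (rule tay_basepoint_change[OF A e(1) _ ap]) (use B z \<delta> mod[OF _ p[OF k] a ap] in auto)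
          also have "e ^ (n - mi_abs \<delta>) = e ^ n * (1 / e) ^ mi_abs \<delta>" using e \<delta> by (simp add: power_diff power_divide)
          finally show ?thesis by (simp add: mult.assoc)
        qed
        have "cmod (pd \<gamma> (\<lambda>w. b k w * ?T k w) z) \<le> 2 ^ mi_abs \<gamma> * B * (?D * e ^ n) * (1 / e) ^ mi_abs \<gamma>"
          by (rule leibniz_bound[OF test_smooth[OF b[OF k]] sT B(1)]) (use D0 e \<gamma> der[OF k] Tb in auto)
        also have "\<dots> \<le> 2 ^ n * B * (?D * e ^ n) * (1 / e) ^ mi_abs \<gamma>"
          by (intro mult_right_mono power_increasing) (use \<gamma> B D0 e in auto)
        also have "\<dots> = ?M" using e \<gamma> by (simp add: power_diff power_divide)
        finally show ?thesis .
      qed (use off[OF k] M0 in simp)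
      have "cmod (\<Sum>k\<in>J. pd \<gamma> (\<lambda>w. b k w * ?T k w) z) \<le> real (3 ^ CARD('n)) * ?M"
        by (rule sum_few[of J "{k. z \<in> fun_support (b k)}" "\<lambda>k. pd \<gamma> (\<lambda>w. b k w * ?T k w) z" ?M "3 ^ CARD('n)"]) (use J off bnd cnt M0 in auto)
      then show "cmod (pd \<gamma> g z - tay n f a \<gamma> z) \<le> ?C * A * e ^ (n - mi_abs \<gamma>)"
        unfolding eq by (simp add: ac_simps)
    qed
  qed
qed

section \<open>Seminorms of Whitney jets\<close>

text \<open>A bound by \<open>A\<close> of both parts of the Whitney seminorm of order
  \<open>n\<close>, multiplied out: an inequality between reals without suprema, and one in which
  pairs with x = y need no exception.\<close>

definition wb :: "nat \<Rightarrow> (real ^ 'n::finite) set \<Rightarrow> real \<Rightarrow> 'n jet \<Rightarrow> bool" where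
  "wb n K A h \<longleftrightarrow> (\<forall>\<alpha>. mi_abs \<alpha> \<le> n \<longrightarrow> (\<forall>x\<in>K. cmod (h \<alpha> x) \<le> A \<and>
     (\<forall>y\<in>K. cmod (h \<alpha> y - tay n h x \<alpha> y) \<le> A * norm (y - x) ^ (n - mi_abs \<alpha>))))"

lemma wbD:
  assumes "wb n K A h" "mi_abs \<alpha> \<le> n" "x \<in> K"
  shows "cmod (h \<alpha> x) \<le> A" "y \<in> K \<Longrightarrow> cmod (h \<alpha> y - tay n h x \<alpha> y) \<le> A * norm (y - x) ^ (n - mi_abs \<alpha>)"
  using assms unfolding wb_def by auto

lemma wb_subset: "wb n K A h \<Longrightarrow> L \<subseteq> K \<Longrightarrow> wb n L A h"
  unfolding wb_def by blast

lemma wb_le: "wb n K A h \<Longrightarrow> A \<le> B \<Longrightarrow> wb n K B h"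
  unfolding wb_def by (meson mult_right_mono norm_ge_zero order_trans zero_le_power)

lemma wb_cong: 
  assumes "\<And>\<alpha> x. x \<in> K \<Longrightarrow> h \<alpha> x = h' \<alpha> x" "wb n K A h" 
  shows "wb n K A h'"
proof -
  have "tay n h x \<alpha> y = tay n h' x \<alpha> y" if "x \<in> K" for x \<alpha> y by (rule tay_cong) (rule assms(1)[OF that])
  with assms show ?thesis unfolding wb_def by auto
qed

lemma tay_add: "tay n (\<lambda>\<alpha> x. f \<alpha> x + g \<alpha> x) x \<alpha> y = tay n f x \<alpha> y + tay n g x \<alpha> y"
  by (simp add: tay_def sum.distrib[symmetric] add_divide_distrib distrib_right)

lemma tay_cmult: "tay n (\<lambda>\<alpha> x. c * f \<alpha> x) x \<alpha> y = c * tay n f x \<alpha> y"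
  by (simp add: tay_def sum_distrib_left mult.assoc)

lemma wb_add: 
  assumes f: "wb n K A f" and g: "wb n K B g" shows "wb n K (A + B) (\<lambda>\<alpha> x. f \<alpha> x + g \<alpha> x)"
  unfolding wb_def
proof (intro allI impI ballI conjI)
  fix \<alpha> :: "'a multiindex" and x y assume \<alpha>: "mi_abs \<alpha> \<le> n" and x: "x \<in> K" 
  show "cmod (f \<alpha> x + g \<alpha> x) \<le> A + B"
    by (rule order_trans[OF norm_triangle_ineq add_mono[OF wbD(1)[OF f \<alpha> x] wbD(1)[OF g \<alpha> x]]])
  assume y: "y \<in> K"
  have "f \<alpha> y + g \<alpha> y - tay n (\<lambda>\<alpha> x. f \<alpha> x + g \<alpha> x) x \<alpha> y = (f \<alpha> y - tay n f x \<alpha> y) + (g \<alpha> y - tay n g x \<alpha> y)"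
    by (simp add: tay_add)
  also have "cmod \<dots> \<le> A * norm (y - x) ^ (n - mi_abs \<alpha>) + B * norm (y - x) ^ (n - mi_abs \<alpha>)"
    by (rule order_trans[OF norm_triangle_ineq add_mono[OF wbD(2)[OF f \<alpha> x y] wbD(2)[OF g \<alpha> x y]]])
  finally show "cmod (f \<alpha> y + g \<alpha> y - tay n (\<lambda>\<alpha> x. f \<alpha> x + g \<alpha> x) x \<alpha> y) \<le> (A + B) * norm (y - x) ^ (n - mi_abs \<alpha>)"
    by (simp add: distrib_right)
qed

lemma wb_cmult: 
  assumes f: "wb n K A f" shows "wb n K (cmod c * A) (\<lambda>\<alpha> x. c * f \<alpha> x)"
  unfolding wb_def
proof (intro allI impI ballI conjI)
  fix \<alpha> :: "'a multiindex" and x y assume \<alpha>: "mi_abs \<alpha> \<le> n" and x: "x \<in> K" 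
  show "cmod (c * f \<alpha> x) \<le> cmod c * A"
    unfolding norm_mult by (rule mult_left_mono[OF wbD(1)[OF f \<alpha> x]]) simp
  assume y: "y \<in> K"
  show "cmod (c * f \<alpha> y - tay n (\<lambda>\<alpha> x. c * f \<alpha> x) x \<alpha> y) \<le> cmod c * A * norm (y - x) ^ (n - mi_abs \<alpha>)"
    unfolding tay_cmult right_diff_distrib[symmetric] norm_mult mult.assoc by (rule mult_left_mono[OF wbD(2)[OF f \<alpha> x y]]) simp
qed

lemma wb_zero: "wb n K 0 (\<lambda>\<alpha> x. 0)"
  by (simp add: wb_def tay_def)

lemma wb_sum:
  assumes "finite S" "\<And>i. i \<in> S \<Longrightarrow> wb n K (A i) (f i)"
  shows "wb n K (\<Sum>i\<in>S. A i) (\<lambda>\<alpha> x. \<Sum>i\<in>S. f i \<alpha> x)"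
  using assms
proof (induction S)
  case (insert i S)
  then show ?case using wb_add[of n K "A i" "f i" "sum A S" "\<lambda>\<alpha> x. \<Sum>i\<in>S. f i \<alpha> x"] by simp
qed (simp add: wb_zero)

text \<open>The remainders of order n' are not among those of order \<open>n\<close>. The two Taylor
  sums differ by terms of degree above n' - |\<alpha>|, which on a compact set are bounded by the
  required power of the distance.\<close>

lemma wb_order_mono:
  fixes K :: "(real ^ 'n::finite) set"
  assumes K: "compact K" and n: "n' \<le> n"
  obtains C where "C \<ge> 0" "\<And>A h. A \<ge> 0 \<Longrightarrow> wb n K A h \<Longrightarrow> wb n' K (C * A) h"
proof -
  obtain R where R: "R > 0" "\<And>x. x \<in> K \<Longrightarrow> norm x \<le> R" using compact_imp_bounded[OF K] by (auto simp: bounded_pos)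
  define D where "D = max 1 (2 * R)"
  have D: "D \<ge> 1" by (simp add: D_def)
  have dist: "norm (y - x) \<le> D" if "x \<in> K" "y \<in> K" for x y
    using R(2)[OF that(1)] R(2)[OF that(2)] norm_triangle_ineq4[of y x] by (simp add: D_def)
  let ?C = "1 + D ^ n * (1 + card {\<beta> :: 'n multiindex. mi_abs \<beta> \<le> n})"
  have pw: "norm (y - x) ^ k \<le> D ^ n * norm (y - x) ^ l" if "x \<in> K" "y \<in> K" "l \<le> k" "k \<le> n" for x y k l
  proof -
    have "norm (y - x) ^ k = norm (y - x) ^ (k - l) * norm (y - x) ^ l" using that by (simp add: power_add[symmetric])
    also have "\<dots> \<le> D ^ (k - l) * norm (y - x) ^ l" by (intro mult_right_mono power_mono dist that) auto
    also have "\<dots> \<le> D ^ n * norm (y - x) ^ l" by (intro mult_right_mono power_increasing) (use that D in auto)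
    finally show ?thesis .
  qed
  show ?thesis
  proof (rule that[of ?C])
    show "?C \<ge> 0" using D by simp
    fix A and h :: "'n jet" assume A: "A \<ge> 0" and h: "wb n K A h"
    show "wb n' K (?C * A) h"
      unfolding wb_def
    proof (intro allI impI ballI conjI)
      fix \<alpha> :: "'n multiindex" and x y assume \<alpha>: "mi_abs \<alpha> \<le> n'" and x: "x \<in> K"
      have "cmod (h \<alpha> x) \<le> 1 * A" using wbD(1)[OF h _ x] \<alpha> n by simp
      also have "\<dots> \<le> ?C * A" by (rule mult_right_mono) (use A D in auto)
      finally show "cmod (h \<alpha> x) \<le> ?C * A" .
      assume y: "y \<in> K"
      let ?w = "norm (y - x) ^ (n' - mi_abs \<alpha>)"
      let ?S = "{\<beta> :: 'n multiindex. mi_abs \<alpha> + mi_abs \<beta> \<le> n}" and ?S' = "{\<beta> :: 'n multiindex. mi_abs \<alpha> + mi_abs \<beta> \<le> n'}"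
      let ?t = "\<lambda>\<beta>. h (\<alpha> + \<beta>) x / of_nat (mi_fact \<beta>) * mi_power (cvec (y - x)) \<beta>"
      have eq: "tay n h x \<alpha> y - tay n' h x \<alpha> y = (\<Sum>\<beta>\<in>?S - ?S'. ?t \<beta>)"
        unfolding tay_def by (rule sum_diff[symmetric, OF finite_mi]) (use n in auto)
      have "cmod (\<Sum>\<beta>\<in>?S - ?S'. ?t \<beta>) \<le> card (?S - ?S') * (A * (D ^ n * ?w))"
      proof (rule sum_norm_bound)
        fix \<beta> assume \<beta>: "\<beta> \<in> ?S - ?S'"
        have 1: "1 \<le> real (mi_fact \<beta>)" using mi_fact_pos[of \<beta>] by linarith
        have "cmod (h (\<alpha> + \<beta>) x / of_nat (mi_fact \<beta>)) \<le> A"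
        proof -
          have "cmod (h (\<alpha> + \<beta>) x) \<le> A" using wbD(1)[OF h _ x] \<beta> by simp
          moreover have "A * 1 \<le> A * real (mi_fact \<beta>)" by (rule mult_left_mono[OF 1 A])
          ultimately show ?thesis using 1 by (simp add: norm_divide divide_le_eq)
        qed
        moreover have "cmod (mi_power (cvec (y - x)) \<beta>) \<le> D ^ n * ?w"
          by (rule order_trans[OF mi_power_bound pw[OF x y]]) (use \<beta> in auto)
        ultimately show "cmod (?t \<beta>) \<le> A * (D ^ n * ?w)" unfolding norm_mult by (intro mult_mono) (use A in auto)
      qed
      also have "\<dots> \<le> card {\<beta> :: 'n multiindex. mi_abs \<beta> \<le> n} * (A * (D ^ n * ?w))"
      proof (rule mult_right_mono)
        show "real (card (?S - ?S')) \<le> real (card {\<beta> :: 'n multiindex. mi_abs \<beta> \<le> n})"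
          by (rule of_nat_mono, rule card_mono[OF finite_multiindices]) auto
        show "0 \<le> A * (D ^ n * ?w)" using A D by simp
      qed
      finally have 1: "cmod (tay n h x \<alpha> y - tay n' h x \<alpha> y) \<le> card {\<beta> :: 'n multiindex. mi_abs \<beta> \<le> n} * (A * (D ^ n * ?w))"
        unfolding eq .
      have "cmod (h \<alpha> y - tay n h x \<alpha> y) \<le> A * norm (y - x) ^ (n - mi_abs \<alpha>)" using wbD(2)[OF h _ x y] \<alpha> n by simp
      also have "\<dots> \<le> A * (D ^ n * ?w)" by (intro mult_left_mono pw x y A) (use n in auto)
      finally have 2: "cmod (h \<alpha> y - tay n h x \<alpha> y) \<le> A * (D ^ n * ?w)" .
      have "h \<alpha> y - tay n' h x \<alpha> y = (h \<alpha> y - tay n h x \<alpha> y) + (tay n h x \<alpha> y - tay n' h x \<alpha> y)" by simp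
      also have "cmod \<dots> \<le> A * (D ^ n * ?w) + card {\<beta> :: 'n multiindex. mi_abs \<beta> \<le> n} * (A * (D ^ n * ?w))"
        by (rule order_trans[OF norm_triangle_ineq add_mono[OF 2 1]])
      also have "\<dots> \<le> ?C * A * ?w" using A by (simp add: algebra_simps)
      finally show "cmod (h \<alpha> y - tay n' h x \<alpha> y) \<le> ?C * A * ?w" .
    qed
  qed
qed

definition jop :: "'n::finite multiindex set \<Rightarrow> ('n multiindex \<Rightarrow> complex) \<Rightarrow> 'n jet \<Rightarrow> 'n jet" where
  "jop S a f \<beta> x = (\<Sum>\<alpha>\<in>S. a \<alpha> * f (\<beta> + \<alpha>) x)"

lemma jop_jets: "smooth \<psi> \<Longrightarrow> jop S a (jets \<psi>) = jets (pdo S a \<psi>)"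
  by (simp add: jop_def[abs_def] jets_def pd_pdo)

text \<open>Shifting a jet by \<open>\<alpha>\<close> turns Taylor sums of order n + m into Taylor
  sums of order n + m - |\<alpha>|. This order is at least \<open>n\<close>, and
  \<open>wb_order_mono\<close> brings all shifts to order \<open>n\<close>.\<close>

lemma wb_jop:
  fixes K :: "(real ^ 'n::finite) set"
  assumes K: "compact K" and S: "finite S" and m: "\<And>\<alpha>. \<alpha> \<in> S \<Longrightarrow> mi_abs \<alpha> \<le> m"
  obtains C where "C \<ge> 0" "\<And>A h. A \<ge> 0 \<Longrightarrow> wb (n + m) K A h \<Longrightarrow> wb n K (C * A) (jop S a h)"
proof -
  have "\<exists>C. C \<ge> 0 \<and> (\<forall>A h. A \<ge> 0 \<longrightarrow> wb (n + m) K A h \<longrightarrow> wb n K (C * A) (\<lambda>\<beta>. h (\<beta> + \<alpha>)))" if \<alpha>: "\<alpha> \<in> S" for \<alpha>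
  proof -
    have le: "n \<le> n + m - mi_abs \<alpha>" using m[OF \<alpha>] by simp
    obtain C where C: "C \<ge> 0" "\<And>A h. A \<ge> 0 \<Longrightarrow> wb (n + m - mi_abs \<alpha>) K A h \<Longrightarrow> wb n K (C * A) h"
      by (rule wb_order_mono[OF K le], rule that)
    have "wb (n + m - mi_abs \<alpha>) K A (\<lambda>\<beta>. h (\<beta> + \<alpha>))" if h: "wb (n + m) K A h" for A h
      unfolding wb_def
    proof (intro allI impI ballI conjI)
      fix \<beta> :: "'n multiindex" and x y assume \<beta>: "mi_abs \<beta> \<le> n + m - mi_abs \<alpha>" and x: "x \<in> K"
      have \<beta>\<alpha>: "mi_abs (\<beta> + \<alpha>) \<le> n + m" using \<beta> m[OF \<alpha>] by simp
      show "cmod (h (\<beta> + \<alpha>) x) \<le> A" by (rule wbD(1)[OF h \<beta>\<alpha> x])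
      assume y: "y \<in> K"
      have "{\<gamma> :: 'n multiindex. mi_abs \<beta> + mi_abs \<gamma> \<le> n + m - mi_abs \<alpha>} = {\<gamma>. mi_abs (\<beta> + \<alpha>) + mi_abs \<gamma> \<le> n + m}"
        using m[OF \<alpha>] by auto
      then have "tay (n + m - mi_abs \<alpha>) (\<lambda>\<beta>. h (\<beta> + \<alpha>)) x \<beta> y = tay (n + m) h x (\<beta> + \<alpha>) y"
        unfolding tay_def by (simp add: ac_simps)
      moreover have "n + m - mi_abs (\<beta> + \<alpha>) = n + m - mi_abs \<alpha> - mi_abs \<beta>" by simp
      ultimately show "cmod (h (\<beta> + \<alpha>) y - tay (n + m - mi_abs \<alpha>) (\<lambda>\<beta>. h (\<beta> + \<alpha>)) x \<beta> y) \<le> A * norm (y - x) ^ (n + m - mi_abs \<alpha> - mi_abs \<beta>)"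
        using wbD(2)[OF h \<beta>\<alpha> x y] by simp
    qed
    with C show ?thesis by blast
  qed
  then obtain C where C: "\<And>\<alpha>. \<alpha> \<in> S \<Longrightarrow> C \<alpha> \<ge> 0" 
     "\<And>\<alpha> A h. \<alpha> \<in> S \<Longrightarrow> A \<ge> 0 \<Longrightarrow> wb (n + m) K A h \<Longrightarrow> wb n K (C \<alpha> * A) (\<lambda>\<beta>. h (\<beta> + \<alpha>))" by metis
  show ?thesis
  proof (rule that[of "\<Sum>\<alpha>\<in>S. cmod (a \<alpha>) * C \<alpha>"])
    show "0 \<le> (\<Sum>\<alpha>\<in>S. cmod (a \<alpha>) * C \<alpha>)" by (intro sum_nonneg mult_nonneg_nonneg C) auto
    fix A h assume A: "A \<ge> 0" and h: "wb (n + m) K A h"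
    have "wb n K (\<Sum>\<alpha>\<in>S. cmod (a \<alpha>) * (C \<alpha> * A)) (\<lambda>\<beta> x. \<Sum>\<alpha>\<in>S. a \<alpha> * h (\<beta> + \<alpha>) x)"
      by (rule wb_sum[OF S wb_cmult[OF C(2)[OF _ A h]]])
    then show "wb n K ((\<Sum>\<alpha>\<in>S. cmod (a \<alpha>) * C \<alpha>) * A) (jop S a h)"
      by (simp add: jop_def[abs_def] sum_distrib_right mult.assoc)
  qed
qed

section \<open>Jets of smooth functions\<close>

lemma smooth_bounded_compact:
  fixes \<psi> :: "real ^ 'n::finite \<Rightarrow> complex"
  assumes "smooth \<psi>" "compact K"
  obtains M where "M \<ge> 0" "\<And>\<gamma> w. mi_abs \<gamma> \<le> n \<Longrightarrow> w \<in> K \<Longrightarrow> cmod (pd \<gamma> \<psi> w) \<le> M"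
proof -
  obtain \<zeta> V where \<zeta>: "test \<zeta>" "open V" "K \<subseteq> V" "\<And>x. x \<in> V \<Longrightarrow> \<zeta> x = 1"
    by (rule cutoff_exists[OF assms(2) open_UNIV]) auto
  have t: "test (\<lambda>x. \<zeta> x * \<psi> x)" by (rule test_mult2[OF assms(1) \<zeta>(1)])
  obtain A where A: "A \<ge> 0" "bd n A (\<lambda>x. \<zeta> x * \<psi> x)" by (rule test_bd[OF t, of n], rule that)
  show ?thesis
  proof (rule that[OF A(1)])
    fix \<gamma> :: "'n multiindex" and w assume \<gamma>: "mi_abs \<gamma> \<le> n" "w \<in> K"
    have "pd \<gamma> \<psi> w = pd \<gamma> (\<lambda>x. \<zeta> x * \<psi> x) w"
      by (rule pd_cong_open[OF assms(1) test_smooth[OF t] \<zeta>(2)]) (use \<gamma> \<zeta> in auto)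
    then show "cmod (pd \<gamma> \<psi> w) \<le> A" using bdD[OF A(2) \<gamma>(1)] by simp
  qed
qed

lemma jets_remainder:
  fixes \<psi> :: "real ^ 'n::finite \<Rightarrow> complex" and K :: "(real ^ 'n) set"
  assumes \<psi>: "smooth \<psi>" and K: "compact K"
  obtains M where "M \<ge> 0" "\<And>\<alpha> x y. mi_abs \<alpha> \<le> n \<Longrightarrow> x \<in> K \<Longrightarrow> y \<in> K \<Longrightarrow>
     cmod (pd \<alpha> \<psi> y - tay n (jets \<psi>) x \<alpha> y) \<le> M * norm (y - x) ^ (Suc n - mi_abs \<alpha>)"
proof -
  obtain R where R: "R > 0" "\<And>x. x \<in> K \<Longrightarrow> norm x \<le> R" using compact_imp_bounded[OF K] by (auto simp: bounded_pos)
  \<comment> \<open>Balls of radius \<open>norm (y - x)\<close> around points \<open>x\<close> of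
    \<open>K\<close>, with \<open>y\<close> in \<open>K\<close>, lie in the ball of radius
    3R.\<close>
  obtain M where M: "M \<ge> 0" "\<And>\<gamma> w. mi_abs \<gamma> \<le> Suc n \<Longrightarrow> w \<in> cball 0 (3 * R) \<Longrightarrow> cmod (pd \<gamma> \<psi> w) \<le> M"
    by (rule smooth_bounded_compact[OF \<psi> compact_cball, of "Suc n" 0 "3 * R"], rule that)
  show ?thesis
  proof (rule that[of "CARD('n) ^ Suc n * M"])
    fix \<alpha> :: "'n multiindex" and x y assume \<alpha>: "mi_abs \<alpha> \<le> n" and xy: "x \<in> K" "y \<in> K"
    have "cmod (pd \<alpha> \<psi> y - tay n (jets \<psi>) x \<alpha> y) \<le> CARD('n) ^ (Suc n - mi_abs \<alpha>) * M * norm (y - x) ^ (Suc n - mi_abs \<alpha>)"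
    proof (rule taylor_remainder[OF \<psi> _ \<alpha>])
      fix \<gamma> :: "'n multiindex" and w assume \<gamma>: "mi_abs \<gamma> = Suc n" and w: "w \<in> cball x (norm (y - x))"
      have "norm w \<le> norm x + norm (y - x)" using w norm_triangle_ineq2[of w x] by (simp add: dist_norm norm_minus_commute)
      also have "\<dots> \<le> 3 * R" using R(2)[OF xy(1)] R(2)[OF xy(2)] norm_triangle_ineq4[of y x] by linarith
      finally show "cmod (pd \<gamma> \<psi> w) \<le> M" using M(2)[of \<gamma> w] \<gamma> by simp
    qed
    also have "\<dots> \<le> real (CARD('n) ^ Suc n) * M * norm (y - x) ^ (Suc n - mi_abs \<alpha>)"
      by (intro mult_right_mono of_nat_mono power_increasing) (use M in auto)
    finally show "cmod (pd \<alpha> \<psi> y - tay n (jets \<psi>) x \<alpha> y) \<le> CARD('n) ^ Suc n * M * norm (y - x) ^ (Suc n - mi_abs \<alpha>)" .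
  qed (use M in simp)
qed

text \<open>With one derivative more than the Whitney order, the Taylor remainder has an additional
  factor |y - x|, which is at most 2R on \<open>K\<close>.\<close>

lemma test_wb:
  fixes K :: "(real ^ 'n::finite) set"
  assumes K: "compact K"
  obtains C where "C \<ge> 0" "\<And>\<phi> A. test \<phi> \<Longrightarrow> bd (Suc n) A \<phi> \<Longrightarrow> wb n K (C * A) (jets \<phi>)"
proof -
  obtain R where R: "R > 0" "\<And>x. x \<in> K \<Longrightarrow> norm x \<le> R" using compact_imp_bounded[OF K] by (auto simp: bounded_pos)
  let ?C = "1 + real (CARD('n) ^ Suc n) * (2 * R)"
  show ?thesis
  proof (rule that[of ?C])
    show "?C \<ge> 0" using R by simp
    fix \<phi> :: "real ^ 'n \<Rightarrow> complex" and A assume \<phi>: "test \<phi>" and A: "bd (Suc n) A \<phi>"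
    have A0: "A \<ge> 0" by (rule bd_nonneg[OF A])
    show "wb n K (?C * A) (jets \<phi>)"
      unfolding wb_def
    proof (intro allI impI ballI conjI)
      fix \<alpha> :: "'n multiindex" and x y assume \<alpha>: "mi_abs \<alpha> \<le> n" and x: "x \<in> K"
      have "cmod (jets \<phi> \<alpha> x) \<le> 1 * A" using bdD[OF A, of \<alpha> x] \<alpha> by simp
      also have "\<dots> \<le> ?C * A" by (rule mult_right_mono) (use A0 R in auto)
      finally show "cmod (jets \<phi> \<alpha> x) \<le> ?C * A" .
      assume y: "y \<in> K"
      have "cmod (pd \<alpha> \<phi> y - tay n (jets \<phi>) x \<alpha> y) \<le> CARD('n) ^ (Suc n - mi_abs \<alpha>) * A * norm (y - x) ^ (Suc n - mi_abs \<alpha>)"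
        by (rule taylor_remainder[OF test_smooth[OF \<phi>] _ \<alpha>]) (simp add: bdD[OF A])
      also have "\<dots> \<le> real (CARD('n) ^ Suc n) * A * norm (y - x) ^ (Suc n - mi_abs \<alpha>)"
        by (intro mult_right_mono of_nat_mono power_increasing) (use A0 in auto)
      also have "norm (y - x) ^ (Suc n - mi_abs \<alpha>) = norm (y - x) * norm (y - x) ^ (n - mi_abs \<alpha>)"
        using \<alpha> by (simp add: Suc_diff_le)
      also have "real (CARD('n) ^ Suc n) * A * (norm (y - x) * norm (y - x) ^ (n - mi_abs \<alpha>)) \<le> real (CARD('n) ^ Suc n) * A * ((2 * R) * norm (y - x) ^ (n - mi_abs \<alpha>))"
        by (intro mult_left_mono mult_right_mono) (use R(2)[OF x] R(2)[OF y] norm_triangle_ineq4[of y x] A0 in auto)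
      also have "\<dots> \<le> ?C * A * norm (y - x) ^ (n - mi_abs \<alpha>)" using A0 by (simp add: algebra_simps)
      finally show "cmod (jets \<phi> \<alpha> y - tay n (jets \<phi>) x \<alpha> y) \<le> ?C * A * norm (y - x) ^ (n - mi_abs \<alpha>)" unfolding jets_apply .
    qed
  qed
qed

section \<open>Whitney jets: modulus, topology, density\<close>

lemma whitney_q_upper:
  assumes "mi_abs \<alpha> \<le> n" "x \<in> K" "y \<in> K" "x \<noteq> y" "norm (y - x) < t"
  shows "ennreal (cmod (f \<alpha> y - tay n f x \<alpha> y) / norm (y - x) ^ (n - mi_abs \<alpha>)) \<le> whitney_q K n t f"
  unfolding whitney_q_def pd_taylor dist_norm
proof (rule Sup_upper, rule CollectI, intro exI conjI)
  show "ennreal (cmod (f \<alpha> y - tay n f x \<alpha> y) / norm (y - x) ^ (n - mi_abs \<alpha>)) =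
      ennreal (cmod (f \<alpha> y - tay n f x \<alpha> y) / norm (x - y) ^ (n - mi_abs \<alpha>))" by (simp only: norm_minus_commute[of y x])
qed (use assms in \<open>auto simp: norm_minus_commute[of y x]\<close>)

lemma whitney_q_least:
  assumes "\<And>\<alpha> x y. mi_abs \<alpha> \<le> n \<Longrightarrow> x \<in> K \<Longrightarrow> y \<in> K \<Longrightarrow> x \<noteq> y \<Longrightarrow> norm (y - x) < t \<Longrightarrow> 
     ennreal (cmod (f \<alpha> y - tay n f x \<alpha> y) / norm (y - x) ^ (n - mi_abs \<alpha>)) \<le> M"
  shows "whitney_q K n t f \<le> M"
  unfolding whitney_q_def
  by (rule Sup_least) (use assms in \<open>auto simp: pd_taylor dist_norm norm_minus_commute\<close>)

lemma ratio_le: "x \<noteq> (y :: 'a :: real_normed_vector) \<Longrightarrow> c / norm (y - x) ^ k \<le> A \<longleftrightarrow> c \<le> A * norm (y - x) ^ k"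
  by (simp add: divide_le_eq)

lemma whitney_modulus:
  assumes f: "f \<in> whitney_jets F" and K: "compact K" "K \<subseteq> F" and e: "e > 0"
  obtains t where "t > 0" "\<And>\<alpha> x y. mi_abs \<alpha> \<le> n \<Longrightarrow> x \<in> K \<Longrightarrow> y \<in> K \<Longrightarrow> norm (y - x) < t \<Longrightarrow> 
     cmod (f \<alpha> y - tay n f x \<alpha> y) \<le> e * norm (y - x) ^ (n - mi_abs \<alpha>)"
proof -
  let ?r = "jet_restrict K f"
  have "((\<lambda>t. whitney_q K n t ?r) \<longlongrightarrow> 0) (at_right 0)"
    using f K unfolding whitney_jets_def whitney_jets_compact_def by blast
  then have "eventually (\<lambda>t. whitney_q K n t ?r < ennreal e) (at_right 0)"
    by (rule order_tendstoD(2)) (use e in simp)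
  then obtain b where b: "b > 0" "\<And>t. 0 < t \<Longrightarrow> t < b \<Longrightarrow> whitney_q K n t ?r < ennreal e"
    unfolding eventually_at_right_field by blast
  show ?thesis
  proof (rule that[of "b/2"])
    show "b/2 > 0" using b by simp
    fix \<alpha> :: "'a multiindex" and x y assume \<alpha>: "mi_abs \<alpha> \<le> n" and xy: "x \<in> K" "y \<in> K" "norm (y - x) < b/2"
    have t: "tay n ?r x \<alpha> y = tay n f x \<alpha> y" by (rule tay_cong) (simp add: jet_restrict_def xy)
    have v: "?r \<alpha> y = f \<alpha> y" by (simp add: jet_restrict_def xy)
    show "cmod (f \<alpha> y - tay n f x \<alpha> y) \<le> e * norm (y - x) ^ (n - mi_abs \<alpha>)"
    proof (cases "x = y")
      case True
      then show ?thesis using e \<alpha> by (simp add: tay_self)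
    next
      case False
      have "ennreal (cmod (?r \<alpha> y - tay n ?r x \<alpha> y) / norm (y - x) ^ (n - mi_abs \<alpha>)) \<le> whitney_q K n (b/2) ?r"
        by (rule whitney_q_upper[OF \<alpha> xy(1,2) False xy(3)])
      also have "\<dots> < ennreal e" by (rule b(2)) (use b in auto)
      finally have "cmod (f \<alpha> y - tay n f x \<alpha> y) / norm (y - x) ^ (n - mi_abs \<alpha>) \<le> e"
        unfolding t v using e by (simp add: ennreal_less_iff less_imp_le)
      then show ?thesis using ratio_le[OF False] by blast
    qed
  qed
qed

text \<open>Pairs closer than \<open>t\<close> are controlled by the modulus with e = 1. For the
  others the crude bound \<open>?Q\<close> is divided by \<open>s ^ n\<close>, a lower bound for
  every power of the distance that occurs.\<close>

lemma whitney_jets_wb: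
  fixes F :: "(real ^ 'n::finite) set"
  assumes f: "f \<in> whitney_jets F" and K: "compact K" "K \<subseteq> F"
  obtains A where "A \<ge> 0" "wb n K A f"
proof -
  have "\<exists>B. \<forall>x\<in>K. cmod (f \<alpha> x) \<le> B" for \<alpha>
  proof -
    have "continuous_on K (f \<alpha>)" using f K unfolding whitney_jets_def by (blast intro: continuous_on_subset)
    from compact_imp_bounded[OF compact_continuous_image[OF this K(1)]] show ?thesis by (auto simp: bounded_iff)
  qed
  then obtain B where B: "\<And>\<alpha> x. x \<in> K \<Longrightarrow> cmod (f \<alpha> x) \<le> B \<alpha>" by metis
  define M where "M = (\<Sum>\<alpha> | mi_abs \<alpha> \<le> n. \<bar>B \<alpha>\<bar>)"
  have M: "cmod (f \<alpha> x) \<le> M" if "mi_abs \<alpha> \<le> n" "x \<in> K" for \<alpha> x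
  proof -
    have "\<bar>B \<alpha>\<bar> \<le> M" unfolding M_def by (rule member_le_sum) (use that in \<open>auto simp: finite_multiindices\<close>)
    with B[OF that(2), of \<alpha>] show ?thesis by linarith
  qed
  have M0: "M \<ge> 0" unfolding M_def by (rule sum_nonneg) simp
  obtain R where R: "R > 0" "\<And>x. x \<in> K \<Longrightarrow> norm x \<le> R" using compact_imp_bounded[OF K(1)] by (auto simp: bounded_pos)
  obtain t where t: "t > 0" "\<And>\<alpha> x y. mi_abs \<alpha> \<le> n \<Longrightarrow> x \<in> K \<Longrightarrow> y \<in> K \<Longrightarrow> norm (y - x) < t \<Longrightarrow> 
     cmod (f \<alpha> y - tay n f x \<alpha> y) \<le> 1 * norm (y - x) ^ (n - mi_abs \<alpha>)"
    by (rule whitney_modulus[OF f K zero_less_one], rule that)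
  define s where "s = min t 1"
  have s: "0 < s" "s \<le> 1" "s \<le> t" using t by (auto simp: s_def)
  let ?D = "(max 1 (2 * R)) ^ n"
  let ?Q = "M + Nm n TYPE('n) * (M * ?D)"
  have Q: "?Q \<ge> 0" using M0 by (simp add: Nm_nonneg)
  let ?A = "1 + M + ?Q / s ^ n"
  have A1: "1 \<le> ?A" "M \<le> ?A" "?Q / s ^ n \<le> ?A" using M0 Q s by auto
  show ?thesis
  proof (rule that[of ?A])
    show "?A \<ge> 0" using A1 by linarith
    show "wb n K ?A f"
      unfolding wb_def
    proof (intro allI impI ballI conjI)
      fix \<alpha> :: "'n multiindex" and x y assume \<alpha>: "mi_abs \<alpha> \<le> n" and x: "x \<in> K"
      show "cmod (f \<alpha> x) \<le> ?A" using M[OF \<alpha> x] A1 by linarith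
      assume y: "y \<in> K"
      show "cmod (f \<alpha> y - tay n f x \<alpha> y) \<le> ?A * norm (y - x) ^ (n - mi_abs \<alpha>)"
      proof (cases "norm (y - x) < t")
        case True
        have "cmod (f \<alpha> y - tay n f x \<alpha> y) \<le> 1 * norm (y - x) ^ (n - mi_abs \<alpha>)" by (rule t(2)[OF \<alpha> x y True])
        also have "\<dots> \<le> ?A * norm (y - x) ^ (n - mi_abs \<alpha>)" by (rule mult_right_mono[OF A1(1)]) simp
        finally show ?thesis .
      next
        case False
        have nd: "norm (y - x) \<le> max 1 (2 * R)" using R(2)[OF x] R(2)[OF y] norm_triangle_ineq4[of y x] by simp
        have "cmod (tay n f x \<alpha> y) \<le> Nm n TYPE('n) * (M * ?D)"
        proof (rule tay_bound)
          fix \<beta> :: "'n multiindex" assume \<beta>: "mi_abs \<alpha> + mi_abs \<beta> \<le> n"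
          have "norm (y - x) ^ mi_abs \<beta> \<le> max 1 (2 * R) ^ mi_abs \<beta>" by (rule power_mono[OF nd]) simp
          also have "\<dots> \<le> ?D" by (rule power_increasing) (use \<beta> in auto)
          finally show "cmod (f (\<alpha> + \<beta>) x) * norm (y - x) ^ mi_abs \<beta> \<le> M * ?D"
            by (intro mult_mono M x) (use \<beta> M0 in auto)
        qed (use M0 in simp)
        then have "cmod (f \<alpha> y - tay n f x \<alpha> y) \<le> ?Q"
          using order_trans[OF norm_triangle_ineq4 add_mono[OF M[OF \<alpha> y]]] by blast
        also have "?Q = (?Q / s ^ n) * s ^ n" using s by simp
        also have "\<dots> \<le> (?Q / s ^ n) * norm (y - x) ^ (n - mi_abs \<alpha>)"
        proof (rule mult_left_mono)
          have "s ^ n \<le> s ^ (n - mi_abs \<alpha>)" by (rule power_decreasing) (use s in auto)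
          also have "\<dots> \<le> norm (y - x) ^ (n - mi_abs \<alpha>)" by (rule power_mono) (use s False in auto)
          finally show "s ^ n \<le> norm (y - x) ^ (n - mi_abs \<alpha>)" .
        qed (use Q s in simp)
        also have "\<dots> \<le> ?A * norm (y - x) ^ (n - mi_abs \<alpha>)" by (rule mult_right_mono[OF A1(3)]) simp
        finally show ?thesis .
      qed
    qed
  qed
qed

section \<open>The topology of Whitney jets in terms of real bounds\<close>

lemma jet_norm_imp_wb:
  assumes "jet_norm n K h < ennreal r"
  shows "wb n K r h"
  unfolding wb_def
proof (intro allI impI ballI conjI)
  fix \<alpha> :: "'a multiindex" and x y assume \<alpha>: "mi_abs \<alpha> \<le> n" and x: "x \<in> K"
  have r: "r > 0" using assms by (metis ennreal_eq_0_iff not_le not_less_zero)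
  have "ennreal (cmod (h \<alpha> x)) \<le> Sup {ennreal (cmod (h \<alpha> x)) | \<alpha> x. x \<in> K \<and> mi_abs \<alpha> \<le> n}"
    by (rule Sup_upper) (use \<alpha> x in blast)
  also have "\<dots> \<le> jet_norm n K h" unfolding jet_norm_def by (rule add_increasing2) simp_all
  also note assms
  finally show "cmod (h \<alpha> x) \<le> r" by (simp add: ennreal_less_iff)
  assume y: "y \<in> K"
  show "cmod (h \<alpha> y - tay n h x \<alpha> y) \<le> r * norm (y - x) ^ (n - mi_abs \<alpha>)"
  proof (cases "x = y")
    case True
    then show ?thesis using r \<alpha> by (simp add: tay_self)
  next
    case False
    let ?t = "norm (y - x) + 1"
    have "ennreal (cmod (h \<alpha> y - tay n h x \<alpha> y) / norm (y - x) ^ (n - mi_abs \<alpha>)) \<le> whitney_q K n ?t h"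
      by (rule whitney_q_upper[OF \<alpha> x y False]) simp
    also have "\<dots> \<le> (SUP t\<in>{0<..}. whitney_q K n t h)" by (rule SUP_upper) (simp add: add_nonneg_pos)
    also have "\<dots> \<le> jet_norm n K h" unfolding jet_norm_def by (rule add_increasing) simp_all
    also note assms
    finally have "cmod (h \<alpha> y - tay n h x \<alpha> y) / norm (y - x) ^ (n - mi_abs \<alpha>) \<le> r" by (simp add: ennreal_less_iff)
    then show ?thesis using ratio_le[OF False] by blast
  qed
qed

text \<open>The factor 2 arises because \<open>jet_norm\<close> adds the two parts that
  \<open>wb\<close> bounds separately.\<close>

lemma wb_imp_jet_norm:
  assumes "wb n K A h" "A \<ge> 0"
  shows "jet_norm n K h \<le> ennreal (2 * A)"
proof -
  have 1: "Sup {ennreal (cmod (h \<alpha> x)) | \<alpha> x. x \<in> K \<and> mi_abs \<alpha> \<le> n} \<le> ennreal A"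
    by (rule Sup_least) (use wbD(1)[OF assms(1)] in \<open>auto intro!: ennreal_leI\<close>)
  have 2: "(SUP t\<in>{0<..}. whitney_q K n t h) \<le> ennreal A"
  proof (rule SUP_least, rule whitney_q_least, rule ennreal_leI)
    fix \<alpha> :: "'a multiindex" and x y assume "mi_abs \<alpha> \<le> n" "x \<in> K" "y \<in> K" "x \<noteq> y"
    then show "cmod (h \<alpha> y - tay n h x \<alpha> y) / norm (y - x) ^ (n - mi_abs \<alpha>) \<le> A"
      using wbD(2)[OF assms(1)] ratio_le by blast
  qed
  have "jet_norm n K h \<le> ennreal A + ennreal A" unfolding jet_norm_def by (rule add_mono[OF 1 2])
  also have "\<dots> = ennreal (2 * A)" using assms(2) by (simp add: ennreal_plus[symmetric] del: ennreal_plus)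
  finally show ?thesis .
qed

lemma jet_norm_add: "jet_norm n K (\<lambda>\<alpha> x. f \<alpha> x + g \<alpha> x) \<le> jet_norm n K f + jet_norm n K g"
proof -
  let ?S = "\<lambda>h. Sup {ennreal (cmod (h \<alpha> x)) | \<alpha> x. x \<in> K \<and> mi_abs \<alpha> \<le> n}"
  let ?Q = "\<lambda>h. SUP t\<in>{0<..}. whitney_q K n t h"
  have 1: "?S (\<lambda>\<alpha> x. f \<alpha> x + g \<alpha> x) \<le> ?S f + ?S g"
  proof (rule Sup_least)
    fix z assume "z \<in> {ennreal (cmod (f \<alpha> x + g \<alpha> x)) | \<alpha> x. x \<in> K \<and> mi_abs \<alpha> \<le> n}"
    then obtain \<alpha> x where z: "z = ennreal (cmod (f \<alpha> x + g \<alpha> x))" "x \<in> K" "mi_abs \<alpha> \<le> n" by blast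
    have "z \<le> ennreal (cmod (f \<alpha> x)) + ennreal (cmod (g \<alpha> x))"
      unfolding z(1) ennreal_plus[OF norm_ge_zero norm_ge_zero, symmetric] by (rule ennreal_leI[OF norm_triangle_ineq])
    also have "\<dots> \<le> ?S f + ?S g" by (intro add_mono Sup_upper) (use z in blast)+
    finally show "z \<le> ?S f + ?S g" .
  qed
  have 2: "?Q (\<lambda>\<alpha> x. f \<alpha> x + g \<alpha> x) \<le> ?Q f + ?Q g"
  proof (rule SUP_least, rule whitney_q_least)
    fix t :: real and \<alpha> :: "'a multiindex" and x y 
    assume t: "t \<in> {0<..}" and a: "mi_abs \<alpha> \<le> n" "x \<in> K" "y \<in> K" "x \<noteq> y" "norm (y - x) < t"
    let ?w = "norm (y - x) ^ (n - mi_abs \<alpha>)" and ?r = "\<lambda>h. cmod (h \<alpha> y - tay n h x \<alpha> y)"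
    have "f \<alpha> y + g \<alpha> y - tay n (\<lambda>\<alpha> x. f \<alpha> x + g \<alpha> x) x \<alpha> y = (f \<alpha> y - tay n f x \<alpha> y) + (g \<alpha> y - tay n g x \<alpha> y)"
      unfolding tay_add by (rule add_diff_add)
    then have "?r (\<lambda>\<alpha> x. f \<alpha> x + g \<alpha> x) \<le> ?r f + ?r g" by (simp only: norm_triangle_ineq)
    then have "?r (\<lambda>\<alpha> x. f \<alpha> x + g \<alpha> x) / ?w \<le> ?r f / ?w + ?r g / ?w"
      unfolding add_divide_distrib[symmetric] by (rule divide_right_mono) simp
    then have "ennreal (?r (\<lambda>\<alpha> x. f \<alpha> x + g \<alpha> x) / ?w) \<le> ennreal (?r f / ?w) + ennreal (?r g / ?w)"
      using ennreal_leI[of _ "?r f / ?w + ?r g / ?w"] ennreal_plus[of "?r f / ?w" "?r g / ?w"] by simp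
    also have "\<dots> \<le> whitney_q K n t f + whitney_q K n t g" by (intro add_mono whitney_q_upper a)
    also have "\<dots> \<le> ?Q f + ?Q g" by (intro add_mono SUP_upper t)
    finally show "ennreal (cmod (f \<alpha> y + g \<alpha> y - tay n (\<lambda>\<alpha> x. f \<alpha> x + g \<alpha> x) x \<alpha> y) / ?w) \<le> ?Q f + ?Q g" .
  qed
  show ?thesis unfolding jet_norm_def using add_mono[OF 1 2] by (simp add: ac_simps)
qed

lemma whitney_jets_smooth:
  assumes \<psi>: "smooth \<psi>"
  shows "jet_restrict F (jets \<psi>) \<in> whitney_jets F"
proof -
  have c: "continuous_on K (restrict (pd \<alpha> \<psi>) K)" for K \<alpha>
    by (rule continuous_on_eq[OF smooth_continuous[OF smooth_pd[OF \<psi>]]]) simp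
  have "jet_restrict K (jets \<psi>) \<in> whitney_jets_compact K" if K: "compact K" for K
    unfolding whitney_jets_compact_def
  proof (intro CollectI conjI allI)
    show "jet_restrict K (jets \<psi>) \<alpha> \<in> extensional K" "continuous_on K (jet_restrict K (jets \<psi>) \<alpha>)" for \<alpha>
      using c by (auto simp: jet_restrict_def jets_def)
    fix n
    obtain M where M: "M \<ge> 0" "\<And>\<alpha> x y. mi_abs \<alpha> \<le> n \<Longrightarrow> x \<in> K \<Longrightarrow> y \<in> K \<Longrightarrow>
     cmod (pd \<alpha> \<psi> y - tay n (jets \<psi>) x \<alpha> y) \<le> M * norm (y - x) ^ (Suc n - mi_abs \<alpha>)"
      by (rule jets_remainder[OF \<psi> K, of n], rule that)
    have le: "whitney_q K n t (jet_restrict K (jets \<psi>)) \<le> ennreal (M * t)" for t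
    proof (rule whitney_q_least, rule ennreal_leI)
      fix \<alpha> :: "'a multiindex" and x y assume a: "mi_abs \<alpha> \<le> n" "x \<in> K" "y \<in> K" "x \<noteq> y" "norm (y - x) < t"
      have "tay n (jet_restrict K (jets \<psi>)) x \<alpha> y = tay n (jets \<psi>) x \<alpha> y" by (rule tay_cong) (simp add: jet_restrict_def a)
      moreover have "jet_restrict K (jets \<psi>) \<alpha> y = pd \<alpha> \<psi> y" by (simp add: jet_restrict_def a)
      moreover have "cmod (pd \<alpha> \<psi> y - tay n (jets \<psi>) x \<alpha> y) \<le> (M * t) * norm (y - x) ^ (n - mi_abs \<alpha>)"
      proof (rule order_trans[OF M(2)[OF a(1-3)]])
        have "norm (y - x) ^ (Suc n - mi_abs \<alpha>) = norm (y - x) * norm (y - x) ^ (n - mi_abs \<alpha>)"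
          using a by (simp add: Suc_diff_le)
        also have "\<dots> \<le> t * norm (y - x) ^ (n - mi_abs \<alpha>)" by (rule mult_right_mono) (use a in auto)
        finally show "M * norm (y - x) ^ (Suc n - mi_abs \<alpha>) \<le> (M * t) * norm (y - x) ^ (n - mi_abs \<alpha>)"
          unfolding mult.assoc by (rule mult_left_mono[OF _ M(1)])
      qed
      ultimately show "cmod (jet_restrict K (jets \<psi>) \<alpha> y - tay n (jet_restrict K (jets \<psi>)) x \<alpha> y) / norm (y - x) ^ (n - mi_abs \<alpha>) \<le> M * t"
        using ratio_le[OF a(4)] by metis
    qed
    have "((\<lambda>t. ennreal (M * t)) \<longlongrightarrow> ennreal (M * 0)) (at_right 0)"
      by (intro tendsto_ennrealI tendsto_intros) 
    then have lim: "((\<lambda>t. ennreal (M * t)) \<longlongrightarrow> 0) (at_right 0)" by simp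
    show "((\<lambda>t. whitney_q K n t (jet_restrict K (jets \<psi>))) \<longlongrightarrow> 0) (at_right 0)"
      by (rule tendsto_sandwich[OF _ _ tendsto_const lim]) (simp_all add: le)
  qed
  moreover have "jet_restrict K (jet_restrict F (jets \<psi>)) = jet_restrict K (jets \<psi>)" if "K \<subseteq> F" for K
    using that by (auto simp: jet_restrict_def restrict_def fun_eq_iff)
  ultimately show ?thesis
    unfolding whitney_jets_def using c by (auto simp: jet_restrict_def jets_def)
qed

text \<open>The balls form only a subbasis. Intersections are absorbed by raising the order and
  enlarging the compact set, a ball with another centre by shrinking the radius.\<close>

lemma whitney_nbhd:
  assumes T: "openin (whitney_topology F) T" and f: "f \<in> T"
  shows "\<exists>n K A. compact K \<and> K \<subseteq> F \<and> A > 0 \<and> (\<forall>g\<in>whitney_jets F. wb n K A (\<lambda>\<alpha> x. g \<alpha> x - f \<alpha> x) \<longrightarrow> g \<in> T)"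
proof -
  have "generate_topology_on {whitney_ball F f n K r | f n K r. f \<in> whitney_jets F \<and> compact K \<and> K \<subseteq> F \<and> r > 0} T"
    using T unfolding whitney_topology_def openin_topology_generated_by_iff .
  then show ?thesis using f
  proof (induction T)
    case Empty
    then show ?case by simp
  next
    case (Int T1 T2)
    obtain n1 K1 A1 where 1: "compact K1" "K1 \<subseteq> F" "A1 > 0" "\<And>g. g \<in> whitney_jets F \<Longrightarrow> wb n1 K1 A1 (\<lambda>\<alpha> x. g \<alpha> x - f \<alpha> x) \<Longrightarrow> g \<in> T1"
      using Int.IH(1) Int.prems by blast
    obtain n2 K2 A2 where 2: "compact K2" "K2 \<subseteq> F" "A2 > 0" "\<And>g. g \<in> whitney_jets F \<Longrightarrow> wb n2 K2 A2 (\<lambda>\<alpha> x. g \<alpha> x - f \<alpha> x) \<Longrightarrow> g \<in> T2"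
      using Int.IH(2) Int.prems by blast
    obtain C1 where C1: "C1 \<ge> 0" "\<And>A h. A \<ge> 0 \<Longrightarrow> wb (max n1 n2) K1 A h \<Longrightarrow> wb n1 K1 (C1 * A) h"
      by (rule wb_order_mono[OF 1(1) max.cobounded1[of n1 n2]], rule that)
    obtain C2 where C2: "C2 \<ge> 0" "\<And>A h. A \<ge> 0 \<Longrightarrow> wb (max n1 n2) K2 A h \<Longrightarrow> wb n2 K2 (C2 * A) h"
      by (rule wb_order_mono[OF 2(1) max.cobounded2[of n2 n1]], rule that)
    define A where "A = min (A1 / (C1 + 1)) (A2 / (C2 + 1))"
    have A: "A > 0" using 1 2 C1 C2 by (simp add: A_def add_nonneg_pos)
    have "C1 * A \<le> (C1 + 1) * (A1 / (C1 + 1))" by (rule mult_mono) (use C1 A in \<open>auto simp: A_def\<close>)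
    then have a1: "C1 * A \<le> A1" using C1 by simp
    have "C2 * A \<le> (C2 + 1) * (A2 / (C2 + 1))" by (rule mult_mono) (use C2 A in \<open>auto simp: A_def\<close>)
    then have a2: "C2 * A \<le> A2" using C2 by simp
    show ?case
    proof (intro exI[of _ "max n1 n2"] exI[of _ "K1 \<union> K2"] exI[of _ A] conjI ballI impI)
      fix g assume g: "g \<in> whitney_jets F" and w: "wb (max n1 n2) (K1 \<union> K2) A (\<lambda>\<alpha> x. g \<alpha> x - f \<alpha> x)"
      have "wb n1 K1 A1 (\<lambda>\<alpha> x. g \<alpha> x - f \<alpha> x)"
        by (rule wb_le[OF C1(2)[OF less_imp_le[OF A] wb_subset[OF w]] a1]) simp
      moreover have "wb n2 K2 A2 (\<lambda>\<alpha> x. g \<alpha> x - f \<alpha> x)"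
        by (rule wb_le[OF C2(2)[OF less_imp_le[OF A] wb_subset[OF w]] a2]) simp
      ultimately show "g \<in> T1 \<inter> T2" using 1(4)[OF g] 2(4)[OF g] by blast
    qed (use 1 2 A in auto)
  next
    case (UN TT)
    then obtain T' where T': "T' \<in> TT" "f \<in> T'" by blast
    from UN.IH[OF T'] T'(1) show ?case by (meson UnionI)
  next
    case (Basis s)
    then obtain f' n K r where s: "s = whitney_ball F f' n K r" "f' \<in> whitney_jets F" "compact K" "K \<subseteq> F" "r > 0" by blast
    have lt: "jet_norm n K (jet_restrict K (f - f')) < ennreal r" using Basis s(1) by (simp add: whitney_ball_def)
    then obtain q where q: "jet_norm n K (jet_restrict K (f - f')) = ennreal q" "q \<ge> 0" by (metis ennreal_cases not_less_iff_gr_or_eq ennreal_less_top order.strict_trans)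
    then have qr: "q < r" using lt s(5) by (simp add: ennreal_less_iff)
    show ?case
    \<comment> \<open>\<open>wb_imp_jet_norm\<close> doubles the radius, so a quarter of the gap
      keeps the total at q + (r - q)/2, below \<open>r\<close>.\<close>
    proof (intro exI[of _ n] exI[of _ K] exI[of _ "(r - q) / 4"] conjI ballI impI)
      fix g assume g: "g \<in> whitney_jets F" and w: "wb n K ((r - q) / 4) (\<lambda>\<alpha> x. g \<alpha> x - f \<alpha> x)"
      let ?h = "\<lambda>\<alpha> x. jet_restrict K (f - f') \<alpha> x + (if x \<in> K then g \<alpha> x - f \<alpha> x else 0)"
      have e: "jet_restrict K (g - f') = ?h"
        by (auto simp: jet_restrict_def fun_eq_iff)
      have "wb n K ((r - q) / 4) (\<lambda>\<alpha> x. if x \<in> K then g \<alpha> x - f \<alpha> x else 0)" by (rule wb_cong[OF _ w]) simp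
      then have "jet_norm n K (\<lambda>\<alpha> x. if x \<in> K then g \<alpha> x - f \<alpha> x else 0) \<le> ennreal (2 * ((r - q) / 4))"
        by (rule wb_imp_jet_norm) (use qr in simp)
      then have "jet_norm n K (jet_restrict K (g - f')) \<le> ennreal q + ennreal (2 * ((r - q) / 4))"
        unfolding e q(1)[symmetric] by (intro order_trans[OF jet_norm_add add_mono] order_refl)
      also have "\<dots> = ennreal (q + 2 * ((r - q) / 4))" using q qr by (intro ennreal_plus[symmetric]) auto
      also have "\<dots> < ennreal r" using q qr by (subst ennreal_less_iff) (auto simp: field_simps)
      finally show "g \<in> s" using g by (simp add: s(1) whitney_ball_def)
    qed (use s qr in auto)
  qed
qed

lemma diff_diff_eq_swap: "(a - b) - (c - d) = (a - c) - (b - d)" for a b c d :: complex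
  by simp

text \<open>\<open>g\<close> smooths \<open>f\<close> at a scale \<open>e\<close> at which the
  modulus of \<open>f\<close> is at most \<open>A\<close>. For pairs at distance at least
  \<open>e\<close> each component of the error is already small against the required power of the
  distance. For closer pairs the remainders of \<open>g\<close> and of \<open>f\<close> are
  estimated separately; that of \<open>g\<close> comes from its derivatives of order
  \<open>n\<close>, which stay close to the value of the jet at \<open>x\<close>.\<close>

lemma whitney_density:
  fixes F :: "(real ^ 'n::finite) set"
  assumes f: "f \<in> whitney_jets F" and K: "compact K" "K \<subseteq> F" and \<eta>: "\<eta> > 0"
  obtains g where "test g" "wb n K \<eta> (\<lambda>\<alpha> x. jets g \<alpha> x - f \<alpha> x)"
proof -
  obtain C c :: real where C: "C \<ge> 0" "c \<ge> 1" and
    sm: "\<And>(K :: (real ^ 'n::finite) set) e f A. compact K \<Longrightarrow> 0 < e \<Longrightarrow> e \<le> 1 \<Longrightarrow> A \<ge> 0 \<Longrightarrow>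
      \<forall>\<alpha> x y. mi_abs \<alpha> \<le> n \<longrightarrow> x \<in> K \<longrightarrow> y \<in> K \<longrightarrow> norm (y - x) \<le> c * e \<longrightarrow> cmod (f \<alpha> y - tay n f x \<alpha> y) \<le> A * norm (y - x) ^ (n - mi_abs \<alpha>) \<Longrightarrow>
      \<exists>g. test g \<and> (\<forall>a\<in>K. \<forall>z. norm (z - a) < e \<longrightarrow> (\<forall>\<gamma>. mi_abs \<gamma> \<le> n \<longrightarrow> 
          cmod (pd \<gamma> g z - tay n f a \<gamma> z) \<le> C * A * e ^ (n - mi_abs \<gamma>)))"
    by (rule whitney_smoothing[of n], rule that)
  let ?N = "Nm n TYPE('n)" and ?d = "real (CARD('n) ^ n)"
  \<comment> \<open>Dominates the constants of the pointwise bound, of the distant pairs and of the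
    near pairs at once.\<close>
  define Q where "Q = C * (1 + ?N) + ?d * (2 * C) + 1"
  have CN: "0 \<le> C * (1 + ?N)" "0 \<le> ?d * (2 * C)" "C * 1 \<le> C * (1 + ?N)"
    using C Nm_nonneg[of n "TYPE('n)"] mult_left_mono[of 1 "1 + ?N" C] by auto
  have Q: "Q > 0" "C * (1 + ?N) \<le> Q" "C \<le> Q" "?d * (2 * C) + 1 \<le> Q"
    using CN unfolding Q_def by linarith+
  define A where "A = \<eta> / Q"
  have A: "A > 0" "Q * A = \<eta>" using \<eta> Q by (auto simp: A_def)
  obtain t where t: "t > 0" "\<And>\<alpha> x y. mi_abs \<alpha> \<le> n \<Longrightarrow> x \<in> K \<Longrightarrow> y \<in> K \<Longrightarrow> norm (y - x) < t \<Longrightarrow> 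
     cmod (f \<alpha> y - tay n f x \<alpha> y) \<le> A * norm (y - x) ^ (n - mi_abs \<alpha>)"
    by (rule whitney_modulus[OF f K A(1)], rule that)
  \<comment> \<open>Keeps \<open>c * e\<close> below \<open>t\<close>, since smoothing at scale
    \<open>e\<close> uses remainders of pairs up to distance \<open>c * e\<close>.\<close>
  define e where "e = min 1 (t / (2 * c))"
  have e: "0 < e" "e \<le> 1" using t C by (auto simp: e_def)
  have "c * e \<le> c * (t / (2 * c))" by (rule mult_left_mono) (use C in \<open>auto simp: e_def\<close>)
  also have "\<dots> = t / 2" using C by simp
  finally have ct: "c * e < t" using t by linarith
  have "e \<le> c * e" using mult_right_mono[OF C(2), of e] e by simp
  with ct have et: "e < t" by linarith
  obtain g where g: "test g" "\<And>a z \<gamma>. a \<in> K \<Longrightarrow> norm (z - a) < e \<Longrightarrow> mi_abs \<gamma> \<le> n \<Longrightarrow> cmod (pd \<gamma> g z - tay n f a \<gamma> z) \<le> C * A * e ^ (n - mi_abs \<gamma>)"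
  proof -
    have "\<forall>\<alpha> x y. mi_abs \<alpha> \<le> n \<longrightarrow> x \<in> K \<longrightarrow> y \<in> K \<longrightarrow> norm (y - x) \<le> c * e \<longrightarrow> cmod (f \<alpha> y - tay n f x \<alpha> y) \<le> A * norm (y - x) ^ (n - mi_abs \<alpha>)"
      using t(2) ct by (meson le_less_trans)
    from sm[OF K(1) e less_imp_le[OF A(1)] this] that show thesis by blast
  qed
  have sg: "smooth g" by (rule test_smooth[OF g(1)])
  let ?h = "\<lambda>\<alpha> x. jets g \<alpha> x - f \<alpha> x"
  have hx: "cmod (?h \<alpha> x) \<le> C * A * e ^ (n - mi_abs \<alpha>)" if "mi_abs \<alpha> \<le> n" "x \<in> K" for \<alpha> x
    using g(2)[OF that(2) _ that(1), of x] e that by (simp add: tay_self)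
  have CA: "C * A \<ge> 0" using C A by simp
  have hx1: "cmod (?h \<alpha> x) \<le> C * A" if "mi_abs \<alpha> \<le> n" "x \<in> K" for \<alpha> x
    using hx[OF that] mult_left_mono[OF power_le_one[of e "n - mi_abs \<alpha>"] CA] e by simp
  show ?thesis
  proof (rule that[OF g(1)])
    show "wb n K \<eta> ?h"
      unfolding wb_def
    proof (intro allI impI ballI conjI)
      fix \<alpha> :: "'n multiindex" and x y assume \<alpha>: "mi_abs \<alpha> \<le> n" and x: "x \<in> K"
      have "cmod (?h \<alpha> x) \<le> C * A" by (rule hx1[OF \<alpha> x])
      also have "\<dots> \<le> Q * A" by (rule mult_right_mono) (use Q A in auto)
      finally show "cmod (?h \<alpha> x) \<le> \<eta>" using A by simp
      assume y: "y \<in> K"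
      let ?w = "norm (y - x) ^ (n - mi_abs \<alpha>)"
      show "cmod (?h \<alpha> y - tay n ?h x \<alpha> y) \<le> \<eta> * ?w"
      proof (cases "norm (y - x) < e")
        case False
        then have ne: "e \<le> norm (y - x)" by simp
        have "cmod (tay n ?h x \<alpha> y) \<le> ?N * (C * A * ?w)"
        proof (rule tay_bound)
          fix \<beta> :: "'n multiindex" assume \<beta>: "mi_abs \<alpha> + mi_abs \<beta> \<le> n"
          have "cmod (?h (\<alpha> + \<beta>) x) * norm (y - x) ^ mi_abs \<beta> \<le> C * A * e ^ (n - mi_abs (\<alpha> + \<beta>)) * norm (y - x) ^ mi_abs \<beta>"
            by (rule mult_right_mono[OF hx]) (use \<beta> x in auto)
          also have "\<dots> \<le> C * A * norm (y - x) ^ (n - mi_abs (\<alpha> + \<beta>)) * norm (y - x) ^ mi_abs \<beta>"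
            by (intro mult_right_mono mult_left_mono power_mono ne CA) (use e in auto)
          also have "\<dots> = C * A * norm (y - x) ^ (n - mi_abs (\<alpha> + \<beta>) + mi_abs \<beta>)" by (simp only: power_add mult.assoc)
          also have "n - mi_abs (\<alpha> + \<beta>) + mi_abs \<beta> = n - mi_abs \<alpha>" using \<beta> by simp
          finally show "cmod (?h (\<alpha> + \<beta>) x) * norm (y - x) ^ mi_abs \<beta> \<le> C * A * ?w" .
        qed (use CA in simp)
        moreover have "cmod (?h \<alpha> y) \<le> C * A * ?w"
          by (rule order_trans[OF hx[OF \<alpha> y]]) (intro mult_left_mono power_mono ne CA; use e in simp)
        ultimately have "cmod (?h \<alpha> y - tay n ?h x \<alpha> y) \<le> C * A * ?w + ?N * (C * A * ?w)"
          using order_trans[OF norm_triangle_ineq4 add_mono] by blast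
        also have "\<dots> = (C * (1 + ?N)) * (A * ?w)" by (simp add: algebra_simps)
        also have "\<dots> \<le> Q * (A * ?w)" by (rule mult_right_mono) (use Q A in auto)
        also have "\<dots> = \<eta> * ?w" using A(2) by (simp add: mult.assoc[symmetric])
        finally show ?thesis .
      next
        case True
        \<comment> \<open>The derivatives of \<open>?G\<close> of order below \<open>n\<close>
          vanish at \<open>x\<close>. In order \<open>n\<close> they are differences of two values
          of the derivative of \<open>g\<close>, each within \<open>C * A\<close> of
          \<open>f \<gamma> x\<close>.\<close>
        let ?G = "\<lambda>w. g w - tay n (jets g) x 0 w"
        have sG: "smooth ?G" by (intro smooth_minus sg smooth_tay)
        have pG: "pd \<gamma> ?G = (\<lambda>w. pd \<gamma> g w - tay n (jets g) x \<gamma> w)" for \<gamma> by (simp add: pd_minus sg smooth_tay pd_tay)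
        have top: "tay n h x \<gamma> w = h \<gamma> x" if "mi_abs \<gamma> = n" for h \<gamma> and w :: "real ^ 'n"
        proof -
          have "{\<beta> :: 'n multiindex. mi_abs \<gamma> + mi_abs \<beta> \<le> n} = {0}" using that by (auto simp: mi_abs_eq_0_iff)
          then show ?thesis by (simp add: tay_def)
        qed
        have "cmod (pd \<alpha> ?G y) \<le> CARD('n) ^ (n - mi_abs \<alpha>) * (2 * C * A) * norm (y - x) ^ (n - mi_abs \<alpha>)"
        proof (rule iterated_mean_value[OF sG _ _ \<alpha>])
          show "pd \<gamma> ?G x = 0" if "mi_abs \<gamma> < n" for \<gamma> using that by (simp add: pG tay_self)
          fix \<gamma> :: "'n multiindex" and w assume \<gamma>: "mi_abs \<gamma> = n" and w: "w \<in> cball x (norm (y - x))"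
          have wx: "norm (w - x) < e" using w True by (simp add: dist_norm norm_minus_commute)
          have 1: "cmod (pd \<gamma> g w - f \<gamma> x) \<le> C * A" using g(2)[OF x wx, of \<gamma>] \<gamma> by (simp add: top)
          have 2: "cmod (?h \<gamma> x) \<le> C * A" using hx1[of \<gamma> x] \<gamma> x by simp
          have "pd \<gamma> ?G w = (pd \<gamma> g w - f \<gamma> x) - ?h \<gamma> x" using \<gamma> by (simp add: pG top)
          then show "cmod (pd \<gamma> ?G w) \<le> 2 * C * A"
            using order_trans[OF norm_triangle_ineq4 add_mono[OF 1 2]] by (simp add: ac_simps)
        qed
        also have "\<dots> \<le> ?d * (2 * C * A) * ?w"
          by (intro mult_right_mono of_nat_mono power_increasing) (use C A in auto)
        finally have 1: "cmod (jets g \<alpha> y - tay n (jets g) x \<alpha> y) \<le> ?d * (2 * C * A) * ?w" by (simp add: pG)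
        have 2: "cmod (f \<alpha> y - tay n f x \<alpha> y) \<le> A * ?w" by (rule t(2)[OF \<alpha> x y]) (use True et in simp)
        have "?h \<alpha> y - tay n ?h x \<alpha> y = (jets g \<alpha> y - tay n (jets g) x \<alpha> y) - (f \<alpha> y - tay n f x \<alpha> y)"
          unfolding tay_diff[where f="jets g" and g=f, symmetric] by (rule diff_diff_eq_swap)
        also have "cmod \<dots> \<le> ?d * (2 * C * A) * ?w + A * ?w" by (rule order_trans[OF norm_triangle_ineq4 add_mono[OF 1 2]])
        also have "\<dots> = (?d * (2 * C) + 1) * (A * ?w)" by (simp add: algebra_simps)
        also have "\<dots> \<le> Q * (A * ?w)" by (rule mult_right_mono) (use Q A in auto)
        also have "\<dots> = \<eta> * ?w" using A(2) by (simp add: mult.assoc[symmetric])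
        finally show ?thesis .
      qed
    qed
  qed
qed

section \<open>Whitney-type estimates for compactly supported distributions\<close>

text \<open>The cutoff costs up to |\<gamma>| powers of 1/e, while \<open>h\<close> is small of
  order N + 1 - |\<gamma>|, so a full factor \<open>e\<close> is left for all orders up to
  \<open>N\<close>.\<close>

lemma cutoff_mult_scaled:
  fixes \<zeta> h :: "real ^ 'n::finite \<Rightarrow> complex" and B D e :: real
  assumes \<zeta>: "test \<zeta>" "\<And>\<gamma> z. mi_abs \<gamma> \<le> N \<Longrightarrow> cmod (pd \<gamma> \<zeta> z) \<le> B * (1 / e) ^ mi_abs \<gamma>" "B \<ge> 0"
    and e: "0 < e" "e \<le> 1" and h: "smooth h" "D \<ge> 0"
    "\<And>\<gamma> z. mi_abs \<gamma> \<le> N \<Longrightarrow> z \<in> fun_support \<zeta> \<Longrightarrow> cmod (pd \<gamma> h z) \<le> D * e ^ (Suc N - mi_abs \<gamma>)"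
  shows "bd N (2 ^ N * B * D * e) (\<lambda>x. \<zeta> x * h x)"
  unfolding bd_def
proof (intro allI impI)
  fix \<gamma> :: "'n multiindex" and z assume \<gamma>: "mi_abs \<gamma> \<le> N"
  have t: "test (\<lambda>x. \<zeta> x * h x)" by (rule test_mult2[OF h(1) \<zeta>(1)])
  show "cmod (pd \<gamma> (\<lambda>x. \<zeta> x * h x) z) \<le> 2 ^ N * B * D * e"
  proof (cases "z \<in> fun_support \<zeta>")
    case False
    have "fun_support (\<lambda>x. \<zeta> x * h x) \<subseteq> fun_support \<zeta>" by (rule fun_support_mono) simp
    then have "z \<notin> fun_support (\<lambda>x. \<zeta> x * h x)" using False by blast
    then have "pd \<gamma> (\<lambda>x. \<zeta> x * h x) z = 0" by (rule pd_outside_support[OF test_smooth[OF t]])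
    then show ?thesis using \<zeta>(3) e h(2) by simp
  next
    case True
    have re: "e ^ Suc N * (1 / e) ^ k = e ^ (Suc N - k)" if "k \<le> N" for k
      using that e by (simp add: power_one_over power_diff)
    have "cmod (pd \<gamma> (\<lambda>x. \<zeta> x * h x) z) \<le> 2 ^ mi_abs \<gamma> * B * (D * e ^ Suc N) * (1 / e) ^ mi_abs \<gamma>"
    proof (rule leibniz_bound[OF test_smooth[OF \<zeta>(1)] h(1) \<zeta>(3)])
      show "0 \<le> D * e ^ Suc N" "0 \<le> 1 / e" using h(2) e by auto
      fix \<beta> :: "'n multiindex" assume \<beta>: "mi_abs \<beta> \<le> mi_abs \<gamma>"
      show "cmod (pd \<beta> \<zeta> z) \<le> B * (1 / e) ^ mi_abs \<beta>" using \<zeta>(2) \<beta> \<gamma> by simp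
      have "D * e ^ Suc N * (1 / e) ^ mi_abs \<beta> = D * e ^ (Suc N - mi_abs \<beta>)"
        unfolding mult.assoc using \<beta> \<gamma> by (subst re) auto
      then show "cmod (pd \<beta> h z) \<le> D * e ^ Suc N * (1 / e) ^ mi_abs \<beta>" using h(3)[of \<beta> z] True \<beta> \<gamma> by (simp only: order_trans)
    qed
    also have "\<dots> = 2 ^ mi_abs \<gamma> * B * (D * e ^ (Suc N - mi_abs \<gamma>))" unfolding re[OF \<gamma>, symmetric] by (simp add: mult.assoc)
    also have "\<dots> \<le> 2 ^ N * B * (D * e)"
    proof (intro mult_mono)
      show "(2::real) ^ mi_abs \<gamma> \<le> 2 ^ N" using \<gamma> by simp
      show "e ^ (Suc N - mi_abs \<gamma>) \<le> e" using power_decreasing[of 1 "Suc N - mi_abs \<gamma>" e] e \<gamma> by simp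
    qed (use \<zeta>(3) h(2) e in auto)
    finally show ?thesis by (simp only: mult.assoc)
  qed
qed

text \<open>If \<open>N\<close> is the order of \<open>u\<close> on a ball around \<open>K\<close>,
  Whitney order n = N + 1 makes consecutive approximations \<open>s k\<close> differ by a multiple
  of \<open>A * e (Suc k)\<close>. The distance from \<open>s k\<close> to \<open>u \<phi>\<close>
  involves a constant \<open>X\<close> that depends on \<open>\<phi>\<close> and not only on
  \<open>A\<close>; it is multiplied by \<open>e k\<close> and disappears in the limit.\<close>

lemma support_estimate:
  fixes u :: "'n::finite functional"
  assumes u: "distribution u" and K: "compact K" "dist_support u \<subseteq> K"
  obtains C :: real and n where "C \<ge> 0" "\<And>\<phi> A. test \<phi> \<Longrightarrow> A \<ge> 0 \<Longrightarrow> wb n K A (jets \<phi>) \<Longrightarrow> cmod (u \<phi>) \<le> C * A"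
proof -
  obtain R where R: "R > 0" "\<And>x. x \<in> K \<Longrightarrow> norm x \<le> R" using compact_imp_bounded[OF K(1)] by (auto simp: bounded_pos)
  obtain C0 :: real and N where C0: "C0 \<ge> 0" "\<And>\<phi> A. test \<phi> \<Longrightarrow> fun_support \<phi> \<subseteq> cball 0 (R + 1) \<Longrightarrow> bd N A \<phi> \<Longrightarrow> cmod (u \<phi>) \<le> C0 * A"
    by (rule distribution_bd[OF u compact_cball], rule that)
  obtain B :: real where B: "B \<ge> 0" and cut: "\<And>(K :: (real ^ 'n) set) e. compact K \<Longrightarrow> 0 < e \<Longrightarrow> e \<le> 1 \<Longrightarrow> \<exists>\<zeta> V. test \<zeta> \<and> open V \<and> K \<subseteq> V \<and>
       (\<forall>x\<in>V. \<zeta> x = 1) \<and> (\<forall>z\<in>fun_support \<zeta>. \<exists>a\<in>K. norm (z - a) < e) \<and>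
       (\<forall>\<gamma> z. mi_abs \<gamma> \<le> N \<longrightarrow> cmod (pd \<gamma> \<zeta> z) \<le> B * (1 / e) ^ mi_abs \<gamma>)"
    by (rule scaled_cutoff[of N], rule that)
  define n where "n = Suc N"
  obtain C c :: real where C: "C \<ge> 0" "c \<ge> 1" and
    sm: "\<And>(K :: (real ^ 'n) set) e f A. compact K \<Longrightarrow> 0 < e \<Longrightarrow> e \<le> 1 \<Longrightarrow> A \<ge> 0 \<Longrightarrow>
      \<forall>\<alpha> x y. mi_abs \<alpha> \<le> n \<longrightarrow> x \<in> K \<longrightarrow> y \<in> K \<longrightarrow> norm (y - x) \<le> c * e \<longrightarrow> cmod (f \<alpha> y - tay n f x \<alpha> y) \<le> A * norm (y - x) ^ (n - mi_abs \<alpha>) \<Longrightarrow>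
      \<exists>g. test g \<and> (\<forall>a\<in>K. \<forall>z. norm (z - a) < e \<longrightarrow> (\<forall>\<gamma>. mi_abs \<gamma> \<le> n \<longrightarrow> 
          cmod (pd \<gamma> g z - tay n f a \<gamma> z) \<le> C * A * e ^ (n - mi_abs \<gamma>)))"
    by (rule whitney_smoothing[of n], rule that)
  let ?N = "Nm n TYPE('n)"
  define q where "q = C0 * (2 ^ N * B)"
  have q: "q \<ge> 0" using C0 B by (simp add: q_def)
  define Q1 where "Q1 = q * (?N + C)"
  define Q2 where "Q2 = q * (C * (1 + 2 ^ n))"
  have Q: "Q1 \<ge> 0" "Q2 \<ge> 0" using q C by (auto simp: Q1_def Q2_def Nm_nonneg)
  show thesis
  proof (rule that[of "Q1 + Q2" n])
    show "Q1 + Q2 \<ge> 0" using Q by simp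
    fix \<phi> :: "real ^ 'n \<Rightarrow> complex" and A :: real assume \<phi>: "test \<phi>" and A: "A \<ge> 0" and w: "wb n K A (jets \<phi>)"
    define e where "e k = (1 / 2 :: real) ^ k" for k
    have e: "0 < e k" "e k \<le> 1" "e k = 2 * e (Suc k)" "e 0 = 1" for k by (auto simp: e_def power_le_one)
    have s\<phi>: "smooth \<phi>" by (rule test_smooth[OF \<phi>])
    have "\<exists>g. test g \<and> (\<forall>a\<in>K. \<forall>z. norm (z - a) < e k \<longrightarrow> (\<forall>\<gamma>. mi_abs \<gamma> \<le> n \<longrightarrow> 
          cmod (pd \<gamma> g z - tay n (jets \<phi>) a \<gamma> z) \<le> C * A * e k ^ (n - mi_abs \<gamma>)))" for k
      by (rule sm[OF K(1) e(1) e(2) A]) (use wbD(2)[OF w] in blast)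
    then obtain G where "\<forall>k. test (G k) \<and> (\<forall>a\<in>K. \<forall>z. norm (z - a) < e k \<longrightarrow> (\<forall>\<gamma>. mi_abs \<gamma> \<le> n \<longrightarrow> 
          cmod (pd \<gamma> (G k) z - tay n (jets \<phi>) a \<gamma> z) \<le> C * A * e k ^ (n - mi_abs \<gamma>)))" by metis
    then have G: "\<And>k. test (G k)" "\<And>k a z \<gamma>. a \<in> K \<Longrightarrow> norm (z - a) < e k \<Longrightarrow> mi_abs \<gamma> \<le> n \<Longrightarrow> 
          cmod (pd \<gamma> (G k) z - tay n (jets \<phi>) a \<gamma> z) \<le> C * A * e k ^ (n - mi_abs \<gamma>)" by blast+
    have "\<forall>k. \<exists>\<zeta> V. test \<zeta> \<and> open V \<and> K \<subseteq> V \<and>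
       (\<forall>x\<in>V. \<zeta> x = 1) \<and> (\<forall>z\<in>fun_support \<zeta>. \<exists>a\<in>K. norm (z - a) < e k) \<and>
       (\<forall>\<gamma> z. mi_abs \<gamma> \<le> N \<longrightarrow> cmod (pd \<gamma> \<zeta> z) \<le> B * (1 / e k) ^ mi_abs \<gamma>)" using cut[OF K(1) e(1) e(2)] by blast
    from choice[OF this] obtain Z where "\<forall>k. \<exists>V. test (Z k) \<and> open V \<and> K \<subseteq> V \<and>
       (\<forall>x\<in>V. Z k x = 1) \<and> (\<forall>z\<in>fun_support (Z k). \<exists>a\<in>K. norm (z - a) < e k) \<and>
       (\<forall>\<gamma> z. mi_abs \<gamma> \<le> N \<longrightarrow> cmod (pd \<gamma> (Z k) z) \<le> B * (1 / e k) ^ mi_abs \<gamma>)" by blast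
    from choice[OF this] obtain V where "\<forall>k. test (Z k) \<and> open (V k) \<and> K \<subseteq> V k \<and>
       (\<forall>x\<in>V k. Z k x = 1) \<and> (\<forall>z\<in>fun_support (Z k). \<exists>a\<in>K. norm (z - a) < e k) \<and>
       (\<forall>\<gamma> z. mi_abs \<gamma> \<le> N \<longrightarrow> cmod (pd \<gamma> (Z k) z) \<le> B * (1 / e k) ^ mi_abs \<gamma>)" by blast
    then have Z: "\<And>k. test (Z k)" "\<And>k. open (V k)" "\<And>k. K \<subseteq> V k" "\<And>k x. x \<in> V k \<Longrightarrow> Z k x = 1" 
      "\<And>k z. z \<in> fun_support (Z k) \<Longrightarrow> \<exists>a\<in>K. norm (z - a) < e k"
      "\<And>k \<gamma> z. mi_abs \<gamma> \<le> N \<Longrightarrow> cmod (pd \<gamma> (Z k) z) \<le> B * (1 / e k) ^ mi_abs \<gamma>" by blast+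
    have est: "cmod (u (\<lambda>x. Z k x * h x)) \<le> q * D * e k" if h: "smooth h" "D \<ge> 0" 
       "\<And>\<gamma> z a. mi_abs \<gamma> \<le> N \<Longrightarrow> a \<in> K \<Longrightarrow> norm (z - a) < e k \<Longrightarrow> cmod (pd \<gamma> h z) \<le> D * e k ^ (n - mi_abs \<gamma>)" for k h D
    proof -
      have b: "bd N (2 ^ N * B * D * e k) (\<lambda>x. Z k x * h x)"
      proof (rule cutoff_mult_scaled[OF Z(1) _ B e(1) e(2) h(1) h(2)])
        show "cmod (pd \<gamma> (Z k) z) \<le> B * (1 / e k) ^ mi_abs \<gamma>" if "mi_abs \<gamma> \<le> N" for \<gamma> z by (rule Z(6)[OF that])
        show "cmod (pd \<gamma> h z) \<le> D * e k ^ (Suc N - mi_abs \<gamma>)" if "mi_abs \<gamma> \<le> N" "z \<in> fun_support (Z k)" for \<gamma> z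
          using h(3)[OF that(1)] Z(5)[OF that(2)] unfolding n_def by blast
      qed
      have s: "fun_support (\<lambda>x. Z k x * h x) \<subseteq> cball 0 (R + 1)"
      proof (rule order_trans[OF fun_support_mono[of "Z k"]])
        show "fun_support (Z k) \<subseteq> cball 0 (R + 1)"
        proof
          fix z assume "z \<in> fun_support (Z k)"
          then obtain a where a: "a \<in> K" "norm (z - a) < e k" using Z(5) by blast
          have "norm z \<le> norm a + norm (z - a)" using norm_triangle_ineq2[of z a] by simp
          then show "z \<in> cball 0 (R + 1)" using R(2)[OF a(1)] a(2) e(2)[of k] by simp
        qed
      qed simp
      have "cmod (u (\<lambda>x. Z k x * h x)) \<le> C0 * (2 ^ N * B * D * e k)" by (rule C0(2)[OF test_mult2[OF h(1) Z(1)] s b])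
      then show ?thesis by (simp only: q_def mult.assoc)
    qed
    define s where "s k = u (\<lambda>x. Z k x * G k x)" for k
    \<comment> \<open>At the coarsest scale 1 the powers of the distance are at most 1, so the
      Taylor sums are bounded by the jet itself.\<close>
    have s0: "cmod (s 0) \<le> Q1 * A"
    proof -
      have "cmod (s 0) \<le> q * ((?N + C) * A) * e 0"
        unfolding s_def
      proof (rule est[OF test_smooth[OF G(1)]])
        show "0 \<le> (?N + C) * A" using C A by (simp add: Nm_nonneg)
        fix \<gamma> :: "'n multiindex" and z a assume \<gamma>: "mi_abs \<gamma> \<le> N" and a: "a \<in> K" and z: "norm (z - a) < e 0"
        have t: "cmod (tay n (jets \<phi>) a \<gamma> z) \<le> ?N * A"
        proof (rule tay_bound[OF _ A])
          fix \<beta> :: "'n multiindex" assume \<beta>: "mi_abs \<gamma> + mi_abs \<beta> \<le> n"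
          have 1: "cmod (jets \<phi> (\<gamma> + \<beta>) a) \<le> A" by (rule wbD(1)[OF w _ a]) (use \<beta> in simp)
          have 2: "norm (z - a) ^ mi_abs \<beta> \<le> 1" by (rule power_le_one) (use z e(4) in auto)
          show "cmod (jets \<phi> (\<gamma> + \<beta>) a) * norm (z - a) ^ mi_abs \<beta> \<le> A"
            using mult_mono[OF 1 2 A] by simp
        qed
        have g: "cmod (pd \<gamma> (G 0) z - tay n (jets \<phi>) a \<gamma> z) \<le> C * A"
          using G(2)[OF a z, of \<gamma>] \<gamma> by (simp add: e(4) n_def)
        have "cmod (pd \<gamma> (G 0) z) \<le> cmod (pd \<gamma> (G 0) z - tay n (jets \<phi>) a \<gamma> z) + cmod (tay n (jets \<phi>) a \<gamma> z)"
          using norm_triangle_ineq[of "pd \<gamma> (G 0) z - tay n (jets \<phi>) a \<gamma> z" "tay n (jets \<phi>) a \<gamma> z"] by simp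
        also have "\<dots> \<le> C * A + ?N * A" by (rule add_mono[OF g t])
        finally show "cmod (pd \<gamma> (G 0) z) \<le> (?N + C) * A * e 0 ^ (n - mi_abs \<gamma>)" by (simp add: e(4) algebra_simps)
      qed
      then show ?thesis by (simp add: e(4) Q1_def mult.assoc)
    qed
    have step: "cmod (s (Suc k) - s k) \<le> Q2 * A * e (Suc k)" for k
    proof -
      have tG: "test (\<lambda>x. Z i x * G j x)" for i j by (rule test_mult2[OF test_smooth[OF G(1)] Z(1)])
      \<comment> \<open>Both cutoffs are 1 near the support of \<open>u\<close> and may be
        exchanged, so that consecutive smoothings are compared under one cutoff.\<close>
      have sk: "s k = u (\<lambda>x. Z (Suc k) x * G k x)" unfolding s_def
        by (rule distribution_cong_near_support[OF u tG tG open_Int[OF Z(2) Z(2)], of k "Suc k"])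
           (use Z(3)[of k] Z(3)[of "Suc k"] Z(4) K in auto)
      have "s (Suc k) - s k = u (\<lambda>x. Z (Suc k) x * G (Suc k) x - Z (Suc k) x * G k x)"
        unfolding sk unfolding s_def by (rule distribution_minus[OF u tG tG, symmetric])
      also have "\<dots> = u (\<lambda>x. Z (Suc k) x * (G (Suc k) x - G k x))" by (simp only: right_diff_distrib)
      finally have sd: "s (Suc k) - s k = u (\<lambda>x. Z (Suc k) x * (G (Suc k) x - G k x))" .
      have "cmod (s (Suc k) - s k) \<le> q * (C * (1 + 2 ^ n) * A) * e (Suc k)"
        unfolding sd
      proof (rule est[OF smooth_minus[OF test_smooth[OF G(1)] test_smooth[OF G(1)]]])
        show "0 \<le> C * (1 + 2 ^ n) * A" using C A by simp
        fix \<gamma> :: "'n multiindex" and z a assume \<gamma>: "mi_abs \<gamma> \<le> N" and a: "a \<in> K" and z: "norm (z - a) < e (Suc k)"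
        let ?T = "tay n (jets \<phi>) a \<gamma> z" and ?w = "e (Suc k) ^ (n - mi_abs \<gamma>)"
        have \<gamma>': "mi_abs \<gamma> \<le> n" using \<gamma> by (simp add: n_def)
        have z': "norm (z - a) < e k" using z e(3)[of k] e(1)[of "Suc k"] by linarith
        have 1: "cmod (pd \<gamma> (G (Suc k)) z - ?T) \<le> C * A * ?w" by (rule G(2)[OF a z \<gamma>'])
        have "cmod (pd \<gamma> (G k) z - ?T) \<le> C * A * e k ^ (n - mi_abs \<gamma>)" by (rule G(2)[OF a z' \<gamma>'])
        also have "\<dots> \<le> C * A * (2 ^ n * ?w)"
          unfolding e(3)[of k] power_mult_distrib by (intro mult_left_mono mult_right_mono power_increasing) (use C A e(1) in \<open>auto simp: less_imp_le\<close>)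
        finally have 2: "cmod (pd \<gamma> (G k) z - ?T) \<le> C * A * (2 ^ n * ?w)" .
        have "pd \<gamma> (\<lambda>x. G (Suc k) x - G k x) z = (pd \<gamma> (G (Suc k)) z - ?T) - (pd \<gamma> (G k) z - ?T)"
          by (simp add: pd_minus test_smooth G(1))
        then have "cmod (pd \<gamma> (\<lambda>x. G (Suc k) x - G k x) z) \<le> C * A * ?w + C * A * (2 ^ n * ?w)"
          using order_trans[OF norm_triangle_ineq4 add_mono[OF 1 2]] by simp
        then show "cmod (pd \<gamma> (\<lambda>x. G (Suc k) x - G k x) z) \<le> C * (1 + 2 ^ n) * A * ?w" by (simp add: algebra_simps)
      qed
      then show ?thesis by (simp add: Q2_def mult.assoc)
    qed
    obtain M where M: "M \<ge> 0" "bd (Suc n) M \<phi>" by (rule test_bd[OF \<phi>, of "Suc n"], rule that)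
    define X where "X = CARD('n) ^ Suc n * M + C * A"
    have X: "X \<ge> 0" using M C A by (simp add: X_def)
    have lim: "cmod (u \<phi> - s k) \<le> q * X * e k" for k
    proof -
      have tG: "test (\<lambda>x. Z k x * G k x)" and t\<phi>: "test (\<lambda>x. Z k x * \<phi> x)" by (rule test_mult2[OF test_smooth Z(1)]; rule G(1) \<phi>)+
      have "u \<phi> = u (\<lambda>x. Z k x * \<phi> x)"
        by (rule distribution_cong_near_support[OF u \<phi> t\<phi> Z(2)[of k]])
           (use Z(3)[of k] Z(4) K in auto)
      then have "u \<phi> - s k = u (\<lambda>x. Z k x * \<phi> x - Z k x * G k x)"
        unfolding s_def by (simp only: distribution_minus[OF u t\<phi> tG])
      also have "\<dots> = u (\<lambda>x. Z k x * (\<phi> x - G k x))" by (simp only: right_diff_distrib)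
      finally have sd: "u \<phi> - s k = u (\<lambda>x. Z k x * (\<phi> x - G k x))" .
      show ?thesis
        unfolding sd
      proof (rule est[OF smooth_minus[OF s\<phi> test_smooth[OF G(1)]] X])
        fix \<gamma> :: "'n multiindex" and z a assume \<gamma>: "mi_abs \<gamma> \<le> N" and a: "a \<in> K" and z: "norm (z - a) < e k"
        let ?T = "tay n (jets \<phi>) a \<gamma> z" and ?w = "e k ^ (n - mi_abs \<gamma>)"
        have \<gamma>': "mi_abs \<gamma> \<le> n" using \<gamma> by (simp add: n_def)
        have "cmod (pd \<gamma> \<phi> z - ?T) \<le> CARD('n) ^ (Suc n - mi_abs \<gamma>) * M * norm (z - a) ^ (Suc n - mi_abs \<gamma>)"
          by (rule taylor_remainder[OF s\<phi> _ \<gamma>']) (simp add: bdD[OF M(2)])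
        also have "\<dots> \<le> real (CARD('n) ^ Suc n) * M * ?w"
        proof (intro mult_mono)
          show "real (CARD('n) ^ (Suc n - mi_abs \<gamma>)) \<le> real (CARD('n) ^ Suc n)" by (intro of_nat_mono power_increasing) auto
          have "norm (z - a) ^ (Suc n - mi_abs \<gamma>) \<le> e k ^ (Suc n - mi_abs \<gamma>)" by (rule power_mono) (use z in auto)
          also have "\<dots> \<le> ?w" by (rule power_decreasing) (use e(1)[of k] e(2)[of k] in \<open>auto simp: less_imp_le\<close>)
          finally show "norm (z - a) ^ (Suc n - mi_abs \<gamma>) \<le> ?w" .
        qed (use M e(1)[of k] in \<open>auto simp: less_imp_le\<close>)
        finally have 1: "cmod (pd \<gamma> \<phi> z - ?T) \<le> real (CARD('n) ^ Suc n) * M * ?w" .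
        have 2: "cmod (pd \<gamma> (G k) z - ?T) \<le> C * A * ?w" by (rule G(2)[OF a z \<gamma>'])
        have "pd \<gamma> (\<lambda>x. \<phi> x - G k x) z = (pd \<gamma> \<phi> z - ?T) - (pd \<gamma> (G k) z - ?T)"
          by (simp add: pd_minus test_smooth G(1) s\<phi>)
        then have "cmod (pd \<gamma> (\<lambda>x. \<phi> x - G k x) z) \<le> real (CARD('n) ^ Suc n) * M * ?w + C * A * ?w"
          using order_trans[OF norm_triangle_ineq4 add_mono[OF 1 2]] by simp
        then show "cmod (pd \<gamma> (\<lambda>x. \<phi> x - G k x) z) \<le> X * ?w" by (simp add: X_def distrib_right)
      qed
    qed
    \<comment> \<open>The step bounds add up by e 1 + ... + e k = 1 - e k.\<close>
    have sk: "cmod (s k) \<le> Q1 * A + Q2 * A * (1 - e k)" for k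
    proof (induction k)
      case 0
      then show ?case using s0 by (simp add: e(4))
    next
      case (Suc k)
      have "cmod (s (Suc k)) \<le> cmod (s k) + cmod (s (Suc k) - s k)" using norm_triangle_ineq[of "s k" "s (Suc k) - s k"] by simp
      also have "\<dots> \<le> Q1 * A + Q2 * A * (1 - e k) + Q2 * A * e (Suc k)" by (rule add_mono[OF Suc step])
      also have "\<dots> = Q1 * A + Q2 * A * (1 - e (Suc k))" unfolding e(3)[of k] by (simp add: algebra_simps)
      finally show ?case .
    qed
    have bound: "cmod (u \<phi>) \<le> (Q1 + Q2) * A + q * X * e k" for k
    proof -
      have "cmod (u \<phi>) \<le> cmod (s k) + cmod (u \<phi> - s k)" using norm_triangle_ineq[of "s k" "u \<phi> - s k"] by simp
      also have "\<dots> \<le> Q1 * A + Q2 * A * (1 - e k) + q * X * e k" by (rule add_mono[OF sk lim])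
      also have "Q2 * A * (1 - e k) \<le> Q2 * A * 1" by (rule mult_left_mono) (use e(1)[of k] Q A in \<open>auto simp: less_imp_le\<close>)
      finally show ?thesis by (simp add: algebra_simps)
    qed
    have "(\<lambda>k. (Q1 + Q2) * A + q * X * e k) \<longlonglongrightarrow> (Q1 + Q2) * A + q * X * 0"
      unfolding e_def by (intro tendsto_intros LIMSEQ_realpow_zero) auto
    then have "(\<lambda>k. (Q1 + Q2) * A + q * X * e k) \<longlonglongrightarrow> (Q1 + Q2) * A" by simp
    then show "cmod (u \<phi>) \<le> (Q1 + Q2) * A" by (rule LIMSEQ_le_const) (use bound in blast)
  qed
qed

section \<open>Translation of the operators\<close>

text \<open>The coefficients of P(D) with respect to partial derivatives, the factor -i of each D_j
  being absorbed.\<close>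

definition opc :: "'n::finite cpoly \<Rightarrow> 'n multiindex \<Rightarrow> complex" where
  "opc P \<alpha> = Poly_Mapping.lookup P \<alpha> * (- \<i>) ^ mi_abs \<alpha>"

lemma iter_jet_D: "iter_op jet_D \<alpha> f = (\<lambda>\<beta> x. (- \<i>) ^ mi_abs \<alpha> * f (\<beta> + \<alpha>) x)"
proof (induction \<alpha> rule: mi_induct)
  case (step \<alpha> j)
  have "iter_op jet_D (\<alpha> + ei j) f = jet_D j (iter_op jet_D \<alpha> f)"
    by (rule iter_op_Suc[where X="\<lambda>_. True"]) (auto simp: jet_D_def upd_Suc_eq ac_simps)
  then show ?case unfolding step jet_D_def by (simp add: upd_Suc_eq ac_simps)
qed simp

lemma jet_op_jop: "jet_op P f = jop (Poly_Mapping.keys P) (opc P) f"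
  by (simp add: jet_op_def jop_def[abs_def] iter_jet_D opc_def mult.assoc)

lemma smooth_partial_power: "smooth \<phi> \<Longrightarrow> smooth ((partial j ^^ k) \<phi>)"
  by (induction k) (auto intro: smooth_partial)

lemma smooth_foldr_partial: "smooth \<phi> \<Longrightarrow> smooth (foldr (\<lambda>j. partial j ^^ \<alpha> j) js \<phi>)"
  by (induction js) (auto intro: smooth_partial_power)

lemma partial_power_commute1: "smooth \<phi> \<Longrightarrow> (partial j ^^ k) (partial i \<phi>) = partial i ((partial j ^^ k) \<phi>)"
proof (induction k)
  case (Suc k)
  then show ?case using partial_commute[OF smooth_partial_power[OF Suc.prems], of j i k j] by simp
qed simp

lemma partial_power_commute: "smooth \<phi> \<Longrightarrow> (partial j ^^ k) ((partial i ^^ m) \<phi>) = (partial i ^^ m) ((partial j ^^ k) \<phi>)"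
proof (induction m)
  case (Suc m)
  then show ?case using partial_power_commute1[OF smooth_partial_power[OF Suc.prems], of k j i m i] by simp
qed simp

lemma partial_power_foldr:
  "smooth \<phi> \<Longrightarrow> (partial j ^^ k) (foldr (\<lambda>j. partial j ^^ \<alpha> j) js \<phi>) = foldr (\<lambda>j. partial j ^^ \<alpha> j) js ((partial j ^^ k) \<phi>)"
proof (induction js)
  case (Cons i js)
  then show ?case using partial_power_commute[OF smooth_foldr_partial[OF Cons.prems], of k j "\<alpha> i" i \<alpha> js] by simp
qed simp

lemma dist_D_power: "(dist_D j ^^ k) u \<phi> = \<i> ^ k * u ((partial j ^^ k) \<phi>)"
proof (induction k arbitrary: \<phi>)
  case (Suc k)
  have "(dist_D j ^^ Suc k) u \<phi> = \<i> * (dist_D j ^^ k) u (partial j \<phi>)" by (simp add: dist_D_def dist_partial_def)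
  also have "\<dots> = \<i> ^ Suc k * u ((partial j ^^ k) (partial j \<phi>))" by (simp add: Suc)
  also have "(partial j ^^ k) (partial j \<phi>) = (partial j ^^ Suc k) \<phi>" by (simp add: funpow_swap1)
  finally show ?case .
qed simp

text \<open>The operators \<open>dist_D j\<close> commute only as functionals on smooth functions, hence the induction on lists.\<close>

lemma iter_dist_D: 
  assumes "smooth \<phi>"
  shows "iter_op dist_D \<alpha> u \<phi> = \<i> ^ mi_abs \<alpha> * u (pd \<alpha> \<phi>)"
proof -
  have "foldr (\<lambda>j. dist_D j ^^ \<alpha> j) js u \<phi> = \<i> ^ sum_list (map \<alpha> js) * u (foldr (\<lambda>j. partial j ^^ \<alpha> j) js \<phi>)" 
    if "smooth \<phi>" for js \<phi>
    using that
  proof (induction js arbitrary: \<phi>)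
    case (Cons j js)
    have "foldr (\<lambda>j. dist_D j ^^ \<alpha> j) (j # js) u \<phi> = \<i> ^ \<alpha> j * foldr (\<lambda>j. dist_D j ^^ \<alpha> j) js u ((partial j ^^ \<alpha> j) \<phi>)"
      unfolding foldr.simps comp_apply by (rule dist_D_power)
    also have "\<dots> = \<i> ^ \<alpha> j * (\<i> ^ sum_list (map \<alpha> js) * u (foldr (\<lambda>j. partial j ^^ \<alpha> j) js ((partial j ^^ \<alpha> j) \<phi>)))"
      unfolding Cons.IH[OF smooth_partial_power[OF Cons.prems]] ..
    also have "foldr (\<lambda>j. partial j ^^ \<alpha> j) js ((partial j ^^ \<alpha> j) \<phi>) = foldr (\<lambda>j. partial j ^^ \<alpha> j) (j # js) \<phi>"
      unfolding foldr.simps comp_apply by (rule partial_power_foldr[OF Cons.prems, symmetric])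
    finally show ?case by (simp only: list.map sum_list.Cons power_add mult.assoc)
  qed simp
  moreover have "sum_list (map \<alpha> coords) = mi_abs \<alpha>"
    using sum.distinct_set_conv_list[OF coords(1), of \<alpha>] by (simp add: mi_abs_def coords(2))
  ultimately show ?thesis using assms by (simp add: iter_op_def)
qed

text \<open>Moving D_j from \<open>u\<close> to the test function turns it into -D_j, and the
  reflection of the symbol undoes this sign: the reflected operator on distributions is the
  transpose of P(D).\<close>

lemma dist_op_reflect:
  assumes u: "distribution u" and \<phi>: "test \<phi>"
  shows "dist_op (cpoly_reflect P) u \<phi> = u (pdo (Poly_Mapping.keys P) (opc P) \<phi>)"
proof -
  have keys: "Poly_Mapping.keys (cpoly_reflect P) = Poly_Mapping.keys P"
    by (auto simp: cpoly_reflect_def in_keys_iff lookup_mapp when_def)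
  have "dist_op (cpoly_reflect P) u \<phi> = (\<Sum>\<alpha>\<in>Poly_Mapping.keys P. opc P \<alpha> * u (pd \<alpha> \<phi>))"
    unfolding dist_op_def keys
  proof (rule sum.cong[OF refl])
    fix \<alpha> assume "\<alpha> \<in> Poly_Mapping.keys P"
    then have "Poly_Mapping.lookup (cpoly_reflect P) \<alpha> = (-1) ^ mi_abs \<alpha> * Poly_Mapping.lookup P \<alpha>"
      by (simp add: cpoly_reflect_def lookup_mapp)
    moreover have "(- \<i>) ^ mi_abs \<alpha> = (-1) ^ mi_abs \<alpha> * \<i> ^ mi_abs \<alpha>" by (rule power_minus)
    ultimately show "Poly_Mapping.lookup (cpoly_reflect P) \<alpha> * iter_op dist_D \<alpha> u \<phi> = opc P \<alpha> * u (pd \<alpha> \<phi>)"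
      by (simp add: iter_dist_D test_smooth \<phi> opc_def)
  qed
  also have "\<dots> = u (pdo (Poly_Mapping.keys P) (opc P) \<phi>)"
    unfolding pdo_def by (subst distribution_sum[OF u]) (auto intro!: test_cmult test_pd \<phi> sum.cong distribution_cmult[OF u, symmetric])
  finally show ?thesis .
qed

lemma nonconstant_coeff:
  assumes "nonconstant P" obtains \<alpha> where "\<alpha> \<in> Poly_Mapping.keys P" "opc P \<alpha> \<noteq> 0"
proof -
  have "P \<noteq> 0" using assms unfolding nonconstant_def by (metis single_zero)
  then obtain \<alpha> where "\<alpha> \<in> Poly_Mapping.keys P" by (metis all_not_in_conv keys_eq_empty)
  then show thesis by (intro that[of \<alpha>]) (auto simp: opc_def in_keys_iff)
qed

section \<open>Transposed operators on distributions\<close>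

lemma fun_support_pdo: "smooth \<phi> \<Longrightarrow> fun_support (pdo S a \<phi>) \<subseteq> fun_support \<phi>"
  by (rule fun_support_subset[OF closed_fun_support]) (simp add: pdo_def pd_outside_support)

lemma order_bound:
  assumes "finite S" obtains m :: nat where "\<And>\<alpha> :: 'n::finite multiindex. \<alpha> \<in> S \<Longrightarrow> mi_abs \<alpha> \<le> m"
  by (rule that[of "\<Sum>\<alpha>\<in>S. mi_abs \<alpha>"]) (simp add: member_le_sum assms)

lemma bd_pdo:
  assumes m: "\<And>\<alpha>. \<alpha> \<in> S \<Longrightarrow> mi_abs \<alpha> \<le> m" and \<phi>: "smooth \<phi>" "bd (N + m) A \<phi>"
  shows "bd N ((\<Sum>\<alpha>\<in>S. cmod (a \<alpha>)) * A) (pdo S a \<phi>)"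
  unfolding bd_def pd_pdo[OF \<phi>(1)] sum_distrib_right
proof (intro allI impI sum_norm_le)
  fix \<beta> :: "'a multiindex" and x and \<alpha> assume "mi_abs \<beta> \<le> N" "\<alpha> \<in> S"
  then have "cmod (pd (\<beta> + \<alpha>) \<phi> x) \<le> A" using m[of \<alpha>] by (intro bdD[OF \<phi>(2)]) simp
  then show "cmod (a \<alpha> * pd (\<beta> + \<alpha>) \<phi> x) \<le> cmod (a \<alpha>) * A" unfolding norm_mult by (rule mult_left_mono) simp
qed

lemma distribution_pdo:
  fixes u :: "'n::finite functional"
  assumes u: "distribution u" and S: "finite S"
  shows "distribution (\<lambda>\<phi>. u (pdo S a \<phi>))"
proof (rule distributionI)
  show "u (pdo S a (\<lambda>x. \<phi> x + \<psi> x)) = u (pdo S a \<phi>) + u (pdo S a \<psi>)" if "test \<phi>" "test \<psi>" for \<phi> \<psi>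
    using that by (simp add: pdo_add test_smooth distribution_add[OF u] test_pdo)
  show "u (pdo S a (\<lambda>x. c * \<phi> x)) = c * u (pdo S a \<phi>)" if "test \<phi>" for \<phi> c
    using that by (simp add: pdo_cmult test_smooth distribution_cmult[OF u] test_pdo)
  fix K :: "(real ^ 'n) set" assume K: "compact K"
  obtain C :: real and N where C: "C \<ge> 0" "\<And>\<phi> A. test \<phi> \<Longrightarrow> fun_support \<phi> \<subseteq> K \<Longrightarrow> bd N A \<phi> \<Longrightarrow> cmod (u \<phi>) \<le> C * A"
    by (rule distribution_bd[OF u K], rule that)
  obtain m where m: "\<And>\<alpha>. \<alpha> \<in> S \<Longrightarrow> mi_abs \<alpha> \<le> m" by (rule order_bound[OF S], rule that)
  show "\<exists>C N. C \<ge> 0 \<and> (\<forall>\<phi> A. test \<phi> \<longrightarrow> fun_support \<phi> \<subseteq> K \<longrightarrow> bd N A \<phi> \<longrightarrow> cmod (u (pdo S a \<phi>)) \<le> C * A)"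
  proof (intro exI[of _ "C * (\<Sum>\<alpha>\<in>S. cmod (a \<alpha>))"] exI[of _ "N + m"] conjI allI impI)
    show "0 \<le> C * (\<Sum>\<alpha>\<in>S. cmod (a \<alpha>))" using C(1) by (simp add: sum_nonneg)
    fix \<phi> A assume \<phi>: "test \<phi>" "fun_support \<phi> \<subseteq> K" "bd (N + m) A \<phi>"
    show "cmod (u (pdo S a \<phi>)) \<le> C * (\<Sum>\<alpha>\<in>S. cmod (a \<alpha>)) * A"
      unfolding mult.assoc
      by (rule C(2)[OF test_pdo[OF \<phi>(1)] order_trans[OF fun_support_pdo[OF test_smooth[OF \<phi>(1)]] \<phi>(2)] bd_pdo[OF m test_smooth[OF \<phi>(1)] \<phi>(3)]])
  qed
qed

lemma dist_support_pdo:
  assumes u: "distribution u"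
  shows "dist_support (\<lambda>\<phi>. u (pdo S a \<phi>)) \<subseteq> dist_support u"
proof (rule dist_support_subset[OF closed_dist_support])
  fix \<phi> assume \<phi>: "test \<phi>" "fun_support \<phi> \<inter> dist_support u = {}"
  then show "u (pdo S a \<phi>) = 0"
    using fun_support_pdo[OF test_smooth[OF \<phi>(1)], of S a] by (intro dist_support_vanish[OF u] test_pdo) auto
qed

lemma dist_support_cong: "(\<And>\<phi>. test \<phi> \<Longrightarrow> u \<phi> = v \<phi>) \<Longrightarrow> dist_support u = dist_support v"
  by (simp add: dist_support_def)

text \<open>Being bounded by a Whitney seminorm on \<open>K\<close>, the composition of
  \<open>v\<close> with the operator extends to jets on \<open>K\<close> and vanishes on jets of
  zero solutions. In quantitative form: it is small on every test function close to such a
  jet.\<close>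

lemma flat_estimate:
  fixes v :: "'n::finite functional"
  assumes S: "finite S" and v: "distribution v" and K: "compact K" "dist_support v \<subseteq> K"
  obtains C :: real and n where "C \<ge> 0" 
    "\<And>f g r. test g \<Longrightarrow> r \<ge> 0 \<Longrightarrow> \<forall>\<beta>. \<forall>x\<in>K. jop S a f \<beta> x = 0 \<Longrightarrow> wb n K r (\<lambda>\<alpha> x. jets g \<alpha> x - f \<alpha> x) \<Longrightarrow> cmod (v (pdo S a g)) \<le> C * r"
proof -
  obtain C1 :: real and n where C1: "C1 \<ge> 0" "\<And>\<phi> A. test \<phi> \<Longrightarrow> A \<ge> 0 \<Longrightarrow> wb n K A (jets \<phi>) \<Longrightarrow> cmod (v \<phi>) \<le> C1 * A"
    by (rule support_estimate[OF v K], rule that)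
  obtain m where m: "\<And>\<alpha>. \<alpha> \<in> S \<Longrightarrow> mi_abs \<alpha> \<le> m" by (rule order_bound[OF S], rule that)
  obtain C2 where C2: "C2 \<ge> 0" "\<And>A h. A \<ge> 0 \<Longrightarrow> wb (n + m) K A h \<Longrightarrow> wb n K (C2 * A) (jop S a h)"
    by (rule wb_jop[OF K(1) S m, where n=n and a=a]) (assumption, rule that)
  show thesis
  proof (rule that[of "C1 * C2" "n + m"])
    show "0 \<le> C1 * C2" using C1 C2 by simp
    fix f :: "'n jet" and g and r :: real
    assume g: "test g" and r: "r \<ge> 0" and f: "\<forall>\<beta>. \<forall>x\<in>K. jop S a f \<beta> x = 0" and w: "wb (n + m) K r (\<lambda>\<alpha> x. jets g \<alpha> x - f \<alpha> x)"
    have "wb n K (C2 * r) (jets (pdo S a g))"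
    proof (rule wb_cong[OF _ C2(2)[OF r w]])
      fix \<alpha> x assume x: "x \<in> K"
      have "jop S a (\<lambda>\<alpha> x. jets g \<alpha> x - f \<alpha> x) \<alpha> x = jop S a (jets g) \<alpha> x - jop S a f \<alpha> x"
        by (simp add: jop_def right_diff_distrib sum_subtractf)
      then show "jop S a (\<lambda>\<alpha> x. jets g \<alpha> x - f \<alpha> x) \<alpha> x = jets (pdo S a g) \<alpha> x" using f x by (simp add: jop_jets test_smooth g)
    qed
    from C1(2)[OF test_pdo[OF g] _ this] C2(1) r show "cmod (v (pdo S a g)) \<le> C1 * C2 * r" by (simp add: mult.assoc)
  qed
qed

section \<open>Density in spaces of zero solutions\<close>

definition jker :: "'n::finite multiindex set \<Rightarrow> ('n multiindex \<Rightarrow> complex) \<Rightarrow> (real ^ 'n) set \<Rightarrow> 'n jet set" where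
  "jker S a F = {f \<in> whitney_jets F. \<forall>\<beta>. \<forall>x\<in>F. jop S a f \<beta> x = 0}"

lemma whitney_kernel_jker: "whitney_kernel P F = jker (Poly_Mapping.keys P) (opc P) F"
  by (simp add: whitney_kernel_def jker_def jet_op_jop)

lemma jet_restrict_apply: "x \<in> F \<Longrightarrow> jet_restrict F f \<alpha> x = f \<alpha> x"
  by (simp add: jet_restrict_def)

lemma jop_restrict: "x \<in> F \<Longrightarrow> jop S a (jet_restrict F f) \<beta> x = jop S a f \<beta> x"
  by (simp add: jop_def jet_restrict_apply)

lemma jet_restrict_restrict: "K \<subseteq> F \<Longrightarrow> jet_restrict K (jet_restrict F f) = jet_restrict K f"
  by (auto simp: jet_restrict_def restrict_def fun_eq_iff)

lemma jker_restrict: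
  assumes f: "f \<in> jker S a F2" and sub: "F1 \<subseteq> F2"
  shows "jet_restrict F1 f \<in> jker S a F1"
proof -
  have f': "f \<in> whitney_jets F2" using f by (simp add: jker_def)
  have "continuous_on F1 (restrict (f \<alpha>) F1)" for \<alpha>
  proof (rule continuous_on_eq)
    show "continuous_on F1 (f \<alpha>)" using f' sub unfolding whitney_jets_def by (blast intro: continuous_on_subset)
  qed simp
  moreover have "jet_restrict K (jet_restrict F1 f) \<in> whitney_jets_compact K" if "compact K" "K \<subseteq> F1" for K
    unfolding jet_restrict_restrict[OF that(2)] using f' that sub unfolding whitney_jets_def by blast
  ultimately have "jet_restrict F1 f \<in> whitney_jets F1" unfolding whitney_jets_def by (simp add: jet_restrict_def)
  moreover have "jop S a (jet_restrict F1 f) \<beta> x = 0" if "x \<in> F1" for \<beta> x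
    using f sub that by (auto simp: jop_restrict jker_def)
  ultimately show ?thesis by (simp add: jker_def)
qed

lemma jker_smooth:
  assumes \<psi>: "smooth \<psi>" and flat: "\<And>\<beta> x. x \<in> F \<Longrightarrow> pd \<beta> (pdo S a \<psi>) x = 0"
  shows "jet_restrict F (jets \<psi>) \<in> jker S a F"
  using whitney_jets_smooth[OF \<psi>, of F] flat by (simp add: jker_def jop_restrict jop_jets[OF \<psi>])

lemma smooth_wb:
  fixes \<psi> :: "real ^ 'n::finite \<Rightarrow> complex"
  assumes \<psi>: "smooth \<psi>" and K: "compact K"
  obtains A where "A \<ge> 0" "wb n K A (jets \<psi>)"
proof -
  obtain A where A: "A \<ge> 0" "wb n K A (jet_restrict K (jets \<psi>))"
    by (rule whitney_jets_wb[OF whitney_jets_smooth[OF \<psi>, of K] K subset_refl, of n], rule that)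
  show thesis by (rule that[OF A(1) wb_cong[OF _ A(2)]]) (rule jet_restrict_apply)
qed

lemma nonpos_if_small:
  fixes c x :: real assumes "\<And>r. r > 0 \<Longrightarrow> x \<le> c * r" shows "x \<le> 0"
proof -
  have "((\<lambda>r. c * r) \<longlongrightarrow> c * 0) (at_right 0)" by (intro tendsto_intros)
  then have l: "((\<lambda>r. c * r) \<longlongrightarrow> 0) (at_right 0)" by simp
  have "eventually (\<lambda>r. x \<le> c * r) (at_right 0)" unfolding eventually_at_right_field using assms by (intro exI[of _ 1]) auto
  then show ?thesis by (intro tendsto_lowerbound[OF l]) auto
qed

text \<open>For \<open>\<phi>\<close> supported off \<open>F1\<close>, the value
  \<open>u \<phi>\<close> equals \<open>w\<close> on the cut-off convolution of \<open>E\<close>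
  with \<open>\<phi>\<close>, where \<open>w\<close> is the transposed image of \<open>u\<close>. On
  \<open>F1\<close> the jet of this convolution is a zero solution. By density it is approximated by
  zero solutions on \<open>F2\<close>, and on those \<open>w\<close> vanishes in the sense of
  \<open>flat_estimate\<close>, since \<open>w\<close> factors through the operator and
  \<open>u\<close> lives on \<open>F2\<close>.\<close>

lemma dense_imp_support:
  fixes u :: "'n::finite functional" and S :: "'n multiindex set"
  assumes S: "finite S" and a0: "\<alpha>0 \<in> S" "a \<alpha>0 \<noteq> 0" and F: "closed F1" "F1 \<subseteq> F2"
    and dense: "\<And>f T. f \<in> jker S a F1 \<Longrightarrow> openin (whitney_topology F1) T \<Longrightarrow> f \<in> T \<Longrightarrow> \<exists>g\<in>jker S a F2. jet_restrict F1 g \<in> T"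
    and u: "distribution u" "compact (dist_support u)" "dist_support u \<subseteq> F2" and Pu: "dist_support (\<lambda>\<phi>. u (pdo S a \<phi>)) \<subseteq> F1"
  shows "dist_support u \<subseteq> F1"
proof -
  define w where "w \<phi> = u (pdo S a \<phi>)" for \<phi>
  have w: "distribution w" unfolding w_def[abs_def] by (rule distribution_pdo[OF u(1) S])
  define K1 where "K1 = dist_support w"
  define K2 where "K2 = dist_support u"
  have K12: "K1 \<subseteq> K2" unfolding K1_def K2_def w_def[abs_def] by (rule dist_support_pdo[OF u(1)])
  have K2: "compact K2" "K2 \<subseteq> F2" using u by (simp_all add: K2_def)
  have K1F: "K1 \<subseteq> F1" using Pu by (simp add: K1_def w_def[abs_def])
  have K1: "compact K1" using compact_Int_closed[OF K2(1) closed_dist_support[of w]] K12 by (simp add: K1_def Int_absorb1)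
  obtain C1 :: real and n1 where C1: "C1 \<ge> 0" "\<And>\<phi> A. test \<phi> \<Longrightarrow> A \<ge> 0 \<Longrightarrow> wb n1 K1 A (jets \<phi>) \<Longrightarrow> cmod (w \<phi>) \<le> C1 * A"
    by (rule support_estimate[OF w K1 eq_refl[OF K1_def[symmetric]]], rule that)
  obtain C2 :: real and n2 where C2: "C2 \<ge> 0" 
    "\<And>f g r. test g \<Longrightarrow> r \<ge> 0 \<Longrightarrow> \<forall>\<beta>. \<forall>x\<in>K2. jop S a f \<beta> x = 0 \<Longrightarrow> wb n2 K2 r (\<lambda>\<alpha> x. jets g \<alpha> x - f \<alpha> x) \<Longrightarrow> cmod (u (pdo S a g)) \<le> C2 * r"
    by (rule flat_estimate[OF S u(1) K2(1) eq_refl[OF K2_def[symmetric]], where a=a], rule that)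
  obtain D1 where D1: "D1 \<ge> 0" "\<And>A h. A \<ge> 0 \<Longrightarrow> wb (max n1 n2) K2 A h \<Longrightarrow> wb n1 K2 (D1 * A) h"
    by (rule wb_order_mono[OF K2(1) max.cobounded1[of n1 n2]], rule that)
  obtain D2 where D2: "D2 \<ge> 0" "\<And>A h. A \<ge> 0 \<Longrightarrow> wb (max n1 n2) K2 A h \<Longrightarrow> wb n2 K2 (D2 * A) h"
    by (rule wb_order_mono[OF K2(1) max.cobounded2[of n2 n1]], rule that)
  obtain \<zeta> V where \<zeta>: "test \<zeta>" "open V" "K2 \<subseteq> V" "\<And>x. x \<in> V \<Longrightarrow> \<zeta> x = 1"
    by (rule cutoff_exists[OF K2(1) open_UNIV]) auto
  have key: "w (\<lambda>x. \<zeta> x * \<psi> x) = 0" if \<psi>: "smooth \<psi>" and flat: "\<And>\<beta> x. x \<in> F1 \<Longrightarrow> pd \<beta> (pdo S a \<psi>) x = 0" for \<psi>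
  proof -
    let ?\<phi> = "\<lambda>x. \<zeta> x * \<psi> x"
    have t\<phi>: "test ?\<phi>" by (rule test_mult2[OF \<psi> \<zeta>(1)])
    let ?f1 = "jet_restrict F1 (jets \<psi>)"
    have f1: "?f1 \<in> jker S a F1" by (rule jker_smooth[OF \<psi> flat])
    have f1': "?f1 \<in> whitney_jets F1" by (rule whitney_jets_smooth[OF \<psi>])
    have "cmod (w ?\<phi>) \<le> (C1 * (D1 + 1) + C2 * D2) * r" if r: "r > 0" for r
    proof -
      let ?T = "whitney_ball F1 ?f1 n1 K1 r"
      have T: "openin (whitney_topology F1) ?T"
        unfolding whitney_topology_def by (rule topology_generated_by_Basis) (use f1' K1 K1F r in blast)
      have "wb n1 K1 0 (jet_restrict K1 (?f1 - ?f1))"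
        by (rule wb_cong[OF _ wb_zero]) (simp add: jet_restrict_apply zero_fun_apply)
      then have "jet_norm n1 K1 (jet_restrict K1 (?f1 - ?f1)) \<le> ennreal (2 * 0)" by (rule wb_imp_jet_norm) simp
      also have "\<dots> < ennreal r" using r by simp
      finally have "?f1 \<in> ?T" using f1' by (simp only: whitney_ball_def mem_Collect_eq simp_thms)
      from dense[OF f1 T this] obtain f2 where f2: "f2 \<in> jker S a F2" "jet_restrict F1 f2 \<in> ?T" by blast
      have f2': "f2 \<in> whitney_jets F2" "\<forall>\<beta>. \<forall>x\<in>K2. jop S a f2 \<beta> x = 0" using f2(1) K2(2) by (auto simp: jker_def)
      have "jet_norm n1 K1 (jet_restrict K1 (jet_restrict F1 f2 - ?f1)) < ennreal r" using f2(2) by (simp add: whitney_ball_def)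
      then have "wb n1 K1 r (jet_restrict K1 (jet_restrict F1 f2 - ?f1))" by (rule jet_norm_imp_wb)
      then have f2\<psi>: "wb n1 K1 r (\<lambda>\<alpha> x. f2 \<alpha> x - jets \<psi> \<alpha> x)"
        by (rule wb_cong[rotated]) (use K1F in \<open>auto simp: jet_restrict_apply subset_iff\<close>)
      \<comment> \<open>\<open>w\<close> acts on test functions, so the jet \<open>f2\<close> is
        replaced by \<open>g\<close>; order \<open>max n1 n2\<close> on \<open>K2\<close> serves
        both the estimate for \<open>w\<close> and the one for \<open>u\<close>.\<close>
      obtain g where g: "test g" "wb (max n1 n2) K2 r (\<lambda>\<alpha> x. jets g \<alpha> x - f2 \<alpha> x)"
        by (rule whitney_density[OF f2'(1) K2 r], rule that)
      have g1: "wb n1 K1 (D1 * r) (\<lambda>\<alpha> x. jets g \<alpha> x - f2 \<alpha> x)"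
        by (rule wb_subset[OF D1(2)[OF less_imp_le[OF r] g(2)] K12])
      have g2: "wb n2 K2 (D2 * r) (\<lambda>\<alpha> x. jets g \<alpha> x - f2 \<alpha> x)" by (rule D2(2)[OF less_imp_le[OF r] g(2)])
      have tg: "test (\<lambda>x. g x - ?\<phi> x)" by (rule test_minus[OF g(1) t\<phi>])
      have "wb n1 K1 (D1 * r + r) (jets (\<lambda>x. g x - ?\<phi> x))"
      proof (rule wb_cong[OF _ wb_add[OF g1 f2\<psi>]])
        fix \<alpha> x assume x: "x \<in> K1"
        have "pd \<alpha> ?\<phi> x = pd \<alpha> \<psi> x"
          by (rule pd_cong_open[OF test_smooth[OF t\<phi>] \<psi> \<zeta>(2)]) (use x K12 \<zeta> in auto)
        then show "jets g \<alpha> x - f2 \<alpha> x + (f2 \<alpha> x - jets \<psi> \<alpha> x) = jets (\<lambda>x. g x - ?\<phi> x) \<alpha> x"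
          by (simp add: pd_minus test_smooth g(1) t\<phi>)
      qed
      then have 1: "cmod (w (\<lambda>x. g x - ?\<phi> x)) \<le> C1 * (D1 * r + r)"
        by (rule C1(2)[OF tg, rotated]) (use D1(1) r in simp)
      have 2: "cmod (w g) \<le> C2 * (D2 * r)"
        unfolding w_def by (rule C2(2)[OF g(1) _ f2'(2) g2]) (use D2(1) r in simp)
      have "w ?\<phi> = w g - w (\<lambda>x. g x - ?\<phi> x)" by (simp add: distribution_minus[OF w g(1) t\<phi>])
      then have "cmod (w ?\<phi>) \<le> C2 * (D2 * r) + C1 * (D1 * r + r)"
        using order_trans[OF norm_triangle_ineq4 add_mono[OF 2 1]] by simp
      then show ?thesis by (simp add: algebra_simps)
    qed
    from nonpos_if_small[OF this] show ?thesis by simp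
  qed
  obtain E where E: "distribution E" "\<And>\<phi>. test \<phi> \<Longrightarrow> E (pdo S (adj a) \<phi>) = \<phi> 0"
    by (rule fundamental_solution[where a=a, OF S a0], rule that)
  show ?thesis
  proof (rule dist_support_subset[OF F(1)])
    fix \<phi> assume \<phi>: "test \<phi>" "fun_support \<phi> \<inter> F1 = {}"
    have s: "smooth (conv E \<phi>)" by (rule smooth_conv[OF E(1) \<phi>(1)])
    have c: "pdo S a (conv E \<phi>) = \<phi>" by (rule conv_fundamental[OF E(1) _ \<phi>(1)]; rule E(2); assumption)
    have t: "test (\<lambda>x. \<zeta> x * conv E \<phi> x)" by (rule test_mult2[OF s \<zeta>(1)])
    have "u \<phi> = w (\<lambda>x. \<zeta> x * conv E \<phi> x)"
      unfolding w_def
    proof (rule distribution_cong_near_support[OF u(1) \<phi>(1) test_pdo[OF t] \<zeta>(2)])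
      show "dist_support u \<subseteq> V" using \<zeta>(3) by (simp add: K2_def)
      fix x assume x: "x \<in> V"
      have "pdo S a (\<lambda>x. \<zeta> x * conv E \<phi> x) x = pdo S a (conv E \<phi>) x"
        by (rule pdo_cong_open[OF test_smooth[OF t] s \<zeta>(2) x]) (use \<zeta>(4) in simp)
      then show "\<phi> x = pdo S a (\<lambda>x. \<zeta> x * conv E \<phi> x) x" using c by simp
    qed
    also have "\<dots> = 0"
    proof (rule key[OF s])
      fix \<beta> x assume "x \<in> F1"
      then have "x \<notin> fun_support \<phi>" using \<phi>(2) by blast
      then show "pd \<beta> (pdo S a (conv E \<phi>)) x = 0" unfolding c by (rule pd_outside_support[OF test_smooth[OF \<phi>(1)]])
    qed
    finally show "u \<phi> = 0" .
  qed
qed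

subsection \<open>The gauge of the Whitney seminorm\<close>

text \<open>The Hahn-Banach theorem requires a real-valued seminorm; this infimum is one on
  \<open>wspace n K\<close>, where some bound exists.\<close>

definition wnorm :: "nat \<Rightarrow> (real ^ 'n::finite) set \<Rightarrow> 'n jet \<Rightarrow> real" where
  "wnorm n K h = Inf {B. B \<ge> 0 \<and> wb n K B h}"

definition wspace :: "nat \<Rightarrow> (real ^ 'n::finite) set \<Rightarrow> 'n jet set" where
  "wspace n K = {h. \<exists>B\<ge>0. wb n K B h}"

lemma wspaceI: "B \<ge> 0 \<Longrightarrow> wb n K B h \<Longrightarrow> h \<in> wspace n K"
  by (auto simp: wspace_def)

lemma wnorm_le: "B \<ge> 0 \<Longrightarrow> wb n K B h \<Longrightarrow> wnorm n K h \<le> B"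
  unfolding wnorm_def by (rule cInf_lower) (auto intro: bdd_belowI)

lemma wnorm_wb:
  assumes h: "h \<in> wspace n K" and "wnorm n K h < B" shows "wb n K B h"
proof -
  have "{B. B \<ge> 0 \<and> wb n K B h} \<noteq> {}" using h by (auto simp: wspace_def)
  from cInf_lessD[OF this] assms(2) obtain B' where B': "wb n K B' h" "B' < B" unfolding wnorm_def by blast
  show ?thesis by (rule wb_le[OF B'(1) less_imp_le[OF B'(2)]])
qed

lemma wnorm_nonneg: "h \<in> wspace n K \<Longrightarrow> wnorm n K h \<ge> 0"
  unfolding wnorm_def by (rule cInf_greatest) (auto simp: wspace_def)

lemma wspace_add: "f \<in> wspace n K \<Longrightarrow> g \<in> wspace n K \<Longrightarrow> (\<lambda>\<alpha> x. f \<alpha> x + g \<alpha> x) \<in> wspace n K"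
  unfolding wspace_def by (blast intro: wb_add add_nonneg_nonneg)

lemma wspace_cmult: 
  assumes "f \<in> wspace n K" shows "(\<lambda>\<alpha> x. c * f \<alpha> x) \<in> wspace n K"
proof -
  obtain B where B: "B \<ge> 0" "wb n K B f" using assms by (auto simp: wspace_def)
  show ?thesis by (rule wspaceI[OF _ wb_cmult[OF B(2)]]) (use B in simp)
qed

lemma wnorm_add:
  assumes f: "f \<in> wspace n K" and g: "g \<in> wspace n K"
  shows "wnorm n K (\<lambda>\<alpha> x. f \<alpha> x + g \<alpha> x) \<le> wnorm n K f + wnorm n K g"
proof (rule field_le_epsilon)
  fix e :: real assume e: "e > 0"
  have "wnorm n K (\<lambda>\<alpha> x. f \<alpha> x + g \<alpha> x) \<le> (wnorm n K f + e/2) + (wnorm n K g + e/2)"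
    by (rule wnorm_le[OF _ wb_add[OF wnorm_wb[OF f] wnorm_wb[OF g]]]) (use e wnorm_nonneg[OF f] wnorm_nonneg[OF g] in auto)
  then show "wnorm n K (\<lambda>\<alpha> x. f \<alpha> x + g \<alpha> x) \<le> wnorm n K f + wnorm n K g + e" by simp
qed

lemma wnorm_cmult_le:
  assumes f: "f \<in> wspace n K"
  shows "wnorm n K (\<lambda>\<alpha> x. c * f \<alpha> x) \<le> cmod c * wnorm n K f"
proof -
  have "wnorm n K (\<lambda>\<alpha> x. c * f \<alpha> x) - cmod c * wnorm n K f \<le> cmod c * r" if r: "r > 0" for r
  proof -
    have "wnorm n K (\<lambda>\<alpha> x. c * f \<alpha> x) \<le> cmod c * (wnorm n K f + r)"
      by (rule wnorm_le[OF _ wb_cmult[OF wnorm_wb[OF f]]]) (use r wnorm_nonneg[OF f] in auto)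
    then show ?thesis by (simp add: algebra_simps)
  qed
  from nonpos_if_small[OF this] show ?thesis by simp
qed

lemma wnorm_cmult:
  assumes f: "f \<in> wspace n K"
  shows "wnorm n K (\<lambda>\<alpha> x. c * f \<alpha> x) = cmod c * wnorm n K f"
proof (rule antisym[OF wnorm_cmult_le[OF f]])
  show "cmod c * wnorm n K f \<le> wnorm n K (\<lambda>\<alpha> x. c * f \<alpha> x)"
  proof (cases "c = 0")
    case True
    then show ?thesis using wnorm_nonneg[OF wspace_cmult[OF f, of c]] by simp
  next
    case False
    then have "wnorm n K f \<le> cmod (1 / c) * wnorm n K (\<lambda>\<alpha> x. c * f \<alpha> x)"
      using wnorm_cmult_le[OF wspace_cmult[OF f, of c], of "1 / c"] by simp
    then show ?thesis using False by (simp add: norm_divide field_simps)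
  qed
qed

interpretation js: complex_space "\<lambda>c (f :: 'n::finite jet) \<alpha> x. c * f \<alpha> x"
  by unfold_locales (simp_all add: fun_eq_iff plus_fun_apply distrib_left distrib_right)

lemma jet_plus: "(f :: 'n::finite jet) + g = (\<lambda>\<alpha> x. f \<alpha> x + g \<alpha> x)"
  by (simp add: fun_eq_iff plus_fun_apply)

text \<open>If \<open>f\<close> is not approximable, a functional \<open>L\<close> separates it from
  the functions \<open>\<psi>\<close> with \<open>flat \<psi>\<close>. On test functions
  \<open>L\<close> is a distribution \<open>u\<close> supported in \<open>K\<close>, and division
  writes it as the transposed image of some \<open>v\<close> on \<open>F2\<close>. The support
  condition places \<open>v\<close> on \<open>F1\<close>, where \<open>f\<close> is a zero solution,
  so that \<open>L f\<close> would have to be 0, against \<open>L f = A\<close>.\<close>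

lemma support_imp_dense:
  fixes S :: "'n::finite multiindex set" and F1 F2 :: "(real ^ 'n) set"
  assumes S: "finite S" and a0: "\<alpha>0 \<in> S" "a \<alpha>0 \<noteq> 0" and F: "closed F2" "F1 \<subseteq> F2"
    and supp: "\<And>u. distribution u \<Longrightarrow> compact (dist_support u) \<Longrightarrow> dist_support u \<subseteq> F2 \<Longrightarrow> 
       dist_support (\<lambda>\<phi>. u (pdo S a \<phi>)) \<subseteq> F1 \<Longrightarrow> dist_support u \<subseteq> F1"
    and f: "f \<in> jker S a F1" and T: "openin (whitney_topology F1) T" "f \<in> T"
  shows "\<exists>g\<in>jker S a F2. jet_restrict F1 g \<in> T"
proof (rule ccontr)
  assume no: "\<not> ?thesis"
  obtain n K A where K: "compact K" "K \<subseteq> F1" and A: "A > 0" 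
    and nb: "\<And>g. g \<in> whitney_jets F1 \<Longrightarrow> wb n K A (\<lambda>\<alpha> x. g \<alpha> x - f \<alpha> x) \<Longrightarrow> g \<in> T"
    using whitney_nbhd[OF T] by blast
  have f': "f \<in> whitney_jets F1" "\<And>\<beta> x. x \<in> F1 \<Longrightarrow> jop S a f \<beta> x = 0" using f by (auto simp: jker_def)
  \<comment> \<open>The jets of these functions restrict to kernel elements on \<open>F2\<close>,
    and they are exactly the functions that the hypothesis \<open>kill\<close> of
    \<open>division\<close> is about.\<close>
  define flat where "flat \<psi> \<longleftrightarrow> smooth \<psi> \<and> (\<forall>\<beta>. \<forall>x\<in>F2. pd \<beta> (pdo S a \<psi>) x = 0)" for \<psi>
  have flat_add: "flat (\<lambda>x. \<psi> x + \<phi> x)" if "flat \<psi>" "flat \<phi>" for \<psi> \<phi>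
    using that by (simp add: flat_def smooth_add pdo_add pd_add smooth_pdo)
  have flat_cmult: "flat (\<lambda>x. c * \<psi> x)" if "flat \<psi>" for \<psi> c
    using that by (simp add: flat_def smooth_cmult pdo_cmult pd_cmult smooth_pdo)
  have far: "\<not> wb n K A (\<lambda>\<alpha> x. jets \<psi> \<alpha> x - f \<alpha> x)" if \<psi>: "flat \<psi>" for \<psi>
  proof
    assume w: "wb n K A (\<lambda>\<alpha> x. jets \<psi> \<alpha> x - f \<alpha> x)"
    have s: "smooth \<psi>" using \<psi> by (simp add: flat_def)
    have "jet_restrict F2 (jets \<psi>) \<in> jker S a F2" by (rule jker_smooth[OF s]) (use \<psi> in \<open>simp add: flat_def\<close>)
    then have "jet_restrict F1 (jet_restrict F2 (jets \<psi>)) \<notin> T" using no by blast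
    moreover have "jet_restrict F1 (jets \<psi>) \<in> T"
    proof (rule nb[OF whitney_jets_smooth[OF s] wb_cong[OF _ w]])
      fix \<alpha> x assume "x \<in> K"
      then have "x \<in> F1" using K(2) by blast
      then show "jets \<psi> \<alpha> x - f \<alpha> x = jet_restrict F1 (jets \<psi>) \<alpha> x - f \<alpha> x" by (simp only: jet_restrict_apply)
    qed
    ultimately show False by (simp add: jet_restrict_restrict[OF F(2)])
  qed
  let ?V = "wspace n K" and ?p = "wnorm n K"
  have jV: "jets \<psi> \<in> ?V" if s: "smooth \<psi>" for \<psi>
  proof -
    obtain B where "B \<ge> 0" "wb n K B (jets \<psi>)" by (rule smooth_wb[OF s K(1)])
    then show ?thesis by (rule wspaceI)
  qed
  have fV: "f \<in> ?V"
  proof -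
    obtain B where "B \<ge> 0" "wb n K B f" by (rule whitney_jets_wb[OF f'(1) K])
    then show ?thesis by (rule wspaceI)
  qed
  \<comment> \<open>The graph of the functional that is 0 on jets of flat functions and
    \<open>A\<close> on \<open>f\<close>; domination by \<open>?p\<close> makes it
    single-valued.\<close>
  define R where "R = {((\<lambda>\<alpha> x. jets \<psi> \<alpha> x + c * f \<alpha> x), c * complex_of_real A) | \<psi> c. flat \<psi>}"
  have RI: "((\<lambda>\<alpha> x. jets \<psi> \<alpha> x + c * f \<alpha> x), c * complex_of_real A) \<in> R" if "flat \<psi>" for \<psi> c
    using that unfolding R_def by blast
  have flat0: "flat (\<lambda>x. 0)" using smooth_const[of 0] by (simp add: flat_def pdo_def)
  obtain L where L: "\<And>x y. x \<in> ?V \<Longrightarrow> y \<in> ?V \<Longrightarrow> L (x + y) = L x + L y" "\<And>x c. x \<in> ?V \<Longrightarrow> L (\<lambda>\<alpha> z. c * x \<alpha> z) = c * L x"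
      "\<And>x b. (x, b) \<in> R \<Longrightarrow> L x = b" "\<And>x. x \<in> ?V \<Longrightarrow> cmod (L x) \<le> ?p x"
  proof (rule js.hahn_banach[of ?V ?p R])
    show "x + y \<in> ?V" "?p (x + y) \<le> ?p x + ?p y" if "x \<in> ?V" "y \<in> ?V" for x y
      unfolding jet_plus by (rule wspace_add[OF that], rule wnorm_add[OF that])
    show "(\<lambda>\<alpha> z. c * x \<alpha> z) \<in> ?V" "?p (\<lambda>\<alpha> z. c * x \<alpha> z) = cmod c * ?p x" if "x \<in> ?V" for c x
      by (rule wspace_cmult[OF that], rule wnorm_cmult[OF that])
    show "R \<noteq> {}" using RI[OF flat0] by blast
    have V: "(\<lambda>\<alpha> x. jets \<psi> \<alpha> x + c * f \<alpha> x) \<in> ?V" if "flat \<psi>" for \<psi> c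
      by (rule wspace_add[OF jV wspace_cmult[OF fV]]) (use that in \<open>simp add: flat_def\<close>)
    then show "x \<in> ?V" if "(x, b) \<in> R" for x b using that unfolding R_def by blast
    show "(x + y, b + d) \<in> R" if xy: "(x, b) \<in> R" "(y, d) \<in> R" for x y b d
    proof -
      obtain \<psi> c where 1: "x = (\<lambda>\<alpha> x. jets \<psi> \<alpha> x + c * f \<alpha> x)" "b = c * complex_of_real A" "flat \<psi>" using xy(1) unfolding R_def by blast
      obtain \<phi> c' where 2: "y = (\<lambda>\<alpha> x. jets \<phi> \<alpha> x + c' * f \<alpha> x)" "d = c' * complex_of_real A" "flat \<phi>" using xy(2) unfolding R_def by blast
      have "x + y = (\<lambda>\<alpha> z. jets (\<lambda>z. \<psi> z + \<phi> z) \<alpha> z + (c + c') * f \<alpha> z)"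
        using 1(3) 2(3) unfolding jet_plus 1(1) 2(1) by (simp add: flat_def pd_add algebra_simps)
      moreover have "b + d = (c + c') * complex_of_real A" unfolding 1(2) 2(2) by (simp add: distrib_right)
      ultimately show ?thesis using RI[OF flat_add[OF 1(3) 2(3)], of "c + c'"] by (simp only:)
    qed
    show "((\<lambda>\<alpha> z. c * x \<alpha> z), c * b) \<in> R" if x: "(x, b) \<in> R" for x b c
    proof -
      obtain \<psi> d where 1: "x = (\<lambda>\<alpha> x. jets \<psi> \<alpha> x + d * f \<alpha> x)" "b = d * complex_of_real A" "flat \<psi>" using x unfolding R_def by blast
      have "(\<lambda>\<alpha> z. c * x \<alpha> z) = (\<lambda>\<alpha> z. jets (\<lambda>z. c * \<psi> z) \<alpha> z + (c * d) * f \<alpha> z)"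
        using 1(3) unfolding 1(1) by (simp add: flat_def pd_cmult algebra_simps)
      moreover have "c * b = (c * d) * complex_of_real A" unfolding 1(2) by simp
      ultimately show ?thesis using RI[OF flat_cmult[OF 1(3), of c], of "c * d"] by (simp only:)
    qed
    show "cmod b \<le> ?p x" if x: "(x, b) \<in> R" for x b
    proof -
      obtain \<psi> c where 1: "x = (\<lambda>\<alpha> x. jets \<psi> \<alpha> x + c * f \<alpha> x)" "b = c * complex_of_real A" "flat \<psi>" using x unfolding R_def by blast
      have xV: "x \<in> ?V" unfolding 1(1) by (rule V[OF 1(3)])
      have cb: "cmod b = cmod c * A" using A by (simp add: 1(2) norm_mult)
      show ?thesis
      proof (rule ccontr)
        assume "\<not> ?thesis"
        then have lt: "?p x < cmod c * A" by (simp add: cb)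
        have c: "c \<noteq> 0" using lt wnorm_nonneg[OF xV] by auto
        \<comment> \<open>Scaling by -1/c would produce a flat function within \<open>A\<close> of
          \<open>f\<close>, which \<open>far\<close> excludes.\<close>
        have "wb n K (cmod (-1 / c) * (cmod c * A)) (\<lambda>\<alpha> z. (-1 / c) * x \<alpha> z)" by (rule wb_cmult[OF wnorm_wb[OF xV lt]])
        moreover have "cmod (-1 / c) * (cmod c * A) = A" using c by (simp add: norm_divide)
        moreover have "(\<lambda>\<alpha> z. (-1 / c) * x \<alpha> z) = (\<lambda>\<alpha> z. jets (\<lambda>z. (-1 / c) * \<psi> z) \<alpha> z - f \<alpha> z)"
        proof (intro ext)
          fix \<alpha> z
          have "jets (\<lambda>z. (-1 / c) * \<psi> z) \<alpha> z = (-1 / c) * pd \<alpha> \<psi> z" using 1(3) unfolding jets_apply flat_def by (simp only: pd_cmult)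
          then show "(-1 / c) * x \<alpha> z = jets (\<lambda>z. (-1 / c) * \<psi> z) \<alpha> z - f \<alpha> z"
            using c unfolding 1(1) jets_apply by (simp add: field_simps)
        qed
        ultimately have "wb n K A (\<lambda>\<alpha> z. jets (\<lambda>z. (-1 / c) * \<psi> z) \<alpha> z - f \<alpha> z)" by (simp only:)
        with far[OF flat_cmult[OF 1(3), of "-1 / c"]] show False by blast
      qed
    qed
  qed (rule that)
  have Lf: "L f = complex_of_real A" using L(3)[OF RI[OF flat0, of 1]] by (simp add: jets_def)
  have Lflat: "L (jets \<psi>) = 0" if "flat \<psi>" for \<psi> using L(3)[OF RI[OF that, of 0]] by (simp add: jets_def)
  have Lle: "cmod (L x) \<le> B" if "B \<ge> 0" "wb n K B x" for x B
    by (rule order_trans[OF L(4)[OF wspaceI[OF that]] wnorm_le[OF that]])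
  have Ldiff: "L (\<lambda>\<alpha> z. x \<alpha> z - y \<alpha> z) = L x - L y" if "x \<in> ?V" "y \<in> ?V" for x y
  proof -
    have "L (x + (\<lambda>\<alpha> z. -1 * y \<alpha> z)) = L x + L (\<lambda>\<alpha> z. -1 * y \<alpha> z)" by (rule L(1)[OF that(1) wspace_cmult[OF that(2)]])
    moreover have "x + (\<lambda>\<alpha> z. -1 * y \<alpha> z) = (\<lambda>\<alpha> z. x \<alpha> z - y \<alpha> z)" unfolding jet_plus by simp
    moreover have "L (\<lambda>\<alpha> z. -1 * y \<alpha> z) = -1 * L y" by (rule L(2)[OF that(2)])
    ultimately show ?thesis by (simp only:) simp
  qed
  have Lcong: "L x = L y" if xy: "x \<in> ?V" "y \<in> ?V" "\<And>\<alpha> z. z \<in> K \<Longrightarrow> x \<alpha> z = y \<alpha> z" for x y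
  proof -
    have "wb n K 0 (\<lambda>\<alpha> z. x \<alpha> z - y \<alpha> z)" by (rule wb_cong[OF _ wb_zero]) (simp add: xy(3))
    from Lle[OF order_refl this] show ?thesis by (simp add: Ldiff[OF xy(1,2)])
  qed
  define u where "u \<phi> = L (jets \<phi>)" for \<phi>
  have u: "distribution u"
  proof (rule distributionI)
    show "u (\<lambda>x. \<phi> x + \<psi> x) = u \<phi> + u \<psi>" if "test \<phi>" "test \<psi>" for \<phi> \<psi>
    proof -
      have "jets (\<lambda>x. \<phi> x + \<psi> x) = jets \<phi> + jets \<psi>" using that by (simp add: jets_def jet_plus pd_add test_smooth)
      then show ?thesis using L(1)[OF jV[OF test_smooth[OF that(1)]] jV[OF test_smooth[OF that(2)]]] by (simp only: u_def)
    qed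
    show "u (\<lambda>x. c * \<phi> x) = c * u \<phi>" if "test \<phi>" for c \<phi>
    proof -
      have "jets (\<lambda>x. c * \<phi> x) = (\<lambda>\<alpha> z. c * jets \<phi> \<alpha> z)" using that by (simp add: jets_def pd_cmult test_smooth)
      then show ?thesis using L(2)[OF jV[OF test_smooth[OF that]]] by (simp only: u_def)
    qed
    obtain C :: real where C: "C \<ge> 0" "\<And>\<phi> B. test \<phi> \<Longrightarrow> bd (Suc n) B \<phi> \<Longrightarrow> wb n K (C * B) (jets \<phi>)"
      by (rule test_wb[OF K(1)], rule that)
    show "\<exists>C N. C \<ge> 0 \<and> (\<forall>\<phi> B. test \<phi> \<longrightarrow> fun_support \<phi> \<subseteq> H \<longrightarrow> bd N B \<phi> \<longrightarrow> cmod (u \<phi>) \<le> C * B)" for H :: "(real ^ 'n) set"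
    proof (intro exI[of _ C] exI[of _ "Suc n"] conjI allI impI C(1))
      fix \<phi> :: "real ^ 'n \<Rightarrow> complex" and B assume "test \<phi>" and B: "bd (Suc n) B \<phi>"
      then show "cmod (u \<phi>) \<le> C * B" unfolding u_def by (intro Lle C) (use C(1) bd_nonneg[OF B] in auto)
    qed
  qed
  have uK: "dist_support u \<subseteq> K"
  proof (rule dist_support_subset[OF compact_imp_closed[OF K(1)]])
    fix \<phi> assume \<phi>: "test \<phi>" "fun_support \<phi> \<inter> K = {}"
    have "pd \<alpha> \<phi> x = 0" if "x \<in> K" for \<alpha> x by (rule pd_outside_support[OF test_smooth[OF \<phi>(1)]]) (use that \<phi>(2) in blast)
    then have "wb n K 0 (jets \<phi>)" by (intro wb_cong[OF _ wb_zero]) simp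
    from Lle[OF order_refl this] show "u \<phi> = 0" by (simp add: u_def)
  qed
  have ucomp: "compact (dist_support u)" 
    using compact_Int_closed[OF K(1) closed_dist_support[of u]] uK by (simp add: Int_absorb1)
  \<comment> \<open>\<open>L\<close> sees the jet on all of \<open>K\<close>, whereas the cutoff in
    \<open>division\<close> is 1 only near the support of \<open>u\<close>; hence a second cutoff
    equal to 1 near \<open>K\<close>.\<close>
  obtain \<xi> W where \<xi>: "test \<xi>" "open W" "K \<subseteq> W" "\<And>x. x \<in> W \<Longrightarrow> \<xi> x = 1"
    by (rule cutoff_exists[OF K(1) open_UNIV]) auto
  obtain v where v: "distribution v" "compact (dist_support v)" "dist_support v \<subseteq> F2" "\<And>\<phi>. test \<phi> \<Longrightarrow> v (pdo S a \<phi>) = u \<phi>"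
  proof (rule division[where a=a, OF S a0 u ucomp F(1)])
    fix \<zeta> V \<psi> assume \<zeta>: "test \<zeta>" "open V" "dist_support u \<subseteq> V" "\<And>x. x \<in> V \<Longrightarrow> \<zeta> x = 1" and \<psi>: "smooth \<psi>"
      and fl: "\<And>\<beta> x. x \<in> F2 \<Longrightarrow> pd \<beta> (pdo S a \<psi>) x = 0"
    have t: "test (\<lambda>x. \<zeta> x * \<psi> x)" "test (\<lambda>x. \<xi> x * \<psi> x)" by (rule test_mult2[OF \<psi> \<zeta>(1)], rule test_mult2[OF \<psi> \<xi>(1)])
    have "u (\<lambda>x. \<zeta> x * \<psi> x) = u (\<lambda>x. \<xi> x * \<psi> x)"
      by (rule distribution_cong_near_support[OF u t open_Int[OF \<zeta>(2) \<xi>(2)]]) (use \<zeta>(3,4) \<xi>(3,4) uK in auto)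
    also have "\<dots> = L (jets \<psi>)"
      unfolding u_def
    proof (rule Lcong[OF jV[OF test_smooth[OF t(2)]] jV[OF \<psi>]])
      fix \<alpha> z assume z: "z \<in> K"
      show "jets (\<lambda>x. \<xi> x * \<psi> x) \<alpha> z = jets \<psi> \<alpha> z"
        unfolding jets_apply by (rule pd_cong_open[OF test_smooth[OF t(2)] \<psi> \<xi>(2)]) (use z \<xi>(3,4) in auto)
    qed
    also have "\<dots> = 0" by (rule Lflat) (use \<psi> fl in \<open>simp add: flat_def\<close>)
    finally show "u (\<lambda>x. \<zeta> x * \<psi> x) = 0" .
  qed (rule that)
  have "dist_support (\<lambda>\<phi>. v (pdo S a \<phi>)) = dist_support u" by (rule dist_support_cong[OF v(4)])
  then have "dist_support v \<subseteq> F1" using supp[OF v(1-3)] uK K(2) by blast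
  then have KK: "compact (K \<union> dist_support v)" "K \<union> dist_support v \<subseteq> F1" using K v(2) by (auto intro: compact_Un)
  obtain C2 :: real and n2 where C2: "C2 \<ge> 0" 
    "\<And>f g r. test g \<Longrightarrow> r \<ge> 0 \<Longrightarrow> \<forall>\<beta>. \<forall>x\<in>K \<union> dist_support v. jop S a f \<beta> x = 0 \<Longrightarrow> wb n2 (K \<union> dist_support v) r (\<lambda>\<alpha> x. jets g \<alpha> x - f \<alpha> x) \<Longrightarrow> cmod (v (pdo S a g)) \<le> C2 * r"
    by (rule flat_estimate[OF S v(1) KK(1) Un_upper2, where a=a], rule that)
  obtain D1 where D1: "D1 \<ge> 0" "\<And>A h. A \<ge> 0 \<Longrightarrow> wb (max n n2) (K \<union> dist_support v) A h \<Longrightarrow> wb n (K \<union> dist_support v) (D1 * A) h"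
    by (rule wb_order_mono[OF KK(1) max.cobounded1[of n n2]], rule that)
  obtain D2 where D2: "D2 \<ge> 0" "\<And>A h. A \<ge> 0 \<Longrightarrow> wb (max n n2) (K \<union> dist_support v) A h \<Longrightarrow> wb n2 (K \<union> dist_support v) (D2 * A) h"
    by (rule wb_order_mono[OF KK(1) max.cobounded2[of n2 n]], rule that)
  have "A \<le> (C2 * D2 + D1) * r" if r: "r > 0" for r
  proof -
    obtain g where g: "test g" "wb (max n n2) (K \<union> dist_support v) r (\<lambda>\<alpha> x. jets g \<alpha> x - f \<alpha> x)"
      by (rule whitney_density[OF f'(1) KK r], rule that)
    have g1: "wb n K (D1 * r) (\<lambda>\<alpha> x. jets g \<alpha> x - f \<alpha> x)"
      by (rule wb_subset[OF D1(2)[OF less_imp_le[OF r] g(2)] Un_upper1])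
    have g2: "wb n2 (K \<union> dist_support v) (D2 * r) (\<lambda>\<alpha> x. jets g \<alpha> x - f \<alpha> x)" by (rule D2(2)[OF less_imp_le[OF r] g(2)])
    have "cmod (L (\<lambda>\<alpha> x. jets g \<alpha> x - f \<alpha> x)) \<le> D1 * r" by (rule Lle[OF _ g1]) (use D1 r in simp)
    then have 1: "cmod (u g - complex_of_real A) \<le> D1 * r"
      unfolding Ldiff[OF jV[OF test_smooth[OF g(1)]] fV] Lf u_def .
    have "cmod (v (pdo S a g)) \<le> C2 * (D2 * r)" by (rule C2(2)[OF g(1) _ _ g2]) (use D2 r f'(2) KK(2) in auto)
    then have 2: "cmod (u g) \<le> C2 * (D2 * r)" by (simp add: v(4) g(1))
    have "A = cmod (u g - (u g - complex_of_real A))" using A by simp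
    also have "\<dots> \<le> C2 * (D2 * r) + D1 * r" by (rule order_trans[OF norm_triangle_ineq4 add_mono[OF 2 1]])
    finally show ?thesis by (simp add: algebra_simps)
  qed
  from nonpos_if_small[OF this] A show False by simp
qed

section \<open>The Runge property tested on open sets, and the equivalence\<close>

lemma Runge_pair_iff:
  assumes "F1 \<subseteq> F2"
  shows "Runge_pair P F1 F2 \<longleftrightarrow> (\<forall>f\<in>whitney_kernel P F1. \<forall>T. openin (whitney_topology F1) T \<longrightarrow> f \<in> T \<longrightarrow>
     (\<exists>g\<in>whitney_kernel P F2. jet_restrict F1 g \<in> T))"
proof -
  let ?X = "whitney_kernel P F1" and ?I = "jet_restrict F1 ` whitney_kernel P F2"
  let ?W = "subtopology (whitney_topology F1) ?X"
  have sub: "?I \<subseteq> ?X" using jker_restrict[OF _ assms] by (auto simp: whitney_kernel_jker)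
  have X: "topspace ?W = ?X" by (auto simp: topspace_whitney_topology whitney_kernel_def)
  have "?W closure_of ?I \<subseteq> ?X" using closure_of_subset_topspace[of ?W ?I] X by simp
  then have "Runge_pair P F1 F2 \<longleftrightarrow> (\<forall>f\<in>?X. f \<in> ?W closure_of ?I)" unfolding Runge_pair_def by blast
  moreover have "f \<in> ?W closure_of ?I \<longleftrightarrow> (\<forall>T. openin (whitney_topology F1) T \<longrightarrow> f \<in> T \<longrightarrow> (\<exists>g\<in>whitney_kernel P F2. jet_restrict F1 g \<in> T))"
    if "f \<in> ?X" for f
  proof -
    have "f \<in> ?W closure_of ?I \<longleftrightarrow> (\<forall>T. openin (whitney_topology F1) T \<longrightarrow> f \<in> T \<longrightarrow> (\<exists>y\<in>?I. y \<in> T))"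
      unfolding in_closure_of X openin_subtopology using that sub by auto blast
    then show ?thesis by simp
  qed
  ultimately show ?thesis by simp
qed

theorem theorem5:
  fixes F1 F2 :: "(real ^ 'n::finite) set" and P :: "'n cpoly"
  assumes "closed F1" and "closed F2" and "F1 \<subseteq> F2" and "F1 \<noteq> F2"
    and "nonconstant P"
  shows "Runge_pair P F1 F2 \<longleftrightarrow>
    (\<forall>u. distribution u \<and> compact (dist_support u) \<and> dist_support u \<subseteq> F2 \<and>
         dist_support (dist_op (cpoly_reflect P) u) \<subseteq> F1
       \<longrightarrow> dist_support u \<subseteq> F1)"
proof -
  let ?S = "Poly_Mapping.keys P"
  have S: "finite ?S" by simp
  obtain \<alpha>0 where a0: "\<alpha>0 \<in> ?S" "opc P \<alpha>0 \<noteq> 0" by (rule nonconstant_coeff[OF assms(5)])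
  have Pu: "dist_support (dist_op (cpoly_reflect P) u) = dist_support (\<lambda>\<phi>. u (pdo ?S (opc P) \<phi>))" if "distribution u" for u
    by (rule dist_support_cong) (rule dist_op_reflect[OF that])
  show ?thesis
  proof
    assume "Runge_pair P F1 F2"
    then have dense: "\<exists>g\<in>jker ?S (opc P) F2. jet_restrict F1 g \<in> T"
      if "f \<in> jker ?S (opc P) F1" "openin (whitney_topology F1) T" "f \<in> T" for f T
      using that unfolding Runge_pair_iff[OF assms(3)] whitney_kernel_jker by blast
    show "\<forall>u. distribution u \<and> compact (dist_support u) \<and> dist_support u \<subseteq> F2 \<and>
         dist_support (dist_op (cpoly_reflect P) u) \<subseteq> F1 \<longrightarrow> dist_support u \<subseteq> F1"
    proof (intro allI impI, elim conjE)
      fix u assume u: "distribution u" "compact (dist_support u)" "dist_support u \<subseteq> F2" "dist_support (dist_op (cpoly_reflect P) u) \<subseteq> F1"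
      show "dist_support u \<subseteq> F1"
        by (rule dense_imp_support[where a="opc P", OF S a0 assms(1,3) dense u(1-3)]) (use u(4) Pu[OF u(1)] in auto)
    qed
  next
    assume ii: "\<forall>u. distribution u \<and> compact (dist_support u) \<and> dist_support u \<subseteq> F2 \<and>
         dist_support (dist_op (cpoly_reflect P) u) \<subseteq> F1 \<longrightarrow> dist_support u \<subseteq> F1"
    show "Runge_pair P F1 F2"
      unfolding Runge_pair_iff[OF assms(3)] whitney_kernel_jker
    proof (intro ballI allI impI)
      fix f T assume f: "f \<in> jker ?S (opc P) F1" "openin (whitney_topology F1) T" "f \<in> T"
      show "\<exists>g\<in>jker ?S (opc P) F2. jet_restrict F1 g \<in> T"
        by (rule support_imp_dense[where a="opc P", OF S a0 assms(2,3) _ f]) (use ii Pu in auto)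
    qed
  qed
qed

end
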